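(* Let $\widetilde w^\bullet_\epsilon(s)$ be the Laplace transform of the queueing delay of the discard base model, calculated as a perturbation of the Laplace transform $\widetilde w(s)=\mathbf u\boldsymbol\omega\prod_{j=1}^{rM}(s+y_j)/\prod_{j=1}^{rM}(s+x_j)$ of the queueing delay of the replace base model. Let $-y_1,\dots,-y_\sigma$ denote the distinct numbers among $-y_1,\dots,-y_{rM}$, with multiplicities $r_1,\dots,r_\sigma$, $\sum_{j=1}^\sigma r_j=rM$. Then there exist unique coefficients $\beta$, $\gamma$, $\alpha_k,\beta_k,\gamma_k$ ($k=2,\dots,N$), and $\alpha''_{j,l},\beta''_{j,l},\gamma''_{j,l}$ ($j=1,\dots,\sigma$, $l=1,\dots,r_j$), such that the Laplace transform $\widetilde w_\epsilon(s)$ of the queueing delay of the mixture model satisfies $$\begin{aligned}\widetilde w_\epsilon(s)=\widetilde w^\bullet_\epsilon(s)+\epsilon\frac{1}{\mathbf u^\bullet_\epsilon\boldsymbol\omega}\,\widetilde w^\bullet_\epsilon(s)\Bigg[&\Big((\mathbf z-\mathbf z^\bullet)\boldsymbol\omega+\sum_{k=2}^N\frac{\alpha_k}{s-s_k}+\sum_{j=1}^{\sigma}\sum_{l=1}^{r_j}\frac{\alpha''_{j,l}\,y_j^{\,r_j-l+1}}{(s+y_j)^{r_j-l+1}}\Big)\\ &-\mu_h\widetilde F^e_h(s)\Big(\beta+\sum_{k=2}^N\frac{\beta_k}{s-s_k}+\sum_{j=1}^{\sigma}\sum_{l=1}^{r_j}\frac{\beta''_{j,l}\,y_j^{\,r_j-l+1}}{(s+y_j)^{r_j-l+1}}\Big)\\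 &+\mu_h\widetilde F^e_h(s)\,\widetilde w^\bullet_\epsilon(s)\Big(\gamma+\sum_{k=2}^N\frac{\gamma_k}{s-s_k}+\sum_{j=1}^{\sigma}\sum_{l=1}^{r_j}\frac{\gamma''_{j,l}\,y_j^{\,r_j-l+1}}{(s+y_j)^{r_j-l+1}}\Big)\Bigg]+O(\epsilon^2).\end{aligned}$$
   Context: Arrivals. Single-server FIFO queue with arrivals governed by a Markov process on $\mathcal N=\{1,\dots,N\}$ with intensity matrix $\mathbf D=\mathbf D^{(1)}+\mathbf D^{(2)}$. Entries $d^{(2)}_{ij}\ge0$ are rates of transitions accompanied by a real customer; off-diagonal entries $d^{(1)}_{ij}\ge0$ are rates of transitions without a real customer (a "dummy" customer with zero service time is said to arrive); $d^{(1)}_{ii}=-\sum_{k\ne i}d^{(1)}_{ik}-\sum_kd^{(2)}_{ik}$. Put $\lambda_i=\sum_{k\neq i}d^{(1)}_{ik}+\sum_{k}d^{(2)}_{ik}$, $p_{ij}=\big(d^{(1)}_{ij}(1-\delta_{ij})+d^{(2)}_{ij}\big)/\lambda_i$ ($\delta_{ij}$ Kronecker), and, if $p_{ij}>0$, $q^{(1)}_{ij}=d^{(1)}_{ij}(1-\delta_{ij})/(\lambda_ip_{ij})$, $q^{(2)}_{ij}=d^{(2)}_{ij}/(\lambda_ip_{ij})$ (both $0$ if $p_{ij}=0$). $\mathbf P=[p_{ij}]$ (transition matrix of the Markov chain embedded at arrivals of real and dummy customers) is irreducible with stationary row vector $\boldsymbol\pi$; $\mathbf\Lambda=\mathrm{diag}(\lambda_1,\dots,\lambda_N)$,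 $\mathbf Q^{(i)}=[q^{(i)}_{kl}]$; $\circ$ is the Hadamard product, and $\mathbf Q\circ\mathbf P\mathbf\Lambda$ means $\mathbf Q\circ(\mathbf P\mathbf\Lambda)$; $\mathbf e$ is the all-ones column vector, $\mathbf I$ the identity. An arriving customer at a transition from $i$ to $j$ is tagged $i$. Service times of real customers are i.i.d., independent of the arrival process. Three models: the replace base model has phase-type service distribution $F_p$ with mean $\mu_p$ and Laplace–Stieltjes transform (LST) $\widetilde F_p=q/p$, with $q,p$ polynomials without common roots, $p$ monic of degree $M$, $\deg q\le M-1$; the mixture model has $G_\epsilon=(1-\epsilon)F_p+\epsilon F_h$, with $F_h$ heavy-tailed of finite mean $\mu_h$ and LST $\widetilde F_h$; the discard base model has service LST $\widetilde G^\bullet_\epsilon(s)=(1-\epsilon)\widetilde F_p(s)+\epsilon$. Stationary-excess LSTs: $\widetilde F^e_p(s)=(1-\widetilde F_p(s))/(\mu_ps)$, $\widetilde F^e_h(s)=(1-\widetilde F_h(s))/(\mu_hs)$. All models are assumed stable: $\boldsymbol\pi(\mathbf\Lambda^{-1}-\widehat{\mathbf M})\mathbf e>0$ for $\widehat{\mathbf M}=\hat\mu\,\mathbf Q^{(2)}\circ\mathbf P$, with $\hat\mu$ the mean service time of the model ($\mu_p$; $(1-\epsilon)\mu_p+\epsilon\mu_h$; $(1-\epsilon)\mu_p$, respectively). Put $\mathbf M=\mu_p\mathbf Q^{(2)}\circ\mathbf P$. Delay. In each model, let $V$ be the steady-state workload just before an arrival (real or dummy), $Z$ the steady-state tag, $\widetilde\phi_i(s)=\mathbb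 E(e^{-sV};Z=i)$, $\widetilde{\mathbf\Phi}=[\widetilde\phi_1,\dots,\widetilde\phi_N]$. The Laplace transform of the queueing delay of real customers is $\widetilde{\mathbf\Phi}(s)\boldsymbol\omega$, where $\boldsymbol\omega=\mathbf\Lambda^{-1}\mathbf D^{(2)}\mathbf e/(\boldsymbol\pi\mathbf\Lambda^{-1}\mathbf D^{(2)}\mathbf e)$; denoted $\widetilde w$, $\widetilde w_\epsilon$, $\widetilde w^\bullet_\epsilon$ in the replace base, mixture and discard base model respectively. Let $\mathbf E(s,g)=(\mathbf Q^{(1)}+g\mathbf Q^{(2)})\circ\mathbf P\mathbf\Lambda+s\mathbf I-\mathbf\Lambda$. In the discard model, $\mathbf u_\epsilon^\bullet$ is the row vector with $\widetilde{\mathbf\Phi}(s)\,\mathbf E(s,\widetilde G^\bullet_\epsilon(s))=s\mathbf u^\bullet_\epsilon$. Replace-base-model quantities. $\mathbf E(s)=\mathbf E(s,\widetilde F_p(s))$, $\mathrm{adj}$ is the adjugate. $\det\mathbf E(s)=0$ has exactly $N$ solutions with non-negative real part, $s_1=0$ and $s_2,\dots,s_N$ with $\Re s_i>0$, assumed simple. For $i\ge2$ choose $m=m_i$ such that the $m$-th column of $\mathrm{adj}\,\mathbf E(s_i)$ is nonzero; $\mathbf a_i$ is that column and $\mathbf a_i^{(1)}$ is the derivative at $s=s_i$ of the $m$-th column of $\mathrm{adj}\,\mathbf E(s)$. The row vector $\mathbf u$ is the unique solution of $\mathbf u\mathbf\Lambda^{-1}\mathbf e=\boldsymbol\pi(\mathbf\Lambda^{-1}-\mathbf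 M)\mathbf e$, $\mathbf u\mathbf a_i=0$ ($i=2,\dots,N$); one has $\widetilde w(s)=s\mathbf u\,\mathrm{adj}(\mathbf E(s))\boldsymbol\omega/\det\mathbf E(s)$. Here $r$ is the highest power of $p$ occurring in the denominators of $\det\mathbf E(s)$ and $s\mathbf u\,\mathrm{adj}(\mathbf E(s))\boldsymbol\omega$, and $x_j,y_j$ ($\Re x_j,\Re y_j>0$, $j=1,\dots,rM$) are defined by $p^r\det\mathbf E(s)=s\prod_{k=2}^N(s-s_k)\prod_{j=1}^{rM}(s+x_j)$ and $p^rs\mathbf u\,\mathrm{adj}(\mathbf E(s))\boldsymbol\omega=\mathbf u\boldsymbol\omega\,s\prod_{k=2}^N(s-s_k)\prod_{j=1}^{rM}(s+y_j)$. The vectors $\mathbf z,\mathbf z^\bullet$. Write $\mathbf X_{\bullet j}$ for the $j$-th column of $\mathbf X$, and $\mathbf X^{W}_{U}$ for the submatrix with rows $U$, columns $W$. For an analytic matrix function $\mathbf K(s)$ and $i=2,\dots,N$ put $$\delta_i[\mathbf K]=\frac{\sum_{j=1}^N\det(\mathbf E(s_i)_{\bullet1},\dots,\mathbf K(s_i)_{\bullet j},\dots,\mathbf E(s_i)_{\bullet N})}{\sum_{j=1}^N\det(\mathbf E(s_i)_{\bullet1},\dots,\mathbf E^{(1)}(s_i)_{\bullet j},\dots,\mathbf E(s_i)_{\bullet N})},\quad \mathbf E^{(1)}=\tfrac{d}{ds}\mathbf E,$$ let $\mathbf k_i[\mathbf K]$ be the column vector with entries $k_{i,j}=(-1)^{m+j}\sum_{k=1}^{N-1}\det\big((\mathbf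 E(s_i)^{\mathcal N\setminus\{j\}}_{\mathcal N\setminus\{m\}})_{\bullet1},\dots,(\mathbf K(s_i)^{\mathcal N\setminus\{j\}}_{\mathcal N\setminus\{m\}})_{\bullet k},\dots,(\mathbf E(s_i)^{\mathcal N\setminus\{j\}}_{\mathcal N\setminus\{m\}})_{\bullet N-1}\big)$, and $\mathbf B[\mathbf K]=(\mathbf0,\delta_2[\mathbf K]\mathbf a_2^{(1)}-\mathbf k_2[\mathbf K],\dots,\delta_N[\mathbf K]\mathbf a_N^{(1)}-\mathbf k_N[\mathbf K])$. Let $\mathbf A=(\mathbf\Lambda^{-1}\mathbf e,\mathbf a_2,\dots,\mathbf a_N)$, $\mathbf c=(\boldsymbol\pi(\mathbf\Lambda^{-1}-\mathbf M)\mathbf e,0,\dots,0)$. Then $\mathbf z=(\mathbf c\mathbf A^{-1}\mathbf B[\mathbf K]+\mathbf d)\mathbf A^{-1}$ with $\mathbf K(s)=s(\mu_p\widetilde F_p^e(s)-\mu_h\widetilde F_h^e(s))\mathbf Q^{(2)}\circ\mathbf P\mathbf\Lambda$, $\mathbf d=((\mu_p-\mu_h)\boldsymbol\pi(\mathbf Q^{(2)}\circ\mathbf P)\mathbf e,0,\dots,0)$; and $\mathbf z^\bullet=(\mathbf c\mathbf A^{-1}\mathbf B[\mathbf K^\bullet]+\mathbf d^\bullet)\mathbf A^{-1}$ with $\mathbf K^\bullet(s)=s\mu_p\widetilde F_p^e(s)\mathbf Q^{(2)}\circ\mathbf P\mathbf\Lambda$, $\mathbf d^\bullet=(\mu_p\boldsymbol\pi(\mathbf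 Q^{(2)}\circ\mathbf P)\mathbf e,0,\dots,0)$.
   Formalization: Uniqueness fails as written: adding 1 to the β-factor and 1/w to the γ-factor changes the expansion only by O(ε²). The formal statement fixes the γ-factor as the determinant-perturbation term (s Q2∘PΛ columns in E) times uω/(s u adj(E) ω); given this, all coefficients are unique. *)

theory Defs
  imports
    "HOL-Probability.Probability"
    "HOL-Library.Landau_Symbols"
    "Jordan_Normal_Form.Determinant"
    "Jordan_Normal_Form.Gauss_Jordan_Elimination"
begin

no_notation inner (infix "\<bullet>" 70)

text \<open>
  States are numbered \<open>0, \<dots>, N - 1\<close>.  Row vectors are plain vectors; \<open>row_mult v A\<close> is the
  row vector \<open>v A\<close>.
\<close>

definition ones :: "nat \<Rightarrow> 'a::one vec" where
  "ones n = vec n (\<lambda>_. 1)"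

definition row_mult :: "'a::comm_semiring_0 vec \<Rightarrow> 'a mat \<Rightarrow> 'a vec" where
  "row_mult v A = transpose_mat A *\<^sub>v v"

definition hadamard :: "'a::times mat \<Rightarrow> 'a mat \<Rightarrow> 'a mat" where
  "hadamard A B = mat (dim_row A) (dim_col A) (\<lambda>(i, j). A $$ (i, j) * B $$ (i, j))"

abbreviation cvec :: "real vec \<Rightarrow> complex vec" where
  "cvec \<equiv> map_vec complex_of_real"

abbreviation cmat :: "real mat \<Rightarrow> complex mat" where
  "cmat \<equiv> map_mat complex_of_real"


section \<open>The arrival process\<close>

definition arrival_process :: "nat \<Rightarrow> real mat \<Rightarrow> real mat \<Rightarrow> bool" where
  "arrival_process N D1 D2 \<longleftrightarrow>
     0 < N \<and> D1 \<in> carrier_mat N N \<and> D2 \<in> carrier_mat N N \<and>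
     (\<forall>i<N. \<forall>j<N. i \<noteq> j \<longrightarrow> 0 \<le> D1 $$ (i, j)) \<and>
     (\<forall>i<N. \<forall>j<N. 0 \<le> D2 $$ (i, j)) \<and>
     (\<forall>i<N. D1 $$ (i, i) = - (\<Sum>k\<in>{..<N} - {i}. D1 $$ (i, k)) - (\<Sum>k<N. D2 $$ (i, k)))"

definition rate :: "real mat \<Rightarrow> real mat \<Rightarrow> nat \<Rightarrow> real" where
  "rate D1 D2 i = (\<Sum>k\<in>{..<dim_row D1} - {i}. D1 $$ (i, k)) + (\<Sum>k<dim_row D1. D2 $$ (i, k))"

definition trans_prob :: "real mat \<Rightarrow> real mat \<Rightarrow> nat \<Rightarrow> nat \<Rightarrow> real" where
  "trans_prob D1 D2 i j = (D1 $$ (i, j) * (if i = j then 0 else 1) + D2 $$ (i, j)) / rate D1 D2 i"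

definition dummy_prob :: "real mat \<Rightarrow> real mat \<Rightarrow> nat \<Rightarrow> nat \<Rightarrow> real" where
  "dummy_prob D1 D2 i j =
     (if trans_prob D1 D2 i j > 0
      then D1 $$ (i, j) * (if i = j then 0 else 1) / (rate D1 D2 i * trans_prob D1 D2 i j) else 0)"

definition real_prob :: "real mat \<Rightarrow> real mat \<Rightarrow> nat \<Rightarrow> nat \<Rightarrow> real" where
  "real_prob D1 D2 i j =
     (if trans_prob D1 D2 i j > 0
      then D2 $$ (i, j) / (rate D1 D2 i * trans_prob D1 D2 i j) else 0)"

definition P_mat :: "real mat \<Rightarrow> real mat \<Rightarrow> real mat" where
  "P_mat D1 D2 = mat (dim_row D1) (dim_row D1) (\<lambda>(i, j). trans_prob D1 D2 i j)"

definition Q1_mat :: "real mat \<Rightarrow> real mat \<Rightarrow> real mat" where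
  "Q1_mat D1 D2 = mat (dim_row D1) (dim_row D1) (\<lambda>(i, j). dummy_prob D1 D2 i j)"

definition Q2_mat :: "real mat \<Rightarrow> real mat \<Rightarrow> real mat" where
  "Q2_mat D1 D2 = mat (dim_row D1) (dim_row D1) (\<lambda>(i, j). real_prob D1 D2 i j)"

definition Lam :: "real mat \<Rightarrow> real mat \<Rightarrow> real mat" where
  "Lam D1 D2 = mat_diag (dim_row D1) (rate D1 D2)"

definition Lam_inv :: "real mat \<Rightarrow> real mat \<Rightarrow> real mat" where
  "Lam_inv D1 D2 = mat_diag (dim_row D1) (\<lambda>i. 1 / rate D1 D2 i)"

definition Q2P :: "real mat \<Rightarrow> real mat \<Rightarrow> real mat" where
  "Q2P D1 D2 = hadamard (Q2_mat D1 D2) (P_mat D1 D2)"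

definition Q2PLam :: "real mat \<Rightarrow> real mat \<Rightarrow> real mat" where
  "Q2PLam D1 D2 = hadamard (Q2_mat D1 D2) (P_mat D1 D2 * Lam D1 D2)"

definition irreducible_mat :: "real mat \<Rightarrow> bool" where
  "irreducible_mat A \<longleftrightarrow> (\<forall>i<dim_row A. \<forall>j<dim_row A. \<exists>n. (A ^\<^sub>m n) $$ (i, j) > 0)"

definition stationary_vec :: "real mat \<Rightarrow> real vec \<Rightarrow> bool" where
  "stationary_vec A v \<longleftrightarrow>
     v \<in> carrier_vec (dim_row A) \<and> (\<forall>i<dim_row A. 0 \<le> v $ i) \<and> (\<Sum>i<dim_row A. v $ i) = 1 \<and>
     row_mult v A = v"

text \<open>\<open>drift D1 D2 v m\<close> is \<open>v (\<Lambda>\<^sup>-\<^sup>1 - m Q\<^sup>(\<^sup>2\<^sup>) \<circ> P) e\<close>; a model with mean service time \<open>m\<close> is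
  stable iff this is positive for the stationary vector \<open>v\<close>.\<close>

definition drift :: "real mat \<Rightarrow> real mat \<Rightarrow> real vec \<Rightarrow> real \<Rightarrow> real" where
  "drift D1 D2 v m = v \<bullet> ((Lam_inv D1 D2 - m \<cdot>\<^sub>m Q2P D1 D2) *\<^sub>v ones (dim_row D1))"

definition omega :: "real mat \<Rightarrow> real mat \<Rightarrow> real vec \<Rightarrow> real vec" where
  "omega D1 D2 v =
     (let w = (Lam_inv D1 D2 * D2) *\<^sub>v ones (dim_row D1) in (1 / (v \<bullet> w)) \<cdot>\<^sub>v w)"

text \<open>
  \<open>E(s, g) = (Q\<^sup>(\<^sup>1\<^sup>) + g Q\<^sup>(\<^sup>2\<^sup>)) \<circ> P\<Lambda> + sI - \<Lambda>\<close> over an arbitrary ring, into which the real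
  coefficients are embedded by \<open>h\<close>.  It is used over the complex numbers, and over polynomials
  in \<open>g\<close> with coefficients in the polynomials in \<open>s\<close>.
\<close>

definition E_gen ::
    "(real \<Rightarrow> 'a::comm_ring_1) \<Rightarrow> real mat \<Rightarrow> real mat \<Rightarrow> 'a \<Rightarrow> 'a \<Rightarrow> 'a mat" where
  "E_gen h D1 D2 s g =
     hadamard (map_mat h (Q1_mat D1 D2) + g \<cdot>\<^sub>m map_mat h (Q2_mat D1 D2))
       (map_mat h (P_mat D1 D2 * Lam D1 D2))
     + s \<cdot>\<^sub>m 1\<^sub>m (dim_row D1) - map_mat h (Lam D1 D2)"

abbreviation E_sg :: "real mat \<Rightarrow> real mat \<Rightarrow> complex \<Rightarrow> complex \<Rightarrow> complex mat" where
  "E_sg \<equiv> E_gen complex_of_real"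

definition E_poly :: "real mat \<Rightarrow> real mat \<Rightarrow> complex poly poly mat" where
  "E_poly D1 D2 = E_gen (\<lambda>c. [:[:complex_of_real c:]:]) D1 D2 [:[:0, 1:]:] [:0, 1:]"

text \<open>
  Highest power of \<open>p\<close> occurring in the denominators of \<open>det E(s, q/p)\<close> and of the terms of
  \<open>s u adj(E(s, q/p)) \<omega>\<close>: after substituting \<open>g = q/p\<close>, the monomial \<open>c\<^sub>k(s) g\<^sup>k\<close> has
  denominator \<open>p\<^sup>k\<close>.  So this is a degree in \<open>g\<close>.  Cancellations between \<open>c\<^sub>k\<close> and \<open>p\<close>, or
  between the entries of \<open>adj(E) \<omega>\<close> when they are combined with the weights \<open>u\<^sub>i\<close>, are
  not taken into account.
\<close>

definition p_exponent :: "real mat \<Rightarrow> real mat \<Rightarrow> real vec \<Rightarrow> nat" where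
  "p_exponent D1 D2 w =
     max (degree (det (E_poly D1 D2)))
       (Max ((\<lambda>i. degree ([:[:0, 1:]:] * (adj_mat (E_poly D1 D2) *\<^sub>v
                 map_vec (\<lambda>c. [:[:complex_of_real c:]:]) w) $ i)) ` {..<dim_row D1}))"


section \<open>Service times\<close>

definition service_law :: "real measure \<Rightarrow> bool" where
  "service_law F \<longleftrightarrow> prob_space F \<and> sets F = sets borel \<and> (AE x in F. 0 \<le> x) \<and> integrable F (\<lambda>x. x)"

definition mean :: "real measure \<Rightarrow> real" where
  "mean F = (LINT x|F. x)"

definition lst :: "real measure \<Rightarrow> complex \<Rightarrow> complex" where
  "lst F s = (LINT x|F. exp (- s * complex_of_real x))"

text \<open>LST of the stationary-excess law, continuously extended to \<open>s = 0\<close>.\<close>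

definition excess_lst :: "real \<Rightarrow> (complex \<Rightarrow> complex) \<Rightarrow> complex \<Rightarrow> complex" where
  "excess_lst m f s = (if s = 0 then 1 else (1 - f s) / (complex_of_real m * s))"

text \<open>\<open>F\<close> is the law of the absorption time of a finite Markov process with initial
  distribution \<open>a\<close> and (invertible) subgenerator \<open>T\<close>; the series is \<open>a exp(xT) e\<close>.\<close>

definition phase_type :: "real measure \<Rightarrow> bool" where
  "phase_type F \<longleftrightarrow>
     (\<exists>m a T. a \<in> carrier_vec m \<and> T \<in> carrier_mat m m \<and>
        (\<forall>i<m. 0 \<le> a $ i) \<and> (\<Sum>i<m. a $ i) \<le> 1 \<and>
        (\<forall>i<m. \<forall>j<m. i \<noteq> j \<longrightarrow> 0 \<le> T $$ (i, j)) \<and>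
        (\<forall>i<m. (\<Sum>j<m. T $$ (i, j)) \<le> 0) \<and> det T \<noteq> 0 \<and>
        (\<forall>x\<ge>0. measure F {x<..} = (\<Sum>n. x ^ n / fact n * (a \<bullet> ((T ^\<^sub>m n) *\<^sub>v ones m)))))"

definition heavy_tailed :: "real measure \<Rightarrow> bool" where
  "heavy_tailed F \<longleftrightarrow> (\<forall>t>0. (\<integral>\<^sup>+x. ennreal (exp (t * x)) \<partial>F) = \<infinity>)"

text \<open>The mixture \<open>(1 - \<epsilon>) F + \<epsilon> H\<close>.\<close>

definition mix :: "real \<Rightarrow> real measure \<Rightarrow> real measure \<Rightarrow> real measure" where
  "mix \<epsilon> F H = measure_pmf (bernoulli_pmf \<epsilon>) \<bind> (\<lambda>b. if b then H else F)"


section \<open>Steady state at arrivals\<close>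

text \<open>
  Law of the pair (workload just before an arrival, tag).  From workload \<open>v\<close> and tag \<open>i\<close> the next
  tag is \<open>j\<close> with probability \<open>p\<^sub>i\<^sub>j\<close>; the arriving customer brings work \<open>b\<close>, which is \<open>0\<close>
  (dummy) with probability \<open>q\<^sup>(\<^sup>1\<^sup>)\<^sub>i\<^sub>j\<close> and has law \<open>F\<close> with probability \<open>q\<^sup>(\<^sup>2\<^sup>)\<^sub>i\<^sub>j\<close>; the time \<open>t\<close> until
  the next arrival is exponential with rate \<open>\<lambda>\<^sub>j\<close>; and the next workload is \<open>max 0 (v + b - t)\<close>.
\<close>

definition stationary_law ::
    "nat \<Rightarrow> real mat \<Rightarrow> real mat \<Rightarrow> real measure \<Rightarrow> (real \<times> nat) measure \<Rightarrow> bool" where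
  "stationary_law N D1 D2 F S \<longleftrightarrow>
     prob_space S \<and> sets S = sets (borel \<Otimes>\<^sub>M count_space {..<N}) \<and> (AE x in S. 0 \<le> fst x) \<and>
     (\<forall>X\<in>sets S. emeasure S X =
        (\<integral>\<^sup>+x. (\<Sum>j<N. ennreal (trans_prob D1 D2 (snd x) j) *
            (\<integral>\<^sup>+b. (\<integral>\<^sup>+t. indicator X (max 0 (fst x + b - t), j)
               \<partial>density lborel (exponential_density (rate D1 D2 j)))
             \<partial>mix (real_prob D1 D2 (snd x) j) (return borel 0) F)) \<partial>S))"

definition Phi :: "nat \<Rightarrow> (real \<times> nat) measure \<Rightarrow> complex \<Rightarrow> complex vec" where
  "Phi N S s =
     vec N (\<lambda>i. LINT x|S. (if snd x = i then exp (- s * complex_of_real (fst x)) else 0))"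


section \<open>Perturbation vectors\<close>

text \<open>Sum over \<open>j\<close> of the determinants of \<open>X\<close> with its \<open>j\<close>-th column replaced by that of \<open>Y\<close>.\<close>

definition col_subst_sum :: "complex mat \<Rightarrow> complex mat \<Rightarrow> complex" where
  "col_subst_sum X Y = (\<Sum>j<dim_col X. det (replace_col X (col Y j) j))"

definition mat_deriv :: "(complex \<Rightarrow> complex mat) \<Rightarrow> complex \<Rightarrow> complex mat" where
  "mat_deriv X s = mat (dim_row (X s)) (dim_col (X s)) (\<lambda>(i, j). deriv (\<lambda>t. X t $$ (i, j)) s)"

text \<open>In the following, the argument \<open>s\<close> stands for a root \<open>s\<^sub>i\<close> and \<open>m\<close> for the chosen
  column \<open>m\<^sub>i\<close>.\<close>

definition a_vec :: "(complex \<Rightarrow> complex mat) \<Rightarrow> complex \<Rightarrow> nat \<Rightarrow> complex vec" where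
  "a_vec E s m = col (adj_mat (E s)) m"

definition a1_vec :: "(complex \<Rightarrow> complex mat) \<Rightarrow> complex \<Rightarrow> nat \<Rightarrow> complex vec" where
  "a1_vec E s m = col (mat_deriv (\<lambda>t. adj_mat (E t)) s) m"

definition delta ::
    "(complex \<Rightarrow> complex mat) \<Rightarrow> (complex \<Rightarrow> complex mat) \<Rightarrow> complex \<Rightarrow> complex" where
  "delta E K s = col_subst_sum (E s) (K s) / col_subst_sum (E s) (mat_deriv E s)"

definition k_vec ::
    "(complex \<Rightarrow> complex mat) \<Rightarrow> (complex \<Rightarrow> complex mat) \<Rightarrow> complex \<Rightarrow> nat \<Rightarrow> complex vec" where
  "k_vec E K s m =
     vec (dim_row (E s))
       (\<lambda>j. (- 1) ^ (m + j) * col_subst_sum (mat_delete (E s) m j) (mat_delete (K s) m j))"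

definition A_mat ::
    "nat \<Rightarrow> complex vec \<Rightarrow> (complex \<Rightarrow> complex mat) \<Rightarrow> (nat \<Rightarrow> complex) \<Rightarrow> (nat \<Rightarrow> nat) \<Rightarrow> complex mat"
  where
  "A_mat N l E sr m = mat N N (\<lambda>(j, i). if i = 0 then l $ j else a_vec E (sr i) (m i) $ j)"

definition B_mat ::
    "nat \<Rightarrow> (complex \<Rightarrow> complex mat) \<Rightarrow> (complex \<Rightarrow> complex mat) \<Rightarrow> (nat \<Rightarrow> complex) \<Rightarrow> (nat \<Rightarrow> nat)
      \<Rightarrow> complex mat" where
  "B_mat N E K sr m =
     mat N N (\<lambda>(j, i). if i = 0 then 0
       else delta E K (sr i) * a1_vec E (sr i) (m i) $ j - k_vec E K (sr i) (m i) $ j)"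

definition first_vec :: "nat \<Rightarrow> real \<Rightarrow> complex vec" where
  "first_vec N c = vec N (\<lambda>i. if i = 0 then complex_of_real c else 0)"

definition z_vec ::
    "complex vec \<Rightarrow> complex mat \<Rightarrow> complex mat \<Rightarrow> complex vec \<Rightarrow> complex vec" where
  "z_vec c A B d =
     (let Ai = the (mat_inverse A) in row_mult (row_mult (row_mult c Ai) B + d) Ai)"

text \<open>The partial-fraction expression
  \<open>c0 + \<Sum>\<^sub>k c1\<^sub>k / (s - s\<^sub>k) + \<Sum>\<^sub>j \<Sum>\<^sub>l c2\<^sub>j\<^sub>,\<^sub>l y\<^sub>j\<^sup>n / (s + y\<^sub>j)\<^sup>n\<close> with \<open>n = r\<^sub>j - l + 1\<close>.\<close>

definition pf ::
    "nat \<Rightarrow> (nat \<Rightarrow> complex) \<Rightarrow> nat \<Rightarrow> (nat \<Rightarrow> complex) \<Rightarrow> (nat \<Rightarrow> nat) \<Rightarrow>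
     complex \<Rightarrow> (nat \<Rightarrow> complex) \<Rightarrow> (nat \<times> nat \<Rightarrow> complex) \<Rightarrow> complex \<Rightarrow> complex" where
  "pf N sr \<sigma> y r c0 c1 c2 s =
     c0 + (\<Sum>k\<in>{1..<N}. c1 k / (s - sr k))
        + (\<Sum>j\<in>{1..\<sigma>}. \<Sum>l\<in>{1..r j}. c2 (j, l) * y j ^ (r j - l + 1) / (s + y j) ^ (r j - l + 1))"

end

theory Submission
  imports Defs "HOL-Complex_Analysis.Complex_Analysis"
begin

no_notation vec_nth (infixl "$" 90)
no_notation fps_nth (infixl "$" 75)
no_notation inner (infix "\<bullet>" 70)

text \<open>
  In each model the workload seen by an arrival satisfies a functional equation
  \<open>\<Phi>(s) E(s, g(s)) = s c\<close>, where \<open>g\<close> is the service transform and \<open>c\<close> a constant row vector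
  (\<open>stationary_transform\<close>).  Write \<open>f = q/p\<close> and \<open>h\<close> for the transforms of the two service laws,
  \<open>E(s) = E(s, f(s))\<close> and \<open>Q = Q\<^sup>(\<^sup>2\<^sup>) \<circ> P\<Lambda>\<close>.  Since \<open>E(s, g)\<close> is affine in \<open>g\<close> with slope \<open>Q\<close>, the
  mixture and the discard model have the kernels \<open>E + \<epsilon> (h - f) Q\<close> and \<open>E + \<epsilon> (1 - f) Q\<close>: both are
  perturbations of the base kernel \<open>E\<close>, of the form \<open>E + \<epsilon> K\<close>.
  
  The locale \<open>perturbed_kernel_equation\<close> expands the solutions of \<open>\<Phi> (E + \<epsilon> K) = s U\<close>, in which
  \<open>\<Phi>\<close> and \<open>U\<close> depend on \<open>\<epsilon>\<close>.  The equation is multiplied by \<open>adj E\<close>, which turns it into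
  \<open>det E \<Phi> + \<epsilon> \<Phi> K adj E = s U adj E\<close>.  At a root \<open>s\<^sub>i\<close> of \<open>det E\<close> the first term vanishes, and as
  \<open>\<Phi>\<close> is bounded, \<open>U adj E(s\<^sub>i) = O(\<epsilon>)\<close>.  The derivative of the equation at \<open>s\<^sub>i\<close>, where \<open>\<Phi>'\<close> is
  bounded by Cauchy's inequality, gives \<open>\<Phi>(s\<^sub>i)\<close> up to \<open>O(\<epsilon>)\<close>; inserted into the equation at \<open>s\<^sub>i\<close>
  this gives the products of \<open>U\<close> with the columns \<open>a\<^sub>i\<close> of \<open>adj E(s\<^sub>i)\<close> up to \<open>O(\<epsilon>\<^sup>2)\<close>.  Together with the exact value of \<open>U \<Lambda>\<^sup>-\<^sup>1 e\<close>, which comes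
  from the behaviour at the origin, this proves \<open>U = u + \<epsilon> z + O(\<epsilon>\<^sup>2)\<close> (\<open>U_first_order\<close>), and dividing
  by \<open>det E\<close> off the roots expands \<open>\<Phi>\<close> (\<open>\<Phi>_expansion\<close>).  The zeros of \<open>det (E + \<epsilon> K)\<close> never
  have to be located.
  
  Subtracting the two expansions, the first-order term of \<open>w\<^sub>\<epsilon> - w\<^sup>\<bullet>\<^sub>\<epsilon>\<close> is
  \<open>s (z - z\<^sup>\<bullet>) adj E \<omega> / det E + s (1 - h) J / (det E)\<^sup>2\<close> with \<open>J = u adj E Q adj E \<omega>\<close>.  The identity
  \<open>adj E Q adj E = T adj E - det E D\<close> (\<open>adj_triple\<close>), with \<open>T\<close> and \<open>D\<close> the derivatives of \<open>det\<close> and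
  \<open>adj\<close> at \<open>E\<close> in the direction \<open>Q\<close>, splits \<open>J\<close> into a part with the factor \<open>u adj E \<omega>\<close>, which is one
  more factor \<open>w\<^sup>\<bullet>\<close>, and a part without it.  As \<open>u adj E \<omega>\<close> is a multiple of \<open>den / p\<^sup>r\<close> with
  \<open>den = \<Prod> (s - s\<^sub>k) \<Prod> (s + y\<^sub>j)\<close>, the three coefficient functions are
  \<open>p\<^sup>r (z - z\<^sup>\<bullet>) adj E \<omega> / den\<close>, \<open>p\<^sup>r s u D \<omega> / den\<close> and \<open>p\<^sup>r T / den\<close>.  Differentiation in the
  direction \<open>Q\<close> is differentiation in \<open>g\<close>, which does not raise the degree in \<open>g\<close>; so \<open>p\<^sup>r\<close> clears
  the denominators, and \<open>E(s) ~ s I\<close> at infinity bounds the degrees of the numerators by that of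
  \<open>den\<close>.  Hence the coefficient functions have partial fractions of the required form, and the constant
  term of the first one is \<open>(z - z\<^sup>\<bullet>) \<omega>\<close>.  At \<open>s = 0\<close> both transforms equal 1, and the bracket
  vanishes (\<open>at_origin\<close>).
  
  For uniqueness, the normalization determines the \<open>\<gamma>\<close>'s.  If two choices of the \<open>\<alpha>\<close>'s and \<open>\<beta>\<close>'s
  were possible, then their differences would be rational functions \<open>a\<close>, \<open>b\<close> with
  \<open>s a = (1 - h) b\<close> near the origin in the right half-plane.  If \<open>b \<noteq> 0\<close>, then \<open>h\<close> extends to a function analytic at
  the origin; as in Pringsheim's theorem, the law with transform \<open>h\<close> would have an exponential moment
  (\<open>exp_moment_if_analytic_at_0\<close>), which a heavy tail excludes.
\<close>

section \<open>Matrix calculus\<close>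

definition has_mat_deriv ::
    "nat \<Rightarrow> (complex \<Rightarrow> complex mat) \<Rightarrow> complex mat \<Rightarrow> complex \<Rightarrow> bool" where
  "has_mat_deriv n X X' s \<longleftrightarrow> (\<forall>t. X t \<in> carrier_mat n n) \<and> X' \<in> carrier_mat n n \<and>
     (\<forall>i<n. \<forall>j<n. ((\<lambda>t. X t $$ (i, j)) has_field_derivative X' $$ (i, j)) (at s))"

lemma has_mat_derivI:
  assumes "\<And>t. X t \<in> carrier_mat n n" "X' \<in> carrier_mat n n"
    and "\<And>i j. i < n \<Longrightarrow> j < n \<Longrightarrow> ((\<lambda>t. X t $$ (i, j)) has_field_derivative X' $$ (i, j)) (at s)"
  shows "has_mat_deriv n X X' s"
  using assms unfolding has_mat_deriv_def by blast

lemma has_mat_derivD: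
  assumes "has_mat_deriv n X X' s"
  shows "X t \<in> carrier_mat n n" "X' \<in> carrier_mat n n"
    and "i < n \<Longrightarrow> j < n \<Longrightarrow> ((\<lambda>t. X t $$ (i, j)) has_field_derivative X' $$ (i, j)) (at s)"
  using assms unfolding has_mat_deriv_def by blast+

lemma has_mat_deriv_unique:
  assumes "has_mat_deriv n X X' s" "has_mat_deriv n X Y' s"
  shows "X' = Y'"
proof (rule eq_matI)
  fix i j assume "i < dim_row Y'" "j < dim_col Y'"
  then have "i < n" "j < n" using assms(2) unfolding has_mat_deriv_def by auto
  then show "X' $$ (i, j) = Y' $$ (i, j)"
    using has_mat_derivD(3)[OF assms(1)] has_mat_derivD(3)[OF assms(2)] by (blast intro: DERIV_unique)
qed (use has_mat_derivD(2)[OF assms(1)] has_mat_derivD(2)[OF assms(2)] in auto)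

lemma has_mat_deriv_mat_deriv:
  assumes "has_mat_deriv n X X' s"
  shows "mat_deriv X s = X'"
proof (rule eq_matI)
  note c = has_mat_derivD(1,2)[OF assms]
  fix i j assume "i < dim_row X'" "j < dim_col X'"
  then have ij: "i < n" "j < n" using c by auto
  then show "mat_deriv X s $$ (i, j) = X' $$ (i, j)"
    using DERIV_imp_deriv[OF has_mat_derivD(3)[OF assms ij]] c(1)[of s] by (simp add: mat_deriv_def)
qed (use has_mat_derivD(1)[OF assms, of s] has_mat_derivD(2)[OF assms] in \<open>auto simp: mat_deriv_def\<close>)

lemma mult_mat_index:
  assumes "A \<in> carrier_mat n n" "B \<in> carrier_mat n n" "i < n" "j < n"
  shows "(A * B) $$ (i, j) = (\<Sum>k<n. A $$ (i, k) * B $$ (k, j))"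
  using assms by (auto simp: scalar_prod_def lessThan_atLeast0 intro!: sum.cong)

lemma has_mat_deriv_mult:
  assumes X: "has_mat_deriv n X X' s" and Y: "has_mat_deriv n Y Y' s"
  shows "has_mat_deriv n (\<lambda>t. X t * Y t) (X' * Y s + X s * Y') s"
proof (rule has_mat_derivI)
  note cX = has_mat_derivD(1,2)[OF X] and cY = has_mat_derivD(1,2)[OF Y]
  show "X t * Y t \<in> carrier_mat n n" for t using cX cY by (meson mult_carrier_mat)
  show "X' * Y s + X s * Y' \<in> carrier_mat n n" 
    using mult_carrier_mat[OF cX(1) cY(2)] by (rule add_carrier_mat)
  fix i j assume ij: "i < n" "j < n"
  have 1: "(\<lambda>t. (X t * Y t) $$ (i, j)) = (\<lambda>t. \<Sum>k<n. X t $$ (i, k) * Y t $$ (k, j))"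
    using mult_mat_index[OF cX(1) cY(1) ij] by auto
  have "(X' * Y s + X s * Y') $$ (i, j) = (X' * Y s) $$ (i,j) + (X s * Y') $$ (i, j)"
    using carrier_matD[OF cX(1)[of s]] carrier_matD[OF cY(2)] ij by (intro index_add_mat(1)) auto
  also have "\<dots> = (\<Sum>k<n. X' $$ (i, k) * Y s $$ (k, j) + Y' $$ (k, j) * X s $$ (i, k))"
    unfolding mult_mat_index[OF cX(2) cY(1) ij] mult_mat_index[OF cX(1) cY(2) ij]
    by (simp add: sum.distrib mult.commute)
  finally have 2: "(X' * Y s + X s * Y') $$ (i, j) = \<dots>" .
  show "((\<lambda>t. (X t * Y t) $$ (i, j)) has_field_derivative (X' * Y s + X s * Y') $$ (i, j)) (at s)"
    unfolding 1 2
    using has_mat_derivD(3)[OF X] has_mat_derivD(3)[OF Y] ij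
    by (intro DERIV_sum DERIV_mult) auto
qed

lemma has_mat_deriv_line:
  assumes "X \<in> carrier_mat n n" "Y \<in> carrier_mat n n"
  shows "has_mat_deriv n (\<lambda>t. X + t \<cdot>\<^sub>m Y) Y 0"
proof (rule has_mat_derivI)
  fix i j assume ij: "i < n" "j < n"
  have "(\<lambda>t. (X + t \<cdot>\<^sub>m Y) $$ (i, j)) = (\<lambda>t. X $$ (i, j) + t * Y $$ (i, j))"
    using assms ij by auto
  then show "((\<lambda>t. (X + t \<cdot>\<^sub>m Y) $$ (i, j)) has_field_derivative Y $$ (i, j)) (at 0)"
    by (auto intro!: derivative_eq_intros)
qed (use assms in auto)

text \<open>
  Grouping the Leibniz formula by the row that supplies the entry of \<open>Y\<close> shows that the column
  substitution sum is the derivative of the determinant in the direction \<open>Y\<close>.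
\<close>

lemma col_subst_sum_expand:
  assumes X: "X \<in> carrier_mat n n" and Y: "Y \<in> carrier_mat n n"
  shows "col_subst_sum X Y = (\<Sum>p\<in>{p. p permutes {0..<n}}.
    signof p * (\<Sum>i\<in>{0..<n}. Y $$ (i, p i) * (\<Prod>k\<in>{0..<n} - {i}. X $$ (k, p k))))"
proof -
  have d: "det (replace_col X (col Y j) j) = (\<Sum>p\<in>{p. p permutes {0..<n}}.
      signof p * (\<Prod>i=0..<n. if p i = j then Y $$ (i, j) else X $$ (i, p i)))" if j: "j < n" for j
  proof -
    have c: "replace_col X (col Y j) j \<in> carrier_mat n n" using X by (auto simp: replace_col_def)
    show ?thesis unfolding det_def'[OF c]
    proof (intro sum.cong refl arg_cong2[where f = "(*)"] prod.cong)
      fix p i assume p: "p \<in> {p. p permutes {0..<n}}" and i: "i \<in> {0..<n}"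
      then have "p i < n" using permutes_in_image[of p "{0..<n}" i] by auto
      then show "replace_col X (col Y j) j $$ (i, p i) = (if p i = j then Y $$ (i, j) else X $$ (i, p i))"
        using i X Y j by (auto simp: replace_col_def)
    qed
  qed
  have "col_subst_sum X Y = (\<Sum>j<n. \<Sum>p\<in>{p. p permutes {0..<n}}.
      signof p * (\<Prod>i=0..<n. if p i = j then Y $$ (i, j) else X $$ (i, p i)))"
    using X d by (auto simp: col_subst_sum_def)
  also have "\<dots> = (\<Sum>p\<in>{p. p permutes {0..<n}}. signof p *
      (\<Sum>j\<in>{0..<n}. \<Prod>i=0..<n. if p i = j then Y $$ (i, j) else X $$ (i, p i)))"
    by (subst sum.swap) (simp add: sum_distrib_left lessThan_atLeast0)
  also have "\<dots> = (\<Sum>p\<in>{p. p permutes {0..<n}}.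
    signof p * (\<Sum>i\<in>{0..<n}. Y $$ (i, p i) * (\<Prod>k\<in>{0..<n} - {i}. X $$ (k, p k))))"
  proof (rule sum.cong[OF refl], rule arg_cong2[where f = "(*)", OF refl])
    fix p assume "p \<in> {p. p permutes {0..<n}}"
    then have p: "p permutes {0..<n}" by simp
    have "(\<Sum>j\<in>{0..<n}. \<Prod>i=0..<n. if p i = j then Y $$ (i, j) else X $$ (i, p i))
      = (\<Sum>j\<in>p ` {0..<n}. \<Prod>i=0..<n. if p i = j then Y $$ (i, j) else X $$ (i, p i))"
      using permutes_image[OF p] by simp
    also have "\<dots> = (\<Sum>i\<in>{0..<n}. \<Prod>k=0..<n. if p k = p i then Y $$ (k, p i) else X $$ (k, p k))"
      using permutes_inj_on[OF p] by (subst sum.reindex) auto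
    also have "\<dots> = (\<Sum>i\<in>{0..<n}. Y $$ (i, p i) * (\<Prod>k\<in>{0..<n} - {i}. X $$ (k, p k)))"
    proof (rule sum.cong[OF refl])
      fix i assume i: "i \<in> {0..<n}"
      have "(\<Prod>k=0..<n. if p k = p i then Y $$ (k, p i) else X $$ (k, p k))
        = Y $$ (i, p i) * (\<Prod>k\<in>{0..<n} - {i}. if p k = p i then Y $$ (k, p i) else X $$ (k, p k))"
        using i by (subst prod.remove[of _ i]) auto
      also have "(\<Prod>k\<in>{0..<n} - {i}. if p k = p i then Y $$ (k, p i) else X $$ (k, p k))
        = (\<Prod>k\<in>{0..<n} - {i}. X $$ (k, p k))"
        using inj_onD[OF permutes_inj_on[OF p, of "{0..<n}"]] i by (intro prod.cong) auto
      finally show "(\<Prod>k=0..<n. if p k = p i then Y $$ (k, p i) else X $$ (k, p k))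
        = Y $$ (i, p i) * (\<Prod>k\<in>{0..<n} - {i}. X $$ (k, p k))" .
    qed
    finally show "(\<Sum>j\<in>{0..<n}. \<Prod>i=0..<n. if p i = j then Y $$ (i, j) else X $$ (i, p i))
      = (\<Sum>i\<in>{0..<n}. Y $$ (i, p i) * (\<Prod>k\<in>{0..<n} - {i}. X $$ (k, p k)))" .
  qed
  finally show ?thesis .
qed

lemma has_field_derivative_det:
  assumes X: "has_mat_deriv n X X' s"
  shows "((\<lambda>t. det (X t)) has_field_derivative col_subst_sum (X s) X') (at s)"
proof -
  note c = has_mat_derivD(1,2)[OF X]
  have 1: "(\<lambda>t. det (X t)) = (\<lambda>t. \<Sum>p\<in>{p. p permutes {0..<n}}. signof p * (\<Prod>i\<in>{0..<n}. X t $$ (i, p i)))"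
    using det_def'[OF c(1)] by auto
  show ?thesis unfolding 1 col_subst_sum_expand[OF c]
  proof (intro DERIV_sum DERIV_cmult has_field_derivative_prod)
    fix p i assume p: "p \<in> {p. p permutes {0..<n}}" and i: "i \<in> {0..<n}"
    then have "p i < n" using permutes_in_image[of p "{0..<n}" i] by auto
    then show "((\<lambda>t. X t $$ (i, p i)) has_field_derivative X' $$ (i, p i)) (at s)"
      using has_mat_derivD(3)[OF X] i by auto
  qed
qed

lemma col_subst_sum_smult:
  assumes "X \<in> carrier_mat n n" "Y \<in> carrier_mat n n"
  shows "col_subst_sum X (c \<cdot>\<^sub>m Y) = c * col_subst_sum X Y"
proof -
  have cY: "c \<cdot>\<^sub>m Y \<in> carrier_mat n n" using assms by auto
  show ?thesis
    unfolding col_subst_sum_expand[OF assms] col_subst_sum_expand[OF assms(1) cY] sum_distrib_left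
  proof (intro sum.cong refl)
    fix p i assume p: "p \<in> {p. p permutes {0..<n}}" and i: "i \<in> {0..<n}"
    then have "p i < n" using permutes_in_image[of p "{0..<n}" i] by auto
    then show "signof p * ((c \<cdot>\<^sub>m Y) $$ (i, p i) * (\<Prod>k\<in>{0..<n} - {i}. X $$ (k, p k))) =
       c * (signof p * (Y $$ (i, p i) * (\<Prod>k\<in>{0..<n} - {i}. X $$ (k, p k))))"
      using i assms by simp
  qed
qed

text \<open>
  The derivative of the adjugate at \<open>X\<close> in the direction \<open>Y\<close>.  Column \<open>m\<close> is the vector \<open>k_vec\<close> when
  \<open>X\<close> and \<open>Y\<close> are the values of \<open>E\<close> and \<open>K\<close> at a root.
\<close>

definition adj_diff :: "complex mat \<Rightarrow> complex mat \<Rightarrow> complex mat" where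
  "adj_diff X Y = mat (dim_row X) (dim_row X)
     (\<lambda>(j, m). (- 1) ^ (m + j) * col_subst_sum (mat_delete X m j) (mat_delete Y m j))"

lemma adj_diff_carrier [simp]: "X \<in> carrier_mat n n \<Longrightarrow> adj_diff X Y \<in> carrier_mat n n"
  by (auto simp: adj_diff_def)

lemma has_mat_deriv_delete:
  assumes "has_mat_deriv n X X' s" "i < n" "j < n"
  shows "has_mat_deriv (n - 1) (\<lambda>t. mat_delete (X t) i j) (mat_delete X' i j) s"
proof (rule has_mat_derivI)
  note c = has_mat_derivD(1,2)[OF assms(1)]
  note d = c[THEN carrier_matD(1)] c[THEN carrier_matD(2)]
  show "mat_delete (X t) i j \<in> carrier_mat (n - 1) (n - 1)" for t
    using d by (auto simp: mat_delete_def)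
  show "mat_delete X' i j \<in> carrier_mat (n - 1) (n - 1)"
    using d by (auto simp: mat_delete_def)
  fix k l assume kl: "k < n - 1" "l < n - 1"
  have e: "mat_delete A i j $$ (k, l) = A $$ (if k < i then k else Suc k, if l < j then l else Suc l)"
    if "A \<in> carrier_mat n n" for A :: "complex mat"
    using kl that by (simp add: mat_delete_def)
  show "((\<lambda>t. mat_delete (X t) i j $$ (k, l)) has_field_derivative mat_delete X' i j $$ (k, l)) (at s)"
    unfolding e[OF c(1)] e[OF c(2)] using kl by (intro has_mat_derivD(3)[OF assms(1)]) auto
qed

lemma has_mat_deriv_adj:
  assumes X: "has_mat_deriv n X X' s"
  shows "has_mat_deriv n (\<lambda>t. adj_mat (X t)) (adj_diff (X s) X') s"
proof (rule has_mat_derivI)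
  note c = has_mat_derivD(1,2)[OF X]
  note d = c[THEN carrier_matD(1)] c[THEN carrier_matD(2)]
  show "adj_mat (X t) \<in> carrier_mat n n" for t using adj_mat(1)[OF c(1)] .
  show "adj_diff (X s) X' \<in> carrier_mat n n" using c by auto
  fix i j assume ij: "i < n" "j < n"
  show "((\<lambda>t. adj_mat (X t) $$ (i, j)) has_field_derivative adj_diff (X s) X' $$ (i, j)) (at s)"
    using has_field_derivative_det[OF has_mat_deriv_delete[OF X ij(2,1)]] ij d
    by (auto simp: adj_mat_def cofactor_def adj_diff_def intro!: DERIV_cmult)
qed

text \<open>
  Obtained by differentiating \<open>X adj X = det X I\<close> and \<open>adj X X = det X I\<close>.
\<close>

lemma adj_deriv_identities:
  assumes X: "has_mat_deriv n X X' s"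
  shows "X' * adj_mat (X s) + X s * adj_diff (X s) X' = col_subst_sum (X s) X' \<cdot>\<^sub>m 1\<^sub>m n"
    and "adj_diff (X s) X' * X s + adj_mat (X s) * X' = col_subst_sum (X s) X' \<cdot>\<^sub>m 1\<^sub>m n"
proof -
  note c = has_mat_derivD(1,2)[OF X]
  have D: "has_mat_deriv n (\<lambda>t. det (X t) \<cdot>\<^sub>m 1\<^sub>m n) (col_subst_sum (X s) X' \<cdot>\<^sub>m 1\<^sub>m n) s"
  proof (rule has_mat_derivI)
    fix i j assume "i < n" "j < n"
    then show "((\<lambda>t. (det (X t) \<cdot>\<^sub>m 1\<^sub>m n) $$ (i, j)) has_field_derivative
        (col_subst_sum (X s) X' \<cdot>\<^sub>m 1\<^sub>m n) $$ (i, j)) (at s)"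
      using has_field_derivative_det[OF X] by (cases "i = j") auto
  qed auto
  show "X' * adj_mat (X s) + X s * adj_diff (X s) X' = col_subst_sum (X s) X' \<cdot>\<^sub>m 1\<^sub>m n"
    using has_mat_deriv_mult[OF X has_mat_deriv_adj[OF X]] D
    unfolding adj_mat(2)[OF c(1)] by (rule has_mat_deriv_unique)
  show "adj_diff (X s) X' * X s + adj_mat (X s) * X' = col_subst_sum (X s) X' \<cdot>\<^sub>m 1\<^sub>m n"
    using has_mat_deriv_mult[OF has_mat_deriv_adj[OF X] X] D
    unfolding adj_mat(3)[OF c(1)] by (rule has_mat_deriv_unique)
qed

text \<open>
  The same along the line \<open>X + t Y\<close>, which reaches every direction \<open>Y\<close>.
\<close>

lemma adj_diff_identities:
  assumes "X \<in> carrier_mat n n" "Y \<in> carrier_mat n n"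
  shows "Y * adj_mat X + X * adj_diff X Y = col_subst_sum X Y \<cdot>\<^sub>m 1\<^sub>m n"
    and "adj_diff X Y * X + adj_mat X * Y = col_subst_sum X Y \<cdot>\<^sub>m 1\<^sub>m n"
proof -
  have "X + 0 \<cdot>\<^sub>m Y = X" using assms by (intro eq_matI) auto
  then show "Y * adj_mat X + X * adj_diff X Y = col_subst_sum X Y \<cdot>\<^sub>m 1\<^sub>m n"
    "adj_diff X Y * X + adj_mat X * Y = col_subst_sum X Y \<cdot>\<^sub>m 1\<^sub>m n"
    using adj_deriv_identities[OF has_mat_deriv_line[OF assms]] by auto
qed

lemma index_row_mult:
  assumes "A \<in> carrier_mat n k" "v \<in> carrier_vec n" "j < k"
  shows "row_mult v A $ j = (\<Sum>i<n. v $ i * A $$ (i, j))"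
  using assms by (auto simp: row_mult_def scalar_prod_def lessThan_atLeast0 mult.commute intro!: sum.cong)

lemma row_mult_carrier [simp]:
  "A \<in> carrier_mat n k \<Longrightarrow> row_mult v A \<in> carrier_vec k"
  by (intro carrier_vecI) (simp add: row_mult_def)

lemma row_mult_scalar:
  fixes v :: "'a :: comm_ring_1 vec"
  assumes "A \<in> carrier_mat n k" "v \<in> carrier_vec n" "w \<in> carrier_vec k"
  shows "row_mult v A \<bullet> w = v \<bullet> (A *\<^sub>v w)"
  using assms unfolding row_mult_def
  by (metis transpose_vec_mult_scalar)

lemma row_mult_assoc:
  fixes v :: "'a :: comm_ring_1 vec"
  assumes "A \<in> carrier_mat n k" "v \<in> carrier_vec n" "B \<in> carrier_mat k l"
  shows "row_mult (row_mult v A) B = row_mult v (A * B)"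
  using assms unfolding row_mult_def by (simp add: transpose_mult)

lemma row_mult_smult_one:
  fixes v :: "'a :: comm_ring_1 vec"
  assumes "v \<in> carrier_vec n"
  shows "row_mult v (c \<cdot>\<^sub>m 1\<^sub>m n) = c \<cdot>\<^sub>v v"
  using assms unfolding row_mult_def by (intro eq_vecI) auto

lemma row_mult_add_right:
  fixes v :: "'a :: comm_ring_1 vec"
  assumes "A \<in> carrier_mat n k" "B \<in> carrier_mat n k" "v \<in> carrier_vec n"
  shows "row_mult v (A + B) = row_mult v A + row_mult v B"
proof (rule eq_vecI)
  fix j assume "j < dim_vec (row_mult v A + row_mult v B)"
  then have j: "j < k" using assms by (simp add: row_mult_def)
  have "row_mult v (A + B) $ j = (\<Sum>i<n. v $ i * (A $$ (i, j) + B $$ (i, j)))"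
    using assms j by (subst index_row_mult) (auto intro!: sum.cong)
  then show "row_mult v (A + B) $ j = (row_mult v A + row_mult v B) $ j"
    using assms j by (simp add: index_row_mult distrib_left sum.distrib row_mult_def[of _ "_ + _"]
        carrier_vecD[OF row_mult_carrier])
qed (use assms in \<open>auto simp: row_mult_def\<close>)

text \<open>
  If the cofactor of \<open>X\<close> at \<open>(i, j)\<close> is nonzero, then replacing row \<open>i\<close> by the \<open>j\<close>-th unit vector
  makes \<open>X\<close> invertible.  A left null vector of \<open>X\<close> with vanishing coordinate \<open>i\<close> is one of the new
  matrix too, hence zero; so coordinate \<open>i\<close> determines a left null vector.
\<close>

lemma adj_nonzero_left_kernel:
  fixes X :: "'a :: field mat"
  assumes X: "X \<in> carrier_mat n n" and adj: "adj_mat X \<noteq> 0\<^sub>m n n"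
    and a: "a \<in> carrier_vec n" "row_mult a X = 0\<^sub>v n"
    and b: "b \<in> carrier_vec n" "row_mult b X = 0\<^sub>v n" "b \<noteq> 0\<^sub>v n"
  obtains k where "a = k \<cdot>\<^sub>v b"
proof -
  note aX = adj_mat(1)[OF X]
  obtain j i where ij: "j < n" "i < n" "adj_mat X $$ (j, i) \<noteq> 0"
  proof (rule ccontr)
    assume "\<not> thesis"
    then have "adj_mat X = 0\<^sub>m n n" using aX that by (intro eq_matI) auto
    then show False using adj by simp
  qed
  then have cof: "cofactor X i j \<noteq> 0" using X by (auto simp: adj_mat_def)
  define X' where "X' = mat n n (\<lambda>(k, l). if k = i then (if l = j then 1 else 0) else X $$ (k, l))"
  have X': "X' \<in> carrier_mat n n" by (simp add: X'_def)
  have "det X' = (\<Sum>l<n. X' $$ (i, l) * cofactor X' i l)"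
    by (rule laplace_expansion_row[OF X' ij(2)])
  also have "\<dots> = (\<Sum>l<n. if l = j then cofactor X' i l else 0)"
    using ij by (intro sum.cong) (auto simp: X'_def)
  also have "\<dots> = cofactor X' i j" using ij by simp
  also have "mat_delete X' i j = mat_delete X i j"
    using X ij by (intro eq_matI) (auto simp: mat_delete_def X'_def)
  then have "cofactor X' i j = cofactor X i j" by (simp add: cofactor_def)
  finally have det: "det X' \<noteq> 0" using cof by simp
  have zero: "v = 0\<^sub>v n" if v: "v \<in> carrier_vec n" "row_mult v X = 0\<^sub>v n" "v $ i = 0" for v
  proof (rule ccontr)
    assume "v \<noteq> 0\<^sub>v n"
    moreover have "transpose_mat X' *\<^sub>v v = 0\<^sub>v n"
    proof (rule eq_vecI)
      fix l assume l: "l < dim_vec (0\<^sub>v n :: 'a vec)"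
      have "row_mult v X' $ l = (\<Sum>k<n. v $ k * X' $$ (k, l))"
        using l v X' by (subst index_row_mult) auto
      also have "\<dots> = (\<Sum>k<n. v $ k * X $$ (k, l))"
        using v(3) l by (intro sum.cong) (auto simp: X'_def)
      also have "\<dots> = row_mult v X $ l" using l v X by (subst index_row_mult) auto
      finally show "(transpose_mat X' *\<^sub>v v) $ l = 0\<^sub>v n $ l" using v(2) by (simp add: row_mult_def)
    qed (use X' in auto)
    ultimately have "det (transpose_mat X') = 0"
      using det_0_iff_vec_prod_zero[of "transpose_mat X'" n] X' v by auto
    then show False using det det_transpose[OF X'] by simp
  qed
  have bi: "b $ i \<noteq> 0" using zero[OF b(1,2)] b(3) by auto
  define v where "v = a - (a $ i / b $ i) \<cdot>\<^sub>v b"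
  have v: "v \<in> carrier_vec n" using a b by (simp add: v_def)
  have "row_mult v X = 0\<^sub>v n"
  proof (rule eq_vecI)
    fix l assume "l < dim_vec (0\<^sub>v n :: 'a vec)"
    then have l: "l < n" by simp
    have "row_mult v X $ l = (\<Sum>k<n. a $ k * X $$ (k, l)) - (a $ i / b $ i) * (\<Sum>k<n. b $ k * X $$ (k, l))"
      using l v X a b
      by (subst index_row_mult) (auto simp: v_def sum_distrib_left sum_subtractf algebra_simps)
    also have "\<dots> = row_mult a X $ l - (a $ i / b $ i) * row_mult b X $ l"
      by (simp only: index_row_mult[OF X a(1) l] index_row_mult[OF X b(1) l])
    finally show "row_mult v X $ l = 0\<^sub>v n $ l" using a b l by simp
  qed (use X in \<open>auto simp: row_mult_def\<close>)
  moreover have "v $ i = 0" using a b ij bi by (simp add: v_def)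
  ultimately have "v = 0\<^sub>v n" using zero v by blast
  have "a = (a $ i / b $ i) \<cdot>\<^sub>v b"
  proof (rule eq_vecI)
    fix l assume "l < dim_vec ((a $ i / b $ i) \<cdot>\<^sub>v b)"
    then have "l < n" using b by simp
    then have "v $ l = 0" using \<open>v = 0\<^sub>v n\<close> by simp
    then show "a $ l = ((a $ i / b $ i) \<cdot>\<^sub>v b) $ l" using \<open>l < n\<close> a b by (simp add: v_def)
  qed (use a b in auto)
  then show ?thesis using that by blast
qed

section \<open>Partial fractions\<close>

text \<open>
  This is \<open>D / (x - a i)^l\<close> for \<open>D = \<Prod>b\<in>I. (x - a b) ^ n b\<close>.  Partial fractions over \<open>D\<close> thus become
  linear combinations of polynomials.
\<close>

definition pole_basis :: "'i set \<Rightarrow> ('i \<Rightarrow> complex) \<Rightarrow> ('i \<Rightarrow> nat) \<Rightarrow> 'i \<Rightarrow> nat \<Rightarrow> complex poly" where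
  "pole_basis I a n i l = [:- a i, 1:] ^ (n i - l) * (\<Prod>b\<in>I - {i}. [:- a b, 1:] ^ n b)"

text \<open>
  The tool for inductions on the total multiplicity: when \<open>n i\<close> is lowered by one, the family loses its
  member \<open>(i, n i)\<close>, and the others lose a factor \<open>x - a i\<close>.
\<close>

lemma pole_basis_step:
  assumes "finite I" "i \<in> I" "0 < n i" and n': "n' = n(i := n i - 1)"
    and "j \<in> I" "1 \<le> l" "l \<le> n' j"
  shows "pole_basis I a n j l = [:- a i, 1:] * pole_basis I a n' j l"
proof (cases "j = i")
  case True
  have "(\<Prod>b\<in>I - {i}. [:- a b, 1:] ^ n b) = (\<Prod>b\<in>I - {i}. [:- a b, 1:] ^ n' b)"
    using n' by (intro prod.cong) auto
  moreover have "n i - l = Suc (n' i - l)" using assms True by auto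
  ultimately show ?thesis using True by (simp only: pole_basis_def power_Suc mult.assoc)
next
  case False
  have fin: "finite (I - {j})" and mem: "i \<in> I - {j}" using assms False by auto
  have "(\<Prod>b\<in>I - {j}. [:- a b, 1:] ^ n b) = [:- a i, 1:] ^ n i * (\<Prod>b\<in>I - {j} - {i}. [:- a b, 1:] ^ n b)"
    using prod.remove[OF fin mem] by simp
  also have "[:- a i, 1:] ^ n i = [:- a i, 1:] * [:- a i, 1:] ^ n' i"
    using assms(3) n' by (cases "n i") auto
  also have "(\<Prod>b\<in>I - {j} - {i}. [:- a b, 1:] ^ n b) = (\<Prod>b\<in>I - {j} - {i}. [:- a b, 1:] ^ n' b)"
    using n' by (intro prod.cong) auto
  finally have e: "(\<Prod>b\<in>I - {j}. [:- a b, 1:] ^ n b) = [:- a i, 1:] * (\<Prod>b\<in>I - {j}. [:- a b, 1:] ^ n' b)"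
    unfolding prod.remove[OF fin mem, of "\<lambda>b. [:- a b, 1:] ^ n' b"] by (simp only: mult.assoc)
  have "n' j = n j" using n' False by simp
  then show ?thesis unfolding pole_basis_def e by (simp only: mult_ac)
qed

lemma pole_basis_top:
  assumes "finite I" "i \<in> I" "inj_on a I"
  shows "poly (pole_basis I a n i (n i)) (a i) \<noteq> 0"
    and "degree (pole_basis I a n i (n i)) = (\<Sum>b\<in>I - {i}. n b)"
proof -
  show "poly (pole_basis I a n i (n i)) (a i) \<noteq> 0"
    using assms by (auto simp: pole_basis_def poly_prod inj_on_def)
  show "degree (pole_basis I a n i (n i)) = (\<Sum>b\<in>I - {i}. n b)"
    unfolding pole_basis_def
    by (simp add: degree_prod_eq_sum_degree degree_power_eq)
qed

lemma pole_basis_sum_step: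
  assumes "finite I" "i \<in> I" "0 < n i" and n': "n' = n(i := n i - 1)"
  shows "(\<Sum>j\<in>I. \<Sum>l\<in>{1..n j}. Polynomial.smult (c j l) (pole_basis I a n j l))
    = Polynomial.smult (c i (n i)) (pole_basis I a n i (n i))
      + [:- a i, 1:] * (\<Sum>j\<in>I. \<Sum>l\<in>{1..n' j}. Polynomial.smult (c j l) (pole_basis I a n' j l))"
proof -
  have "(\<Sum>j\<in>I. \<Sum>l\<in>{1..n j}. Polynomial.smult (c j l) (pole_basis I a n j l))
    = (\<Sum>j\<in>I. (if j = i then Polynomial.smult (c i (n i)) (pole_basis I a n i (n i)) else 0)
        + (\<Sum>l\<in>{1..n' j}. Polynomial.smult (c j l) (pole_basis I a n j l)))"
  proof (rule sum.cong[OF refl])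
    fix j assume "j \<in> I"
    have "{1..n i} = insert (n i) {1..n' i}" "n i \<notin> {1..n' i}" using assms(3) n' by auto
    then show "(\<Sum>l\<in>{1..n j}. Polynomial.smult (c j l) (pole_basis I a n j l)) =
       (if j = i then Polynomial.smult (c i (n i)) (pole_basis I a n i (n i)) else 0)
        + (\<Sum>l\<in>{1..n' j}. Polynomial.smult (c j l) (pole_basis I a n j l))"
      using n' by (cases "j = i") (simp_all del: fun_upd_apply, simp)
  qed
  also have "\<dots> = Polynomial.smult (c i (n i)) (pole_basis I a n i (n i))
      + (\<Sum>j\<in>I. \<Sum>l\<in>{1..n' j}. Polynomial.smult (c j l) (pole_basis I a n j l))"
    using assms by (simp add: sum.distrib del: fun_upd_apply)
  also have "(\<Sum>j\<in>I. \<Sum>l\<in>{1..n' j}. Polynomial.smult (c j l) (pole_basis I a n j l))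
    = (\<Sum>j\<in>I. \<Sum>l\<in>{1..n' j}. [:- a i, 1:] * Polynomial.smult (c j l) (pole_basis I a n' j l))"
    by (intro sum.cong refl) (use pole_basis_step[OF assms] in \<open>simp\<close>)
  finally show ?thesis by (simp only: sum_distrib_left)
qed

text \<open>
  At \<open>a i\<close> only the member \<open>(i, n i)\<close> of the family does not vanish.  This fixes its coefficient, and
  the remainder is divisible by \<open>x - a i\<close>.
\<close>

lemma pole_basis_spans:
  assumes "finite I" "inj_on a I" "degree H < (\<Sum>i\<in>I. n i) \<or> H = 0"
  shows "\<exists>c. H = (\<Sum>j\<in>I. \<Sum>l\<in>{1..n j}. Polynomial.smult (c j l) (pole_basis I a n j l))"
  using assms(3)
proof (induction "\<Sum>i\<in>I. n i" arbitrary: n H)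
  case 0
  then have "H = 0" by auto
  then show ?case by (intro exI[of _ "\<lambda>_ _. 0"]) simp
next
  case (Suc m)
  obtain i where i: "i \<in> I" "0 < n i" using Suc(2) assms(1)
    by (metis gr0I nat.distinct(1) sum.neutral)
  define n' where n': "n' = n(i := n i - 1)"
  have sn: "(\<Sum>i\<in>I. n i) = n i + (\<Sum>b\<in>I - {i}. n b)" using i assms(1) by (simp add: sum.remove)
  have "(\<Sum>i\<in>I. n' i) = n' i + (\<Sum>b\<in>I - {i}. n' b)" using i assms(1) by (simp add: sum.remove)
  also have "(\<Sum>b\<in>I - {i}. n' b) = (\<Sum>b\<in>I - {i}. n b)" using n' by (intro sum.cong) auto
  finally have m: "m = (\<Sum>i\<in>I. n' i)" using sn Suc(2) i n' by auto
  define B where "B = pole_basis I a n i (n i)"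
  have B: "poly B (a i) \<noteq> 0" "degree B = (\<Sum>b\<in>I - {i}. n b)"
    unfolding B_def using pole_basis_top[OF assms(1) i(1) assms(2)] by auto
  define c0 where "c0 = poly H (a i) / poly B (a i)"
  have "poly (H - Polynomial.smult c0 B) (a i) = 0" using B by (simp add: c0_def)
  then have "[:- a i, 1:] dvd H - Polynomial.smult c0 B" by (simp only: poly_eq_0_iff_dvd)
  then obtain H1 where H1: "H - Polynomial.smult c0 B = [:- a i, 1:] * H1" by (rule dvdE)
  have "degree H1 < m \<or> H1 = 0"
  proof (rule ccontr)
    assume "\<not> ?thesis"
    then have h: "m \<le> degree H1" "H1 \<noteq> 0" by auto
    have "degree (H - Polynomial.smult c0 B) = Suc (degree H1)" using h unfolding H1 by (subst degree_mult_eq) auto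
    moreover have "degree (H - Polynomial.smult c0 B) < Suc m"
    proof (rule le_less_trans[OF degree_diff_le_max], rule max_less_iff_conj[THEN iffD2], intro conjI)
      show "degree H < Suc m" using Suc by auto
      have "degree (Polynomial.smult c0 B) \<le> degree B" by (rule degree_smult_le)
      also have "degree B < Suc m" using B(2) sn Suc(2) i by simp
      finally show "degree (Polynomial.smult c0 B) < Suc m" .
    qed
    ultimately show False using h by simp
  qed
  then have "degree H1 < (\<Sum>i\<in>I. n' i) \<or> H1 = 0" using m by simp
  from Suc(1)[OF m this] obtain c where
    c: "H1 = (\<Sum>j\<in>I. \<Sum>l\<in>{1..n' j}. Polynomial.smult (c j l) (pole_basis I a n' j l))" by blast
  define c' where "c' = (\<lambda>j l. if j = i \<and> l = n i then c0 else c j l)"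
  have "(\<Sum>j\<in>I. \<Sum>l\<in>{1..n' j}. Polynomial.smult (c' j l) (pole_basis I a n' j l)) = H1"
    unfolding c using i(2) by (intro sum.cong refl) (auto simp: c'_def n')
  moreover have "c' i (n i) = c0" by (simp add: c'_def)
  ultimately have "H = (\<Sum>j\<in>I. \<Sum>l\<in>{1..n j}. Polynomial.smult (c' j l) (pole_basis I a n j l))"
    unfolding pole_basis_sum_step[OF assms(1) i n'] using H1 by (simp add: B_def algebra_simps)
  then show ?case by blast
qed

lemma pole_basis_independent:
  assumes "finite I" "inj_on a I"
    and "(\<Sum>j\<in>I. \<Sum>l\<in>{1..n j}. Polynomial.smult (c j l) (pole_basis I a n j l)) = 0"
    and "j \<in> I" "l \<in> {1..n j}"
  shows "c j l = 0"
  using assms(3-)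
proof (induction "\<Sum>i\<in>I. n i" arbitrary: n j l)
  case 0
  then show ?case using assms(1) by auto
next
  case (Suc m)
  obtain i where i: "i \<in> I" "0 < n i" using Suc(2) assms(1)
    by (metis gr0I nat.distinct(1) sum.neutral)
  define n' where n': "n' = n(i := n i - 1)"
  have "(\<Sum>i\<in>I. n' i) = n' i + (\<Sum>b\<in>I - {i}. n' b)" using i assms(1) by (simp add: sum.remove)
  also have "(\<Sum>b\<in>I - {i}. n' b) = (\<Sum>b\<in>I - {i}. n b)" using n' by (intro sum.cong) auto
  finally have m: "m = (\<Sum>i\<in>I. n' i)" using Suc(2) i n' assms(1) by (auto simp: sum.remove)
  let ?S = "\<Sum>j\<in>I. \<Sum>l\<in>{1..n' j}. Polynomial.smult (c j l) (pole_basis I a n' j l)"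
  let ?B = "pole_basis I a n i (n i)"
  have e: "Polynomial.smult (c i (n i)) ?B + [:- a i, 1:] * ?S = 0"
    using Suc.prems(1) unfolding pole_basis_sum_step[OF assms(1) i n'] .
  then have "poly (Polynomial.smult (c i (n i)) ?B + [:- a i, 1:] * ?S) (a i) = 0" by (simp only: poly_0)
  then have top: "c i (n i) = 0" using pole_basis_top(1)[OF assms(1) i(1) assms(2)] by simp
  have "[:- a i, 1:] * ?S = 0" using e top by (simp only: smult_0_left add_0_left)
  then have S0: "?S = 0" by (simp only: mult_eq_0_iff) simp
  show ?case
  proof (cases "j = i \<and> l = n i")
    case True
    then show ?thesis using top by simp
  next
    case False
    then have "l \<in> {1..n' j}" using Suc.prems(3) n' by auto
    then show ?thesis using Suc(1)[OF m S0 Suc.prems(2)] by blast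
  qed
qed

lemma poly_pole_basis:
  assumes "finite I" "i \<in> I" "s \<noteq> a i" "l \<le> n i"
  shows "poly (pole_basis I a n i l) s = (\<Prod>b\<in>I. (s - a b) ^ n b) / (s - a i) ^ l"
proof -
  have "(\<Prod>b\<in>I. (s - a b) ^ n b) = (s - a i) ^ (n i) * (\<Prod>b\<in>I - {i}. (s - a b) ^ n b)"
    using assms by (simp add: prod.remove)
  moreover have "(s - a i) ^ n i = (s - a i) ^ (n i - l) * (s - a i) ^ l"
    using assms(4) by (simp flip: power_add)
  ultimately show ?thesis using assms(3) by (simp add: pole_basis_def poly_prod)
qed

text \<open>
  The poles are indexed by a disjoint sum, for the simple ones \<open>sr k\<close> and the ones \<open>- y j\<close> of
  multiplicity \<open>r j\<close>.  The definition of \<open>pf\<close> counts the powers at \<open>- y j\<close> downwards, whence the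
  reversal \<open>r j - l + 1\<close>.
\<close>

lemma pf_eq_basis:
  fixes sr y :: "nat \<Rightarrow> complex" and r :: "nat \<Rightarrow> nat" and N \<sigma> :: nat
  defines "I \<equiv> {1..<N} <+> {1..\<sigma>}"
    and "a \<equiv> case_sum sr (\<lambda>j. - y j)" and "n \<equiv> case_sum (\<lambda>_. 1) r"
  assumes s: "s \<notin> sr ` {1..<N}" "\<And>j. j \<in> {1..\<sigma>} \<Longrightarrow> s + y j \<noteq> 0"
  assumes c: "c = case_sum (\<lambda>k l. c1 k) (\<lambda>j l. c2 (j, r j - l + 1) * y j ^ l)"
  shows "pf N sr \<sigma> y r c0 c1 c2 s = c0 +
     poly (\<Sum>i\<in>I. \<Sum>l\<in>{1..n i}. Polynomial.smult (c i l) (pole_basis I a n i l)) s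
       / ((\<Prod>k\<in>{1..<N}. s - sr k) * (\<Prod>j\<in>{1..\<sigma>}. (s + y j) ^ r j))"
proof -
  have fin: "finite I" by (simp add: I_def)
  define D where "D = (\<Prod>b\<in>I. (s - a b) ^ n b)"
  have D: "D = (\<Prod>k\<in>{1..<N}. s - sr k) * (\<Prod>j\<in>{1..\<sigma>}. (s + y j) ^ r j)"
    unfolding D_def I_def by (subst prod.Plus) (auto simp: a_def n_def)
  have D0: "D \<noteq> 0" using s unfolding D by auto
  have nz: "s \<noteq> a i" if "i \<in> I" for i
  proof (cases i)
    case (Inl k)
    then show ?thesis using that s(1) by (auto simp: I_def a_def)
  next
    case (Inr j)
    then have "s + y j \<noteq> 0" using that s(2)[of j] by (auto simp: I_def)
    then show ?thesis using Inr by (simp add: a_def eq_neg_iff_add_eq_0)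
  qed
  have "poly (\<Sum>i\<in>I. \<Sum>l\<in>{1..n i}. Polynomial.smult (c i l) (pole_basis I a n i l)) s
    = (\<Sum>i\<in>I. \<Sum>l\<in>{1..n i}. c i l * (D / (s - a i) ^ l))"
    unfolding poly_sum poly_smult D_def using poly_pole_basis[OF fin _ nz]
    by (intro sum.cong refl arg_cong2[where f = "(*)"]) auto
  also have "\<dots> = D * (\<Sum>i\<in>I. \<Sum>l\<in>{1..n i}. c i l / (s - a i) ^ l)"
    by (simp add: sum_distrib_left mult.commute)
  finally have 1: "poly (\<Sum>i\<in>I. \<Sum>l\<in>{1..n i}. Polynomial.smult (c i l) (pole_basis I a n i l)) s / D
    = (\<Sum>i\<in>I. \<Sum>l\<in>{1..n i}. c i l / (s - a i) ^ l)" using D0 by simp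
  have "(\<Sum>i\<in>I. \<Sum>l\<in>{1..n i}. c i l / (s - a i) ^ l) = (\<Sum>k\<in>{1..<N}. c1 k / (s - sr k))
     + (\<Sum>j\<in>{1..\<sigma>}. \<Sum>l\<in>{1..r j}. c2 (j, r j - l + 1) * y j ^ l / (s + y j) ^ l)"
    unfolding I_def by (subst sum.Plus) (auto simp: a_def n_def c)
  also have "(\<Sum>j\<in>{1..\<sigma>}. \<Sum>l\<in>{1..r j}. c2 (j, r j - l + 1) * y j ^ l / (s + y j) ^ l)
    = (\<Sum>j\<in>{1..\<sigma>}. \<Sum>l\<in>{1..r j}. c2 (j, l) * y j ^ (r j - l + 1) / (s + y j) ^ (r j - l + 1))"
  proof (rule sum.cong[OF refl])
    fix j
    show "(\<Sum>l\<in>{1..r j}. c2 (j, r j - l + 1) * y j ^ l / (s + y j) ^ l)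
      = (\<Sum>l\<in>{1..r j}. c2 (j, l) * y j ^ (r j - l + 1) / (s + y j) ^ (r j - l + 1))"
      by (rule sum.reindex_bij_witness[of _ "\<lambda>l. r j - l + 1" "\<lambda>l. r j - l + 1"]) auto
  qed
  finally show ?thesis using 1 unfolding D pf_def by simp
qed

context
  fixes sr y :: "nat \<Rightarrow> complex" and r :: "nat \<Rightarrow> nat" and N \<sigma> :: nat
  assumes inj_sr: "inj_on sr {1..<N}" and inj_y: "inj_on y {1..\<sigma>}"
    and sep: "\<And>k j. k \<in> {1..<N} \<Longrightarrow> j \<in> {1..\<sigma>} \<Longrightarrow> sr k \<noteq> - y j"
    and y0: "\<And>j. j \<in> {1..\<sigma>} \<Longrightarrow> y j \<noteq> 0"
begin

lemma inj_poles: "inj_on (case_sum sr (\<lambda>j. - y j)) ({1..<N} <+> {1..\<sigma>})"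
proof (rule inj_onI)
  fix u v assume "u \<in> {1..<N} <+> {1..\<sigma>}" "v \<in> {1..<N} <+> {1..\<sigma>}"
    "case_sum sr (\<lambda>j. - y j) u = case_sum sr (\<lambda>j. - y j) v"
  then show "u = v"
    using inj_onD[OF inj_sr] inj_onD[OF inj_y] sep sep[symmetric] by (auto elim!: PlusE)
qed

text \<open>
  The denominator \<open>D\<close> is monic of degree \<open>n\<close>, so subtracting \<open>c0 D\<close> with \<open>c0\<close> the coefficient of
  \<open>H\<close> at \<open>n\<close> leaves a proper fraction.
\<close>

theorem pf_exists:
  fixes H :: "complex poly"
  defines "n \<equiv> N - 1 + (\<Sum>j\<in>{1..\<sigma>}. r j)"
  assumes deg: "degree H \<le> n" and c0: "coeff H n = c0"
  obtains c1 c2 where "c1 \<in> extensional {1..<N}" "c2 \<in> extensional (SIGMA j:{1..\<sigma>}. {1..r j})"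
    and "\<And>s. s \<notin> sr ` {1..<N} \<Longrightarrow> (\<And>j. j \<in> {1..\<sigma>} \<Longrightarrow> s + y j \<noteq> 0) \<Longrightarrow>
      pf N sr \<sigma> y r c0 c1 c2 s
        = poly H s / ((\<Prod>k\<in>{1..<N}. s - sr k) * (\<Prod>j\<in>{1..\<sigma>}. (s + y j) ^ r j))"
proof -
  define I where "I = {1..<N} <+> {1..\<sigma>}"
  define a where "a = case_sum sr (\<lambda>j. - y j)"
  define m where "m = case_sum (\<lambda>_::nat. 1::nat) r"
  define D where "D = (\<Prod>k\<in>{1..<N}. [:- sr k, 1:]) * (\<Prod>j\<in>{1..\<sigma>}. [:y j, 1:] ^ r j)"
  have fin: "finite I" by (simp add: I_def)
  have sum_m: "(\<Sum>i\<in>I. m i) = n"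
    unfolding I_def by (subst sum.Plus) (auto simp: m_def n_def)
  have "degree D = (\<Sum>k\<in>{1..<N}. degree [:- sr k, 1:]) + (\<Sum>j\<in>{1..\<sigma>}. degree ([:y j, 1:] ^ r j))"
    unfolding D_def by (subst degree_mult_eq) (auto simp: degree_prod_eq_sum_degree)
  also have "\<dots> = n" by (simp add: n_def degree_power_eq)
  finally have dD: "degree D = n" .
  have lD: "coeff D n = 1"
  proof -
    have "lead_coeff D = 1" unfolding D_def
      by (simp add: lead_coeff_mult lead_coeff_prod lead_coeff_power)
    then show ?thesis using dD by simp
  qed
  have pD: "poly D s = (\<Prod>k\<in>{1..<N}. s - sr k) * (\<Prod>j\<in>{1..\<sigma>}. (s + y j) ^ r j)" for s
    by (simp add: D_def poly_prod add.commute)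
  have "degree (H - Polynomial.smult c0 D) \<le> n"
    using deg dD degree_diff_le degree_smult_le[of c0 D] by (metis le_trans order_refl)
  moreover have "coeff (H - Polynomial.smult c0 D) n = 0" using c0 lD by simp
  ultimately have "degree (H - Polynomial.smult c0 D) < (\<Sum>i\<in>I. m i) \<or> H - Polynomial.smult c0 D = 0"
    unfolding sum_m by (metis leading_coeff_0_iff nat_less_le)
  from pole_basis_spans[OF fin _ this, of a] inj_poles
  obtain c where c: "H - Polynomial.smult c0 D = (\<Sum>j\<in>I. \<Sum>l\<in>{1..m j}. Polynomial.smult (c j l) (pole_basis I a m j l))"
    by (auto simp: a_def I_def)
  define c1 where "c1 = restrict (\<lambda>k. c (Inl k) 1) {1..<N}"
  define c2 where "c2 = restrict (\<lambda>(j, l). c (Inr j) (r j - l + 1) / y j ^ (r j - l + 1)) (SIGMA j:{1..\<sigma>}. {1..r j})"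
  define c' where "c' = case_sum (\<lambda>k (l::nat). c1 k) (\<lambda>j l. c2 (j, r j - l + 1) * y j ^ l)"
  have cc: "c i l = c' i l" if "i \<in> I" "l \<in> {1..m i}" for i l
  proof (cases i)
    case (Inl k)
    then show ?thesis using that by (auto simp: c'_def c1_def m_def I_def)
  next
    case (Inr j)
    then have "j \<in> {1..\<sigma>}" "l \<in> {1..r j}" using that by (auto simp: m_def I_def)
    then have "(j, r j - l + 1) \<in> (SIGMA j:{1..\<sigma>}. {1..r j})" and e: "r j - (r j - l + 1) + 1 = l" by auto
    then have "c2 (j, r j - l + 1) = c (Inr j) (r j - (r j - l + 1) + 1) / y j ^ (r j - (r j - l + 1) + 1)"
      by (simp only: c2_def restrict_apply if_True prod.case)
    then show ?thesis using Inr y0[OF \<open>j \<in> {1..\<sigma>}\<close>] unfolding e by (simp add: c'_def)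
  qed
  show ?thesis
  proof (rule that[of c1 c2])
    show "c1 \<in> extensional {1..<N}" by (simp add: c1_def)
    show "c2 \<in> extensional (SIGMA j:{1..\<sigma>}. {1..r j})" by (simp add: c2_def)
    fix s assume s: "s \<notin> sr ` {1..<N}" "\<And>j. j \<in> {1..\<sigma>} \<Longrightarrow> s + y j \<noteq> 0"
    have D0: "poly D s \<noteq> 0" using s unfolding pD by auto
    have "pf N sr \<sigma> y r c0 c1 c2 s
      = c0 + poly (\<Sum>i\<in>I. \<Sum>l\<in>{1..m i}. Polynomial.smult (c' i l) (pole_basis I a m i l)) s / poly D s"
      unfolding pD I_def a_def m_def by (rule pf_eq_basis[OF s c'_def])
    also have "(\<Sum>i\<in>I. \<Sum>l\<in>{1..m i}. Polynomial.smult (c' i l) (pole_basis I a m i l)) = H - Polynomial.smult c0 D"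
      unfolding c using cc by (intro sum.cong refl) simp
    finally show "pf N sr \<sigma> y r c0 c1 c2 s
      = poly H s / ((\<Prod>k\<in>{1..<N}. s - sr k) * (\<Prod>j\<in>{1..\<sigma>}. (s + y j) ^ r j))"
      unfolding pD[symmetric] using D0 by (simp add: field_simps)
  qed
qed

lemma pf_numerator:
  obtains H where "\<And>s. s \<notin> sr ` {1..<N} \<Longrightarrow> (\<And>j. j \<in> {1..\<sigma>} \<Longrightarrow> s + y j \<noteq> 0) \<Longrightarrow>
      pf N sr \<sigma> y r c0 c1 c2 s
        = poly H s / ((\<Prod>k\<in>{1..<N}. s - sr k) * (\<Prod>j\<in>{1..\<sigma>}. (s + y j) ^ r j))"
    and "H = 0 \<Longrightarrow> c0 = 0"
    and "H = 0 \<Longrightarrow> k \<in> {1..<N} \<Longrightarrow> c1 k = 0"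
    and "H = 0 \<Longrightarrow> jl \<in> (SIGMA j:{1..\<sigma>}. {1..r j}) \<Longrightarrow> c2 jl = 0"
proof -
  define I where "I = {1..<N} <+> {1..\<sigma>}"
  define a where "a = case_sum sr (\<lambda>j. - y j)"
  define m where "m = case_sum (\<lambda>_::nat. 1::nat) r"
  define c where "c = case_sum (\<lambda>k (l::nat). c1 k) (\<lambda>j l. c2 (j, r j - l + 1) * y j ^ l)"
  define S where "S = (\<Sum>i\<in>I. \<Sum>l\<in>{1..m i}. Polynomial.smult (c i l) (pole_basis I a m i l))"
  define n where "n = (\<Sum>i\<in>I. m i)"
  define D where "D = (\<Prod>k\<in>{1..<N}. [:- sr k, 1:]) * (\<Prod>j\<in>{1..\<sigma>}. [:y j, 1:] ^ r j)"
  have fin: "finite I" by (simp add: I_def)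
  have n: "n = N - 1 + (\<Sum>j\<in>{1..\<sigma>}. r j)"
    unfolding I_def n_def by (subst sum.Plus) (auto simp: m_def)
  have "degree D = (\<Sum>k\<in>{1..<N}. degree [:- sr k, 1:]) + (\<Sum>j\<in>{1..\<sigma>}. degree ([:y j, 1:] ^ r j))"
    unfolding D_def by (subst degree_mult_eq) (auto simp: degree_prod_eq_sum_degree)
  also have "\<dots> = n" by (simp add: n degree_power_eq)
  finally have dD: "degree D = n" .
  have lD: "lead_coeff D = 1" unfolding D_def
      by (simp add: lead_coeff_mult lead_coeff_prod lead_coeff_power)
  have pD: "poly D s = (\<Prod>k\<in>{1..<N}. s - sr k) * (\<Prod>j\<in>{1..\<sigma>}. (s + y j) ^ r j)" for s
    by (simp add: D_def poly_prod add.commute)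
  have dS: "coeff S n = 0"
  proof -
    have "coeff (pole_basis I a m i l) n = 0" if il: "i \<in> I" "l \<in> {1..m i}" for i l
    proof (rule coeff_eq_0)
      have "degree (pole_basis I a m i l) = m i - l + (\<Sum>b\<in>I - {i}. m b)"
        unfolding pole_basis_def
        by (subst degree_mult_eq) (auto simp: degree_prod_eq_sum_degree degree_power_eq fin)
      also have "\<dots> < n" using il fin by (auto simp: n_def sum.remove[of I i])
      finally show "degree (pole_basis I a m i l) < n" .
    qed
    then show ?thesis by (simp add: S_def coeff_sum)
  qed
  show ?thesis
  proof (rule that[of "S + Polynomial.smult c0 D"])
    fix s assume s: "s \<notin> sr ` {1..<N}" "\<And>j. j \<in> {1..\<sigma>} \<Longrightarrow> s + y j \<noteq> 0"
    have D0: "poly D s \<noteq> 0" using s unfolding pD by auto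
    have "pf N sr \<sigma> y r c0 c1 c2 s = c0 + poly S s / poly D s"
      unfolding pD S_def I_def a_def m_def by (rule pf_eq_basis[OF s c_def])
    then show "pf N sr \<sigma> y r c0 c1 c2 s
      = poly (S + Polynomial.smult c0 D) s / ((\<Prod>k\<in>{1..<N}. s - sr k) * (\<Prod>j\<in>{1..\<sigma>}. (s + y j) ^ r j))"
      unfolding pD[symmetric] using D0 by (simp add: field_simps)
  next
    assume "S + Polynomial.smult c0 D = 0"
    then have "coeff (S + Polynomial.smult c0 D) n = 0" by simp
    then show c0: "c0 = 0" using dS lD dD by simp
  next
    assume z: "S + Polynomial.smult c0 D = 0"
    then have "coeff (S + Polynomial.smult c0 D) n = 0" by simp
    then have "c0 = 0" using dS lD dD by simp
    with z have "S = 0" by simp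
    then have c: "c i l = 0" if "i \<in> I" "l \<in> {1..m i}" for i l
      using pole_basis_independent[where I = I and a = a and n = m and c = c and j = i and l = l]
        fin inj_poles that by (simp add: S_def a_def I_def)
    { assume "k \<in> {1..<N}"
      then have "Inl k \<in> I" unfolding I_def by (rule InlI)
      then show "c1 k = 0" using c[of "Inl k" 1] by (simp add: m_def c_def) }
    { assume "jl \<in> (SIGMA j:{1..\<sigma>}. {1..r j})"
      then obtain j l where jl: "jl = (j, l)" "j \<in> {1..\<sigma>}" "l \<in> {1..r j}" by auto
      then have "Inr j \<in> I" "r j - l + 1 \<in> {1..m (Inr j)}"
        unfolding I_def by (auto intro: InrI simp: m_def)
      then have "c2 (j, r j - (r j - l + 1) + 1) * y j ^ (r j - l + 1) = 0"
        using c[of "Inr j" "r j - l + 1"] by (simp only: c_def sum.case)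
      moreover have "r j - (r j - l + 1) + 1 = l" using jl by auto
      ultimately show "c2 jl = 0" using y0[OF jl(2)] jl by simp }
  qed
qed

end

section \<open>Laplace transforms of laws on the half-line\<close>

text \<open>
  The restriction to an event makes one theory serve two purposes: service transforms, where the
  event is sure, and the components of \<open>Phi\<close>, where it fixes the tag.
\<close>

definition lt_on :: "'a measure \<Rightarrow> ('a \<Rightarrow> real) \<Rightarrow> ('a \<Rightarrow> bool) \<Rightarrow> complex \<Rightarrow> complex" where
  "lt_on M g P s = (LINT x|M. (if P x then exp (- s * complex_of_real (g x)) else 0))"

lemma powser_coeff_unique:
  fixes a b :: "nat \<Rightarrow> complex"
  assumes "0 < r" and a: "\<And>w. norm w < r \<Longrightarrow> (\<lambda>n. a n * w ^ n) sums f w"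
    and b: "\<And>w. norm w < r \<Longrightarrow> (\<lambda>n. b n * w ^ n) sums f w"
  shows "a m = b m"
proof (rule ccontr)
  assume ne: "a m \<noteq> b m"
  have d: "(\<lambda>n. (a n - b n) * w ^ n) sums 0" if "norm w < r" for w
    using sums_diff[OF a[OF that] b[OF that]] by (simp add: algebra_simps)
  have "(\<lambda>n. (a n - b n) * 0 ^ n) sums (a 0 - b 0)" by (rule powser_sums_zero)
  with d[of 0] \<open>0 < r\<close> have "a 0 - b 0 = 0" by (auto intro: sums_unique2)
  then have "m > 0" using ne by (cases m) auto
  obtain s where "0 < s" "\<And>z::complex. z \<in> cball 0 s - {0} \<Longrightarrow> (0::complex) \<noteq> 0"
    by (rule powser_0_nonzero[where r = r and a = "\<lambda>n. a n - b n" and \<xi> = 0 and f = "\<lambda>_. 0" and m = m])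
      (use assms(1) d ne \<open>m > 0\<close> in \<open>auto simp: dist_norm\<close>)
  moreover have "complex_of_real s \<in> cball 0 s - {0}" using \<open>0 < s\<close> by simp
  ultimately show False by blast
qed

context
  fixes M :: "'a measure" and g :: "'a \<Rightarrow> real" and P :: "'a \<Rightarrow> bool"
  assumes prob: "prob_space M" and g [measurable]: "g \<in> borel_measurable M"
    and P [measurable]: "Measurable.pred M P" and g0: "AE x in M. 0 \<le> g x"
begin

interpretation prob_space M by (rule prob)

lemma lt_bound: "AE x in M. norm (if P x then exp (- s * complex_of_real (g x)) else 0) \<le> 1"
  if "0 \<le> Re s"
  using g0 by eventually_elim (use that in \<open>auto\<close>)

lemma lt_integrable:
  assumes "0 \<le> Re s"
  shows "integrable M (\<lambda>x. if P x then exp (- s * complex_of_real (g x)) else 0)"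
  by (rule integrable_const_bound[OF lt_bound[OF assms]]) measurable

lemma norm_lt_on_le:
  assumes "0 \<le> Re s"
  shows "norm (lt_on M g P s) \<le> 1"
proof -
  have "norm (lt_on M g P s) \<le> (LINT x|M. norm (if P x then exp (- s * complex_of_real (g x)) else 0))"
    unfolding lt_on_def by (rule integral_norm_bound)
  also have "\<dots> \<le> (LINT x|M. 1)"
    using lt_bound[OF assms] by (intro integral_mono_AE integrable_norm lt_integrable assms) auto
  finally show ?thesis by (simp add: prob_space)
qed

definition lt_coeff :: "real \<Rightarrow> nat \<Rightarrow> real" where
  "lt_coeff a n = (LINT x|M. (if P x then g x ^ n / fact n * exp (- a * g x) else 0))"

lemma lt_coeff_integrable:
  assumes "0 < a"
  shows "integrable M (\<lambda>x. if P x then g x ^ n / fact n * exp (- a * g x) else 0)"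
proof (rule integrable_const_bound[where B = "1 / a ^ n"])
  show "AE x in M. norm (if P x then g x ^ n / fact n * exp (- a * g x) else 0) \<le> 1 / a ^ n"
    using g0
  proof eventually_elim
    case (elim x)
    define y where "y = a * g x"
    have y: "0 \<le> y" using elim assms by (simp add: y_def)
    have sm: "(\<lambda>k. y ^ k / fact k) sums exp y"
      using exp_converges[of y] by (simp add: field_simps)
    then have "(\<Sum>k\<in>{n}. y ^ k / fact k) \<le> (\<Sum>k. y ^ k / fact k)"
      using y by (intro sum_le_suminf) (auto simp: sums_iff)
    then have "y ^ n / fact n \<le> exp y" using sm by (simp add: sums_iff)
    then have "y ^ n / fact n * exp (- y) \<le> exp y * exp (- y)" by (intro mult_right_mono) auto
    then have "a ^ n * (g x ^ n / fact n * exp (- a * g x)) \<le> 1"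
      by (simp add: y_def power_mult_distrib flip: exp_add)
    then show ?case using elim assms by (auto simp: field_simps)
  qed
qed measurable

text \<open>
  The expansion of the transform about a point \<open>a > 0\<close>.  Up to the alternating sign its coefficients are
  nonnegative, which drives \<open>exp_moment_if_analytic_at_0\<close>.
\<close>

lemma lt_power_series:
  assumes a: "0 < a" and w: "norm w < a"
  shows "(\<lambda>n. (- 1) ^ n * complex_of_real (lt_coeff a n) * w ^ n) sums lt_on M g P (complex_of_real a + w)"
proof -
  define f where "f = (\<lambda>n x. if P x then (- w * complex_of_real (g x)) ^ n / fact n * exp (- complex_of_real a * complex_of_real (g x)) else 0)"
  define h where "h = (\<lambda>n x. if P x then (norm w * g x) ^ n / fact n * exp (- a * g x) else 0)"
  have int_h: "integrable M (h n)" for n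
  proof -
    have "h n = (\<lambda>x. norm w ^ n * (if P x then g x ^ n / fact n * exp (- a * g x) else 0))"
      by (auto simp: h_def power_mult_distrib)
    then show ?thesis using lt_coeff_integrable[OF a] by simp
  qed
  have fh: "f n = (\<lambda>x. (- w) ^ n * complex_of_real (if P x then g x ^ n / fact n * exp (- a * g x) else 0))" for n
    unfolding f_def
    by (intro ext) (auto simp: power_mult_distrib exp_of_real[symmetric] power_minus[of w]
        power_minus[of "w * complex_of_real (g x)" for x])
  have int_f: "integrable M (f n)" for n
    unfolding fh using lt_coeff_integrable[OF a] by (intro integrable_mult_right integrable_of_real)
  have norm_f: "AE x in M. norm (f n x) = h n x" for n
    using g0 by eventually_elim (auto simp: f_def h_def norm_mult norm_power norm_divide)
  have norm_f_all: "AE x in M. \<forall>n. norm (f n x) = h n x"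
    using norm_f by (simp add: AE_all_countable)
  have sum_h: "(\<lambda>n. h n x) sums (if P x then exp (norm w * g x) * exp (- a * g x) else 0)" for x
  proof (cases "P x")
    case True
    have "(\<lambda>n. (norm w * g x) ^ n / fact n) sums exp (norm w * g x)"
      using exp_converges[of "norm w * g x"] by (simp add: field_simps)
    from sums_mult2[OF this] True show ?thesis by (simp add: h_def)
  qed (simp add: h_def)
  have "(\<lambda>n. integral\<^sup>L M (f n)) sums (LINT x|M. (\<Sum>n. f n x))"
  proof (rule sums_integral[OF int_f])
    show "AE x in M. summable (\<lambda>n. norm (f n x))"
      using norm_f_all
      by eventually_elim (use sum_h in \<open>auto simp: sums_iff\<close>)
    have "(LINT x|M. norm (f n x)) = integral\<^sup>L M (h n)" for n
      using norm_f[of n] int_f int_h by (intro integral_cong_AE) auto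
    moreover have "summable (\<lambda>n. integral\<^sup>L M (h n))"
    proof (rule summableI_nonneg_bounded[where x = 1])
      have h0: "AE x in M. 0 \<le> h n x" for n using g0 by eventually_elim (auto simp: h_def)
      then have h0_all: "AE x in M. \<forall>n. 0 \<le> h n x" by (simp add: AE_all_countable)
      show "0 \<le> integral\<^sup>L M (h n)" for n using h0 by (rule integral_nonneg_AE)
      fix k
      have "(\<Sum>n<k. integral\<^sup>L M (h n)) = (LINT x|M. (\<Sum>n<k. h n x))"
        using int_h by (simp add: Bochner_Integration.integral_sum)
      also have "\<dots> \<le> (LINT x|M. 1)"
      proof (rule integral_mono_AE)
        show "integrable M (\<lambda>x. \<Sum>n<k. h n x)" using int_h by auto
        show "AE x in M. (\<Sum>n<k. h n x) \<le> 1"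
          using g0 h0_all
        proof eventually_elim
          case (elim x)
          have "(\<Sum>n<k. h n x) \<le> (\<Sum>n. h n x)"
            using elim(2) sum_h[of x] by (intro sum_le_suminf) (auto simp: sums_iff)
          also have "\<dots> = (if P x then exp (norm w * g x) * exp (- a * g x) else 0)"
            using sum_h[of x] by (simp add: sums_iff)
          also have "\<dots> \<le> 1"
          proof -
            have "norm w * g x \<le> a * g x" using w elim(1) by (intro mult_right_mono) auto
            then show ?thesis by (simp flip: exp_add)
          qed
          finally show ?case .
        qed
      qed auto
      finally show "(\<Sum>n<k. integral\<^sup>L M (h n)) \<le> 1" by (simp add: prob_space)
    qed
    ultimately show "summable (\<lambda>n. LINT x|M. norm (f n x))" by simp
  qed
  also have "(LINT x|M. (\<Sum>n. f n x)) = lt_on M g P (complex_of_real a + w)"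
    unfolding lt_on_def
  proof (rule Bochner_Integration.integral_cong[OF refl])
    fix x
    have "(\<lambda>n. (- w * complex_of_real (g x)) ^ n / fact n) sums exp (- w * complex_of_real (g x))"
      using exp_converges[of "- w * complex_of_real (g x)"] by (simp add: scaleR_conv_of_real field_simps)
    from sums_mult2[OF this, of "exp (- complex_of_real a * complex_of_real (g x))"]
    show "(\<Sum>n. f n x) = (if P x then exp (- (complex_of_real a + w) * complex_of_real (g x)) else 0)"
      by (auto simp: f_def sums_iff exp_add[symmetric] algebra_simps)
  qed
  also have "(\<lambda>n. integral\<^sup>L M (f n)) = (\<lambda>n. (- 1) ^ n * complex_of_real (lt_coeff a n) * w ^ n)"
    unfolding fh lt_coeff_def by (subst power_minus) (simp add: mult_ac)
  finally show ?thesis .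
qed

lemma lt_on_holomorphic: "lt_on M g P holomorphic_on {s. 0 < Re s}"
proof -
  have "lt_on M g P field_differentiable (at s within {s. 0 < Re s})" if s: "0 < Re s" for s
  proof -
    (* a disc about a point of the positive axis that contains s: |s - a|^2 = a^2 - |s|^2 *)
    define a where "a = (norm s)\<^sup>2 / Re s"
    have ns: "0 < norm s" using s by auto
    then have a: "0 < a" using s by (simp add: a_def)
    have "(norm (s - complex_of_real a))\<^sup>2 = (norm s)\<^sup>2 - 2 * a * Re s + a\<^sup>2"
      unfolding cmod_power2 by (simp add: power2_eq_square algebra_simps)
    also have "\<dots> = a\<^sup>2 - (norm s)\<^sup>2" using s by (simp add: a_def)
    also have "\<dots> < a\<^sup>2" using ns by simp
    finally have "norm (s - complex_of_real a) < a" using a by (simp add: power2_less_imp_less)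
    then have sb: "s \<in> ball (complex_of_real a) a" by (simp add: dist_norm norm_minus_commute)
    have "lt_on M g P holomorphic_on ball (complex_of_real a) a"
    proof (rule power_series_holomorphic)
      fix w assume "w \<in> ball (complex_of_real a) a"
      then have "norm (w - complex_of_real a) < a" by (simp add: dist_norm norm_minus_commute)
      from lt_power_series[OF a this]
      show "(\<lambda>n. (- 1) ^ n * complex_of_real (lt_coeff a n) * (w - complex_of_real a) ^ n) sums lt_on M g P w"
        by simp
    qed
    then have "lt_on M g P field_differentiable (at s)"
      using sb by (auto intro: holomorphic_on_imp_differentiable_at)
    then show ?thesis by (rule field_differentiable_at_within)
  qed
  then show ?thesis by (simp add: holomorphic_on_def)
qed

lemma lt_on_continuous: "continuous_on {s. 0 \<le> Re s} (lt_on M g P)"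
  unfolding continuous_on_sequentially comp_def
proof (intro allI ballI impI)
  fix X :: "nat \<Rightarrow> complex" and s
  assume s: "s \<in> {s. 0 \<le> Re s}" and X: "(\<forall>n. X n \<in> {s. 0 \<le> Re s}) \<and> X \<longlonglongrightarrow> s"
  show "(\<lambda>n. lt_on M g P (X n)) \<longlonglongrightarrow> lt_on M g P s"
    unfolding lt_on_def
  proof (rule integral_dominated_convergence[where w = "\<lambda>_. 1"])
    show "AE x in M. norm (if P x then exp (- X n * complex_of_real (g x)) else 0) \<le> 1" for n
      using X by (intro lt_bound) auto
    show "AE x in M. (\<lambda>n. if P x then exp (- X n * complex_of_real (g x)) else 0)
        \<longlonglongrightarrow> (if P x then exp (- s * complex_of_real (g x)) else 0)"
      using X by (auto intro!: tendsto_intros)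
  qed (auto)
qed

text \<open>
  The argument of Pringsheim's theorem.  The Taylor series of \<open>f\<close> about \<open>a\<close> converges at \<open>- a / 2\<close>,
  beyond the origin.  There all its terms are nonnegative, so summation and expectation may be
  exchanged, and the sum is the exponential moment of order \<open>a / 2\<close>.
\<close>

lemma exp_moment_if_analytic_at_0:
  assumes a: "0 < a" and f: "f holomorphic_on ball (complex_of_real a) (2 * a)"
    and eq: "\<And>s. s \<in> ball (complex_of_real a) a \<Longrightarrow> f s = lt_on M g P s"
  shows "(\<integral>\<^sup>+x. (if P x then ennreal (exp (a / 2 * g x)) else 0) \<partial>M) < \<infinity>"
proof -
  have c: "(deriv ^^ n) f (complex_of_real a) / fact n = (- 1) ^ n * complex_of_real (lt_coeff a n)" for n
  proof (rule powser_coeff_unique[OF a])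
    fix w :: complex assume w: "norm w < a"
    then have "(\<lambda>n. (deriv ^^ n) f (complex_of_real a) / fact n * (complex_of_real a + w - complex_of_real a) ^ n)
        sums f (complex_of_real a + w)"
      using a by (intro holomorphic_power_series[OF f]) (auto simp: dist_norm)
    then show "(\<lambda>n. (deriv ^^ n) f (complex_of_real a) / fact n * w ^ n) sums f (complex_of_real a + w)" by simp
    have "f (complex_of_real a + w) = lt_on M g P (complex_of_real a + w)"
      using w by (intro eq) (auto simp: dist_norm)
    then show "(\<lambda>n. (- 1) ^ n * complex_of_real (lt_coeff a n) * w ^ n) sums f (complex_of_real a + w)"
      using lt_power_series[OF a w] by simp
  qed
  (* the distance from a to - a / 2 *)
  define b where "b = 3 / 2 * a"
  have "(\<lambda>n. (deriv ^^ n) f (complex_of_real a) / fact n * (complex_of_real (- a / 2) - complex_of_real a) ^ n)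
      sums f (complex_of_real (- a / 2))"
  proof (rule holomorphic_power_series[OF f])
    have "complex_of_real a - complex_of_real (- a / 2) = complex_of_real b" by (simp add: b_def)
    then show "complex_of_real (- a / 2) \<in> ball (complex_of_real a) (2 * a)"
      using a unfolding mem_ball dist_norm by (simp only: norm_of_real) (simp add: b_def)
  qed
  moreover have "complex_of_real (- a / 2) - complex_of_real a = - complex_of_real b" by (simp add: b_def)
  ultimately have "(\<lambda>n. (- 1) ^ n * complex_of_real (lt_coeff a n) * (- complex_of_real b) ^ n)
      sums f (complex_of_real (- a / 2))" unfolding c by simp
  moreover have "(- 1) ^ n * complex_of_real (lt_coeff a n) * (- complex_of_real b) ^ n
      = complex_of_real (lt_coeff a n * b ^ n)" for n
    by (subst (2) power_minus) (simp add: mult_ac flip: power_mult_distrib)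
  ultimately have "summable (\<lambda>n. complex_of_real (lt_coeff a n * b ^ n))" by (simp add: sums_iff)
  then have summ: "summable (\<lambda>n. lt_coeff a n * b ^ n)" by (simp only: summable_of_real_iff)
  have b0: "0 < b" using a by (simp add: b_def)
  define k where "k = (\<lambda>n x. if P x then (b * g x) ^ n / fact n * exp (- a * g x) else 0)"
  have k_eq: "k n = (\<lambda>x. b ^ n * (if P x then g x ^ n / fact n * exp (- a * g x) else 0))" for n
    by (auto simp: k_def power_mult_distrib)
  have k0: "AE x in M. 0 \<le> k n x" for n using g0 by eventually_elim (use b0 in \<open>auto simp: k_def\<close>)
  have k0_all: "AE x in M. \<forall>n. 0 \<le> k n x" using k0 by (simp add: AE_all_countable)
  have kn: "(\<integral>\<^sup>+x. ennreal (k n x) \<partial>M) = ennreal (lt_coeff a n * b ^ n)" for n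
  proof -
    have "integrable M (k n)" unfolding k_eq using lt_coeff_integrable[OF a] by simp
    then have "(\<integral>\<^sup>+x. ennreal (k n x) \<partial>M) = ennreal (integral\<^sup>L M (k n))"
      using k0 by (intro nn_integral_eq_integral) auto
    also have "integral\<^sup>L M (k n) = lt_coeff a n * b ^ n" unfolding k_eq lt_coeff_def by simp
    finally show ?thesis .
  qed
  have [measurable]: "k n \<in> borel_measurable M" for n unfolding k_def by measurable
  have "(\<integral>\<^sup>+x. (if P x then ennreal (exp (a / 2 * g x)) else 0) \<partial>M) = (\<integral>\<^sup>+x. (\<Sum>n. ennreal (k n x)) \<partial>M)"
  proof (rule nn_integral_cong_AE)
    show "AE x in M. (if P x then ennreal (exp (a / 2 * g x)) else 0) = (\<Sum>n. ennreal (k n x))"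
      using k0_all
    proof eventually_elim
      case (elim x)
      have "(\<lambda>n. k n x) sums (if P x then exp (a / 2 * g x) else 0)"
      proof (cases "P x")
        case True
        have "(\<lambda>n. (b * g x) ^ n / fact n) sums exp (b * g x)"
          using exp_converges[of "b * g x"] by (simp add: field_simps)
        from sums_mult2[OF this, of "exp (- a * g x)"] True show ?thesis
          by (simp add: k_def b_def algebra_simps flip: exp_add)
      qed (simp add: k_def)
      then have "(\<Sum>n. ennreal (k n x)) = ennreal (if P x then exp (a / 2 * g x) else 0)"
        using elim by (intro suminf_ennreal_eq) blast+
      then show ?case by auto
    qed
  qed
  also have "\<dots> = (\<Sum>n. \<integral>\<^sup>+x. ennreal (k n x) \<partial>M)" by (rule nn_integral_suminf) measurable
  also have "\<dots> = (\<Sum>n. ennreal (lt_coeff a n * b ^ n))" unfolding kn ..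
  also have "\<dots> < \<infinity>"
  proof -
    have "0 \<le> lt_coeff a n * b ^ n" for n
    proof -
      have "0 \<le> integral\<^sup>L M (k n)" using k0 by (rule integral_nonneg_AE)
      also have "integral\<^sup>L M (k n) = lt_coeff a n * b ^ n" unfolding k_eq lt_coeff_def by simp
      finally show ?thesis .
    qed
    then have "(\<Sum>n. ennreal (lt_coeff a n * b ^ n)) = ennreal (\<Sum>n. lt_coeff a n * b ^ n)"
      by (intro suminf_ennreal2 summ)
    then show ?thesis by (simp only: infinity_ennreal_def ennreal_less_top)
  qed
  finally show ?thesis .
qed

end

subsection \<open>Service laws\<close>

lemma lst_eq_lt_on: "lst F = lt_on F (\<lambda>x. x) (\<lambda>_. True)"
  by (simp add: lst_def lt_on_def fun_eq_iff)

lemma service_lawD: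
  assumes "service_law F"
  shows "prob_space F" "sets F = sets borel" "(\<lambda>x. x) \<in> borel_measurable F"
    "AE x in F. 0 \<le> x" "integrable F (\<lambda>x. x)"
  using assms by (auto simp: service_law_def dest: borel_measurable_integrable)

context
  fixes F :: "real measure"
  assumes F: "service_law F"
begin

interpretation prob_space F using service_lawD(1)[OF F] .

lemma lst_holomorphic: "lst F holomorphic_on {s. 0 < Re s}"
  unfolding lst_eq_lt_on using service_lawD[OF F] by (intro lt_on_holomorphic) auto

lemma lst_continuous: "continuous_on {s. 0 \<le> Re s} (lst F)"
  unfolding lst_eq_lt_on using service_lawD[OF F] by (intro lt_on_continuous) auto

lemma norm_lst_le: "0 \<le> Re s \<Longrightarrow> norm (lst F s) \<le> 1"
  unfolding lst_eq_lt_on using service_lawD[OF F] by (intro norm_lt_on_le) auto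

lemma lst_0: "lst F 0 = 1"
  by (simp add: lst_def prob_space)

lemma lst_excess: "0 \<le> Re s \<Longrightarrow>
    s * (complex_of_real (mean F) * excess_lst (mean F) (lst F) s) = 1 - lst F s"
proof (cases "s = 0 \<or> mean F \<noteq> 0")
  case True
  then show ?thesis by (auto simp: excess_lst_def lst_0)
next
  case False
  have "AE x in F. x = 0"
    using integral_nonneg_eq_0_iff_AE[OF service_lawD(5,4)[OF F]] False by (simp add: mean_def)
  then have "lst F s = (LINT x|F. 1)"
    unfolding lst_def using service_lawD(3)[OF F] by (intro integral_cong_AE) (auto elim: eventually_mono)
  then show ?thesis using False by (simp add: excess_lst_def prob_space)
qed

lemma lst_deriv_at_0:
  "((\<lambda>t. (1 - lst F (complex_of_real t)) / complex_of_real t) \<longlongrightarrow> complex_of_real (mean F)) (at_right 0)"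
  unfolding tendsto_at_iff_sequentially comp_def
proof (intro allI impI)
  fix X :: "nat \<Rightarrow> real" assume X: "\<forall>n. X n \<in> {0<..} - {0}" "X \<longlonglongrightarrow> 0"
  have X0: "0 < X n" for n using X by auto
  note m [measurable] = service_lawD(3)[OF F]
  have "(\<lambda>n. LINT x|F. (1 - exp (- X n * x)) / X n) \<longlonglongrightarrow> (LINT x|F. x)"
  proof (rule integral_dominated_convergence[where w = "\<lambda>x. x"])
    show "integrable F (\<lambda>x. x)" by (rule service_lawD[OF F])
    show "AE x in F. norm ((1 - exp (- X n * x)) / X n) \<le> x" for n
      using service_lawD(4)[OF F]
    proof eventually_elim
      case (elim x)
      have "1 - exp (- X n * x) \<le> X n * x" using exp_ge_add_one_self[of "- X n * x"] by simp
      moreover have "0 \<le> 1 - exp (- X n * x)" using elim X0[of n] by simp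
      ultimately show ?case using X0[of n] by (simp add: field_simps)
    qed
    show "AE x in F. (\<lambda>n. (1 - exp (- X n * x)) / X n) \<longlonglongrightarrow> x"
    proof (rule AE_I2)
      fix x
      have "((\<lambda>t. 1 - exp (- t * x)) has_real_derivative x) (at 0)"
        by (auto intro!: derivative_eq_intros)
      then have "((\<lambda>t. (1 - exp (- t * x)) / t) \<longlongrightarrow> x) (at 0)"
        by (simp add: has_field_derivative_iff)
      then show "(\<lambda>n. (1 - exp (- X n * x)) / X n) \<longlonglongrightarrow> x"
      proof (rule filterlim_compose)
        show "filterlim X (at 0) sequentially"
          using X(2) less_imp_neq[OF X0, symmetric] by (simp add: filterlim_at)
      qed
    qed
  qed auto
  then have "(\<lambda>n. complex_of_real (LINT x|F. (1 - exp (- X n * x)) / X n)) \<longlonglongrightarrow> complex_of_real (mean F)"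
    unfolding mean_def by (intro tendsto_of_real)
  moreover have e: "complex_of_real (LINT x|F. (1 - exp (- X n * x)) / X n)
      = (1 - lst F (complex_of_real (X n))) / complex_of_real (X n)" for n
  proof -
    have i: "integrable F (\<lambda>x. exp (- X n * x))"
    proof (rule integrable_const_bound[where B = 1])
      show "AE x in F. norm (exp (- X n * x)) \<le> 1"
        using service_lawD(4)[OF F] by eventually_elim (use X0[of n] in simp)
    qed measurable
    have d: "(LINT x|F. (1 - exp (- X n * x))) = (LINT x|F. 1) - (LINT x|F. exp (- X n * x))"
      by (rule Bochner_Integration.integral_diff) (use i in simp_all)
    have "lst F (complex_of_real (X n)) = (LINT x|F. complex_of_real (exp (- X n * x)))"
      unfolding lst_def by (simp add: exp_of_real flip: of_real_minus of_real_mult)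
    also have "\<dots> = complex_of_real (LINT x|F. exp (- X n * x))" by (rule integral_of_real[OF i])
    finally show ?thesis unfolding integral_divide_zero d by (simp add: prob_space)
  qed
  ultimately show "(\<lambda>n. (1 - lst F (complex_of_real (X n))) / complex_of_real (X n))
      \<longlonglongrightarrow> complex_of_real (mean F)" by (simp only: e)
qed

text \<open>
  A root of \<open>p\<close> is not one of \<open>q\<close>.  But \<open>\<bar>q\<bar> \<le> \<bar>p\<bar>\<close> to the right of it, as transforms are bounded by 1.
\<close>

lemma rational_lst_denominator:
  fixes p q :: "complex poly"
  assumes "\<forall>s. 0 \<le> Re s \<longrightarrow> lst F s = poly q s / poly p s" "coprime q p" "0 \<le> Re s" "p \<noteq> 0"
  shows "poly p s \<noteq> 0"
proof
  assume p0: "poly p s = 0"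
  have "poly q s \<noteq> 0"
  proof
    assume "poly q s = 0"
    then have "[:- s, 1:] dvd q" "[:- s, 1:] dvd p" using p0 by (auto simp: poly_eq_0_iff_dvd)
    then have "is_unit [:- s, 1:]" using assms(2) by (meson coprime_common_divisor)
    then show False by (simp add: is_unit_pCons_iff)
  qed
  have ev: "eventually (\<lambda>t. norm (poly q (s + complex_of_real t)) \<le> norm (poly p (s + complex_of_real t))) (at_right 0)"
  proof -
    have fin: "finite {t. poly p (s + complex_of_real t) = 0}"
    proof (rule finite_imageD)
      show "finite ((\<lambda>t. s + complex_of_real t) ` {t. poly p (s + complex_of_real t) = 0})"
        by (rule finite_subset[OF _ poly_roots_finite[OF assms(4)]]) auto
    qed (auto simp: inj_on_def)
    have "eventually (\<lambda>t. t \<notin> {t. poly p (s + complex_of_real t) = 0}) (at_right 0)"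
    proof -
      have "eventually (\<lambda>t. \<forall>x\<in>{t. poly p (s + complex_of_real t) = 0} - {0}. t \<noteq> x) (nhds 0)"
        using fin by (intro eventually_ball_finite) (auto intro: t1_space_nhds)
      then show ?thesis
        unfolding eventually_at_filter by (auto elim: eventually_mono)
    qed
    moreover have "eventually (\<lambda>t::real. 0 < t) (at_right 0)" by (rule eventually_at_right_less)
    ultimately show ?thesis
    proof eventually_elim
      case (elim t)
      let ?s = "s + complex_of_real t"
      have "0 \<le> Re ?s" using assms(3) elim by simp
      then have "norm (poly q ?s / poly p ?s) \<le> 1" using assms(1) norm_lst_le[of ?s] by simp
      then show ?case using elim by (simp add: norm_divide field_simps)
    qed
  qed
  have "isCont (\<lambda>t. norm (poly q (s + complex_of_real t))) 0" "isCont (\<lambda>t. norm (poly p (s + complex_of_real t))) 0"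
    by (intro continuous_intros)+
  then have "((\<lambda>t. norm (poly q (s + complex_of_real t))) \<longlongrightarrow> norm (poly q s)) (at_right 0)"
     "((\<lambda>t. norm (poly p (s + complex_of_real t))) \<longlongrightarrow> norm (poly p s)) (at_right 0)"
    by (auto simp: isCont_def intro: tendsto_within_subset)
  then have "norm (poly q s) \<le> norm (poly p s)"
    using tendsto_le[OF trivial_limit_at_right_real _ _ ev] by blast
  then show False using p0 \<open>poly q s \<noteq> 0\<close> by simp
qed

text \<open>
  Factors \<open>s\<close> of \<open>B\<close> cancel, because \<open>\<bar>A\<bar> \<le> \<bar>B\<bar>\<close> near the origin by boundedness of the transform.
  After that \<open>A / B\<close> is an analytic extension of the transform to a neighbourhood of the origin.
\<close>

lemma rational_lst_not_heavy_tailed: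
  fixes A B :: "complex poly"
  assumes "B \<noteq> 0" "0 < \<rho>" "\<And>s. 0 < Re s \<Longrightarrow> norm s < \<rho> \<Longrightarrow> lst F s * poly B s = poly A s"
  shows "\<not> heavy_tailed F"
  using assms
proof (induction "degree B" arbitrary: A B rule: less_induct)
  case less
  show ?case
  proof (cases "poly B 0 = 0")
    case True
    then obtain B' where B': "B = [:0, 1:] * B'" by (auto simp: poly_eq_0_iff_dvd)
    have "((\<lambda>t. norm (poly A (complex_of_real t))) \<longlongrightarrow> norm (poly A 0)) (at_right 0)"
      "((\<lambda>t. norm (poly B (complex_of_real t))) \<longlongrightarrow> norm (poly B 0)) (at_right 0)"
    proof -
      have "isCont (\<lambda>t. norm (poly A (complex_of_real t))) 0" "isCont (\<lambda>t. norm (poly B (complex_of_real t))) 0"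
        by (intro continuous_intros)+
      then show "((\<lambda>t. norm (poly A (complex_of_real t))) \<longlongrightarrow> norm (poly A 0)) (at_right 0)"
        "((\<lambda>t. norm (poly B (complex_of_real t))) \<longlongrightarrow> norm (poly B 0)) (at_right 0)"
        by (auto simp: isCont_def intro: tendsto_within_subset)
    qed
    moreover have "eventually (\<lambda>t. norm (poly A (complex_of_real t)) \<le> norm (poly B (complex_of_real t))) (at_right 0)"
    proof -
      have "eventually (\<lambda>t::real. t \<in> {0<..<\<rho>}) (at_right 0)" using less.prems(2) by (rule eventually_at_right_real)
      then show ?thesis
      proof eventually_elim
        case (elim t)
        then have e: "lst F (complex_of_real t) * poly B (complex_of_real t) = poly A (complex_of_real t)"
          using less.prems(3)[of "complex_of_real t"] by simp
        have "norm (lst F (complex_of_real t)) \<le> 1" using norm_lst_le elim by simp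
        then show ?case unfolding e[symmetric] norm_mult by (simp add: mult_left_le_one_le)
      qed
    qed
    ultimately have "norm (poly A 0) \<le> norm (poly B 0)" 
      using tendsto_le[OF trivial_limit_at_right_real] by blast
    then have "poly A 0 = 0" using True by simp
    then obtain A' where A': "A = [:0, 1:] * A'" by (auto simp: poly_eq_0_iff_dvd)
    have "B' \<noteq> 0" using less.prems(1) B' by auto
    have "degree B' < degree B" unfolding B' using \<open>B' \<noteq> 0\<close> by (subst degree_mult_eq) auto
    then show ?thesis
    proof (rule less.hyps[OF _ \<open>B' \<noteq> 0\<close> less.prems(2)])
      fix s assume "0 < Re s" "norm s < \<rho>"
      then show "lst F s * poly B' s = poly A' s"
        using less.prems(3)[of s] unfolding A' B' by auto
    qed
  next
    case False
    have "eventually (\<lambda>s. poly B s \<noteq> 0) (nhds 0)"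
    proof -
      have "open {s. poly B s \<noteq> 0}" by (intro open_Collect_neq continuous_intros)
      from eventually_nhds_in_open[OF this, of 0] False show ?thesis by simp
    qed
    then obtain d where d: "0 < d" "\<And>s. norm s < d \<Longrightarrow> poly B s \<noteq> 0"
      by (auto simp: eventually_nhds_metric)
    (* the disc of radius 2 a about a lies in the disc of radius 3 a about 0 *)
    define a where "a = min d \<rho> / 4"
    have a: "0 < a" "3 * a < d" "3 * a < \<rho>" using d(1) less.prems(2) by (auto simp: a_def)
    have nb: "norm s < 3 * a" if "s \<in> ball (complex_of_real a) (2 * a)" for s
    proof -
      have "norm s \<le> norm (complex_of_real a) + norm (s - complex_of_real a)"
        using norm_triangle_ineq[of "complex_of_real a" "s - complex_of_real a"] by simp
      also have "\<dots> < a + 2 * a" using that a(1) by (simp add: dist_norm norm_minus_commute)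
      finally show ?thesis by simp
    qed
    have "(\<integral>\<^sup>+x. (if True then ennreal (exp (a / 2 * x)) else 0) \<partial>F) < \<infinity>"
    proof (rule exp_moment_if_analytic_at_0[where f = "\<lambda>s. poly A s / poly B s"])
      show "(\<lambda>s. poly A s / poly B s) holomorphic_on ball (complex_of_real a) (2 * a)"
        using nb d(2) a by (intro holomorphic_intros) fastforce
      fix s assume s: "s \<in> ball (complex_of_real a) a"
      then have n: "norm s < 3 * a" using a by (intro nb) auto
      have "\<bar>Re (s - complex_of_real a)\<bar> < a"
        using abs_Re_le_cmod[of "s - complex_of_real a"] s by (simp add: dist_norm norm_minus_commute)
      then have "0 < Re s" by simp
      then have "lst F s * poly B s = poly A s" using n a by (intro less.prems(3)) auto
      moreover have "poly B s \<noteq> 0" using n a d(2) by auto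
      ultimately show "poly A s / poly B s = lt_on F (\<lambda>x. x) (\<lambda>_. True) s"
        by (simp add: lst_eq_lt_on[symmetric] field_simps)
    qed (use service_lawD[OF F] a in auto)
    then have "(\<integral>\<^sup>+x. ennreal (exp (a / 2 * x)) \<partial>F) \<noteq> \<infinity>" by simp
    moreover have "0 < a / 2" using a by simp
    ultimately show ?thesis unfolding heavy_tailed_def by blast
  qed
qed

end

section \<open>The stationary workload\<close>

lemma mix_kernel:
  assumes "prob_space F" "sets F = sets borel" "prob_space H" "sets H = sets borel"
  shows "(\<lambda>b. if b then H else F) \<in> measurable (measure_pmf p) (subprob_algebra borel)"
  using assms by (auto simp: space_subprob_algebra prob_space_imp_subprob_space)

lemma sets_mix:
  assumes "sets F = sets borel" "sets H = sets borel"
  shows "sets (mix \<epsilon> F H) = sets borel"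
  unfolding mix_def using assms by (intro sets_bind) auto

lemma nn_integral_mix:
  assumes "prob_space F" "sets F = sets borel" "prob_space H" "sets H = sets borel"
    and e: "0 \<le> \<epsilon>" "\<epsilon> \<le> 1" and f: "f \<in> borel_measurable borel"
  shows "(\<integral>\<^sup>+x. f x \<partial>mix \<epsilon> F H) = ennreal \<epsilon> * (\<integral>\<^sup>+x. f x \<partial>H) + ennreal (1 - \<epsilon>) * (\<integral>\<^sup>+x. f x \<partial>F)"
  unfolding mix_def nn_integral_bind[OF f mix_kernel[OF assms(1-4)]] using e
  by (subst nn_integral_bernoulli_pmf) (auto simp: mult.commute)

lemma prob_space_mix:
  assumes "prob_space F" "sets F = sets borel" "prob_space H" "sets H = sets borel"
    and "0 \<le> \<epsilon>" "\<epsilon> \<le> 1"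
  shows "prob_space (mix \<epsilon> F H)"
proof
  have "space (mix \<epsilon> F H) = UNIV"
    using sets_eq_imp_space_eq[OF sets_mix[OF assms(2,4)]] by simp
  then have "emeasure (mix \<epsilon> F H) (space (mix \<epsilon> F H)) = (\<integral>\<^sup>+x. 1 \<partial>mix \<epsilon> F H)" by simp
  also have "\<dots> = ennreal \<epsilon> * (\<integral>\<^sup>+x. 1 \<partial>H) + ennreal (1 - \<epsilon>) * (\<integral>\<^sup>+x. 1 \<partial>F)"
    by (rule nn_integral_mix[OF assms]) simp
  also have "\<dots> = ennreal \<epsilon> + ennreal (1 - \<epsilon>)"
    using assms(1,3) by (simp add: prob_space.emeasure_space_1)
  also have "\<dots> = 1" using assms(5,6) by (simp flip: ennreal_plus)
  finally show "emeasure (mix \<epsilon> F H) (space (mix \<epsilon> F H)) = 1" .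
qed

lemma AE_mix_nonneg:
  assumes "prob_space F" "sets F = sets borel" "prob_space H" "sets H = sets borel"
    and "0 \<le> \<epsilon>" "\<epsilon> \<le> 1" and F: "AE x in F. 0 \<le> x" and H: "AE x in H. 0 \<le> x"
  shows "AE x in mix \<epsilon> F H. 0 \<le> x"
proof -
  have z: "(\<integral>\<^sup>+x. indicator {..<0::real} x \<partial>M) = 0" if "AE x in M. 0 \<le> x" for M :: "real measure"
  proof -
    have "(\<integral>\<^sup>+x. indicator {..<0::real} x \<partial>M) = (\<integral>\<^sup>+x. 0 \<partial>M)"
      using that by (intro nn_integral_cong_AE) (auto elim!: eventually_mono)
    then show ?thesis by simp
  qed
  have "(\<integral>\<^sup>+x. indicator {..<0} x \<partial>mix \<epsilon> F H) = 0"
    by (subst nn_integral_mix[OF assms(1-6)]) (auto simp: z[OF F, simplified] z[OF H, simplified])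
  then have "AE x in mix \<epsilon> F H. (indicator {..<0} x :: ennreal) = 0"
    by (subst nn_integral_0_iff_AE[symmetric]) (simp_all add: measurable_cong_sets[OF sets_mix[OF assms(2,4)] refl])
  then show ?thesis by eventually_elim (auto split: split_indicator_asm)
qed

text \<open>
  The effect of one exponential interarrival time on \<open>exp (- s v)\<close>.  The identity is arranged without
  differences of terms, so that it can be integrated in the extended nonnegative reals.
\<close>

lemma exponential_mean_transform:
  assumes s: "0 < s" "s < l" and w: "0 \<le> w"
  shows "ennreal (l - s) * (\<integral>\<^sup>+t. ennreal (exp (- s * max 0 (w - t))) \<partial>density lborel (exponential_density l))
     + ennreal (s * exp (- l * w)) = ennreal (l * exp (- s * w))"
proof -
  define A where "A = l / (l - s) * (exp (- s * w) - exp (- l * w))"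
  have l: "0 < l" using s by simp
  have A0: "0 \<le> A" unfolding A_def using s w by (intro mult_nonneg_nonneg) (auto intro: mult_right_mono)
  have [measurable]: "exponential_density l \<in> borel_measurable borel" by simp
  have fd: "((\<lambda>t. - l / (l - s) * exp (- l * t - s * (w - t))) has_real_derivative
      l * exp (- l * t - s * (w - t))) (at t)" for t
  proof -
    have "((\<lambda>t. - l / (l - s) * exp (- l * t - s * (w - t))) has_real_derivative
      - l / (l - s) * (exp (- l * t - s * (w - t)) * (- l + s))) (at t)"
      by (intro DERIV_cmult DERIV_fun_exp) (auto intro!: derivative_eq_intros)
    moreover have "- l / (l - s) * (c * (- l + s)) = l * c" for c
      using s by (simp add: field_simps)
    ultimately show ?thesis by simp
  qed
  have "(\<integral>\<^sup>+t. ennreal (exp (- s * max 0 (w - t))) \<partial>density lborel (exponential_density l))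
    = (\<integral>\<^sup>+t. ennreal (exponential_density l t) * ennreal (exp (- s * max 0 (w - t))) \<partial>lborel)"
    by (rule nn_integral_density) auto
  also have "\<dots> = (\<integral>\<^sup>+t. ennreal (l * exp (- l * t - s * (w - t))) * indicator {0..w} t
      + ennreal (l * exp (- l * t)) * indicator {w..} t \<partial>lborel)"
  proof (rule nn_integral_cong_AE)
    show "AE t in lborel. ennreal (exponential_density l t) * ennreal (exp (- s * max 0 (w - t)))
      = ennreal (l * exp (- l * t - s * (w - t))) * indicator {0..w} t
      + ennreal (l * exp (- l * t)) * indicator {w..} t"
      using AE_lborel_singleton[of w]
    proof eventually_elim
      case (elim t)
      then consider "t < 0" | "0 \<le> t" "t < w" | "w < t" by linarith
      then show ?case
      proof cases
        case 2
        then show ?thesis using l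
          by (simp add: exponential_density_def max_def algebra_simps flip: ennreal_mult exp_add)
      qed (use l w in \<open>auto simp: exponential_density_def max_def mult.commute split: split_indicator\<close>)
    qed
  qed
  also have "\<dots> = (\<integral>\<^sup>+t. ennreal (l * exp (- l * t - s * (w - t))) * indicator {0..w} t \<partial>lborel)
      + (\<integral>\<^sup>+t. ennreal (l * exp (- l * t)) * indicator {w..} t \<partial>lborel)"
    by (rule nn_integral_add) auto
  also have "(\<integral>\<^sup>+t. ennreal (l * exp (- l * t - s * (w - t))) * indicator {0..w} t \<partial>lborel)
     = ennreal (- l / (l - s) * exp (- l * w - s * (w - w)) - (- l / (l - s) * exp (- l * 0 - s * (w - 0))))"
    using l s w
    by (intro nn_integral_FTC_Icc fd) auto
  also have "- l / (l - s) * exp (- l * w - s * (w - w)) - (- l / (l - s) * exp (- l * 0 - s * (w - 0))) = A"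
    by (simp add: A_def algebra_simps)
  also have "(\<integral>\<^sup>+t. ennreal (l * exp (- l * t)) * indicator {w..} t \<partial>lborel) = ennreal (0 - (- exp (- l * w)))"
  proof (rule nn_integral_FTC_atLeast)
    have "((\<lambda>t. exp (- (l * t))) \<longlongrightarrow> 0) at_top"
      using l by (intro filterlim_compose[OF exp_at_bot])
        (auto intro!: filterlim_tendsto_pos_mult_at_top filterlim_ident simp: filterlim_uminus_at_bot)
    then show "((\<lambda>t. - exp (- l * t)) \<longlongrightarrow> 0) at_top" using tendsto_minus by fastforce
  qed (use l in \<open>auto intro!: derivative_eq_intros\<close>)
  finally have I: "(\<integral>\<^sup>+t. ennreal (exp (- s * max 0 (w - t))) \<partial>density lborel (exponential_density l))
      = ennreal (A + exp (- l * w))" using A0 by simp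
  have "(l - s) * (A + exp (- l * w)) + s * exp (- l * w) = l * exp (- s * w)"
    using s by (simp add: A_def field_simps)
  then show ?thesis unfolding I using A0 s by (simp flip: ennreal_mult ennreal_plus)
qed

lemma E_gen_index:
  assumes "dim_row D1 = N" "i < N" "j < N"
  shows "E_gen h D1 D2 s g $$ (i, j) = (h (dummy_prob D1 D2 i j) + g * h (real_prob D1 D2 i j))
      * h (trans_prob D1 D2 i j * rate D1 D2 j) + s * (if i = j then 1 else 0)
      - h (if i = j then rate D1 D2 i else 0)"
proof -
  have "(P_mat D1 D2 * Lam D1 D2) $$ (i, j) = trans_prob D1 D2 i j * rate D1 D2 j"
    using assms unfolding Lam_def by (subst mat_diag_mult_right[of _ N]) (auto simp: P_mat_def)
  then show ?thesis
    using assms by (simp add: E_gen_def hadamard_def Q1_mat_def Q2_mat_def Lam_def mat_diag_def P_mat_def)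
qed

lemma E_gen_carrier: "dim_row D1 = N \<Longrightarrow> E_gen h D1 D2 s g \<in> carrier_mat N N"
  by (auto simp: E_gen_def hadamard_def Q1_mat_def Q2_mat_def Lam_def mat_diag_def P_mat_def)

context
  fixes N :: nat and D1 D2 :: "real mat"
  assumes arr: "arrival_process N D1 D2" and rates: "\<forall>i<N. 0 < rate D1 D2 i"
begin

lemma arrival_dims: "dim_row D1 = N" "dim_row D2 = N" "dim_col D1 = N" "dim_col D2 = N"
  using arr by (auto simp: arrival_process_def)

lemma arrival_trans_prob_nonneg: "i < N \<Longrightarrow> j < N \<Longrightarrow> 0 \<le> trans_prob D1 D2 i j"
  using arr rates by (auto simp: arrival_process_def trans_prob_def intro!: divide_nonneg_pos add_nonneg_nonneg)

lemma arrival_real_prob_bounds: "i < N \<Longrightarrow> j < N \<Longrightarrow> 0 \<le> real_prob D1 D2 i j \<and> real_prob D1 D2 i j \<le> 1"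
proof -
  assume ij: "i < N" "j < N"
  then have r: "0 < rate D1 D2 i" using rates by auto
  define d1 where "d1 = D1 $$ (i, j) * (if i = j then 0 else 1)"
  have d: "0 \<le> d1" "0 \<le> D2 $$ (i, j)" using arr ij by (auto simp: arrival_process_def d1_def)
  have e: "rate D1 D2 i * trans_prob D1 D2 i j = d1 + D2 $$ (i, j)"
    using r by (simp add: trans_prob_def d1_def)
  show ?thesis using d unfolding real_prob_def e by (auto simp: divide_le_eq_1)
qed

lemma real_plus_dummy:
  assumes "i < N" "j < N"
  shows "trans_prob D1 D2 i j * dummy_prob D1 D2 i j = trans_prob D1 D2 i j * (1 - real_prob D1 D2 i j)"
proof (cases "trans_prob D1 D2 i j > 0")
  case True
  have r: "0 < rate D1 D2 i" using rates assms by auto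
  have "rate D1 D2 i * trans_prob D1 D2 i j = D1 $$ (i, j) * (if i = j then 0 else 1) + D2 $$ (i, j)"
    using r by (simp add: trans_prob_def)
  moreover have "rate D1 D2 i * trans_prob D1 D2 i j > 0" using r True by simp
  ultimately show ?thesis using True r
    by (simp add: dummy_prob_def real_prob_def field_simps)
next
  case False
  then have "trans_prob D1 D2 i j = 0" using arrival_trans_prob_nonneg[OF assms] by simp
  then show ?thesis by simp
qed

lemma E_sg_index:
  assumes "i < N" "j < N"
  shows "E_sg D1 D2 s g $$ (i, j) =
    complex_of_real (trans_prob D1 D2 i j * rate D1 D2 j) * (1 - complex_of_real (real_prob D1 D2 i j) + g * complex_of_real (real_prob D1 D2 i j))
      + (if i = j then s - complex_of_real (rate D1 D2 i) else 0)"
proof -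
  have "complex_of_real (dummy_prob D1 D2 i j) * complex_of_real (trans_prob D1 D2 i j * rate D1 D2 j)
    = complex_of_real ((trans_prob D1 D2 i j * dummy_prob D1 D2 i j) * rate D1 D2 j)"
    by simp
  also have "\<dots> = complex_of_real (trans_prob D1 D2 i j * rate D1 D2 j) * (1 - complex_of_real (real_prob D1 D2 i j))"
    unfolding real_plus_dummy[OF assms] by simp
  finally have "complex_of_real (dummy_prob D1 D2 i j) * complex_of_real (trans_prob D1 D2 i j * rate D1 D2 j) = \<dots>" .
  then show ?thesis unfolding E_gen_index[OF arrival_dims(1) assms] distrib_right
    by (cases "i = j") (simp_all add: algebra_simps)
qed

end

context
  fixes N :: nat and D1 D2 :: "real mat" and F :: "real measure" and S :: "(real \<times> nat) measure"
  assumes arr: "arrival_process N D1 D2" and rates: "\<forall>i<N. 0 < rate D1 D2 i"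
    and F: "prob_space F" "sets F = sets borel" "AE x in F. 0 \<le> x"
    and S: "stationary_law N D1 D2 F S"
begin

lemmas trans_prob_nonneg = arrival_trans_prob_nonneg[OF arr rates]
  and real_prob_bounds = arrival_real_prob_bounds[OF arr rates]

abbreviation service_of :: "nat \<Rightarrow> nat \<Rightarrow> real measure" where
  "service_of i j \<equiv> mix (real_prob D1 D2 i j) (return borel 0) F"

lemma service_of:
  assumes "i < N" "j < N"
  shows "prob_space (service_of i j)" "sets (service_of i j) = sets borel" "AE x in service_of i j. 0 \<le> x"
proof -
  have r: "prob_space (return borel (0::real))" by (rule prob_space_return) simp
  have "AE x in return borel (0::real). 0 \<le> x" by (subst AE_return) auto
  then show "AE x in service_of i j. 0 \<le> x"
    using AE_mix_nonneg[OF r sets_return F(1,2) _ _ _ F(3)] real_prob_bounds[OF assms] by simp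
  show "prob_space (service_of i j)"
    using prob_space_mix[OF r sets_return F(1,2)] real_prob_bounds[OF assms] by simp
  show "sets (service_of i j) = sets borel" using sets_mix[OF sets_return F(2)] .
qed

lemma S_facts: "prob_space S" "sets S = sets (borel \<Otimes>\<^sub>M count_space {..<N})" "AE x in S. 0 \<le> fst x"
  "space S = UNIV \<times> {..<N}"
  using S sets_eq_imp_space_eq[of S "borel \<Otimes>\<^sub>M count_space {..<N}"]
  by (auto simp: stationary_law_def space_pair_measure)

lemma S_measurable [measurable]: "fst \<in> borel_measurable S" "snd \<in> measurable S (count_space UNIV)"
proof -
  show "fst \<in> borel_measurable S" unfolding measurable_cong_sets[OF S_facts(2) refl] by measurable
  have "snd \<in> measurable S (count_space {..<N})"
    unfolding measurable_cong_sets[OF S_facts(2) refl] by measurable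
  then show "snd \<in> measurable S (count_space UNIV)"
    by (rule measurable_compose) simp
qed

text \<open>
  Stationarity is an equation between probabilities of events; transforms need it for nonnegative
  functions of the workload, on the event that the next tag is \<open>j\<close>.
\<close>

lemma stationary_nn_integral:
  assumes j: "j < N" and g: "g \<in> borel_measurable (borel :: real measure)"
  shows "(\<integral>\<^sup>+x. g (fst x) * indicator {j} (snd x) \<partial>S) =
    (\<Sum>i<N. ennreal (trans_prob D1 D2 i j) *
      (\<integral>\<^sup>+x. (\<integral>\<^sup>+b. (\<integral>\<^sup>+t. g (max 0 (fst x + b - t))
          \<partial>density lborel (exponential_density (rate D1 D2 j))) \<partial>service_of i j)
        * indicator {i} (snd x) \<partial>S))"
proof -
  define E where "E = density lborel (exponential_density (rate D1 D2 j))"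
  interpret S: prob_space S by (rule S_facts)
  interpret E: prob_space E unfolding E_def using rates j by (intro prob_space_exponential_density) auto
  have [measurable_cong]: "sets E = sets borel" by (simp add: E_def)
  have so [measurable_cong]: "sets (service_of i j) = sets borel" for i using sets_mix[OF sets_return F(2)] .
  let ?K = "\<lambda>g i x. (\<integral>\<^sup>+b. (\<integral>\<^sup>+t. g (max 0 (fst x + b - t)) \<partial>E) \<partial>service_of i j)"
  have m1: "(\<lambda>(v, b). \<integral>\<^sup>+t. g (max 0 (v + b - t)) \<partial>E) \<in> borel_measurable (borel \<Otimes>\<^sub>M borel)"
    if [measurable]: "g \<in> borel_measurable borel" for g :: "real \<Rightarrow> ennreal" by measurable
  have m1': "(\<lambda>b. \<integral>\<^sup>+t. g (max 0 (v + b - t)) \<partial>E) \<in> borel_measurable borel"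
    if [measurable]: "g \<in> borel_measurable borel" for g :: "real \<Rightarrow> ennreal" and v by measurable
  have m2: "?K g i \<in> borel_measurable S" if [measurable]: "g \<in> borel_measurable borel" and i: "i < N" for g i
  proof -
    interpret G: prob_space "service_of i j" using service_of(1)[OF i j] .
    show ?thesis by measurable
  qed
  have mi: "(\<lambda>x. indicator {k} (snd x) :: ennreal) \<in> borel_measurable S" for k
    by (rule measurable_compose[OF S_measurable(2)]) simp
  have mg: "(\<lambda>x. u (fst x) * indicator {k} (snd x)) \<in> borel_measurable S"
    if u: "u \<in> borel_measurable borel" for u :: "real \<Rightarrow> ennreal" and k
    by (intro borel_measurable_times_ennreal mi measurable_compose[OF S_measurable(1) u])
  have mK: "(\<lambda>x. ?K u i x * indicator {k} (snd x)) \<in> borel_measurable S"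
    if "u \<in> borel_measurable borel" "i < N" for u i k
    by (intro borel_measurable_times_ennreal mi m2 that)
  have m0: "(\<lambda>t. u (max 0 (v - t))) \<in> borel_measurable E"
    if [measurable]: "u \<in> borel_measurable borel" for u :: "real \<Rightarrow> ennreal" and v by measurable
  have m1s: "(\<lambda>b. \<integral>\<^sup>+t. u (max 0 (v + b - t)) \<partial>E) \<in> borel_measurable (service_of i j)"
    if "u \<in> borel_measurable borel" for u :: "real \<Rightarrow> ennreal" and v i
    unfolding measurable_cong_sets[OF so refl] by (rule m1'[OF that])
  show ?thesis unfolding E_def[symmetric] using g
  proof (induction g rule: borel_measurable_induct)
    case (cong f g)
    then have "f = g" by auto
    then show ?case using cong by simp
  next
    case (set A)
    have X: "A \<times> {j} \<in> sets S" unfolding S_facts(2) using set j by auto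
    define R where "R = (\<lambda>x. \<Sum>k<N. ennreal (trans_prob D1 D2 (snd x) k) *
            (\<integral>\<^sup>+b. (\<integral>\<^sup>+t. indicator (A \<times> {j}) (max 0 (fst x + b - t), k)
               \<partial>density lborel (exponential_density (rate D1 D2 k))) \<partial>service_of (snd x) k))"
    have em: "emeasure S (A \<times> {j}) = integral\<^sup>N S R"
      unfolding R_def using conjunct2[OF conjunct2[OF conjunct2[OF S[unfolded stationary_law_def]]]] X
      by (rule bspec)
    have ind: "(\<integral>\<^sup>+x. indicator A (fst x) * indicator {j} (snd x) \<partial>S) = (\<integral>\<^sup>+x. indicator (A \<times> {j}) x \<partial>S)"
      by (intro nn_integral_cong) (auto split: split_indicator)
    have "(\<integral>\<^sup>+x. indicator A (fst x) * indicator {j} (snd x) \<partial>S) = integral\<^sup>N S R"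
      unfolding ind nn_integral_indicator[OF X] by (rule em)
    also have "\<dots> = (\<integral>\<^sup>+x. (\<Sum>i<N. ennreal (trans_prob D1 D2 i j) * (?K (indicator A) i x * indicator {i} (snd x))) \<partial>S)"
    proof (rule nn_integral_cong)
      fix x assume "x \<in> space S"
      then have x: "snd x < N" unfolding S_facts(4) by (simp add: mem_Times_iff)
      have "R x
        = (\<Sum>k<N. if k = j then ennreal (trans_prob D1 D2 (snd x) j) * ?K (indicator A) (snd x) x else 0)"
        unfolding R_def
      proof (intro sum.cong refl)
        fix k
        have "indicator (A \<times> {j}) (v, k) = (if k = j then indicator A v else 0 :: ennreal)" for v
          by (auto split: split_indicator)
        then show "ennreal (trans_prob D1 D2 (snd x) k) *
            (\<integral>\<^sup>+b. (\<integral>\<^sup>+t. indicator (A \<times> {j}) (max 0 (fst x + b - t), k)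
               \<partial>density lborel (exponential_density (rate D1 D2 k))) \<partial>service_of (snd x) k)
          = (if k = j then ennreal (trans_prob D1 D2 (snd x) j) * ?K (indicator A) (snd x) x else 0)"
          by (simp add: E_def)
      qed
      also have "\<dots> = ennreal (trans_prob D1 D2 (snd x) j) * ?K (indicator A) (snd x) x" using j by simp
      also have "\<dots> = (\<Sum>i<N. if i = snd x then ennreal (trans_prob D1 D2 (snd x) j) * ?K (indicator A) (snd x) x else 0)"
        using x by simp
      also have "\<dots> = (\<Sum>i<N. ennreal (trans_prob D1 D2 i j) * (?K (indicator A) i x * indicator {i} (snd x)))"
        by (intro sum.cong refl) auto
      finally show "R x
        = (\<Sum>i<N. ennreal (trans_prob D1 D2 i j) * (?K (indicator A) i x * indicator {i} (snd x)))" .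
    qed
    also have "\<dots> = (\<Sum>i<N. ennreal (trans_prob D1 D2 i j) * (\<integral>\<^sup>+x. ?K (indicator A) i x * indicator {i} (snd x) \<partial>S))"
    proof -
      have iA: "indicator A \<in> borel_measurable borel" using set by simp
      have "(\<integral>\<^sup>+x. (\<Sum>i<N. ennreal (trans_prob D1 D2 i j) * (?K (indicator A) i x * indicator {i} (snd x))) \<partial>S)
        = (\<Sum>i<N. \<integral>\<^sup>+x. ennreal (trans_prob D1 D2 i j) * (?K (indicator A) i x * indicator {i} (snd x)) \<partial>S)"
        by (rule nn_integral_sum, rule borel_measurable_times_ennreal[OF _ mK[OF iA]]) auto
      also have "\<dots> = (\<Sum>i<N. ennreal (trans_prob D1 D2 i j) * (\<integral>\<^sup>+x. ?K (indicator A) i x * indicator {i} (snd x) \<partial>S))"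
        by (rule sum.cong[OF refl], rule nn_integral_cmult[OF mK[OF iA]]) simp
      finally show ?thesis .
    qed
    finally show ?case .
  next
    case (mult u c)
    have l: "(\<integral>\<^sup>+x. c * u (fst x) * indicator {j} (snd x) \<partial>S) = c * (\<integral>\<^sup>+x. u (fst x) * indicator {j} (snd x) \<partial>S)"
      unfolding mult.assoc by (rule nn_integral_cmult[OF mg[OF mult(2)]])
    have k: "?K (\<lambda>x. c * u x) i x = c * ?K u i x" for i x
      unfolding nn_integral_cmult[OF m0[OF mult(2)]] by (rule nn_integral_cmult[OF m1s[OF mult(2)]])
    have r: "(\<integral>\<^sup>+x. c * ?K u i x * indicator {i} (snd x) \<partial>S) = c * (\<integral>\<^sup>+x. ?K u i x * indicator {i} (snd x) \<partial>S)"
      if i: "i < N" for i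
      unfolding mult.assoc by (rule nn_integral_cmult[OF mK[OF mult(2) i]])
    show ?case unfolding l k mult(4)
      by (simp add: r sum_distrib_left mult.left_commute)
  next
    case (add u v)
    have um: "u \<in> borel_measurable borel" and vm: "v \<in> borel_measurable borel" by fact+
    have l: "(\<integral>\<^sup>+x. (v (fst x) + u (fst x)) * indicator {j} (snd x) \<partial>S)
      = (\<integral>\<^sup>+x. v (fst x) * indicator {j} (snd x) \<partial>S) + (\<integral>\<^sup>+x. u (fst x) * indicator {j} (snd x) \<partial>S)"
      unfolding distrib_right by (rule nn_integral_add[OF mg[OF vm] mg[OF um]])
    have k: "?K (\<lambda>x. v x + u x) i x = ?K v i x + ?K u i x" for i x
      unfolding nn_integral_add[OF m0[OF vm] m0[OF um]]
      by (rule nn_integral_add[OF m1s[OF vm] m1s[OF um]])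
    have r: "(\<integral>\<^sup>+x. (?K v i x + ?K u i x) * indicator {i} (snd x) \<partial>S)
       = (\<integral>\<^sup>+x. ?K v i x * indicator {i} (snd x) \<partial>S) + (\<integral>\<^sup>+x. ?K u i x * indicator {i} (snd x) \<partial>S)"
      if i: "i < N" for i
      unfolding distrib_right by (rule nn_integral_add[OF mK[OF vm i] mK[OF um i]])
    show ?case unfolding l k add.IH
      by (simp add: r sum.distrib distrib_left)
  next
    case (seq U)
    have [measurable]: "U n \<in> borel_measurable borel" for n using seq by auto
    have mono: "U n z \<le> U m z" if "n \<le> m" for n m z using \<open>incseq U\<close> that by (auto simp: incseq_def le_fun_def)
    have U: "U n \<in> borel_measurable borel" for n using seq by auto
    have SUPa: "(SUP n. U n) z = (SUP n. U n z)" for z by (simp add: image_image)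
    have inc1: "incseq (\<lambda>n x. f n x * indicator {k} (snd x :: nat) :: ennreal)"
      if "\<And>n m x. n \<le> m \<Longrightarrow> f n x \<le> f m x" for f :: "nat \<Rightarrow> real \<times> nat \<Rightarrow> ennreal" and k
      using that unfolding incseq_def le_fun_def by (intro allI impI mult_right_mono) auto
    have l: "(\<integral>\<^sup>+x. (SUP n. U n) (fst x) * indicator {j} (snd x) \<partial>S)
      = (SUP n. \<integral>\<^sup>+x. U n (fst x) * indicator {j} (snd x) \<partial>S)"
      unfolding SUPa SUP_mult_right_ennreal
      by (rule nn_integral_monotone_convergence_SUP[OF inc1 mg[OF U]]) (rule mono)
    have kmono: "?K (U n) i x \<le> ?K (U m) i x" if "n \<le> m" for n m i x
      by (intro nn_integral_mono mono that)
    have k: "?K (SUP n. U n) i x = (SUP n. ?K (U n) i x)" for i x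
    proof -
      have t: "(\<integral>\<^sup>+t. (SUP n. U n (max 0 (v - t))) \<partial>E) = (SUP n. \<integral>\<^sup>+t. U n (max 0 (v - t)) \<partial>E)" for v
        by (rule nn_integral_monotone_convergence_SUP[OF _ m0[OF U]])
          (use mono in \<open>auto simp: incseq_def le_fun_def\<close>)
      show ?thesis unfolding SUPa t
        by (rule nn_integral_monotone_convergence_SUP[OF _ m1s[OF U]])
          (unfold incseq_def le_fun_def, intro allI impI nn_integral_mono mono)
    qed
    have r: "(\<integral>\<^sup>+x. (SUP n. ?K (U n) i x) * indicator {i} (snd x) \<partial>S)
      = (SUP n. \<integral>\<^sup>+x. ?K (U n) i x * indicator {i} (snd x) \<partial>S)" if i: "i < N" for i
      unfolding SUP_mult_right_ennreal
      by (rule nn_integral_monotone_convergence_SUP[OF inc1 mK[OF U i]]) (rule kmono)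
    have rmono: "(\<integral>\<^sup>+x. ?K (U n) i x * indicator {i} (snd x) \<partial>S) \<le> (\<integral>\<^sup>+x. ?K (U m) i x * indicator {i} (snd x) \<partial>S)"
      if "n \<le> m" for n m i
      by (intro nn_integral_mono mult_right_mono kmono that) simp
    have "(SUP n. \<Sum>i<N. ennreal (trans_prob D1 D2 i j) * (\<integral>\<^sup>+x. ?K (U n) i x * indicator {i} (snd x) \<partial>S))
      = (\<Sum>i<N. SUP n. ennreal (trans_prob D1 D2 i j) * (\<integral>\<^sup>+x. ?K (U n) i x * indicator {i} (snd x) \<partial>S))"
      by (rule ennreal_SUP_sum) (unfold incseq_def, intro allI impI mult_left_mono rmono, auto)
    then show ?case unfolding l k seq.IH SUP_mult_left_ennreal[symmetric]
      by (simp only:) (intro sum.cong refl arg_cong2[where f = "(*)"] r[symmetric], simp)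
  qed
qed

text \<open>
  For \<open>0 < s < \<lambda>\<^sub>j\<close> all terms below are nonnegative.  The second sum comes from the part of
  \<open>exponential_mean_transform\<close> that is due to the system emptying before the next arrival; up to the factor \<open>s\<close> it does not depend
  on \<open>s\<close> and becomes the constant vector of the functional equation.
\<close>

lemma stationary_transform_ennreal:
  assumes j: "j < N" and s: "0 < s" "s < rate D1 D2 j"
  defines "l \<equiv> rate D1 D2 j"
  defines "\<phi> \<equiv> \<lambda>u i. \<integral>\<^sup>+x. ennreal (exp (- u * fst x)) * indicator {i} (snd x) \<partial>S"
    and "\<gamma> \<equiv> \<lambda>u i. \<integral>\<^sup>+b. ennreal (exp (- u * b)) \<partial>service_of i j"
  shows "ennreal (l - s) * \<phi> s j + ennreal s * (\<Sum>i<N. ennreal (trans_prob D1 D2 i j) * (\<gamma> l i * \<phi> l i))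
    = ennreal l * (\<Sum>i<N. ennreal (trans_prob D1 D2 i j) * (\<gamma> s i * \<phi> s i))"
proof -
  define E where "E = density lborel (exponential_density l)"
  have l: "s < l" "0 < l" using s by (auto simp: l_def)
  interpret E: prob_space E unfolding E_def using l by (intro prob_space_exponential_density)
  have [measurable_cong]: "sets E = sets borel" by (simp add: E_def)
  have so: "sets (service_of i j) = sets borel" for i using sets_mix[OF sets_return F(2)] .
  define T where "T = (\<lambda>w. \<integral>\<^sup>+t. ennreal (exp (- s * max 0 (w - t))) \<partial>E)"
  have T [measurable]: "T \<in> borel_measurable borel" unfolding T_def by measurable
  have Tb: "(\<lambda>b. T (v + b)) \<in> borel_measurable (service_of i j)" for v i
    unfolding measurable_cong_sets[OF so refl] by measurable
  have eb: "(\<lambda>b. ennreal (exp (- u * b))) \<in> borel_measurable (service_of i j)" for u i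
    unfolding measurable_cong_sets[OF so refl] by measurable
  have inner: "ennreal (l - s) * (\<integral>\<^sup>+b. T (v + b) \<partial>service_of i j) + ennreal s * (ennreal (exp (- l * v)) * \<gamma> l i)
      = ennreal l * (ennreal (exp (- s * v)) * \<gamma> s i)" if v: "0 \<le> v" and i: "i < N" for v i
  proof -
    have "ennreal (l - s) * (\<integral>\<^sup>+b. T (v + b) \<partial>service_of i j) + ennreal s * (ennreal (exp (- l * v)) * \<gamma> l i)
      = (\<integral>\<^sup>+b. ennreal (l - s) * T (v + b) \<partial>service_of i j)
        + (\<integral>\<^sup>+b. ennreal s * ennreal (exp (- l * v)) * ennreal (exp (- l * b)) \<partial>service_of i j)"
      unfolding \<gamma>_def mult.assoc[symmetric]
      by (simp only: nn_integral_cmult[OF Tb] nn_integral_cmult[OF eb])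
    also have "\<dots> = (\<integral>\<^sup>+b. ennreal (l - s) * T (v + b)
        + ennreal s * ennreal (exp (- l * v)) * ennreal (exp (- l * b)) \<partial>service_of i j)"
      by (rule nn_integral_add[symmetric]; intro borel_measurable_times_ennreal measurable_const Tb eb; simp)
    also have "\<dots> = (\<integral>\<^sup>+b. ennreal l * ennreal (exp (- s * v)) * ennreal (exp (- s * b)) \<partial>service_of i j)"
    proof (rule nn_integral_cong_AE)
      show "AE b in service_of i j. ennreal (l - s) * T (v + b)
        + ennreal s * ennreal (exp (- l * v)) * ennreal (exp (- l * b))
        = ennreal l * ennreal (exp (- s * v)) * ennreal (exp (- s * b))"
        using service_of(3)[OF i j]
      proof eventually_elim
        case (elim b)
        have e: "ennreal c * ennreal (exp (- u * v)) * ennreal (exp (- u * b)) = ennreal (c * exp (- u * (v + b)))"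
          if "0 < c" for c u
          using that by (simp add: algebra_simps flip: ennreal_mult exp_add)
        have "ennreal (l - s) * T (v + b) + ennreal (s * exp (- l * (v + b))) = ennreal (l * exp (- s * (v + b)))"
          unfolding T_def E_def using elim v s(1) l(1) by (intro exponential_mean_transform) auto
        then show ?case unfolding e[OF s(1)] e[OF l(2)] .
      qed
    qed
    also have "\<dots> = ennreal l * (ennreal (exp (- s * v)) * \<gamma> s i)"
      unfolding \<gamma>_def nn_integral_cmult[OF eb] by (simp only: mult.assoc)
    finally show ?thesis .
  qed
  have mi: "(\<lambda>x. indicator {k} (snd x) :: ennreal) \<in> borel_measurable S" for k
    by (rule measurable_compose[OF S_measurable(2)]) simp
  have ef: "(\<lambda>x. ennreal (exp (- u * fst x)) * indicator {k} (snd x)) \<in> borel_measurable S" for u k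
    by (intro borel_measurable_times_ennreal mi) (use S_measurable(1) in measurable)
  have Tm: "(\<lambda>x. (\<integral>\<^sup>+b. T (fst x + b) \<partial>service_of i j) * indicator {k} (snd x)) \<in> borel_measurable S"
    if i: "i < N" for i k
  proof (intro borel_measurable_times_ennreal mi)
    interpret G: prob_space "service_of i j" using service_of(1)[OF i j] .
    note so [measurable_cong]
    have "(\<lambda>v. \<integral>\<^sup>+b. T (v + b) \<partial>service_of i j) \<in> borel_measurable borel" by measurable
    from measurable_compose[OF S_measurable(1) this]
    show "(\<lambda>x. \<integral>\<^sup>+b. T (fst x + b) \<partial>service_of i j) \<in> borel_measurable S" .
  qed
  define J where "J = (\<lambda>i. \<integral>\<^sup>+x. (\<integral>\<^sup>+b. T (fst x + b) \<partial>service_of i j) * indicator {i} (snd x) \<partial>S)"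
  have J: "\<phi> s j = (\<Sum>i<N. ennreal (trans_prob D1 D2 i j) * J i)"
    unfolding \<phi>_def J_def T_def E_def l_def
    by (rule stationary_nn_integral[OF j]) measurable
  have outer: "ennreal (l - s) * J i + ennreal s * (\<gamma> l i * \<phi> l i) = ennreal l * (\<gamma> s i * \<phi> s i)"
    if i: "i < N" for i
  proof -
    have "ennreal (l - s) * J i + ennreal s * (\<gamma> l i * \<phi> l i)
      = (\<integral>\<^sup>+x. ennreal (l - s) * ((\<integral>\<^sup>+b. T (fst x + b) \<partial>service_of i j) * indicator {i} (snd x)) \<partial>S)
        + (\<integral>\<^sup>+x. ennreal s * \<gamma> l i * (ennreal (exp (- l * fst x)) * indicator {i} (snd x)) \<partial>S)"
      unfolding J_def \<phi>_def nn_integral_cmult[OF Tm[OF i]] nn_integral_cmult[OF ef] by (simp only: mult.assoc)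
    also have "\<dots> = (\<integral>\<^sup>+x. ennreal (l - s) * ((\<integral>\<^sup>+b. T (fst x + b) \<partial>service_of i j) * indicator {i} (snd x))
        + ennreal s * \<gamma> l i * (ennreal (exp (- l * fst x)) * indicator {i} (snd x)) \<partial>S)"
      by (rule nn_integral_add[symmetric]; intro borel_measurable_times_ennreal[OF measurable_const] Tm[OF i] ef; simp)
    also have "\<dots> = (\<integral>\<^sup>+x. ennreal l * \<gamma> s i * (ennreal (exp (- s * fst x)) * indicator {i} (snd x)) \<partial>S)"
    proof (rule nn_integral_cong_AE)
      show "AE x in S. ennreal (l - s) * ((\<integral>\<^sup>+b. T (fst x + b) \<partial>service_of i j) * indicator {i} (snd x))
        + ennreal s * \<gamma> l i * (ennreal (exp (- l * fst x)) * indicator {i} (snd x))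
        = ennreal l * \<gamma> s i * (ennreal (exp (- s * fst x)) * indicator {i} (snd x))"
        using S_facts(3)
      proof eventually_elim
        case (elim x)
        have "ennreal (l - s) * ((\<integral>\<^sup>+b. T (fst x + b) \<partial>service_of i j) * indicator {i} (snd x))
          + ennreal s * \<gamma> l i * (ennreal (exp (- l * fst x)) * indicator {i} (snd x))
          = (ennreal (l - s) * (\<integral>\<^sup>+b. T (fst x + b) \<partial>service_of i j)
            + ennreal s * (ennreal (exp (- l * fst x)) * \<gamma> l i)) * indicator {i} (snd x)"
          unfolding distrib_right by (simp only: mult_ac)
        also have "\<dots> = ennreal l * \<gamma> s i * (ennreal (exp (- s * fst x)) * indicator {i} (snd x))"
          unfolding inner[OF elim i] by (simp only: mult_ac)
        finally show ?case .
      qed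
    qed
    also have "\<dots> = ennreal l * (\<gamma> s i * \<phi> s i)"
      unfolding \<phi>_def nn_integral_cmult[OF ef] by (simp only: mult.assoc)
    finally show ?thesis .
  qed
  have "ennreal (l - s) * \<phi> s j + ennreal s * (\<Sum>i<N. ennreal (trans_prob D1 D2 i j) * (\<gamma> l i * \<phi> l i))
    = (\<Sum>i<N. ennreal (trans_prob D1 D2 i j) * (ennreal (l - s) * J i + ennreal s * (\<gamma> l i * \<phi> l i)))"
    unfolding J by (simp only: sum_distrib_left sum.distrib[symmetric] distrib_left mult_ac)
  also have "\<dots> = (\<Sum>i<N. ennreal (trans_prob D1 D2 i j) * (ennreal l * (\<gamma> s i * \<phi> s i)))"
    using outer by (intro sum.cong refl arg_cong2[where f = "(*)"]) simp
  also have "\<dots> = ennreal l * (\<Sum>i<N. ennreal (trans_prob D1 D2 i j) * (\<gamma> s i * \<phi> s i))"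
    by (simp only: sum_distrib_left mult_ac)
  finally show ?thesis .
qed

lemma stationary_transform_real:
  assumes j: "j < N" and s: "0 < s" "s < rate D1 D2 j"
  defines "l \<equiv> rate D1 D2 j"
  defines "\<phi> \<equiv> \<lambda>u i. LINT x|S. (if snd x = i then exp (- u * fst x) else 0)"
    and "\<gamma> \<equiv> \<lambda>u i. 1 - real_prob D1 D2 i j + real_prob D1 D2 i j * (LINT b|F. exp (- u * b))"
  shows "(l - s) * \<phi> s j + s * (\<Sum>i<N. trans_prob D1 D2 i j * (\<gamma> l i * \<phi> l i))
    = l * (\<Sum>i<N. trans_prob D1 D2 i j * (\<gamma> s i * \<phi> s i))"
proof -
  interpret S: prob_space S by (rule S_facts)
  interpret F: prob_space F by (rule F)
  have l: "s < l" "0 < l" using s by (auto simp: l_def)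
  note S_measurable [measurable]
  have [measurable_cong]: "sets F = sets borel" by (rule F)
  have \<phi>0: "0 \<le> \<phi> u i" for u i unfolding \<phi>_def by (intro integral_nonneg_AE) auto
  have \<phi>: "(\<integral>\<^sup>+x. ennreal (exp (- u * fst x)) * indicator {i} (snd x) \<partial>S) = ennreal (\<phi> u i)" if u: "0 < u" for u i
  proof -
    have "(\<integral>\<^sup>+x. ennreal (exp (- u * fst x)) * indicator {i} (snd x) \<partial>S)
      = (\<integral>\<^sup>+x. ennreal (if snd x = i then exp (- u * fst x) else 0) \<partial>S)"
      by (intro nn_integral_cong) (auto split: split_indicator)
    also have "\<dots> = ennreal (\<phi> u i)" unfolding \<phi>_def
    proof (rule nn_integral_eq_integral)
      show "integrable S (\<lambda>x. if snd x = i then exp (- u * fst x) else 0)"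
      proof (rule S.integrable_const_bound[where B = 1])
        show "AE x in S. norm (if snd x = i then exp (- u * fst x) else 0) \<le> 1"
          using S_facts(3) by eventually_elim (use u in auto)
      qed measurable
    qed auto
    finally show ?thesis .
  qed
  define G where "G = (\<lambda>u. LINT b|F. exp (- u * b))"
  have G_eq: "(LINT b|F. exp (- u * b)) = G u" for u by (simp add: G_def)
  have G0: "0 \<le> G u" for u unfolding G_def by (intro integral_nonneg_AE) auto
  have G: "(\<integral>\<^sup>+b. ennreal (exp (- u * b)) \<partial>F) = ennreal (G u)" if u: "0 < u" for u
    unfolding G_def
  proof (rule nn_integral_eq_integral)
    show "integrable F (\<lambda>b. exp (- u * b))"
    proof (rule F.integrable_const_bound[where B = 1])
      show "AE b in F. norm (exp (- u * b)) \<le> 1"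
        using F(3) by eventually_elim (use u in auto)
    qed measurable
  qed auto
  have \<gamma>0: "0 \<le> \<gamma> u i" if "i < N" for u i
    using real_prob_bounds[OF that j] G0[of u] unfolding \<gamma>_def G_eq by simp
  have \<gamma>: "(\<integral>\<^sup>+b. ennreal (exp (- u * b)) \<partial>service_of i j) = ennreal (\<gamma> u i)" if u: "0 < u" and i: "i < N" for u i
  proof -
    have r: "prob_space (return borel (0::real))" by (rule prob_space_return) simp
    have b: "0 \<le> real_prob D1 D2 i j" "real_prob D1 D2 i j \<le> 1" using real_prob_bounds[OF i j] by auto
    have "(\<integral>\<^sup>+b. ennreal (exp (- u * b)) \<partial>service_of i j)
      = ennreal (real_prob D1 D2 i j) * ennreal (G u) + ennreal (1 - real_prob D1 D2 i j) * 1"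
      unfolding G[OF u, symmetric]
      by (subst nn_integral_mix[OF r sets_return F(1,2) b]) (auto simp: nn_integral_return)
    also have "\<dots> = ennreal (\<gamma> u i)"
      unfolding \<gamma>_def G_eq using b G0[of u] by (simp add: add.commute flip: ennreal_mult ennreal_plus)
    finally show ?thesis .
  qed
  have sm: "(\<Sum>i<N. ennreal (trans_prob D1 D2 i j) * (ennreal (\<gamma> u i) * ennreal (\<phi> u i)))
    = ennreal (\<Sum>i<N. trans_prob D1 D2 i j * (\<gamma> u i * \<phi> u i))"
    and sm0: "0 \<le> (\<Sum>i<N. trans_prob D1 D2 i j * (\<gamma> u i * \<phi> u i))" for u
  proof -
    have n: "0 \<le> trans_prob D1 D2 i j * (\<gamma> u i * \<phi> u i)" if "i < N" for i
      using trans_prob_nonneg[OF that j] \<gamma>0[OF that] \<phi>0 by simp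
    then show "0 \<le> (\<Sum>i<N. trans_prob D1 D2 i j * (\<gamma> u i * \<phi> u i))" by (intro sum_nonneg) auto
    have "(\<Sum>i<N. ennreal (trans_prob D1 D2 i j) * (ennreal (\<gamma> u i) * ennreal (\<phi> u i)))
      = (\<Sum>i<N. ennreal (trans_prob D1 D2 i j * (\<gamma> u i * \<phi> u i)))"
      using trans_prob_nonneg[OF _ j] \<gamma>0 \<phi>0 by (intro sum.cong refl) (simp add: ennreal_mult)
    then show "(\<Sum>i<N. ennreal (trans_prob D1 D2 i j) * (ennreal (\<gamma> u i) * ennreal (\<phi> u i)))
      = ennreal (\<Sum>i<N. trans_prob D1 D2 i j * (\<gamma> u i * \<phi> u i))"
      by (simp only:) (rule sum_ennreal, use n in auto)
  qed
  have sm': "(\<Sum>i<N. ennreal (trans_prob D1 D2 i j) * ((\<integral>\<^sup>+b. ennreal (exp (- u * b)) \<partial>service_of i j)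
      * (\<integral>\<^sup>+x. ennreal (exp (- u * fst x)) * indicator {i} (snd x) \<partial>S)))
    = ennreal (\<Sum>i<N. trans_prob D1 D2 i j * (\<gamma> u i * \<phi> u i))" if "0 < u" for u
    unfolding sm[symmetric] \<phi>[OF that] by (rule sum.cong[OF refl], subst \<gamma>[OF that]) auto
  have "ennreal (l - s) * ennreal (\<phi> s j) + ennreal s * ennreal (\<Sum>i<N. trans_prob D1 D2 i j * (\<gamma> l i * \<phi> l i))
    = ennreal l * ennreal (\<Sum>i<N. trans_prob D1 D2 i j * (\<gamma> s i * \<phi> s i))"
    using stationary_transform_ennreal[OF j s, folded l_def, unfolded sm'[OF s(1)] sm'[OF l(2)]]
    unfolding \<phi>[OF s(1)] .
  then have "ennreal ((l - s) * \<phi> s j + s * (\<Sum>i<N. trans_prob D1 D2 i j * (\<gamma> l i * \<phi> l i)))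
    = ennreal (l * (\<Sum>i<N. trans_prob D1 D2 i j * (\<gamma> s i * \<phi> s i)))"
    using l s \<phi>0 sm0 by (simp add: ennreal_mult[symmetric] ennreal_plus[symmetric] del: ennreal_plus)
  then show ?thesis
    using l s \<phi>0 sm0 by (subst (asm) ennreal_inj) (auto intro!: add_nonneg_nonneg mult_nonneg_nonneg)
qed

lemma Phi_index: "i < N \<Longrightarrow> Phi N S s $ i = lt_on S fst (\<lambda>x. snd x = i) s"
  by (simp add: Phi_def lt_on_def)

lemma Phi_carrier [simp]: "Phi N S s \<in> carrier_vec N"
  by (simp add: Phi_def)

lemma tag_pred: "Measurable.pred S (\<lambda>x. snd x = i)"
  using S_measurable(2) by measurable

lemma Phi_holomorphic: "i < N \<Longrightarrow> (\<lambda>s. Phi N S s $ i) holomorphic_on {s. 0 < Re s}"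
  using lt_on_holomorphic[OF S_facts(1) S_measurable(1) tag_pred S_facts(3)] by (simp add: Phi_index)

lemma Phi_continuous: "i < N \<Longrightarrow> continuous_on {s. 0 \<le> Re s} (\<lambda>s. Phi N S s $ i)"
  using lt_on_continuous[OF S_facts(1) S_measurable(1) tag_pred S_facts(3)] by (simp add: Phi_index)

lemma norm_Phi_le: "i < N \<Longrightarrow> 0 \<le> Re s \<Longrightarrow> norm (Phi N S s $ i) \<le> 1"
  using norm_lt_on_le[OF S_facts(1) S_measurable(1) tag_pred S_facts(3)] by (simp add: Phi_index)

lemma sum_Phi_0: "(\<Sum>i<N. Phi N S 0 $ i) = 1"
proof -
  interpret S: prob_space S by (rule S_facts)
  have "(\<Sum>i<N. Phi N S 0 $ i) = (\<Sum>i<N. LINT x|S. (if snd x = i then exp (- 0 * complex_of_real (fst x)) else 0))"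
    by (simp add: Phi_def)
  also have "\<dots> = (LINT x|S. (\<Sum>i<N. if snd x = i then exp (- 0 * complex_of_real (fst x)) else 0))"
    using lt_integrable[OF S_facts(1) S_measurable(1) tag_pred S_facts(3), of 0]
    by (intro Bochner_Integration.integral_sum[symmetric]) auto
  also have "\<dots> = (LINT x|S. 1)"
  proof (rule Bochner_Integration.integral_cong[OF refl])
    fix x assume "x \<in> space S"
    then have "snd x < N" unfolding S_facts(4) by (simp add: mem_Times_iff)
    then show "(\<Sum>i<N. if snd x = i then exp (- 0 * complex_of_real (fst x)) else 0) = (1 :: complex)" by simp
  qed
  finally show ?thesis by (simp add: S.prob_space)
qed

end

context
  fixes N :: nat and D1 D2 :: "real mat" and F :: "real measure" and S :: "(real \<times> nat) measure"
  assumes arr: "arrival_process N D1 D2" and rates: "\<forall>i<N. 0 < rate D1 D2 i"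
    and F: "prob_space F" "sets F = sets borel" "AE x in F. 0 \<le> x"
    and S: "stationary_law N D1 D2 F S"
begin

text \<open>
  Componentwise, the equation holds on the real interval \<open>(0, \<lambda>\<^sub>j)\<close>.  It extends to the open right
  half-plane by analytic continuation, and to its closure by continuity.
\<close>

theorem stationary_transform:
  assumes g: "g holomorphic_on {s. 0 < Re s}" "continuous_on {s. 0 \<le> Re s} g"
    and g_real: "\<And>u. 0 < u \<Longrightarrow> g (complex_of_real u) = complex_of_real (LINT b|F. exp (- u * b))"
  obtains c where "c \<in> carrier_vec N"
    "\<And>s. 0 \<le> Re s \<Longrightarrow> row_mult (Phi N S s) (E_sg D1 D2 s (g s)) = s \<cdot>\<^sub>v c"
proof -
  note ctx = arr rates F S
  define \<gamma> where "\<gamma> = (\<lambda>u i j. 1 - real_prob D1 D2 i j + real_prob D1 D2 i j * (LINT b|F. exp (- u * b)))"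
  define \<phi> where "\<phi> = (\<lambda>u i. LINT x|S. (if snd x = i then exp (- u * fst x) else 0))"
  define c where "c = vec N (\<lambda>j. complex_of_real (\<Sum>i<N. trans_prob D1 D2 i j * (\<gamma> (rate D1 D2 j) i j * \<phi> (rate D1 D2 j) i)))"
  define H where "H = (\<lambda>j s. (\<Sum>i<N. Phi N S s $ i * (complex_of_real (trans_prob D1 D2 i j * rate D1 D2 j)
      * (1 - complex_of_real (real_prob D1 D2 i j) + g s * complex_of_real (real_prob D1 D2 i j))))
      + Phi N S s $ j * (s - complex_of_real (rate D1 D2 j)) - s * c $ j)"
  have Phi_real: "Phi N S (complex_of_real u) $ i = complex_of_real (\<phi> u i)" if "i < N" for u i
  proof -
    have "Phi N S (complex_of_real u) $ i
      = (LINT x|S. (if snd x = i then exp (- complex_of_real u * complex_of_real (fst x)) else 0))"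
      using that by (simp add: Phi_def)
    also have "\<dots> = (LINT x|S. complex_of_real (if snd x = i then exp (- u * fst x) else 0))"
      by (intro Bochner_Integration.integral_cong refl) (auto simp: exp_of_real[symmetric])
    finally show ?thesis unfolding \<phi>_def by simp
  qed
  have zero_real: "H j (complex_of_real u) = 0" if j: "j < N" and u: "0 < u" "u < rate D1 D2 j" for j u
  proof -
    have "H j (complex_of_real u) = complex_of_real (rate D1 D2 j * (\<Sum>i<N. trans_prob D1 D2 i j * (\<gamma> u i j * \<phi> u i))
      - (rate D1 D2 j - u) * \<phi> u j - u * (\<Sum>i<N. trans_prob D1 D2 i j * (\<gamma> (rate D1 D2 j) i j * \<phi> (rate D1 D2 j) i)))"
      using j unfolding H_def c_def g_real[OF u(1)]
      by (simp add: Phi_real \<gamma>_def sum_distrib_left mult_ac algebra_simps)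
    also have "rate D1 D2 j * (\<Sum>i<N. trans_prob D1 D2 i j * (\<gamma> u i j * \<phi> u i))
      - (rate D1 D2 j - u) * \<phi> u j - u * (\<Sum>i<N. trans_prob D1 D2 i j * (\<gamma> (rate D1 D2 j) i j * \<phi> (rate D1 D2 j) i)) = 0"
      using stationary_transform_real[OF ctx j u] unfolding \<gamma>_def \<phi>_def by linarith
    finally show ?thesis by simp
  qed
  have hol: "H j holomorphic_on {s. 0 < Re s}" if "j < N" for j
    unfolding H_def using Phi_holomorphic[OF ctx] that g(1)
    by (intro holomorphic_intros) auto
  have cont: "continuous_on {s. 0 \<le> Re s} (H j)" if "j < N" for j
    unfolding H_def using Phi_continuous[OF ctx] that g(2)
    by (intro continuous_intros) auto
  have zero_pos: "H j s = 0" if j: "j < N" and s: "0 < Re s" for j s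
  proof -
    let ?l = "rate D1 D2 j"
    have l: "0 < ?l" using rates j by auto
    let ?U = "complex_of_real ` {0<..<?l}"
    show ?thesis
    proof (rule analytic_continuation[OF hol[OF j], of ?U "complex_of_real (?l / 2)"])
      show "open {s. 0 < Re s}" by (rule open_halfspace_Re_gt)
      show "connected {s. 0 < Re s}" by (intro convex_connected convex_halfspace_Re_gt)
      show "complex_of_real (?l / 2) islimpt ?U"
        unfolding islimpt_approachable
      proof (intro allI impI)
        fix e :: real assume e: "0 < e"
        define d where "d = min (e / 2) (?l / 4)"
        have d: "0 < d" "d < e" "d < ?l / 2" using e l by (auto simp: d_def)
        have "dist (complex_of_real (?l / 2 + d)) (complex_of_real (?l / 2)) = d"
          using d by (simp add: dist_norm del: of_real_divide flip: of_real_diff)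
        moreover have "?l / 2 + d \<in> {0<..<?l}" using d l by auto
        moreover have "complex_of_real (?l / 2 + d) \<noteq> complex_of_real (?l / 2)" using d unfolding of_real_eq_iff by simp
        ultimately show "\<exists>x'\<in>?U. x' \<noteq> complex_of_real (?l / 2) \<and> dist x' (complex_of_real (?l / 2)) < e"
          using d(2) by (intro bexI[OF _ imageI[of "?l / 2 + d"]] conjI) (simp_all only: not_False_eq_True)
      qed
    qed (use l s zero_real[OF j] in auto)
  qed
  have zero: "H j s = 0" if j: "j < N" and s: "0 \<le> Re s" for j s
  proof -
    have "(\<lambda>n. s + complex_of_real (inverse (real (Suc n)))) \<longlonglongrightarrow> s + complex_of_real 0"
      by (intro tendsto_intros LIMSEQ_inverse_real_of_nat)
    then have "(\<lambda>n. H j (s + complex_of_real (inverse (real (Suc n))))) \<longlonglongrightarrow> H j s"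
      using s by (intro continuous_on_tendsto_compose[OF cont[OF j]]) (auto intro!: always_eventually add_nonneg_nonneg)
    moreover have "H j (s + complex_of_real (inverse (real (Suc n)))) = 0" for n
    proof (rule zero_pos[OF j])
      have "0 < inverse (real (Suc n))" by simp
      then show "0 < Re (s + complex_of_real (inverse (real (Suc n))))" using s by (simp only: plus_complex.simps Re_complex_of_real)
    qed
    ultimately show ?thesis by (simp add: LIMSEQ_const_iff)
  qed
  show ?thesis
  proof (rule that[of c])
    show "c \<in> carrier_vec N" by (simp add: c_def)
    fix s :: complex assume s: "0 \<le> Re s"
    have E: "E_sg D1 D2 s (g s) \<in> carrier_mat N N" by (rule E_gen_carrier[OF arrival_dims(1)[OF arr rates]])
    show "row_mult (Phi N S s) (E_sg D1 D2 s (g s)) = s \<cdot>\<^sub>v c"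
    proof (rule eq_vecI)
      fix j assume "j < dim_vec (s \<cdot>\<^sub>v c)"
      then have j: "j < N" by (simp add: c_def)
      have "row_mult (Phi N S s) (E_sg D1 D2 s (g s)) $ j = (\<Sum>i<N. Phi N S s $ i * E_sg D1 D2 s (g s) $$ (i, j))"
        by (rule index_row_mult[OF E Phi_carrier[OF ctx] j])
      also have "\<dots> = (\<Sum>i<N. Phi N S s $ i * (complex_of_real (trans_prob D1 D2 i j * rate D1 D2 j)
      * (1 - complex_of_real (real_prob D1 D2 i j) + g s * complex_of_real (real_prob D1 D2 i j)))
         + (if i = j then Phi N S s $ j * (s - complex_of_real (rate D1 D2 j)) else 0))"
        using j by (intro sum.cong refl) (simp add: E_sg_index[OF arr rates] distrib_left)
      also have "\<dots> = H j s + s * c $ j" using j by (simp add: H_def sum.distrib)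
      finally show "row_mult (Phi N S s) (E_sg D1 D2 s (g s)) $ j = (s \<cdot>\<^sub>v c) $ j"
        using zero[OF j s] j by (simp add: c_def)
    qed (use E in \<open>auto simp: c_def row_mult_def\<close>)
  qed
qed

end

section \<open>First-order perturbation\<close>

abbreviation bigoe :: "nat \<Rightarrow> (real \<Rightarrow> complex) set" where
  "bigoe k \<equiv> O[at_right 0](\<lambda>\<epsilon>. complex_of_real \<epsilon> ^ k)"

lemma bigoe_mult:
  assumes "f \<in> bigoe a" "g \<in> bigoe b"
  shows "(\<lambda>\<epsilon>. f \<epsilon> * g \<epsilon>) \<in> bigoe (a + b)"
  using landau_o.big.mult[OF assms] by (simp add: power_add)

lemma bigoe_const: "(\<lambda>_. c) \<in> bigoe 0"
  by simp

lemma bigoe_eps: "f \<in> bigoe k \<Longrightarrow> (\<lambda>\<epsilon>. complex_of_real \<epsilon> * f \<epsilon>) \<in> bigoe (Suc k)"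
  using bigoe_mult[of "\<lambda>\<epsilon>. complex_of_real \<epsilon>" 1 f k] by simp

lemma bigoe_cmult: "f \<in> bigoe k \<Longrightarrow> (\<lambda>\<epsilon>. c * f \<epsilon>) \<in> bigoe k" "f \<in> bigoe k \<Longrightarrow> (\<lambda>\<epsilon>. f \<epsilon> * c) \<in> bigoe k"
  using bigoe_mult[OF bigoe_const, of f k c] bigoe_mult[OF _ bigoe_const, of f k c] by simp_all

lemma bigoe_bounded:
  assumes "eventually (\<lambda>\<epsilon>. norm (f \<epsilon>) \<le> B) (at_right 0)"
  shows "f \<in> bigoe 0"
  using assms by (intro bigoI[of _ B]) simp

lemma bigoe_Suc: "f \<in> bigoe (Suc k) \<Longrightarrow> f \<in> bigoe k"
proof -
  have "(\<lambda>\<epsilon>. complex_of_real \<epsilon>) \<in> bigoe 0"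
    by (rule bigoe_bounded[of _ 1], rule eventually_mono[OF eventually_at_right_real[of 0 1]]) auto
  then have "(\<lambda>\<epsilon>. complex_of_real \<epsilon> * complex_of_real \<epsilon> ^ k) \<in> bigoe (0 + k)"
    by (rule bigoe_mult) simp
  then have "(\<lambda>\<epsilon>. complex_of_real \<epsilon> ^ Suc k) \<in> bigoe k" by simp
  moreover assume "f \<in> bigoe (Suc k)"
  ultimately show ?thesis by (rule landau_o.big_trans[rotated])
qed

lemma bigoe_tendsto_0: "f \<in> bigoe (Suc k) \<Longrightarrow> (f \<longlongrightarrow> 0) (at_right 0)"
proof -
  assume "f \<in> bigoe (Suc k)"
  then have "f \<in> bigoe 1"
  proof (induction k)
    case 0
    then show ?case unfolding One_nat_def .
  next
    case (Suc k)
    then show ?case using bigoe_Suc by blast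
  qed
  then obtain C where "eventually (\<lambda>\<epsilon>. norm (f \<epsilon>) \<le> C * norm (complex_of_real \<epsilon> ^ 1)) (at_right 0)"
    by (auto elim: landau_o.bigE)
  moreover have "((\<lambda>\<epsilon>. C * norm (complex_of_real \<epsilon> ^ 1)) \<longlongrightarrow> 0) (at_right 0)"
    by (auto intro!: tendsto_eq_intros)
  ultimately show ?thesis by (rule Lim_null_comparison)
qed

lemma bigoe_const_eq_0: "(\<lambda>_. c) \<in> bigoe (Suc k) \<Longrightarrow> c = 0"
  by (drule bigoe_tendsto_0) (simp add: tendsto_const_iff)

lemma bigoe_cong:
  assumes "0 < \<epsilon>0" "\<And>\<epsilon>. 0 < \<epsilon> \<Longrightarrow> \<epsilon> < \<epsilon>0 \<Longrightarrow> f \<epsilon> = g \<epsilon>" "f \<in> bigoe k"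
  shows "g \<in> bigoe k"
proof -
  have "eventually (\<lambda>\<epsilon>. f \<epsilon> = g \<epsilon>) (at_right 0)"
    by (rule eventually_mono[OF eventually_at_right_real[OF assms(1)]]) (use assms(2) in auto)
  from landau_o.big.in_cong[OF this] assms(3) show ?thesis by simp
qed

lemma bigoe_row_mult:
  assumes "M \<in> carrier_mat n k" "\<And>\<epsilon>. 0 < \<epsilon> \<Longrightarrow> \<epsilon> < \<epsilon>0 \<Longrightarrow> f \<epsilon> \<in> carrier_vec n" "0 < \<epsilon>0"
    and "\<And>i. i < n \<Longrightarrow> (\<lambda>\<epsilon>. f \<epsilon> $ i) \<in> bigoe l" and j: "j < k"
  shows "(\<lambda>\<epsilon>. row_mult (f \<epsilon>) M $ j) \<in> bigoe l"
proof (rule bigoe_cong[OF assms(3)])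
  show "(\<lambda>\<epsilon>. \<Sum>i<n. f \<epsilon> $ i * M $$ (i, j)) \<in> bigoe l"
    by (intro big_sum_in_bigo bigoe_cmult assms) simp
  fix \<epsilon> :: real assume "0 < \<epsilon>" "\<epsilon> < \<epsilon>0"
  then show "(\<Sum>i<n. f \<epsilon> $ i * M $$ (i, j)) = row_mult (f \<epsilon>) M $ j"
    using index_row_mult[OF assms(1) assms(2) j] by simp
qed

lemma dim_row_mult [simp]: "dim_vec (row_mult v M) = dim_col M"
  by (simp add: row_mult_def)

lemma row_mult_minus_left:
  fixes u v :: "complex vec"
  assumes "M \<in> carrier_mat n k" "u \<in> carrier_vec n" "v \<in> carrier_vec n"
  shows "row_mult (u - v) M = row_mult u M - row_mult v M"
proof (rule eq_vecI)
  fix j assume "j < dim_vec (row_mult u M - row_mult v M)"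
  then have j: "j < k" using assms by (simp add: row_mult_def)
  have "row_mult (u - v) M $ j = (\<Sum>i<n. (u - v) $ i * M $$ (i, j))"
    by (rule index_row_mult) (use assms j in auto)
  also have "\<dots> = (\<Sum>i<n. u $ i * M $$ (i, j)) - (\<Sum>i<n. v $ i * M $$ (i, j))"
    using assms by (simp add: left_diff_distrib sum_subtractf)
  also have "\<dots> = (row_mult u M - row_mult v M) $ j"
    using assms(1) j index_row_mult[OF assms(1,2) j] index_row_mult[OF assms(1,3) j] by simp
  finally show "row_mult (u - v) M $ j = (row_mult u M - row_mult v M) $ j" .
qed (use assms in \<open>auto simp: row_mult_def\<close>)

lemma row_mult_smult_left:
  fixes u :: "complex vec"
  assumes "M \<in> carrier_mat n k" "u \<in> carrier_vec n"
  shows "row_mult (c \<cdot>\<^sub>v u) M = c \<cdot>\<^sub>v row_mult u M"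
  using assms unfolding row_mult_def by (intro mult_mat_vec) auto

lemma row_mult_zero_left: "M \<in> carrier_mat n k \<Longrightarrow> row_mult (0\<^sub>v n :: complex vec) M = 0\<^sub>v k"
  unfolding row_mult_def by (intro eq_vecI) auto

lemma row_mult_one: "(u :: complex vec) \<in> carrier_vec n \<Longrightarrow> row_mult u (1\<^sub>m n) = u"
  unfolding row_mult_def by simp

lemma row_mult_smult_right:
  fixes u :: "complex vec"
  assumes "M \<in> carrier_mat n k" "u \<in> carrier_vec n"
  shows "row_mult u (c \<cdot>\<^sub>m M) = c \<cdot>\<^sub>v row_mult u M"
  using assms unfolding row_mult_def by (intro eq_vecI) (auto simp: scalar_prod_def sum_distrib_left mult_ac)

text \<open>
  Multiply \<open>adj_diff X Y X + adj X Y = T I\<close> by \<open>adj X\<close> from the right.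
\<close>

lemma adj_triple:
  assumes X: "X \<in> carrier_mat n n" and Y: "Y \<in> carrier_mat n n"
  shows "adj_mat X * Y * adj_mat X + det X \<cdot>\<^sub>m adj_diff X Y = col_subst_sum X Y \<cdot>\<^sub>m adj_mat X"
proof -
  note c = adj_mat(1)[OF X] adj_diff_carrier[OF X, of Y]
  have "(adj_diff X Y * X + adj_mat X * Y) * adj_mat X = col_subst_sum X Y \<cdot>\<^sub>m 1\<^sub>m n * adj_mat X"
    unfolding adj_diff_identities(2)[OF X Y] ..
  also have "\<dots> = col_subst_sum X Y \<cdot>\<^sub>m adj_mat X"
    using c by (subst mult_smult_assoc_mat[of _ n n _ n]) auto
  also have "(adj_diff X Y * X + adj_mat X * Y) * adj_mat X
    = adj_diff X Y * (X * adj_mat X) + adj_mat X * Y * adj_mat X"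
    unfolding add_mult_distrib_mat[OF mult_carrier_mat[OF c(2) X] mult_carrier_mat[OF c(1) Y] c(1)]
      assoc_mult_mat[OF c(2) X c(1)] ..
  also have "adj_diff X Y * (X * adj_mat X) = det X \<cdot>\<^sub>m adj_diff X Y"
    unfolding adj_mat(2)[OF X] using c by (subst mult_smult_distrib[of _ n n _ n]) auto
  finally show ?thesis using c Y by (simp add: comm_add_mat[of _ n n])
qed

lemma row_mult_A_mat:
  assumes E: "\<And>s. E s \<in> carrier_mat N N" and l: "l \<in> carrier_vec N" and v: "v \<in> carrier_vec N" and i: "i < N"
  shows "row_mult v (A_mat N l E sr m) $ i = (if i = 0 then v \<bullet> l else v \<bullet> a_vec E (sr i) (m i))"
proof -
  have "col (A_mat N l E sr m) i = (if i = 0 then l else a_vec E (sr i) (m i))"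
    using i l adj_mat(1)[OF E, of "sr i"]
    by (intro eq_vecI) (auto simp: A_mat_def a_vec_def split: if_splits)
  moreover have "row_mult v (A_mat N l E sr m) $ i = col (A_mat N l E sr m) i \<bullet> v"
    using i by (simp add: row_mult_def A_mat_def)
  moreover have "col (A_mat N l E sr m) i \<bullet> v = v \<bullet> col (A_mat N l E sr m) i"
    by (rule comm_scalar_prod[OF carrier_vecI v]) (simp add: A_mat_def)
  ultimately show ?thesis by simp
qed

text \<open>
  The framework for both perturbed models.  The vector \<open>l\<close> stands for \<open>\<Lambda>\<^sup>-\<^sup>1 e\<close>, and \<open>c + \<epsilon> d\<close> is the value
  of \<open>U \<epsilon> \<bullet> l\<close>, which is known exactly; the other \<open>N - 1\<close> conditions on \<open>U \<epsilon>\<close> come from the roots.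
  The matrices \<open>E' i\<close> and \<open>K' i\<close> are the derivatives at the root \<open>sr i\<close>.
\<close>

locale perturbed_kernel_equation =
  fixes N :: nat and E K :: "complex \<Rightarrow> complex mat" and E' K' :: "nat \<Rightarrow> complex mat" and sr :: "nat \<Rightarrow> complex" and m :: "nat \<Rightarrow> nat"
    and l u :: "complex vec" and A :: "complex mat" and c d \<epsilon>0 :: real
    and \<Phi> :: "real \<Rightarrow> complex \<Rightarrow> complex vec" and U :: "real \<Rightarrow> complex vec"
  assumes N: "0 < N" and \<epsilon>0: "0 < \<epsilon>0"
    and E_deriv: "\<And>i. i \<in> {1..<N} \<Longrightarrow> has_mat_deriv N E (E' i) (sr i)"
    and K_deriv: "\<And>i. i \<in> {1..<N} \<Longrightarrow> has_mat_deriv N K (K' i) (sr i)"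
    and E_carrier: "\<And>s. E s \<in> carrier_mat N N" and K_carrier: "\<And>s. K s \<in> carrier_mat N N"
    and root: "\<And>i. i \<in> {1..<N} \<Longrightarrow> det (E (sr i)) = 0" "\<And>i. i \<in> {1..<N} \<Longrightarrow> 0 < Re (sr i)"
    and simple: "\<And>i. i \<in> {1..<N} \<Longrightarrow> col_subst_sum (E (sr i)) (E' i) \<noteq> 0"
    and m: "\<And>i. i \<in> {1..<N} \<Longrightarrow> m i < N"
    and l: "l \<in> carrier_vec N" and A: "A = A_mat N l E sr m" and det_A: "det A \<noteq> 0"
    and u: "u \<in> carrier_vec N" "u \<bullet> l = complex_of_real c" "\<And>i. i \<in> {1..<N} \<Longrightarrow> u \<bullet> a_vec E (sr i) (m i) = 0"
    and \<Phi>: "\<And>\<epsilon> s. 0 < \<epsilon> \<Longrightarrow> \<epsilon> < \<epsilon>0 \<Longrightarrow> \<Phi> \<epsilon> s \<in> carrier_vec N"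
      "\<And>\<epsilon> s j. 0 < \<epsilon> \<Longrightarrow> \<epsilon> < \<epsilon>0 \<Longrightarrow> j < N \<Longrightarrow> 0 \<le> Re s \<Longrightarrow> norm (\<Phi> \<epsilon> s $ j) \<le> 1"
      "\<And>\<epsilon> j. 0 < \<epsilon> \<Longrightarrow> \<epsilon> < \<epsilon>0 \<Longrightarrow> j < N \<Longrightarrow> (\<lambda>s. \<Phi> \<epsilon> s $ j) holomorphic_on {s. 0 < Re s}"
    and U: "\<And>\<epsilon>. 0 < \<epsilon> \<Longrightarrow> \<epsilon> < \<epsilon>0 \<Longrightarrow> U \<epsilon> \<in> carrier_vec N"
      "\<And>\<epsilon>. 0 < \<epsilon> \<Longrightarrow> \<epsilon> < \<epsilon>0 \<Longrightarrow> U \<epsilon> \<bullet> l = complex_of_real (c + \<epsilon> * d)"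
    and eq: "\<And>\<epsilon> s. 0 < \<epsilon> \<Longrightarrow> \<epsilon> < \<epsilon>0 \<Longrightarrow> 0 \<le> Re s \<Longrightarrow>
      row_mult (\<Phi> \<epsilon> s) (E s + complex_of_real \<epsilon> \<cdot>\<^sub>m K s) = s \<cdot>\<^sub>v U \<epsilon>"
begin

lemma A_carrier: "A \<in> carrier_mat N N"
  by (simp add: A A_mat_def)

definition A_inv :: "complex mat" where "A_inv = the (mat_inverse A)"

lemma A_inv: "A_inv \<in> carrier_mat N N" "A * A_inv = 1\<^sub>m N" "A_inv * A = 1\<^sub>m N"
proof -
  have "A \<in> Units (ring_mat TYPE(complex) N ())" by (rule det_non_zero_imp_unit[OF A_carrier det_A])
  then obtain B where "mat_inverse A = Some B"
    using mat_inverse(1)[OF A_carrier, of "()"] by (cases "mat_inverse A") auto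
  then show "A_inv \<in> carrier_mat N N" "A * A_inv = 1\<^sub>m N" "A_inv * A = 1\<^sub>m N"
    using mat_inverse(2)[OF A_carrier] by (auto simp: A_inv_def)
qed

lemma row_mult_A_index:
  assumes "v \<in> carrier_vec N" "i < N"
  shows "row_mult v A $ i = (if i = 0 then v \<bullet> l else v \<bullet> a_vec E (sr i) (m i))"
  unfolding A by (rule row_mult_A_mat[OF E_carrier l assms])

text \<open>
  The order of a vector can be tested on the columns of the invertible matrix \<open>A\<close>.
\<close>

lemma bigoe_via_A:
  assumes "\<And>\<epsilon>. 0 < \<epsilon> \<Longrightarrow> \<epsilon> < \<epsilon>0 \<Longrightarrow> f \<epsilon> \<in> carrier_vec N"
    and "(\<lambda>\<epsilon>. f \<epsilon> \<bullet> l) \<in> bigoe k" "\<And>i. i \<in> {1..<N} \<Longrightarrow> (\<lambda>\<epsilon>. f \<epsilon> \<bullet> a_vec E (sr i) (m i)) \<in> bigoe k"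
    and j: "j < N"
  shows "(\<lambda>\<epsilon>. f \<epsilon> $ j) \<in> bigoe k"
proof -
  have "(\<lambda>\<epsilon>. row_mult (row_mult (f \<epsilon>) A) A_inv $ j) \<in> bigoe k"
  proof (rule bigoe_row_mult[OF A_inv(1) _ \<epsilon>0 _ j])
    fix i assume i: "i < N"
    show "(\<lambda>\<epsilon>. row_mult (f \<epsilon>) A $ i) \<in> bigoe k"
    proof (rule bigoe_cong[OF \<epsilon>0])
      show "(\<lambda>\<epsilon>. if i = 0 then f \<epsilon> \<bullet> l else f \<epsilon> \<bullet> a_vec E (sr i) (m i)) \<in> bigoe k"
        using assms(2,3) i by (cases "i = 0") auto
    qed (use assms(1) i row_mult_A_index in auto)
  qed (use A_carrier in auto)
  then show ?thesis
  proof (rule bigoe_cong[OF \<epsilon>0, rotated])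
    fix \<epsilon> :: real assume "0 < \<epsilon>" "\<epsilon> < \<epsilon>0"
    then show "row_mult (row_mult (f \<epsilon>) A) A_inv $ j = f \<epsilon> $ j"
      using row_mult_assoc[OF A_carrier assms(1) A_inv(1)] by (simp add: A_inv(2) row_mult_one[OF assms(1)])
  qed
qed

text \<open>
  Multiplication by \<open>adj E\<close> isolates \<open>det E\<close>, which makes the equation informative at the roots.
\<close>

lemma adjugate_equation:
  assumes e: "0 < \<epsilon>" "\<epsilon> < \<epsilon>0" and s: "0 \<le> Re s" and j: "j < N"
  shows "det (E s) * \<Phi> \<epsilon> s $ j + complex_of_real \<epsilon> * row_mult (\<Phi> \<epsilon> s) (K s * adj_mat (E s)) $ j
    = s * row_mult (U \<epsilon>) (adj_mat (E s)) $ j"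
proof -
  note c = adj_mat(1)[OF E_carrier, of s] E_carrier[of s] K_carrier[of s] \<Phi>(1)[OF e, of s] U(1)[OF e]
  have cK: "complex_of_real \<epsilon> \<cdot>\<^sub>m K s \<in> carrier_mat N N" using c by auto
  have "row_mult (row_mult (\<Phi> \<epsilon> s) (E s + complex_of_real \<epsilon> \<cdot>\<^sub>m K s)) (adj_mat (E s))
    = row_mult (\<Phi> \<epsilon> s) ((E s + complex_of_real \<epsilon> \<cdot>\<^sub>m K s) * adj_mat (E s))"
    using c cK by (intro row_mult_assoc) auto
  also have "(E s + complex_of_real \<epsilon> \<cdot>\<^sub>m K s) * adj_mat (E s)
    = det (E s) \<cdot>\<^sub>m 1\<^sub>m N + complex_of_real \<epsilon> \<cdot>\<^sub>m (K s * adj_mat (E s))"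
    using c cK by (simp add: add_mult_distrib_mat[of _ N N _ _ N] adj_mat(2)[OF E_carrier] mult_smult_assoc_mat[of _ N N _ N])
  also have "row_mult (\<Phi> \<epsilon> s) (det (E s) \<cdot>\<^sub>m 1\<^sub>m N + complex_of_real \<epsilon> \<cdot>\<^sub>m (K s * adj_mat (E s)))
    = det (E s) \<cdot>\<^sub>v \<Phi> \<epsilon> s + complex_of_real \<epsilon> \<cdot>\<^sub>v row_mult (\<Phi> \<epsilon> s) (K s * adj_mat (E s))"
    using c by (simp add: row_mult_add_right[of _ N N] row_mult_one row_mult_smult_right[of _ N N])
  finally have "row_mult (s \<cdot>\<^sub>v U \<epsilon>) (adj_mat (E s))
    = det (E s) \<cdot>\<^sub>v \<Phi> \<epsilon> s + complex_of_real \<epsilon> \<cdot>\<^sub>v row_mult (\<Phi> \<epsilon> s) (K s * adj_mat (E s))"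
    unfolding eq[OF e s] .
  moreover have "row_mult (s \<cdot>\<^sub>v U \<epsilon>) (adj_mat (E s)) = s \<cdot>\<^sub>v row_mult (U \<epsilon>) (adj_mat (E s))"
    using c by (intro row_mult_smult_left) auto
  ultimately have "s \<cdot>\<^sub>v row_mult (U \<epsilon>) (adj_mat (E s))
    = det (E s) \<cdot>\<^sub>v \<Phi> \<epsilon> s + complex_of_real \<epsilon> \<cdot>\<^sub>v row_mult (\<Phi> \<epsilon> s) (K s * adj_mat (E s))" by simp
  from arg_cong[OF this, of "\<lambda>v. v $ j"] show ?thesis
    using c j by simp
qed

lemma \<Phi>_bounded: "0 \<le> Re s \<Longrightarrow> j < N \<Longrightarrow> (\<lambda>\<epsilon>. \<Phi> \<epsilon> s $ j) \<in> bigoe 0"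
  by (rule bigoe_bounded[of _ 1], rule eventually_mono[OF eventually_at_right_real[OF \<epsilon>0]]) (use \<Phi>(2) in auto)

lemma U_adj_root:
  assumes i: "i \<in> {1..<N}" and j: "j < N"
  shows "(\<lambda>\<epsilon>. row_mult (U \<epsilon>) (adj_mat (E (sr i))) $ j) \<in> bigoe 1"
proof (rule bigoe_cong[OF \<epsilon>0])
  have s: "0 \<le> Re (sr i)" "sr i \<noteq> 0" using root(2)[OF i] by auto
  have KA: "K (sr i) * adj_mat (E (sr i)) \<in> carrier_mat N N"
    using K_carrier adj_mat(1)[OF E_carrier] by (meson mult_carrier_mat)
  show "(\<lambda>\<epsilon>. (1 / sr i) * (complex_of_real \<epsilon> * row_mult (\<Phi> \<epsilon> (sr i)) (K (sr i) * adj_mat (E (sr i))) $ j)) \<in> bigoe 1"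
    unfolding One_nat_def by (intro bigoe_cmult bigoe_eps bigoe_row_mult[OF KA \<Phi>(1) \<epsilon>0 \<Phi>_bounded j] s)
  fix \<epsilon> :: real assume e: "0 < \<epsilon>" "\<epsilon> < \<epsilon>0"
  show "(1 / sr i) * (complex_of_real \<epsilon> * row_mult (\<Phi> \<epsilon> (sr i)) (K (sr i) * adj_mat (E (sr i))) $ j)
    = row_mult (U \<epsilon>) (adj_mat (E (sr i))) $ j"
    using adjugate_equation[OF e s(1) j] root(1)[OF i] s(2) by (simp add: field_simps)
qed

lemma scalar_a_vec:
  assumes "v \<in> carrier_vec N" "i \<in> {1..<N}"
  shows "v \<bullet> a_vec E (sr i) (m i) = row_mult v (adj_mat (E (sr i))) $ m i"
proof -
  have "row_mult v (adj_mat (E (sr i))) $ m i = col (adj_mat (E (sr i))) (m i) \<bullet> v"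
    using assms m[OF assms(2)] adj_mat(1)[OF E_carrier, of "sr i"] by (simp add: row_mult_def)
  also have "\<dots> = v \<bullet> col (adj_mat (E (sr i))) (m i)"
    using assms m[OF assms(2)] adj_mat(1)[OF E_carrier, of "sr i"]
    by (intro comm_scalar_prod[of _ N]) auto
  finally show ?thesis by (simp add: a_vec_def)
qed

lemma U_zeroth_order:
  assumes j: "j < N"
  shows "(\<lambda>\<epsilon>. (U \<epsilon> - u) $ j) \<in> bigoe 1"
proof (rule bigoe_via_A[OF _ _ _ j])
  show "(\<lambda>\<epsilon>. (U \<epsilon> - u) \<bullet> l) \<in> bigoe 1"
  proof (rule bigoe_cong[OF \<epsilon>0])
    show "(\<lambda>\<epsilon>. complex_of_real \<epsilon> * complex_of_real d) \<in> bigoe 1"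
      unfolding One_nat_def by (intro bigoe_eps bigoe_const)
    fix \<epsilon> :: real assume e: "0 < \<epsilon>" "\<epsilon> < \<epsilon>0"
    show "complex_of_real \<epsilon> * complex_of_real d = (U \<epsilon> - u) \<bullet> l"
      using U[OF e] u l by (simp add: minus_scalar_prod_distrib[of _ N])
  qed
  fix i assume i: "i \<in> {1..<N}"
  show "(\<lambda>\<epsilon>. (U \<epsilon> - u) \<bullet> a_vec E (sr i) (m i)) \<in> bigoe 1"
  proof (rule bigoe_cong[OF \<epsilon>0])
    show "(\<lambda>\<epsilon>. row_mult (U \<epsilon>) (adj_mat (E (sr i))) $ m i) \<in> bigoe 1" by (rule U_adj_root[OF i m[OF i]])
    fix \<epsilon> :: real assume e: "0 < \<epsilon>" "\<epsilon> < \<epsilon>0"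
    have a: "a_vec E (sr i) (m i) \<in> carrier_vec N"
      unfolding a_vec_def by (rule col_carrier_vec[OF m[OF i] adj_mat(1)[OF E_carrier]])
    show "row_mult (U \<epsilon>) (adj_mat (E (sr i))) $ m i = (U \<epsilon> - u) \<bullet> a_vec E (sr i) (m i)"
      unfolding minus_scalar_prod_distrib[OF U(1)[OF e] u(1) a] u(3)[OF i] scalar_a_vec[OF U(1)[OF e] i]
      by simp
  qed
qed (use U(1) u in auto)

lemma U_minus_u_mult:
  assumes "M \<in> carrier_mat N N" "j < N"
  shows "(\<lambda>\<epsilon>. row_mult (U \<epsilon>) M $ j - row_mult u M $ j) \<in> bigoe 1"
proof (rule bigoe_cong[OF \<epsilon>0])
  show "(\<lambda>\<epsilon>. row_mult (U \<epsilon> - u) M $ j) \<in> bigoe 1"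
    by (rule bigoe_row_mult[OF assms(1) _ \<epsilon>0 U_zeroth_order assms(2)]) (use U u in auto)
  fix \<epsilon> :: real assume e: "0 < \<epsilon>" "\<epsilon> < \<epsilon>0"
  show "row_mult (U \<epsilon> - u) M $ j = row_mult (U \<epsilon>) M $ j - row_mult u M $ j"
    unfolding row_mult_minus_left[OF assms(1) U(1)[OF e] u(1)]
    using assms by simp
qed

lemma u_adj_root:
  assumes i: "i \<in> {1..<N}"
  shows "row_mult u (adj_mat (E (sr i))) = 0\<^sub>v N"
proof (rule eq_vecI)
  note c = adj_mat(1)[OF E_carrier, of "sr i"]
  fix j assume "j < dim_vec (0\<^sub>v N :: complex vec)"
  then have j: "j < N" by simp
  have "(\<lambda>\<epsilon>. row_mult (U \<epsilon>) (adj_mat (E (sr i))) $ j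
      - (row_mult (U \<epsilon>) (adj_mat (E (sr i))) $ j - row_mult u (adj_mat (E (sr i))) $ j)) \<in> bigoe 1"
    by (intro sum_in_bigo U_adj_root[OF i j] U_minus_u_mult[OF c j])
  then have "row_mult u (adj_mat (E (sr i))) $ j = 0"
    using bigoe_const_eq_0[of _ 0] by simp
  then show "row_mult u (adj_mat (E (sr i))) $ j = 0\<^sub>v N $ j" using j by simp
qed (use adj_mat(1)[OF E_carrier, of "sr i"] in \<open>auto simp: row_mult_def\<close>)

text \<open>
  At a root, \<open>\<Phi>\<close> drops out of the equation itself at leading order but not out of its derivative with
  respect to \<open>s\<close>.  The terms with \<open>\<Phi>'\<close> carry the factor \<open>\<epsilon>\<close> or \<open>det E = 0\<close>, and \<open>\<Phi>'\<close> is bounded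
  uniformly in \<open>\<epsilon>\<close> by Cauchy's inequality.
\<close>

lemma \<Phi>_at_root:
  assumes i: "i \<in> {1..<N}" and j: "j < N"
  shows "(\<lambda>\<epsilon>. col_subst_sum (E (sr i)) (E' i) * \<Phi> \<epsilon> (sr i) $ j
    - sr i * row_mult u (adj_diff (E (sr i)) (E' i)) $ j) \<in> bigoe 1"
proof -
  let ?s = "sr i"
  note c = adj_mat(1)[OF E_carrier, of ?s]
  note s = root(2)[OF i]
  have s0: "0 \<le> Re ?s" using s by simp
  note dA = has_mat_deriv_adj[OF E_deriv[OF i]]
  note dKA = has_mat_deriv_mult[OF K_deriv[OF i] dA]
  define KA' where "KA' = K' i * adj_mat (E ?s) + K ?s * adj_diff (E ?s) (E' i)"
  define A' where "A' = adj_diff (E ?s) (E' i)"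
  have cA': "A' \<in> carrier_mat N N" unfolding A'_def using E_carrier by simp
  define D where "D = (\<lambda>\<epsilon> k. deriv (\<lambda>s. \<Phi> \<epsilon> s $ k) ?s)"
  have dPhi: "((\<lambda>s. \<Phi> \<epsilon> s $ k) has_field_derivative D \<epsilon> k) (at ?s)"
    if "0 < \<epsilon>" "\<epsilon> < \<epsilon>0" "k < N" for \<epsilon> k
    unfolding D_def using \<Phi>(3)[OF that] s
    by (intro holomorphic_derivI[where S = "{s. 0 < Re s}"]) (auto simp: open_halfspace_Re_gt)
  have D_bound: "(\<lambda>\<epsilon>. D \<epsilon> k) \<in> bigoe 0" if k: "k < N" for k
  proof (rule bigoe_bounded[of _ "1 / (Re ?s / 2)"], rule eventually_mono[OF eventually_at_right_real[OF \<epsilon>0]])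
    fix \<epsilon> assume "\<epsilon> \<in> {0<..<\<epsilon>0}"
    then have e: "0 < \<epsilon>" "\<epsilon> < \<epsilon>0" by auto
    have sub: "cball ?s (Re ?s / 2) \<subseteq> {s. 0 < Re s}"
    proof
      fix w assume "w \<in> cball ?s (Re ?s / 2)"
      then have "\<bar>Re (?s - w)\<bar> \<le> Re ?s / 2"
        using abs_Re_le_cmod[of "?s - w"] by (simp add: dist_norm)
      then have "Re ?s - Re w \<le> Re ?s / 2" by (simp only: abs_le_iff minus_complex.simps)
      then show "w \<in> {s. 0 < Re s}" using s by simp
    qed
    have "norm ((deriv ^^ 1) (\<lambda>s. \<Phi> \<epsilon> s $ k) ?s) \<le> fact 1 * 1 / (Re ?s / 2) ^ 1"
    proof (rule Cauchy_inequality)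
      show "(\<lambda>s. \<Phi> \<epsilon> s $ k) holomorphic_on ball ?s (Re ?s / 2)"
        using sub ball_subset_cball by (intro holomorphic_on_subset[OF \<Phi>(3)[OF e k]]) blast
      show "continuous_on (cball ?s (Re ?s / 2)) (\<lambda>s. \<Phi> \<epsilon> s $ k)"
        by (intro holomorphic_on_imp_continuous_on holomorphic_on_subset[OF \<Phi>(3)[OF e k] sub])
      fix w assume "norm (?s - w) = Re ?s / 2"
      then have "w \<in> cball ?s (Re ?s / 2)" by (simp add: dist_norm)
      then have "w \<in> {s. 0 < Re s}" using sub by blast
      then show "norm (\<Phi> \<epsilon> w $ k) \<le> 1" using \<Phi>(2)[OF e k] by auto
    qed (use s in auto)
    then show "norm (D \<epsilon> k) \<le> 1 / (Re ?s / 2)" by (simp add: D_def)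
  qed
  define R where "R = (\<lambda>\<epsilon>. \<Sum>k<N. D \<epsilon> k * (K ?s * adj_mat (E ?s)) $$ (k, j) + KA' $$ (k, j) * \<Phi> \<epsilon> ?s $ k)"
  have R: "R \<in> bigoe 0"
    unfolding R_def
    by (intro big_sum_in_bigo sum_in_bigo bigoe_cmult D_bound \<Phi>_bounded s0) auto
  have key: "col_subst_sum (E ?s) (E' i) * \<Phi> \<epsilon> ?s $ j = row_mult (U \<epsilon>) (adj_mat (E ?s)) $ j
      + ?s * row_mult (U \<epsilon>) A' $ j - complex_of_real \<epsilon> * R \<epsilon>" if e: "0 < \<epsilon>" "\<epsilon> < \<epsilon>0" for \<epsilon>
  proof -
    have KAc: "K t * adj_mat (E t) \<in> carrier_mat N N" for t
      using K_carrier adj_mat(1)[OF E_carrier] by (meson mult_carrier_mat)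
    define f where "f = (\<lambda>t. det (E t) * \<Phi> \<epsilon> t $ j
      + complex_of_real \<epsilon> * (\<Sum>k<N. \<Phi> \<epsilon> t $ k * (K t * adj_mat (E t)) $$ (k, j))
      - t * (\<Sum>k<N. U \<epsilon> $ k * adj_mat (E t) $$ (k, j)))"
    have f0: "f t = 0" if "t \<in> {s. 0 < Re s}" for t
      using adjugate_equation[OF e _ j, of t] that j
        index_row_mult[OF KAc \<Phi>(1)[OF e] j] index_row_mult[OF adj_mat(1)[OF E_carrier] U(1)[OF e] j]
      by (simp add: f_def)
    have "(f has_field_derivative
       (col_subst_sum (E ?s) (E' i) * \<Phi> \<epsilon> ?s $ j + D \<epsilon> j * det (E ?s))
       + complex_of_real \<epsilon> * (\<Sum>k<N. D \<epsilon> k * (K ?s * adj_mat (E ?s)) $$ (k, j) + KA' $$ (k, j) * \<Phi> \<epsilon> ?s $ k)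
       - (1 * (\<Sum>k<N. U \<epsilon> $ k * adj_mat (E ?s) $$ (k, j)) + (\<Sum>k<N. U \<epsilon> $ k * A' $$ (k, j)) * ?s)) (at ?s)"
      unfolding f_def KA'_def A'_def using j
      by (intro DERIV_diff DERIV_add DERIV_mult DERIV_cmult DERIV_sum DERIV_ident dPhi[OF e]
          has_field_derivative_det[OF E_deriv[OF i]] has_mat_derivD(3)[OF dKA] has_mat_derivD(3)[OF dA]) auto
    moreover have "(f has_field_derivative 0) (at ?s)"
      by (rule has_field_derivative_transform_within_open[OF DERIV_const[of 0] open_halfspace_Re_gt[of 0]])
        (use s f0 in auto)
    ultimately have "(col_subst_sum (E ?s) (E' i) * \<Phi> \<epsilon> ?s $ j + D \<epsilon> j * det (E ?s))
       + complex_of_real \<epsilon> * (\<Sum>k<N. D \<epsilon> k * (K ?s * adj_mat (E ?s)) $$ (k, j) + KA' $$ (k, j) * \<Phi> \<epsilon> ?s $ k)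
       - (1 * (\<Sum>k<N. U \<epsilon> $ k * adj_mat (E ?s) $$ (k, j)) + (\<Sum>k<N. U \<epsilon> $ k * A' $$ (k, j)) * ?s) = 0"
      by (rule DERIV_unique)
    then show ?thesis
      unfolding index_row_mult[OF c U(1)[OF e] j] index_row_mult[OF cA' U(1)[OF e] j] R_def root(1)[OF i]
      by (simp add: algebra_simps)
  qed
  show ?thesis unfolding A'_def[symmetric]
  proof (rule bigoe_cong[OF \<epsilon>0])
    show "(\<lambda>\<epsilon>. row_mult (U \<epsilon>) (adj_mat (E ?s)) $ j + ?s * (row_mult (U \<epsilon>) A' $ j - row_mult u A' $ j)
        - complex_of_real \<epsilon> * R \<epsilon>) \<in> bigoe 1"
      using bigoe_eps[OF R] by (intro sum_in_bigo bigoe_cmult U_adj_root[OF i j] U_minus_u_mult[OF cA' j]) auto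
    fix \<epsilon> :: real assume e: "0 < \<epsilon>" "\<epsilon> < \<epsilon>0"
    show "row_mult (U \<epsilon>) (adj_mat (E ?s)) $ j + ?s * (row_mult (U \<epsilon>) A' $ j - row_mult u A' $ j)
        - complex_of_real \<epsilon> * R \<epsilon> = col_subst_sum (E ?s) (E' i) * \<Phi> \<epsilon> ?s $ j - ?s * row_mult u A' $ j"
      using key[OF e] by (simp add: algebra_simps)
  qed
qed

text \<open>
  The first-order coefficient of \<open>U \<epsilon> \<bullet> a\<^sub>i\<close>; by \<open>u_B_index\<close> it is the \<open>i\<close>-th entry of \<open>u B\<close>.
\<close>

definition root_shift :: "nat \<Rightarrow> complex" where
  "root_shift i = col_subst_sum (E (sr i)) (K (sr i)) / col_subst_sum (E (sr i)) (E' i)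
      * row_mult u (adj_diff (E (sr i)) (E' i)) $ m i
    - row_mult u (adj_diff (E (sr i)) (K (sr i))) $ m i"

text \<open>
  As \<open>u adj E = 0\<close> at a root, differentiating \<open>adj E E = det E I\<close> gives \<open>u adj' E = det' u\<close>.
  The claim follows from this and \<open>adj_diff_identities\<close> in the direction \<open>K\<close>.
\<close>

lemma u_adj'_K_adj:
  assumes i: "i \<in> {1..<N}" and j: "j < N"
  shows "row_mult (row_mult u (adj_diff (E (sr i)) (E' i))) (K (sr i) * adj_mat (E (sr i))) $ j
    = col_subst_sum (E (sr i)) (K (sr i)) * row_mult u (adj_diff (E (sr i)) (E' i)) $ j
      - col_subst_sum (E (sr i)) (E' i) * row_mult u (adj_diff (E (sr i)) (K (sr i))) $ j"
proof -
  let ?X = "E (sr i)" and ?Y = "K (sr i)"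
  define A' where "A' = adj_diff ?X (E' i)"
  define DA where "DA = adj_diff ?X ?Y"
  define w where "w = row_mult u A'"
  note cX = E_carrier[of "sr i"] and cY = K_carrier[of "sr i"] and cE' = has_mat_derivD(2)[OF E_deriv[OF i]]
  note cA = adj_mat(1)[OF cX]
  have cA': "A' \<in> carrier_mat N N" and cDA: "DA \<in> carrier_mat N N" using cX by (auto simp: A'_def DA_def)
  have cw: "w \<in> carrier_vec N" unfolding w_def using cA' by (rule row_mult_carrier)
  have "row_mult w (?Y * adj_mat ?X + ?X * DA) = col_subst_sum ?X ?Y \<cdot>\<^sub>v w"
    unfolding DA_def adj_diff_identities(1)[OF cX cY] by (rule row_mult_smult_one[OF cw])
  then have 1: "row_mult w (?Y * adj_mat ?X) + row_mult w (?X * DA) = col_subst_sum ?X ?Y \<cdot>\<^sub>v w"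
    unfolding row_mult_add_right[OF mult_carrier_mat[OF cY cA] mult_carrier_mat[OF cX cDA] cw] .
  have "row_mult u (A' * ?X + adj_mat ?X * E' i) = col_subst_sum ?X (E' i) \<cdot>\<^sub>v u"
    unfolding A'_def adj_deriv_identities(2)[OF E_deriv[OF i]] by (rule row_mult_smult_one[OF u(1)])
  then have "row_mult u (A' * ?X) + row_mult u (adj_mat ?X * E' i) = col_subst_sum ?X (E' i) \<cdot>\<^sub>v u"
    unfolding row_mult_add_right[OF mult_carrier_mat[OF cA' cX] mult_carrier_mat[OF cA cE'] u(1)] .
  moreover have "row_mult u (adj_mat ?X * E' i) = 0\<^sub>v N"
    unfolding row_mult_assoc[OF cA u(1) cE', symmetric] u_adj_root[OF i] by (rule row_mult_zero_left[OF cE'])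
  ultimately have "row_mult w ?X = col_subst_sum ?X (E' i) \<cdot>\<^sub>v u"
    unfolding w_def row_mult_assoc[OF cA' u(1) cX]
    using row_mult_carrier[OF mult_carrier_mat[OF cA' cX], of u] by simp
  then have 2: "row_mult w (?X * DA) = col_subst_sum ?X (E' i) \<cdot>\<^sub>v row_mult u DA"
    unfolding row_mult_assoc[OF cX cw cDA, symmetric] using row_mult_smult_left[OF cDA u(1)] by simp
  have "(row_mult w (?Y * adj_mat ?X) + row_mult w (?X * DA)) $ j = (col_subst_sum ?X ?Y \<cdot>\<^sub>v w) $ j"
    unfolding 1 ..
  then have "row_mult w (?Y * adj_mat ?X) $ j + col_subst_sum ?X (E' i) * row_mult u DA $ j
     = col_subst_sum ?X ?Y * w $ j"
    unfolding 2 using j cw cDA by simp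
  then show ?thesis unfolding w_def A'_def DA_def by (simp add: algebra_simps)
qed

text \<open>
  The value of \<open>\<Phi>\<close> at the root from \<open>\<Phi>_at_root\<close> is inserted into \<open>adjugate_equation\<close>.
\<close>

lemma U_a_vec:
  assumes i: "i \<in> {1..<N}"
  shows "(\<lambda>\<epsilon>. U \<epsilon> \<bullet> a_vec E (sr i) (m i) - complex_of_real \<epsilon> * root_shift i) \<in> bigoe 2"
proof -
  let ?s = "sr i" and ?d = "col_subst_sum (E (sr i)) (E' i)"
  define KA where "KA = K ?s * adj_mat (E ?s)"
  define w where "w = row_mult u (adj_diff (E ?s) (E' i))"
  have s: "0 \<le> Re ?s" "?s \<noteq> 0" using root(2)[OF i] by auto
  have cKA: "KA \<in> carrier_mat N N" unfolding KA_def
    by (rule mult_carrier_mat[OF K_carrier adj_mat(1)[OF E_carrier]])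
  have cw: "w \<in> carrier_vec N" 
    unfolding w_def by (rule row_mult_carrier[OF adj_diff_carrier[OF E_carrier]])
  have s2: "2 = Suc 1" by simp
  define f where "f = (\<lambda>\<epsilon>. ?d \<cdot>\<^sub>v \<Phi> \<epsilon> ?s - ?s \<cdot>\<^sub>v w)"
  have f: "(\<lambda>\<epsilon>. row_mult (f \<epsilon>) KA $ m i) \<in> bigoe 1"
  proof (rule bigoe_row_mult[OF cKA _ \<epsilon>0 _ m[OF i]])
    fix j assume j: "j < N"
    show "(\<lambda>\<epsilon>. f \<epsilon> $ j) \<in> bigoe 1"
    proof (rule bigoe_cong[OF \<epsilon>0 _ \<Phi>_at_root[OF i j]])
      fix \<epsilon> :: real assume e: "0 < \<epsilon>" "\<epsilon> < \<epsilon>0"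
      show "?d * \<Phi> \<epsilon> ?s $ j - ?s * row_mult u (adj_diff (E ?s) (E' i)) $ j = f \<epsilon> $ j"
        using j cw \<Phi>(1)[OF e, of ?s] unfolding w_def[symmetric] f_def by simp
    qed
  qed (use \<Phi>(1) cw in \<open>auto simp: f_def\<close>)
  show ?thesis
  proof (rule bigoe_cong[OF \<epsilon>0])
    show "(\<lambda>\<epsilon>. 1 / (?s * ?d) * (complex_of_real \<epsilon> * row_mult (f \<epsilon>) KA $ m i)) \<in> bigoe 2"
      unfolding s2 by (intro bigoe_cmult bigoe_eps f)
    fix \<epsilon> :: real assume e: "0 < \<epsilon>" "\<epsilon> < \<epsilon>0"
    have c\<Phi>: "\<Phi> \<epsilon> ?s \<in> carrier_vec N" by (rule \<Phi>(1)[OF e])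
    have r1: "row_mult (f \<epsilon>) KA $ m i = ?d * row_mult (\<Phi> \<epsilon> ?s) KA $ m i - ?s * row_mult w KA $ m i"
      unfolding f_def using cKA c\<Phi> cw m[OF i]
      by (simp add: row_mult_minus_left[of _ N N] row_mult_smult_left[of _ N N])
    have r2: "complex_of_real \<epsilon> * row_mult (\<Phi> \<epsilon> ?s) KA $ m i = ?s * (U \<epsilon> \<bullet> a_vec E ?s (m i))"
      using adjugate_equation[OF e s(1) m[OF i]] root(1)[OF i] scalar_a_vec[OF U(1)[OF e] i]
      by (simp add: KA_def)
    have r3: "row_mult w KA $ m i = ?d * root_shift i"
      unfolding w_def KA_def u_adj'_K_adj[OF i m[OF i]] root_shift_def
      using simple[OF i] by (simp add: right_diff_distrib)
    have "complex_of_real \<epsilon> * row_mult (f \<epsilon>) KA $ m i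
      = ?d * (complex_of_real \<epsilon> * row_mult (\<Phi> \<epsilon> ?s) KA $ m i) - ?s * ?d * (complex_of_real \<epsilon> * root_shift i)"
      unfolding r1 r3 by (simp add: right_diff_distrib)
    also have "\<dots> = ?s * ?d * (U \<epsilon> \<bullet> a_vec E ?s (m i) - complex_of_real \<epsilon> * root_shift i)"
      unfolding r2 by (simp add: right_diff_distrib)
    finally have "complex_of_real \<epsilon> * row_mult (f \<epsilon>) KA $ m i
      = ?s * ?d * (U \<epsilon> \<bullet> a_vec E ?s (m i) - complex_of_real \<epsilon> * root_shift i)" .
    then show "1 / (?s * ?d) * (complex_of_real \<epsilon> * row_mult (f \<epsilon>) KA $ m i)
      = U \<epsilon> \<bullet> a_vec E ?s (m i) - complex_of_real \<epsilon> * root_shift i"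
      using s simple[OF i] by simp
  qed
qed

abbreviation z where "z \<equiv> z_vec (first_vec N c) A (B_mat N E K sr m) (first_vec N d)"

lemma u_eq: "row_mult (first_vec N c) A_inv = u"
proof -
  have "row_mult u A = first_vec N c"
  proof (rule eq_vecI)
    fix i assume "i < dim_vec (first_vec N c)"
    then have i: "i < N" by (simp add: first_vec_def)
    then show "row_mult u A $ i = first_vec N c $ i"
      using row_mult_A_index[OF u(1) i] u(2,3) by (cases "i = 0") (auto simp: first_vec_def)
  qed (use A_carrier in \<open>auto simp: first_vec_def\<close>)
  then have "row_mult (first_vec N c) A_inv = row_mult (row_mult u A) A_inv" by simp
  also have "\<dots> = u"
    unfolding row_mult_assoc[OF A_carrier u(1) A_inv(1)] A_inv(2) by (rule row_mult_one[OF u(1)])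
  finally show ?thesis .
qed

lemma B_carrier: "B_mat N E K sr m \<in> carrier_mat N N"
  by (simp add: B_mat_def)

lemma u_B_index:
  assumes i: "i < N"
  shows "row_mult u (B_mat N E K sr m) $ i = (if i = 0 then 0 else root_shift i)"
proof (cases "i = 0")
  case True
  then show ?thesis using index_row_mult[OF B_carrier u(1) i] i by (simp add: B_mat_def)
next
  case False
  then have i': "i \<in> {1..<N}" using i by auto
  note cX = E_carrier[of "sr i"]
  have d: "delta E K (sr i) = col_subst_sum (E (sr i)) (K (sr i)) / col_subst_sum (E (sr i)) (E' i)"
    unfolding delta_def has_mat_deriv_mat_deriv[OF E_deriv[OF i']] ..
  have a1: "a1_vec E (sr i) (m i) $ k = adj_diff (E (sr i)) (E' i) $$ (k, m i)" if "k < N" for k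
    unfolding a1_vec_def has_mat_deriv_mat_deriv[OF has_mat_deriv_adj[OF E_deriv[OF i']]]
    using that m[OF i'] cX by (simp add: adj_diff_def)
  have k: "k_vec E K (sr i) (m i) $ k = adj_diff (E (sr i)) (K (sr i)) $$ (k, m i)" if "k < N" for k
    using that m[OF i'] cX by (simp add: k_vec_def adj_diff_def)
  have "row_mult u (B_mat N E K sr m) $ i = (\<Sum>k<N. u $ k * (delta E K (sr i) * a1_vec E (sr i) (m i) $ k - k_vec E K (sr i) (m i) $ k))"
    unfolding index_row_mult[OF B_carrier u(1) i] using False i by (intro sum.cong refl) (simp add: B_mat_def)
  also have "\<dots> = (\<Sum>k<N. delta E K (sr i) * (u $ k * adj_diff (E (sr i)) (E' i) $$ (k, m i))
      - u $ k * adj_diff (E (sr i)) (K (sr i)) $$ (k, m i))"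
    by (intro sum.cong refl) (simp add: a1 k algebra_simps)
  also have "\<dots> = root_shift i"
    unfolding root_shift_def d[symmetric] sum_subtractf sum_distrib_left[symmetric]
    using index_row_mult[OF adj_diff_carrier[OF cX] u(1) m[OF i']] by simp
  finally show ?thesis using False by simp
qed

lemma z_facts:
  shows "z \<in> carrier_vec N" "z \<bullet> l = complex_of_real d"
    "i \<in> {1..<N} \<Longrightarrow> z \<bullet> a_vec E (sr i) (m i) = root_shift i"
proof -
  define b where "b = row_mult u (B_mat N E K sr m) + first_vec N d"
  have cb: "b \<in> carrier_vec N"
    unfolding b_def by (intro add_carrier_vec row_mult_carrier[OF B_carrier]) (simp add: first_vec_def)
  have z: "z = row_mult b A_inv"
    unfolding z_vec_def Let_def A_inv_def[symmetric] u_eq b_def ..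
  show cz: "z \<in> carrier_vec N" unfolding z by (rule row_mult_carrier[OF A_inv(1)])
  have zA: "row_mult z A = b"
    unfolding z row_mult_assoc[OF A_inv(1) cb A_carrier] A_inv(3) by (rule row_mult_one[OF cb])
  have bi: "b $ i = (if i = 0 then complex_of_real d else root_shift i)" if "i < N" for i
    unfolding b_def using that u_B_index[OF that] by (simp add: first_vec_def)
  show "z \<bullet> l = complex_of_real d"
    using row_mult_A_index[OF cz N] unfolding zA bi[OF N] by simp
  show "z \<bullet> a_vec E (sr i) (m i) = root_shift i" if "i \<in> {1..<N}"
    using row_mult_A_index[OF cz, of i] that unfolding zA using bi[of i] by auto
qed

theorem U_first_order:
  assumes j: "j < N"
  shows "(\<lambda>\<epsilon>. (U \<epsilon> - u - complex_of_real \<epsilon> \<cdot>\<^sub>v z) $ j) \<in> bigoe 2"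
proof (rule bigoe_via_A[OF _ _ _ j])
  have dist: "(U \<epsilon> - u - complex_of_real \<epsilon> \<cdot>\<^sub>v z) \<bullet> w = U \<epsilon> \<bullet> w - u \<bullet> w - complex_of_real \<epsilon> * (z \<bullet> w)"
    if "0 < \<epsilon>" "\<epsilon> < \<epsilon>0" "w \<in> carrier_vec N" for \<epsilon> w
    using that U(1) u(1) z_facts(1) by (simp add: minus_scalar_prod_distrib[of _ N])
  show "U \<epsilon> - u - complex_of_real \<epsilon> \<cdot>\<^sub>v z \<in> carrier_vec N" if "0 < \<epsilon>" "\<epsilon> < \<epsilon>0" for \<epsilon>
    using U(1)[OF that] u(1) z_facts(1) by auto
  show "(\<lambda>\<epsilon>. (U \<epsilon> - u - complex_of_real \<epsilon> \<cdot>\<^sub>v z) \<bullet> l) \<in> bigoe 2"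
  proof (rule bigoe_cong[OF \<epsilon>0])
    show "(\<lambda>\<epsilon>. 0) \<in> bigoe 2" by simp
  qed (use dist l U(2) u(2) z_facts(2) in simp)
  fix i assume i: "i \<in> {1..<N}"
  have a: "a_vec E (sr i) (m i) \<in> carrier_vec N"
    unfolding a_vec_def by (rule col_carrier_vec[OF m[OF i] adj_mat(1)[OF E_carrier]])
  show "(\<lambda>\<epsilon>. (U \<epsilon> - u - complex_of_real \<epsilon> \<cdot>\<^sub>v z) \<bullet> a_vec E (sr i) (m i)) \<in> bigoe 2"
    by (rule bigoe_cong[OF \<epsilon>0 _ U_a_vec[OF i]])
      (use dist[OF _ _ a] u(3)[OF i] z_facts(3)[OF i] in simp)
qed

lemma U_first_order_scalar:
  assumes w: "w \<in> carrier_vec N"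
  shows "(\<lambda>\<epsilon>. U \<epsilon> \<bullet> w - u \<bullet> w - complex_of_real \<epsilon> * (z \<bullet> w)) \<in> bigoe 2"
proof (rule bigoe_cong[OF \<epsilon>0])
  show "(\<lambda>\<epsilon>. \<Sum>i<N. (U \<epsilon> - u - complex_of_real \<epsilon> \<cdot>\<^sub>v z) $ i * w $ i) \<in> bigoe 2"
    by (intro big_sum_in_bigo bigoe_cmult U_first_order) simp
  fix \<epsilon> :: real assume e: "0 < \<epsilon>" "\<epsilon> < \<epsilon>0"
  have "(\<Sum>i<N. (U \<epsilon> - u - complex_of_real \<epsilon> \<cdot>\<^sub>v z) $ i * w $ i) = (U \<epsilon> - u - complex_of_real \<epsilon> \<cdot>\<^sub>v z) \<bullet> w"
    using w by (simp add: scalar_prod_def lessThan_atLeast0)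
  also have "\<dots> = U \<epsilon> \<bullet> w - u \<bullet> w - complex_of_real \<epsilon> * (z \<bullet> w)"
    using w U(1)[OF e] u(1) z_facts(1) by (simp add: minus_scalar_prod_distrib[of _ N])
  finally show "(\<Sum>i<N. (U \<epsilon> - u - complex_of_real \<epsilon> \<cdot>\<^sub>v z) $ i * w $ i)
    = U \<epsilon> \<bullet> w - u \<bullet> w - complex_of_real \<epsilon> * (z \<bullet> w)" .
qed

lemma adjugate_equation_scalar:
  assumes e: "0 < \<epsilon>" "\<epsilon> < \<epsilon>0" and s: "0 \<le> Re s" and w: "w \<in> carrier_vec N"
  shows "det (E s) * (\<Phi> \<epsilon> s \<bullet> w) + complex_of_real \<epsilon> * (\<Phi> \<epsilon> s \<bullet> ((K s * adj_mat (E s)) *\<^sub>v w))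
    = s * (U \<epsilon> \<bullet> (adj_mat (E s) *\<^sub>v w))"
proof -
  note cA = adj_mat(1)[OF E_carrier, of s]
  note cKA = mult_carrier_mat[OF K_carrier cA]
  note c\<Phi> = \<Phi>(1)[OF e, of s] and cU = U(1)[OF e]
  have dot: "v \<bullet> w = (\<Sum>j<N. v $ j * w $ j)" for v using w by (simp add: scalar_prod_def lessThan_atLeast0)
  show ?thesis
    unfolding row_mult_scalar[OF cKA c\<Phi> w, symmetric] row_mult_scalar[OF cA cU w, symmetric] dot
      sum_distrib_left sum.distrib[symmetric]
  proof (rule sum.cong[OF refl])
    fix j assume "j \<in> {..<N}"
    then have "j < N" by simp
    from arg_cong[OF adjugate_equation[OF e s this], of "\<lambda>x. x * w $ j"]
    show "det (E s) * (\<Phi> \<epsilon> s $ j * w $ j) + complex_of_real \<epsilon> * (row_mult (\<Phi> \<epsilon> s) (K s * adj_mat (E s)) $ j * w $ j)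
      = s * (row_mult (U \<epsilon>) (adj_mat (E s)) $ j * w $ j)" by (simp add: algebra_simps)
  qed
qed

lemma \<Phi>_scalar_bounded:
  assumes s: "0 \<le> Re s" and w: "w \<in> carrier_vec N"
  shows "(\<lambda>\<epsilon>. \<Phi> \<epsilon> s \<bullet> w) \<in> bigoe 0"
proof (rule bigoe_cong[OF \<epsilon>0])
  show "(\<lambda>\<epsilon>. \<Sum>j<N. \<Phi> \<epsilon> s $ j * w $ j) \<in> bigoe 0"
    by (intro big_sum_in_bigo bigoe_cmult \<Phi>_bounded s) simp
qed (use w in \<open>simp add: scalar_prod_def lessThan_atLeast0\<close>)

lemma U_zeroth_order_scalar:
  assumes w: "w \<in> carrier_vec N"
  shows "(\<lambda>\<epsilon>. U \<epsilon> \<bullet> w - u \<bullet> w) \<in> bigoe 1"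
proof -
  have "(\<lambda>\<epsilon>. (U \<epsilon> \<bullet> w - u \<bullet> w - complex_of_real \<epsilon> * (z \<bullet> w)) + complex_of_real \<epsilon> * (z \<bullet> w)) \<in> bigoe 1"
    by (rule sum_in_bigo(1)[OF bigoe_Suc[of _ 1, unfolded Suc_1, OF U_first_order_scalar[OF w]]
          bigoe_eps[OF bigoe_const, of "z \<bullet> w", folded One_nat_def]])
  then show ?thesis by simp
qed

text \<open>
  Divide \<open>adjugate_equation\<close> by \<open>det E\<close>.  The zeroth order of \<open>\<Phi>\<close> suffices in the term \<open>\<epsilon> \<Phi> K adj E\<close>.
\<close>

theorem \<Phi>_expansion:
  assumes s: "0 \<le> Re s" and det: "det (E s) \<noteq> 0" and w: "w \<in> carrier_vec N"
  defines "a \<equiv> adj_mat (E s)"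
  shows "(\<lambda>\<epsilon>. \<Phi> \<epsilon> s \<bullet> w - s * (u \<bullet> (a *\<^sub>v w)) / det (E s)) \<in> bigoe 1" (is ?zeroth)
    and "(\<lambda>\<epsilon>. \<Phi> \<epsilon> s \<bullet> w - s * (u \<bullet> (a *\<^sub>v w)) / det (E s)
      - complex_of_real \<epsilon> * (s * (z \<bullet> (a *\<^sub>v w)) / det (E s)
          - s * (u \<bullet> ((a * K s * a) *\<^sub>v w)) / (det (E s))\<^sup>2)) \<in> bigoe 2" (is ?first)
proof -
  note ca = adj_mat(1)[OF E_carrier, of s, folded a_def]
  note cK = K_carrier[of s]
  have zeroth: "(\<lambda>\<epsilon>. \<Phi> \<epsilon> s \<bullet> w - s * (u \<bullet> (a *\<^sub>v w)) / det (E s)) \<in> bigoe 1"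
    if w: "w \<in> carrier_vec N" for w
  proof (rule bigoe_cong[OF \<epsilon>0])
    have aw: "a *\<^sub>v w \<in> carrier_vec N" and Kw: "(K s * a) *\<^sub>v w \<in> carrier_vec N"
      using ca cK w by auto
    show "(\<lambda>\<epsilon>. s / det (E s) * (U \<epsilon> \<bullet> (a *\<^sub>v w) - u \<bullet> (a *\<^sub>v w))
        - 1 / det (E s) * (complex_of_real \<epsilon> * (\<Phi> \<epsilon> s \<bullet> ((K s * a) *\<^sub>v w)))) \<in> bigoe 1"
      using bigoe_eps[OF \<Phi>_scalar_bounded[OF s Kw]]
      by (intro sum_in_bigo bigoe_cmult U_zeroth_order_scalar[OF aw]) simp
    fix \<epsilon> :: real assume e: "0 < \<epsilon>" "\<epsilon> < \<epsilon>0"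
    have "det (E s) * (\<Phi> \<epsilon> s \<bullet> w) = s * (U \<epsilon> \<bullet> (a *\<^sub>v w)) - complex_of_real \<epsilon> * (\<Phi> \<epsilon> s \<bullet> ((K s * a) *\<^sub>v w))"
      using adjugate_equation_scalar[OF e s w, folded a_def] by (simp add: algebra_simps)
    then have "\<Phi> \<epsilon> s \<bullet> w = (s * (U \<epsilon> \<bullet> (a *\<^sub>v w)) - complex_of_real \<epsilon> * (\<Phi> \<epsilon> s \<bullet> ((K s * a) *\<^sub>v w))) / det (E s)"
      using det by (simp add: field_simps)
    then show "s / det (E s) * (U \<epsilon> \<bullet> (a *\<^sub>v w) - u \<bullet> (a *\<^sub>v w))
        - 1 / det (E s) * (complex_of_real \<epsilon> * (\<Phi> \<epsilon> s \<bullet> ((K s * a) *\<^sub>v w)))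
      = \<Phi> \<epsilon> s \<bullet> w - s * (u \<bullet> (a *\<^sub>v w)) / det (E s)"
      by (simp add: diff_divide_distrib right_diff_distrib)
  qed
  then show ?zeroth using w .
  have aw: "a *\<^sub>v w \<in> carrier_vec N" and Kw: "(K s * a) *\<^sub>v w \<in> carrier_vec N"
    using ca cK w by auto
  have aKa: "a *\<^sub>v ((K s * a) *\<^sub>v w) = (a * K s * a) *\<^sub>v w"
    unfolding assoc_mult_mat_vec[OF ca mult_carrier_mat[OF cK ca] w, symmetric] assoc_mult_mat[OF ca cK ca] ..
  show ?first
  proof (rule bigoe_cong[OF \<epsilon>0])
    show "(\<lambda>\<epsilon>. s / det (E s) * (U \<epsilon> \<bullet> (a *\<^sub>v w) - u \<bullet> (a *\<^sub>v w) - complex_of_real \<epsilon> * (z \<bullet> (a *\<^sub>v w)))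
        - 1 / det (E s) * (complex_of_real \<epsilon> * (\<Phi> \<epsilon> s \<bullet> ((K s * a) *\<^sub>v w)
           - s * (u \<bullet> (a *\<^sub>v ((K s * a) *\<^sub>v w))) / det (E s)))) \<in> bigoe 2"
      using bigoe_eps[OF zeroth[OF Kw]]
      by (intro sum_in_bigo bigoe_cmult U_first_order_scalar[OF aw]) (simp add: numeral_2_eq_2)
    fix \<epsilon> :: real assume e: "0 < \<epsilon>" "\<epsilon> < \<epsilon>0"
    have "det (E s) * (\<Phi> \<epsilon> s \<bullet> w) = s * (U \<epsilon> \<bullet> (a *\<^sub>v w)) - complex_of_real \<epsilon> * (\<Phi> \<epsilon> s \<bullet> ((K s * a) *\<^sub>v w))"
      using adjugate_equation_scalar[OF e s w, folded a_def] by (simp add: algebra_simps)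
    then have "\<Phi> \<epsilon> s \<bullet> w = (s * (U \<epsilon> \<bullet> (a *\<^sub>v w)) - complex_of_real \<epsilon> * (\<Phi> \<epsilon> s \<bullet> ((K s * a) *\<^sub>v w))) / det (E s)"
      using det by (simp add: field_simps)
    then show "s / det (E s) * (U \<epsilon> \<bullet> (a *\<^sub>v w) - u \<bullet> (a *\<^sub>v w) - complex_of_real \<epsilon> * (z \<bullet> (a *\<^sub>v w)))
        - 1 / det (E s) * (complex_of_real \<epsilon> * (\<Phi> \<epsilon> s \<bullet> ((K s * a) *\<^sub>v w)
           - s * (u \<bullet> (a *\<^sub>v ((K s * a) *\<^sub>v w))) / det (E s)))
      = \<Phi> \<epsilon> s \<bullet> w - s * (u \<bullet> (a *\<^sub>v w)) / det (E s)
      - complex_of_real \<epsilon> * (s * (z \<bullet> (a *\<^sub>v w)) / det (E s)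
          - s * (u \<bullet> ((a * K s * a) *\<^sub>v w)) / (det (E s))\<^sup>2)"
      unfolding aKa by (simp add: diff_divide_distrib right_diff_distrib power2_eq_square)
  qed
qed

end

section \<open>Growth at infinity\<close>

lemma poly_over_power_tendsto:
  fixes H :: "complex poly"
  assumes "degree H \<le> n"
  shows "((\<lambda>x::real. poly H (complex_of_real x) / complex_of_real x ^ n) \<longlongrightarrow> coeff H n) at_top"
proof -
  have inv: "((\<lambda>x::real. inverse (complex_of_real x)) \<longlongrightarrow> 0) at_top"
    using tendsto_of_real[OF tendsto_inverse_0_at_top[OF filterlim_ident], where 'a = complex] by simp
  have summand: "((\<lambda>x::real. coeff H k * (complex_of_real x ^ k / complex_of_real x ^ n)) \<longlongrightarrow> (if k = n then coeff H n else 0)) at_top"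
    if k: "k \<le> n" for k
  proof -
    have "((\<lambda>x::real. coeff H k * inverse (complex_of_real x) ^ (n - k)) \<longlongrightarrow> coeff H k * 0 ^ (n - k)) at_top"
      by (intro tendsto_intros inv)
    moreover have "coeff H k * 0 ^ (n - k) = (if k = n then coeff H n else 0)" using k by simp
    moreover have "eventually (\<lambda>x::real. coeff H k * inverse (complex_of_real x) ^ (n - k)
        = coeff H k * (complex_of_real x ^ k / complex_of_real x ^ n)) at_top"
      using eventually_gt_at_top[of 0]
    proof eventually_elim
      case (elim x)
      have "complex_of_real x ^ n = complex_of_real x ^ k * complex_of_real x ^ (n - k)"
        using k by (simp flip: power_add)
      then show ?case using elim by (simp add: field_simps)
    qed
    ultimately show ?thesis by (auto intro: Lim_transform_eventually)
  qed
  have "poly H x = (\<Sum>k\<le>n. coeff H k * x ^ k)" for x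
    unfolding poly_altdef using assms by (intro sum.mono_neutral_left) (auto simp: coeff_eq_0)
  then have "(\<lambda>x::real. poly H (complex_of_real x) / complex_of_real x ^ n)
    = (\<lambda>x. \<Sum>k\<le>n. coeff H k * (complex_of_real x ^ k / complex_of_real x ^ n))"
    by (simp add: sum_divide_distrib)
  moreover have "((\<lambda>x::real. \<Sum>k\<le>n. coeff H k * (complex_of_real x ^ k / complex_of_real x ^ n))
    \<longlongrightarrow> (\<Sum>k\<le>n. if k = n then coeff H n else 0)) at_top"
    by (intro tendsto_sum summand) simp
  ultimately show ?thesis by simp
qed

text \<open>
  Numerators obtained by clearing denominators are only known as functions; their degrees and leading
  coefficients are read off from their growth along the positive axis.
\<close>

lemma degree_le_if_growth:
  fixes H :: "complex poly"
  assumes lim: "((\<lambda>x::real. poly H (complex_of_real x) / complex_of_real x ^ n) \<longlongrightarrow> L) at_top"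
  shows "degree H \<le> n" "coeff H n = L"
proof -
  show deg: "degree H \<le> n"
  proof (rule ccontr)
    assume "\<not> degree H \<le> n"
    then have d: "n < degree H" by simp
    have inv: "((\<lambda>x::real. inverse (complex_of_real x)) \<longlongrightarrow> 0) at_top"
      using tendsto_of_real[OF tendsto_inverse_0_at_top[OF filterlim_ident], where 'a = complex] by simp
    have a: "((\<lambda>x::real. poly H (complex_of_real x) / complex_of_real x ^ n * inverse (complex_of_real x) ^ (degree H - n))
      \<longlongrightarrow> L * 0 ^ (degree H - n)) at_top"
      by (intro tendsto_intros inv lim)
    have b: "eventually (\<lambda>x::real. poly H (complex_of_real x) / complex_of_real x ^ n * inverse (complex_of_real x) ^ (degree H - n)
       = poly H (complex_of_real x) / complex_of_real x ^ degree H) at_top"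
      using eventually_gt_at_top[of 0]
    proof eventually_elim
      case (elim x)
      have "complex_of_real x ^ degree H = complex_of_real x ^ n * complex_of_real x ^ (degree H - n)"
        using d by (simp flip: power_add)
      then show ?case using elim by (simp add: field_simps)
    qed
    have z: "L * 0 ^ (degree H - n) = 0" using d by simp
    have "((\<lambda>x::real. poly H (complex_of_real x) / complex_of_real x ^ degree H) \<longlongrightarrow> 0) at_top"
      using Lim_transform_eventually[OF a b] unfolding z .
    moreover have "((\<lambda>x::real. poly H (complex_of_real x) / complex_of_real x ^ degree H) \<longlongrightarrow> lead_coeff H) at_top"
      by (rule poly_over_power_tendsto) simp
    ultimately have "lead_coeff H = 0" by (rule tendsto_unique[OF trivial_limit_at_top_linorder, rotated])
    then show False using d by simp
  qed
  show "coeff H n = L"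
    by (rule tendsto_unique[OF trivial_limit_at_top_linorder poly_over_power_tendsto[OF deg] lim])
qed

lemma col_subst_sum_scale:
  assumes X: "X \<in> carrier_mat n n" and Y: "Y \<in> carrier_mat n n"
  shows "col_subst_sum (c \<cdot>\<^sub>m X) Y = c ^ (n - 1) * col_subst_sum X Y"
proof -
  have cX: "c \<cdot>\<^sub>m X \<in> carrier_mat n n" using X by simp
  show ?thesis
    unfolding col_subst_sum_expand[OF X Y] col_subst_sum_expand[OF cX Y] sum_distrib_left
  proof (intro sum.cong refl)
    fix p i assume p: "p \<in> {p. p permutes {0..<n}}" and i: "i \<in> {0..<n}"
    have "(\<Prod>k\<in>{0..<n} - {i}. (c \<cdot>\<^sub>m X) $$ (k, p k)) = (\<Prod>k\<in>{0..<n} - {i}. c * X $$ (k, p k))"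
    proof (rule prod.cong[OF refl])
      fix k assume "k \<in> {0..<n} - {i}"
      then have "k < n" "p k < n" using p permutes_in_image[of p "{0..<n}" k] by auto
      then show "(c \<cdot>\<^sub>m X) $$ (k, p k) = c * X $$ (k, p k)" using X by simp
    qed
    also have "\<dots> = c ^ (n - 1) * (\<Prod>k\<in>{0..<n} - {i}. X $$ (k, p k))"
      using i by (simp add: prod.distrib)
    finally show "signof p * (Y $$ (i, p i) * (\<Prod>k\<in>{0..<n} - {i}. (c \<cdot>\<^sub>m X) $$ (k, p k)))
      = c ^ (n - 1) * (signof p * (Y $$ (i, p i) * (\<Prod>k\<in>{0..<n} - {i}. X $$ (k, p k))))"
      by simp
  qed
qed

lemma tendsto_col_subst_sum:
  assumes X: "\<And>x. X x \<in> carrier_mat n n" and L: "L \<in> carrier_mat n n" and Y: "Y \<in> carrier_mat n n"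
    and lim: "\<And>i j. i < n \<Longrightarrow> j < n \<Longrightarrow> ((\<lambda>x. X x $$ (i, j)) \<longlongrightarrow> L $$ (i, j)) F"
  shows "((\<lambda>x. col_subst_sum (X x) Y) \<longlongrightarrow> col_subst_sum L Y) F"
  unfolding col_subst_sum_expand[OF X Y] col_subst_sum_expand[OF L Y]
proof (intro tendsto_sum tendsto_mult tendsto_const tendsto_prod)
  fix p i k assume "p \<in> {p. p permutes {0..<n}}" "k \<in> {0..<n} - {i}"
  then show "((\<lambda>x. X x $$ (k, p k)) \<longlongrightarrow> L $$ (k, p k)) F"
    using permutes_in_image[of p "{0..<n}" k] by (intro lim) auto
qed

lemma tendsto_det:
  fixes X :: "'a \<Rightarrow> complex mat"
  assumes X: "\<And>x. X x \<in> carrier_mat n n" and L: "L \<in> carrier_mat n n"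
    and lim: "\<And>i j. i < n \<Longrightarrow> j < n \<Longrightarrow> ((\<lambda>x. X x $$ (i, j)) \<longlongrightarrow> L $$ (i, j)) F"
  shows "((\<lambda>x. det (X x)) \<longlongrightarrow> det L) F"
  unfolding det_def'[OF X] det_def'[OF L]
proof (intro tendsto_sum tendsto_mult tendsto_const tendsto_prod)
  fix p k assume "p \<in> {p. p permutes {0..<n}}" "k \<in> {0..<n}"
  then show "((\<lambda>x. X x $$ (k, p k)) \<longlongrightarrow> L $$ (k, p k)) F"
    using permutes_in_image[of p "{0..<n}" k] by (intro lim) auto
qed

lemma mat_delete_index_of:
  assumes "X \<in> carrier_mat n n" "k < n - 1" "l < n - 1"
  shows "mat_delete X i j $$ (k, l) = X $$ (if k < i then k else Suc k, if l < j then l else Suc l)"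
  using assms by (simp add: mat_delete_def)

lemma mat_delete_square: "X \<in> carrier_mat n n \<Longrightarrow> mat_delete X i j \<in> carrier_mat (n - 1) (n - 1)"
  by (auto simp: mat_delete_def)

lemma mat_delete_smult:
  assumes "X \<in> carrier_mat n n"
  shows "mat_delete (c \<cdot>\<^sub>m X) i j = c \<cdot>\<^sub>m mat_delete X i j"
  using assms by (intro eq_matI) (auto simp: mat_delete_def)

lemma adj_mat_scale:
  fixes X :: "complex mat"
  assumes X: "X \<in> carrier_mat n n" and ij: "i < n" "j < n"
  shows "adj_mat (c \<cdot>\<^sub>m X) $$ (i, j) = c ^ (n - 1) * adj_mat X $$ (i, j)"
proof -
  have "det (mat_delete (c \<cdot>\<^sub>m X) j i) = c ^ (n - 1) * det (mat_delete X j i)"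
    unfolding mat_delete_smult[OF X] det_smult
    using carrier_matD(2)[OF mat_delete_square[OF X, of j i]] by (simp only:)
  then show ?thesis using X ij by (simp add: adj_mat_def cofactor_def)
qed

lemma tendsto_adj_mat:
  fixes X :: "'a \<Rightarrow> complex mat"
  assumes X: "\<And>x. X x \<in> carrier_mat n n" and L: "L \<in> carrier_mat n n"
    and lim: "\<And>i j. i < n \<Longrightarrow> j < n \<Longrightarrow> ((\<lambda>x. X x $$ (i, j)) \<longlongrightarrow> L $$ (i, j)) F"
    and ij: "i < n" "j < n"
  shows "((\<lambda>x. adj_mat (X x) $$ (i, j)) \<longlongrightarrow> adj_mat L $$ (i, j)) F"
proof -
  have e: "adj_mat M $$ (i, j) = (- 1) ^ (j + i) * det (mat_delete M j i)" if "M \<in> carrier_mat n n" for M :: "complex mat"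
    using that ij by (simp add: adj_mat_def cofactor_def)
  have "((\<lambda>x. det (mat_delete (X x) j i)) \<longlongrightarrow> det (mat_delete L j i)) F"
  proof (rule tendsto_det[OF mat_delete_square[OF X] mat_delete_square[OF L]])
    fix k l assume kl: "k < n - 1" "l < n - 1"
    show "((\<lambda>x. mat_delete (X x) j i $$ (k, l)) \<longlongrightarrow> mat_delete L j i $$ (k, l)) F"
      unfolding mat_delete_index_of[OF X kl] mat_delete_index_of[OF L kl] using kl by (intro lim) auto
  qed
  then show ?thesis unfolding e[OF X] e[OF L] by (intro tendsto_intros)
qed

lemma adj_diff_scale:
  assumes X: "X \<in> carrier_mat n n" and Y: "Y \<in> carrier_mat n n" and ij: "i < n" "j < n"
  shows "adj_diff (c \<cdot>\<^sub>m X) Y $$ (i, j) = c ^ (n - 2) * adj_diff X Y $$ (i, j)"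
  using X ij col_subst_sum_scale[OF mat_delete_square[OF X] mat_delete_square[OF Y], of c j i]
  by (simp add: adj_diff_def mat_delete_smult[OF X] numeral_2_eq_2)

lemma tendsto_adj_diff:
  assumes X: "\<And>x. X x \<in> carrier_mat n n" and L: "L \<in> carrier_mat n n" and Y: "Y \<in> carrier_mat n n"
    and lim: "\<And>i j. i < n \<Longrightarrow> j < n \<Longrightarrow> ((\<lambda>x. X x $$ (i, j)) \<longlongrightarrow> L $$ (i, j)) F"
    and ij: "i < n" "j < n"
  shows "((\<lambda>x. adj_diff (X x) Y $$ (i, j)) \<longlongrightarrow> adj_diff L Y $$ (i, j)) F"
proof -
  have e: "adj_diff M Y $$ (i, j) = (- 1) ^ (j + i) * col_subst_sum (mat_delete M j i) (mat_delete Y j i)"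
    if "M \<in> carrier_mat n n" for M
    using that ij by (simp add: adj_diff_def)
  have "((\<lambda>x. col_subst_sum (mat_delete (X x) j i) (mat_delete Y j i))
      \<longlongrightarrow> col_subst_sum (mat_delete L j i) (mat_delete Y j i)) F"
  proof (rule tendsto_col_subst_sum[OF mat_delete_square[OF X] mat_delete_square[OF L] mat_delete_square[OF Y]])
    fix k l assume kl: "k < n - 1" "l < n - 1"
    show "((\<lambda>x. mat_delete (X x) j i $$ (k, l)) \<longlongrightarrow> mat_delete L j i $$ (k, l)) F"
      unfolding mat_delete_index_of[OF X kl] mat_delete_index_of[OF L kl] using kl by (intro lim) auto
  qed
  then show ?thesis unfolding e[OF X] e[OF L] by (intro tendsto_intros)
qed

lemma adj_diff_one_dim: "X \<in> carrier_mat 1 1 \<Longrightarrow> adj_diff X Y $$ (0, 0) = 0"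
  by (simp add: adj_diff_def col_subst_sum_def mat_delete_def)

lemma adj_mat_one: "adj_mat (1\<^sub>m n :: complex mat) = 1\<^sub>m n"
proof -
  have "(1 :: complex) \<cdot>\<^sub>m 1\<^sub>m n = 1\<^sub>m n" by (intro eq_matI) auto
  then show ?thesis
    using adj_mat(2)[of "1\<^sub>m n :: complex mat" n] adj_mat(1)[of "1\<^sub>m n :: complex mat" n] by simp
qed

text \<open>
  If \<open>X s ~ s I\<close>, then homogeneity reduces the growth of the adjugate and its relatives to their
  continuity at the identity matrix.
\<close>

context
  fixes X :: "complex \<Rightarrow> complex mat" and n :: nat
  assumes X: "\<And>s. X s \<in> carrier_mat n n"
    and lim: "\<And>i j. i < n \<Longrightarrow> j < n \<Longrightarrow>
      ((\<lambda>x. X (complex_of_real x) $$ (i, j) / complex_of_real x) \<longlongrightarrow> (if i = j then 1 else 0)) at_top"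
begin

lemma scaled_limit:
  assumes "i < n" "j < n"
  shows "((\<lambda>x. (inverse (complex_of_real x) \<cdot>\<^sub>m X (complex_of_real x)) $$ (i, j)) \<longlongrightarrow> 1\<^sub>m n $$ (i, j)) at_top"
  using lim[OF assms] assms X carrier_matD[OF X] by (simp add: divide_inverse mult.commute)

lemma scaled_carrier: "inverse (complex_of_real x) \<cdot>\<^sub>m X (complex_of_real x) \<in> carrier_mat n n"
  using X by simp

lemma growth_adj:
  assumes ij: "i < n" "j < n"
  shows "((\<lambda>x. adj_mat (X (complex_of_real x)) $$ (i, j) / complex_of_real x ^ (n - 1)) \<longlongrightarrow> (if i = j then 1 else 0)) at_top"
proof -
  have "((\<lambda>x. adj_mat (inverse (complex_of_real x) \<cdot>\<^sub>m X (complex_of_real x)) $$ (i, j)) \<longlongrightarrow> adj_mat (1\<^sub>m n) $$ (i, j)) at_top"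
    by (rule tendsto_adj_mat[OF scaled_carrier _ scaled_limit ij]) auto
  then show ?thesis
    unfolding adj_mat_scale[OF X ij] adj_mat_one using ij by (simp add: divide_inverse power_inverse mult.commute)
qed

lemma growth_col_subst_sum:
  assumes Y: "Y \<in> carrier_mat n n"
  shows "((\<lambda>x. col_subst_sum (X (complex_of_real x)) Y / complex_of_real x ^ (n - 1)) \<longlongrightarrow> col_subst_sum (1\<^sub>m n) Y) at_top"
proof -
  have "((\<lambda>x. col_subst_sum (inverse (complex_of_real x) \<cdot>\<^sub>m X (complex_of_real x)) Y) \<longlongrightarrow> col_subst_sum (1\<^sub>m n) Y) at_top"
    by (rule tendsto_col_subst_sum[OF scaled_carrier _ Y scaled_limit]) auto
  then show ?thesis
    unfolding col_subst_sum_scale[OF X Y] by (simp add: divide_inverse power_inverse mult.commute)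
qed

text \<open>
  The entries are linear combinations of minors of \<open>X\<close> of dimension \<open>n - 2\<close>.  In dimension one, where \<open>n - 2\<close>
  is truncated, they vanish.
\<close>

lemma growth_adj_diff:
  assumes Y: "Y \<in> carrier_mat n n" and ij: "i < n" "j < n"
  obtains l where "((\<lambda>x. complex_of_real x * adj_diff (X (complex_of_real x)) Y $$ (i, j) / complex_of_real x ^ (n - 1)) \<longlongrightarrow> l) at_top"
proof (cases "n = 1")
  case True
  then have "adj_diff (X s) Y $$ (i, j) = 0" for s using adj_diff_one_dim[of "X s" Y] X[of s] ij by simp
  then show ?thesis using that[of 0] by simp
next
  case False
  then have n: "n - 1 = Suc (n - 2)" using ij by auto
  have a: "((\<lambda>x. adj_diff (inverse (complex_of_real x) \<cdot>\<^sub>m X (complex_of_real x)) Y $$ (i, j)) \<longlongrightarrow> adj_diff (1\<^sub>m n) Y $$ (i, j)) at_top"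
    by (rule tendsto_adj_diff[OF scaled_carrier _ Y scaled_limit ij]) auto
  have b: "eventually (\<lambda>x. adj_diff (inverse (complex_of_real x) \<cdot>\<^sub>m X (complex_of_real x)) Y $$ (i, j)
     = complex_of_real x * adj_diff (X (complex_of_real x)) Y $$ (i, j) / complex_of_real x ^ (n - 1)) at_top"
    using eventually_gt_at_top[of 0]
  proof eventually_elim
    case (elim x)
    then show ?case unfolding adj_diff_scale[OF X Y ij] n by (simp add: field_simps)
  qed
  show ?thesis by (rule that[OF Lim_transform_eventually[OF a b]])
qed

end

section \<open>Polynomials in two variables\<close>

text \<open>
  The outer variable of the polynomial is \<open>g\<close>, the inner one \<open>s\<close>, as in \<open>E_poly\<close>.
\<close>

definition eval2 :: "complex \<Rightarrow> complex \<Rightarrow> complex poly poly \<Rightarrow> complex" where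
  "eval2 s g P = poly (poly P [:g:]) s"

lemma eval2_hom: "comm_ring_hom (eval2 s g)"
  by unfold_locales (auto simp: eval2_def)

lemma eval2_pCons: "eval2 s g (pCons a P) = poly a s + g * eval2 s g P"
  by (simp add: eval2_def)

lemma has_field_derivative_eval2:
  "((\<lambda>g. eval2 s g P) has_field_derivative eval2 s g (pderiv P)) (at g)"
proof (induction P)
  case 0
  then show ?case by (simp add: eval2_def)
next
  case (pCons a P)
  have "((\<lambda>g. poly a s + g * eval2 s g P) has_field_derivative (0 + (1 * eval2 s g P + eval2 s g (pderiv P) * g))) (at g)"
    by (intro DERIV_add DERIV_mult DERIV_ident DERIV_const pCons)
  moreover have "eval2 s g (pderiv (pCons a P)) = eval2 s g P + g * eval2 s g (pderiv P)"
    by (simp add: pderiv_pCons eval2_def)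
  ultimately show ?case by (simp add: eval2_pCons mult.commute)
qed

lemma eval2_clear_denominators:
  fixes p q :: "complex poly"
  assumes "degree P \<le> r"
  obtains H where "\<And>s. poly p s \<noteq> 0 \<Longrightarrow> poly H s = poly p s ^ r * eval2 s (poly q s / poly p s) P"
proof -
  have "\<exists>H. \<forall>s. poly p s \<noteq> 0 \<longrightarrow> poly H s = poly p s ^ r * eval2 s (poly q s / poly p s) P"
    using assms
  proof (induction P arbitrary: r)
    case 0
    then show ?case by (intro exI[of _ 0]) (simp add: eval2_def)
  next
    case (pCons a P)
    show ?case
    proof (cases "P = 0")
      case True
      then show ?thesis by (intro exI[of _ "p ^ r * a"]) (simp add: eval2_def)
    next
      case False
      then obtain r' where r': "r = Suc r'" "degree P \<le> r'"
        using pCons.prems by (cases r) (auto simp: degree_pCons_eq)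
      from pCons.IH[OF r'(2)] obtain H where
        H: "\<And>s. poly p s \<noteq> 0 \<Longrightarrow> poly H s = poly p s ^ r' * eval2 s (poly q s / poly p s) P" by blast
      show ?thesis
        by (intro exI[of _ "p ^ r * a + q * H"]) (auto simp: eval2_pCons H r'(1) field_simps)
    qed
  qed
  then show ?thesis using that by blast
qed

lemma map_mat_hom_adj:
  fixes X :: "complex poly poly mat"
  assumes X: "X \<in> carrier_mat n n" and ij: "i < n" "j < n"
  shows "adj_mat (map_mat (eval2 s g) X) $$ (i, j) = eval2 s g (adj_mat X $$ (i, j))"
proof -
  interpret comm_ring_hom "eval2 s g" by (rule eval2_hom)
  have "mat_delete (map_mat (eval2 s g) X) j i = map_mat (eval2 s g) (mat_delete X j i)"
    using X ij by (intro eq_matI) (auto simp: mat_delete_def)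
  then show ?thesis using X ij by (simp add: adj_mat_def cofactor_def hom_distribs)
qed

section \<open>The matrix of the queue\<close>

lemma Q2P_index: "i < dim_row D1 \<Longrightarrow> j < dim_row D1 \<Longrightarrow> Q2P D1 D2 $$ (i, j) = real_prob D1 D2 i j * trans_prob D1 D2 i j"
  by (simp add: Q2P_def hadamard_def Q2_mat_def P_mat_def)

lemma Q2P_carrier: "Q2P D1 D2 \<in> carrier_mat (dim_row D1) (dim_row D1)"
  by (simp add: Q2P_def hadamard_def Q2_mat_def)

lemma Q2PLam_index:
  assumes "i < dim_row D1" "j < dim_row D1"
  shows "Q2PLam D1 D2 $$ (i, j) = real_prob D1 D2 i j * (trans_prob D1 D2 i j * rate D1 D2 j)"
proof -
  have "(P_mat D1 D2 * Lam D1 D2) $$ (i, j) = trans_prob D1 D2 i j * rate D1 D2 j"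
    using assms unfolding Lam_def by (subst mat_diag_mult_right[of _ "dim_row D1"]) (auto simp: P_mat_def)
  then show ?thesis using assms by (simp add: Q2PLam_def hadamard_def Q2_mat_def)
qed

lemma Q2PLam_carrier: "Q2PLam D1 D2 \<in> carrier_mat (dim_row D1) (dim_row D1)"
  by (simp add: Q2PLam_def hadamard_def Q2_mat_def)

lemma mult_ones_index:
  fixes A :: "'a :: comm_ring_1 mat"
  assumes "A \<in> carrier_mat n n" "i < n"
  shows "(A *\<^sub>v ones n) $ i = (\<Sum>j<n. A $$ (i, j))"
  using assms by (simp add: ones_def scalar_prod_def lessThan_atLeast0)

lemma mat_vec_index:
  assumes "A \<in> carrier_mat n n" "v \<in> carrier_vec n" "i < n"
  shows "(A *\<^sub>v v) $ i = (\<Sum>j<n. A $$ (i, j) * v $ j)"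
  using assms by (simp add: scalar_prod_def lessThan_atLeast0)

lemma scalar_index: "w \<in> carrier_vec n \<Longrightarrow> v \<bullet> w = (\<Sum>i<n. v $ i * w $ i)"
  by (simp add: scalar_prod_def lessThan_atLeast0)

context
  fixes N :: nat and D1 D2 :: "real mat"
  assumes arr: "arrival_process N D1 D2" and rates: "\<forall>i<N. 0 < rate D1 D2 i"
begin

abbreviation QL :: "complex mat" where "QL \<equiv> cmat (Q2PLam D1 D2)"
abbreviation le :: "complex vec" where "le \<equiv> cvec (Lam_inv D1 D2 *\<^sub>v ones N)"

lemma dimN: "dim_row D1 = N" using arrival_dims[OF arr rates] by simp

lemma E_sg_carrier: "E_sg D1 D2 s g \<in> carrier_mat N N"
  by (rule E_gen_carrier[OF dimN])

lemma QL_carrier: "QL \<in> carrier_mat N N"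
  using Q2PLam_carrier[of D1 D2] dimN by simp

lemma QL_index: "i < N \<Longrightarrow> j < N \<Longrightarrow> QL $$ (i, j)
    = complex_of_real (trans_prob D1 D2 i j * rate D1 D2 j) * complex_of_real (real_prob D1 D2 i j)"
  using Q2PLam_carrier[of D1 D2] dimN by (simp add: Q2PLam_index)

lemma Lam_inv_carrier: "Lam_inv D1 D2 \<in> carrier_mat N N"
  using dimN by (simp add: Lam_inv_def)

lemma Q2P_carrier': "Q2P D1 D2 \<in> carrier_mat N N"
  using Q2P_carrier[of D1 D2] dimN by simp

lemma ones_carrier: "ones n \<in> carrier_vec n"
  by (simp add: ones_def)

lemmas Lam_inv_ones_carrier = mult_mat_vec_carrier[OF Lam_inv_carrier ones_carrier]
  and Q2P_ones_carrier = mult_mat_vec_carrier[OF Q2P_carrier' ones_carrier]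

lemma Lam_inv_ones:
  assumes "i < N"
  shows "(Lam_inv D1 D2 *\<^sub>v ones N) $ i = 1 / rate D1 D2 i"
proof -
  have c: "Lam_inv D1 D2 \<in> carrier_mat N N" using dimN by (simp add: Lam_inv_def)
  have "(Lam_inv D1 D2 *\<^sub>v ones N) $ i = (\<Sum>j<N. if j = i then 1 / rate D1 D2 i else 0)"
    unfolding mult_ones_index[OF c assms] using assms dimN
    by (intro sum.cong) (auto simp: Lam_inv_def mat_diag_def)
  then show ?thesis using assms by simp
qed

lemma le_carrier: "le \<in> carrier_vec N"
  using Lam_inv_ones_carrier by simp

lemma le_index: "i < N \<Longrightarrow> le $ i = complex_of_real (1 / rate D1 D2 i)"
  using Lam_inv_ones carrier_matD[OF Lam_inv_carrier] by simp

lemma E_sg_add: "E_sg D1 D2 s (g + t) = E_sg D1 D2 s g + t \<cdot>\<^sub>m QL"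
proof (rule eq_matI)
  fix i j assume "i < dim_row (E_sg D1 D2 s g + t \<cdot>\<^sub>m QL)" "j < dim_col (E_sg D1 D2 s g + t \<cdot>\<^sub>m QL)"
  then have ij: "i < N" "j < N" using carrier_matD[OF QL_carrier] by auto
  have "(E_sg D1 D2 s g + t \<cdot>\<^sub>m QL) $$ (i, j) = E_sg D1 D2 s g $$ (i, j) + t * QL $$ (i, j)"
    using ij carrier_matD[OF QL_carrier] by simp
  then show "E_sg D1 D2 s (g + t) $$ (i, j) = (E_sg D1 D2 s g + t \<cdot>\<^sub>m QL) $$ (i, j)"
    unfolding E_sg_index[OF arr rates ij] QL_index[OF ij] by (simp add: algebra_simps)
qed (use carrier_matD[OF QL_carrier] carrier_matD[OF E_sg_carrier] in auto)

lemma E_sg_deriv_g: "has_mat_deriv N (\<lambda>g. E_sg D1 D2 s g) QL g"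
proof (rule has_mat_derivI[OF E_sg_carrier QL_carrier])
  fix i j assume ij: "i < N" "j < N"
  show "((\<lambda>g. E_sg D1 D2 s g $$ (i, j)) has_field_derivative QL $$ (i, j)) (at g)"
    unfolding E_sg_index[OF arr rates ij] QL_index[OF ij]
    by (auto intro!: derivative_eq_intros)
qed

lemma E_sg_deriv_s:
  assumes "(f has_field_derivative f') (at s)"
  shows "has_mat_deriv N (\<lambda>s. E_sg D1 D2 s (f s)) (1\<^sub>m N + f' \<cdot>\<^sub>m QL) s"
proof (rule has_mat_derivI[OF E_sg_carrier])
  show "1\<^sub>m N + f' \<cdot>\<^sub>m QL \<in> carrier_mat N N" using QL_carrier by auto
  fix i j assume ij: "i < N" "j < N"
  have "(1\<^sub>m N + f' \<cdot>\<^sub>m QL) $$ (i, j) = (if i = j then 1 else 0) + f' * QL $$ (i, j)"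
    using ij QL_carrier by simp
  then show "((\<lambda>s. E_sg D1 D2 s (f s) $$ (i, j)) has_field_derivative (1\<^sub>m N + f' \<cdot>\<^sub>m QL) $$ (i, j)) (at s)"
    unfolding E_sg_index[OF arr rates ij] QL_index[OF ij] using assms
    by (auto intro!: derivative_eq_intros)
qed

lemma trans_prob_row_sum:
  assumes "i < N"
  shows "(\<Sum>j<N. trans_prob D1 D2 i j) = 1"
proof -
  have r: "0 < rate D1 D2 i" using rates assms by auto
  have "(\<Sum>j<N. D1 $$ (i, j) * (if i = j then 0 else 1)) = (\<Sum>j\<in>{..<N} - {i}. D1 $$ (i, j))"
    using assms by (subst sum.remove[of _ i]) (auto intro!: sum.cong)
  then have "(\<Sum>j<N. D1 $$ (i, j) * (if i = j then 0 else 1) + D2 $$ (i, j)) = rate D1 D2 i"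
    by (simp add: sum.distrib rate_def dimN)
  then show ?thesis unfolding trans_prob_def using r by (simp flip: sum_divide_distrib)
qed

lemma E_sg_0_1_index:
  assumes "i < N" "j < N"
  shows "E_sg D1 D2 0 1 $$ (i, j) = complex_of_real (trans_prob D1 D2 i j * rate D1 D2 j - (if i = j then rate D1 D2 i else 0))"
  using assms by (simp add: E_sg_index[OF arr rates])

text \<open>
  The rows of \<open>P\<close> sum to 1.
\<close>

lemma E_sg_0_1_right: "E_sg D1 D2 0 1 *\<^sub>v le = 0\<^sub>v N"
proof (rule eq_vecI)
  fix i assume "i < dim_vec (0\<^sub>v N :: complex vec)"
  then have i: "i < N" by simp
  have "(E_sg D1 D2 0 1 *\<^sub>v le) $ i = (\<Sum>j<N. E_sg D1 D2 0 1 $$ (i, j) * le $ j)"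
    by (rule mat_vec_index[OF E_sg_carrier le_carrier i])
  also have "\<dots> = (\<Sum>j<N. complex_of_real (trans_prob D1 D2 i j - (if i = j then 1 else 0)))"
  proof (rule sum.cong[OF refl])
    fix j assume "j \<in> {..<N}"
    then have j: "j < N" by simp
    then have "rate D1 D2 j \<noteq> 0" using rates by force
    then show "E_sg D1 D2 0 1 $$ (i, j) * le $ j = complex_of_real (trans_prob D1 D2 i j - (if i = j then 1 else 0))"
      unfolding E_sg_0_1_index[OF i j] le_index[OF j] by (simp flip: of_real_mult add: field_simps)
  qed
  also have "\<dots> = complex_of_real ((\<Sum>j<N. trans_prob D1 D2 i j) - 1)"
    unfolding of_real_sum[symmetric] using i by (simp add: sum_subtractf)
  finally show "(E_sg D1 D2 0 1 *\<^sub>v le) $ i = 0\<^sub>v N $ i" using i trans_prob_row_sum[OF i] by simp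
qed (use E_sg_carrier[of 0 1] in auto)

lemma QL_le: "QL *\<^sub>v le = cvec (Q2P D1 D2 *\<^sub>v ones N)"
proof (rule eq_vecI)
  have c: "Q2P D1 D2 \<in> carrier_mat N N" using Q2P_carrier[of D1 D2] dimN by simp
  show "dim_vec (QL *\<^sub>v le) = dim_vec (cvec (Q2P D1 D2 *\<^sub>v ones N))" using c QL_carrier by simp
  fix i assume "i < dim_vec (cvec (Q2P D1 D2 *\<^sub>v ones N))"
  then have i: "i < N" using c by simp
  have "(QL *\<^sub>v le) $ i = (\<Sum>j<N. QL $$ (i, j) * le $ j)"
    by (rule mat_vec_index[OF QL_carrier le_carrier i])
  also have "\<dots> = (\<Sum>j<N. complex_of_real (Q2P D1 D2 $$ (i, j)))"
  proof (rule sum.cong[OF refl])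
    fix j assume "j \<in> {..<N}"
    then have j: "j < N" by simp
    then have "rate D1 D2 j \<noteq> 0" using rates by force
    then show "QL $$ (i, j) * le $ j = complex_of_real (Q2P D1 D2 $$ (i, j))"
      unfolding QL_index[OF i j] le_index[OF j] using i j dimN by (simp add: Q2P_index)
  qed
  also have "\<dots> = cvec (Q2P D1 D2 *\<^sub>v ones N) $ i"
    using i c mult_ones_index[OF c i] by simp
  finally show "(QL *\<^sub>v le) $ i = cvec (Q2P D1 D2 *\<^sub>v ones N) $ i" .
qed

lemma drift_eq:
  assumes v: "v \<in> carrier_vec N"
  shows "drift D1 D2 v m = v \<bullet> (Lam_inv D1 D2 *\<^sub>v ones N) - m * (v \<bullet> (Q2P D1 D2 *\<^sub>v ones N))"
proof -
  have c: "Q2P D1 D2 \<in> carrier_mat N N" "Lam_inv D1 D2 \<in> carrier_mat N N"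
    using Q2P_carrier[of D1 D2] dimN by (auto simp: Lam_inv_def)
  have o: "ones N \<in> carrier_vec N" by (simp add: ones_def)
  have "(Lam_inv D1 D2 - m \<cdot>\<^sub>m Q2P D1 D2) *\<^sub>v ones N = Lam_inv D1 D2 *\<^sub>v ones N - m \<cdot>\<^sub>v (Q2P D1 D2 *\<^sub>v ones N)"
  proof (rule eq_vecI)
    fix i assume "i < dim_vec (Lam_inv D1 D2 *\<^sub>v ones N - m \<cdot>\<^sub>v (Q2P D1 D2 *\<^sub>v ones N))"
    then have i: "i < N" using c by simp
    have cm: "Lam_inv D1 D2 - m \<cdot>\<^sub>m Q2P D1 D2 \<in> carrier_mat N N" using c by auto
    have "((Lam_inv D1 D2 - m \<cdot>\<^sub>m Q2P D1 D2) *\<^sub>v ones N) $ i = (\<Sum>j<N. Lam_inv D1 D2 $$ (i, j) - m * Q2P D1 D2 $$ (i, j))"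
      unfolding mult_ones_index[OF cm i] using c i by (intro sum.cong) auto
    also have "\<dots> = (Lam_inv D1 D2 *\<^sub>v ones N) $ i - m * (Q2P D1 D2 *\<^sub>v ones N) $ i"
      unfolding mult_ones_index[OF c(1) i] mult_ones_index[OF c(2) i] by (simp add: sum_subtractf sum_distrib_left)
    finally show "((Lam_inv D1 D2 - m \<cdot>\<^sub>m Q2P D1 D2) *\<^sub>v ones N) $ i
      = (Lam_inv D1 D2 *\<^sub>v ones N - m \<cdot>\<^sub>v (Q2P D1 D2 *\<^sub>v ones N)) $ i" using c i by simp
  qed (use c in auto)
  then have "drift D1 D2 v m = v \<bullet> (Lam_inv D1 D2 *\<^sub>v ones N - m \<cdot>\<^sub>v (Q2P D1 D2 *\<^sub>v ones N))"
    unfolding drift_def dimN by simp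
  also have "\<dots> = v \<bullet> (Lam_inv D1 D2 *\<^sub>v ones N) - v \<bullet> (m \<cdot>\<^sub>v (Q2P D1 D2 *\<^sub>v ones N))"
    using v Lam_inv_ones_carrier Q2P_ones_carrier by (intro scalar_prod_minus_distrib[of _ N]) auto
  finally show ?thesis using v Q2P_ones_carrier by simp
qed

lemma cvec_scalar: "w \<in> carrier_vec n \<Longrightarrow> v \<in> carrier_vec n \<Longrightarrow> cvec v \<bullet> cvec w = complex_of_real (v \<bullet> w)"
  by (simp add: scalar_prod_def)

context
  fixes \<pi> :: "real vec"
  assumes pi: "stationary_vec (P_mat D1 D2) \<pi>"
begin

lemma pi_facts: "\<pi> \<in> carrier_vec N" "\<And>i. i < N \<Longrightarrow> 0 \<le> \<pi> $ i" "(\<Sum>i<N. \<pi> $ i) = 1"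
  "row_mult \<pi> (P_mat D1 D2) = \<pi>" "P_mat D1 D2 \<in> carrier_mat N N"
  using pi dimN by (auto simp: stationary_vec_def P_mat_def)

lemma cpi: "cvec \<pi> \<in> carrier_vec N" using pi_facts(1) by simp

lemma cpi_nonzero: "cvec \<pi> \<noteq> 0\<^sub>v N"
proof
  assume "cvec \<pi> = 0\<^sub>v N"
  then have "\<pi> $ i = 0" if "i < N" for i
    using that pi_facts(1) arg_cong[of "cvec \<pi>" "0\<^sub>v N" "\<lambda>v. v $ i"] by simp
  then show False using pi_facts(3) by simp
qed

lemma pi_E_sg_0_1: "row_mult (cvec \<pi>) (E_sg D1 D2 0 1) = 0\<^sub>v N"
proof (rule eq_vecI)
  fix j assume "j < dim_vec (0\<^sub>v N :: complex vec)"
  then have j: "j < N" by simp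
  have "row_mult (cvec \<pi>) (E_sg D1 D2 0 1) $ j = (\<Sum>i<N. cvec \<pi> $ i * E_sg D1 D2 0 1 $$ (i, j))"
    by (rule index_row_mult[OF E_sg_carrier cpi j])
  also have "\<dots> = (\<Sum>i<N. complex_of_real (\<pi> $ i * trans_prob D1 D2 i j * rate D1 D2 j - (if i = j then \<pi> $ j * rate D1 D2 j else 0)))"
    using pi_facts(1) j by (intro sum.cong refl) (auto simp: E_sg_0_1_index algebra_simps)
  also have "\<dots> = complex_of_real ((\<Sum>i<N. \<pi> $ i * trans_prob D1 D2 i j) * rate D1 D2 j - \<pi> $ j * rate D1 D2 j)"
    unfolding of_real_sum[symmetric] using j by (simp add: sum_subtractf sum_distrib_right)
  also have "(\<Sum>i<N. \<pi> $ i * trans_prob D1 D2 i j) = row_mult \<pi> (P_mat D1 D2) $ j"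
    unfolding index_row_mult[OF pi_facts(5,1) j] using j dimN by (intro sum.cong) (auto simp: P_mat_def)
  finally show "row_mult (cvec \<pi>) (E_sg D1 D2 0 1) $ j = 0\<^sub>v N $ j" using j pi_facts(4) by simp
qed (use E_sg_carrier[of 0 1] in auto)

text \<open>
  A state of positive probability leads to \<open>j\<close> in some number \<open>n\<close> of steps, and \<open>\<pi> P\<^sup>n = \<pi>\<close>.
\<close>

lemma stationary_positive:
  assumes irred: "irreducible_mat (P_mat D1 D2)" and j: "j < N"
  shows "0 < \<pi> $ j"
proof (rule ccontr)
  let ?P = "P_mat D1 D2"
  assume "\<not> 0 < \<pi> $ j"
  then have z: "\<pi> $ j = 0" using pi_facts(2)[OF j] by simp
  have cP: "?P ^\<^sub>m n \<in> carrier_mat N N" for n using pi_facts(5) by simp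
  have inv: "row_mult \<pi> (?P ^\<^sub>m n) = \<pi>" for n
  proof (induction n)
    case 0
    then show ?case using pi_facts(1,5) by (simp add: row_mult_def)
  next
    case (Suc n)
    then show ?case using row_mult_assoc[OF cP pi_facts(1,5), of n] pi_facts(4) by simp
  qed
  have nn: "0 \<le> (?P ^\<^sub>m n) $$ (i, k)" if "i < N" "k < N" for n i k
    using that
  proof (induction n arbitrary: k)
    case 0
    then show ?case using pi_facts(5) by simp
  next
    case (Suc n)
    have "0 \<le> ?P $$ (l, k)" if "l < N" for l
      using arrival_trans_prob_nonneg[OF arr rates that Suc.prems(2)] that Suc.prems(2) dimN by (simp add: P_mat_def)
    then show ?case using Suc mult_mat_index[OF cP pi_facts(5) Suc.prems, of n]
      by (auto intro!: sum_nonneg)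
  qed
  have "\<exists>i<N. 0 < \<pi> $ i"
  proof (rule ccontr)
    assume "\<not> (\<exists>i<N. 0 < \<pi> $ i)"
    then have "\<pi> $ i = 0" if "i < N" for i using that pi_facts(2)[OF that] by force
    then show False using pi_facts(3) by simp
  qed
  then obtain i where i: "i < N" "0 < \<pi> $ i" by blast
  obtain n where n: "0 < (?P ^\<^sub>m n) $$ (i, j)"
    using irred i j pi_facts(5) unfolding irreducible_mat_def by auto
  have "(\<Sum>k<N. \<pi> $ k * (?P ^\<^sub>m n) $$ (k, j)) = 0"
    using index_row_mult[OF cP pi_facts(1) j, of n] inv z by simp
  moreover have "0 \<le> \<pi> $ k * (?P ^\<^sub>m n) $$ (k, j)" if "k \<in> {..<N}" for k
    using that nn[OF _ j] pi_facts(2) by simp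
  ultimately have "\<forall>k\<in>{..<N}. \<pi> $ k * (?P ^\<^sub>m n) $$ (k, j) = 0"
    by (subst (asm) sum_nonneg_eq_0_iff) auto
  then have "\<pi> $ i * (?P ^\<^sub>m n) $$ (i, j) = 0" using i by blast
  then show False using i n by simp
qed

lemma pi_omega:
  assumes irred: "irreducible_mat (P_mat D1 D2)" and "\<exists>i<N. \<exists>j<N. 0 < D2 $$ (i, j)"
  shows "omega D1 D2 \<pi> \<in> carrier_vec N" "\<pi> \<bullet> omega D1 D2 \<pi> = 1"
proof -
  define w where "w = (Lam_inv D1 D2 * D2) *\<^sub>v ones N"
  have cD: "D2 \<in> carrier_mat N N" using arr by (simp add: arrival_process_def)
  have cL: "Lam_inv D1 D2 \<in> carrier_mat N N" using dimN by (simp add: Lam_inv_def)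
  have cLD: "Lam_inv D1 D2 * D2 \<in> carrier_mat N N" using cD cL by simp
  have cw: "w \<in> carrier_vec N" unfolding w_def using cLD by (simp add: ones_def)
  have wi: "w $ i = (\<Sum>j<N. D2 $$ (i, j) / rate D1 D2 i)" if i: "i < N" for i
    unfolding w_def mult_ones_index[OF cLD i]
  proof (rule sum.cong[OF refl])
    fix j assume "j \<in> {..<N}"
    then have "(Lam_inv D1 D2 * D2) $$ (i, j) = (\<Sum>k<N. Lam_inv D1 D2 $$ (i, k) * D2 $$ (k, j))"
      using i by (intro mult_mat_index[OF cL cD]) auto
    also have "\<dots> = (\<Sum>k<N. if k = i then D2 $$ (i, j) / rate D1 D2 i else 0)"
      using i dimN by (intro sum.cong) (auto simp: Lam_inv_def mat_diag_def)
    finally show "(Lam_inv D1 D2 * D2) $$ (i, j) = D2 $$ (i, j) / rate D1 D2 i" using i by simp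
  qed
  have D2: "0 \<le> D2 $$ (i, j) / rate D1 D2 i" if "i < N" "j < N" for i j
    using arr rates that by (auto simp: arrival_process_def intro!: divide_nonneg_pos)
  obtain i0 j0 where ij: "i0 < N" "j0 < N" "0 < D2 $$ (i0, j0)" using assms(2) by auto
  have pos: "0 < \<pi> \<bullet> w"
    unfolding scalar_index[OF cw]
  proof (rule sum_pos2[of _ i0])
    have "0 < w $ i0" unfolding wi[OF ij(1)]
      using ij rates D2 by (intro sum_pos2[of _ j0]) auto
    then show "0 < \<pi> $ i0 * w $ i0" using stationary_positive[OF irred ij(1)] by simp
    show "0 \<le> \<pi> $ i * w $ i" if "i \<in> {..<N}" for i
      using that pi_facts(2) wi D2 by (auto intro!: mult_nonneg_nonneg sum_nonneg)
  qed (use ij in auto)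
  have o: "omega D1 D2 \<pi> = (1 / (\<pi> \<bullet> w)) \<cdot>\<^sub>v w"
    unfolding omega_def Let_def w_def dimN ..
  show "omega D1 D2 \<pi> \<in> carrier_vec N" unfolding o using cw by simp
  show "\<pi> \<bullet> omega D1 D2 \<pi> = 1" unfolding o using cw pi_facts(1) pos by simp
qed

text \<open>
  Apply the functional equation to \<open>\<Lambda>\<^sup>-\<^sup>1 e\<close>, which \<open>E(0, 1)\<close> annihilates, divide by \<open>s\<close> and let \<open>s\<close> tend
  to 0 along the positive axis.
\<close>

lemma transform_constant:
  assumes c: "c \<in> carrier_vec N" and \<Phi>: "\<And>s. \<Phi> s \<in> carrier_vec N" "\<Phi> 0 = cvec \<pi>"
    and cont: "\<And>i. i < N \<Longrightarrow> continuous_on {s. 0 \<le> Re s} (\<lambda>s. \<Phi> s $ i)"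
    and eq: "\<And>s. 0 \<le> Re s \<Longrightarrow> row_mult (\<Phi> s) (E_sg D1 D2 s (g s)) = s \<cdot>\<^sub>v c"
    and g: "((\<lambda>t. (1 - g (complex_of_real t)) / complex_of_real t) \<longlongrightarrow> complex_of_real \<mu>) (at_right 0)"
  shows "c \<bullet> le = complex_of_real (drift D1 D2 \<pi> \<mu>)"
proof -
  have Qle: "QL *\<^sub>v le \<in> carrier_vec N" using QL_carrier le_carrier by simp
  have lim: "((\<lambda>t. \<Phi> (complex_of_real t) \<bullet> w) \<longlongrightarrow> cvec \<pi> \<bullet> w) (at_right 0)" if w: "w \<in> carrier_vec N" for w
    unfolding scalar_index[OF w] \<Phi>(2)[symmetric]
  proof (intro tendsto_sum tendsto_mult tendsto_const)
    fix i assume "i \<in> {..<N}"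
    then have i: "i < N" by simp
    have "((\<lambda>t::real. complex_of_real t) \<longlongrightarrow> 0) (at_right 0)" by (auto intro!: tendsto_eq_intros)
    moreover have "eventually (\<lambda>t::real. complex_of_real t \<in> {s. 0 \<le> Re s}) (at_right 0)"
      by (rule eventually_mono[OF eventually_at_right_less]) simp
    ultimately show "((\<lambda>t. \<Phi> (complex_of_real t) $ i) \<longlongrightarrow> \<Phi> 0 $ i) (at_right 0)"
      by (intro continuous_on_tendsto_compose[OF cont[OF i]]) auto
  qed
  have ev: "eventually (\<lambda>t::real. c \<bullet> le = \<Phi> (complex_of_real t) \<bullet> le
      - (1 - g (complex_of_real t)) / complex_of_real t * (\<Phi> (complex_of_real t) \<bullet> (QL *\<^sub>v le))) (at_right 0)"
    using eventually_at_right_less[of 0]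
  proof eventually_elim
    case (elim t)
    define s where "s = complex_of_real t"
    have s: "s \<noteq> 0" "0 \<le> Re s" using elim by (auto simp: s_def)
    have "E_sg D1 D2 s (g s) *\<^sub>v le = s \<cdot>\<^sub>v le - (1 - g s) \<cdot>\<^sub>v (QL *\<^sub>v le)"
    proof (rule eq_vecI)
      fix i assume "i < dim_vec (s \<cdot>\<^sub>v le - (1 - g s) \<cdot>\<^sub>v (QL *\<^sub>v le))"
      then have i: "i < N" using carrier_matD(1)[OF QL_carrier] by simp
      have e: "E_sg D1 D2 s (g s) $$ (i, j) = E_sg D1 D2 0 1 $$ (i, j) + (if i = j then s else 0) - (1 - g s) * QL $$ (i, j)"
        if j: "j < N" for j
        unfolding E_sg_index[OF arr rates i j] QL_index[OF i j] by (simp add: algebra_simps)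
      have "(E_sg D1 D2 s (g s) *\<^sub>v le) $ i = (\<Sum>j<N. E_sg D1 D2 0 1 $$ (i, j) * le $ j + (if i = j then s * le $ i else 0)
          - (1 - g s) * (QL $$ (i, j) * le $ j))"
        unfolding mat_vec_index[OF E_sg_carrier le_carrier i]
        by (intro sum.cong refl) (auto simp: e algebra_simps)
      also have "\<dots> = (E_sg D1 D2 0 1 *\<^sub>v le) $ i + s * le $ i - (1 - g s) * (QL *\<^sub>v le) $ i"
        unfolding mat_vec_index[OF E_sg_carrier le_carrier i] mat_vec_index[OF QL_carrier le_carrier i]
        using i by (simp add: sum.distrib sum_subtractf sum_distrib_left)
      finally show "(E_sg D1 D2 s (g s) *\<^sub>v le) $ i = (s \<cdot>\<^sub>v le - (1 - g s) \<cdot>\<^sub>v (QL *\<^sub>v le)) $ i"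
        unfolding E_sg_0_1_right using i carrier_matD(1)[OF QL_carrier] carrier_matD(1)[OF Lam_inv_carrier] by simp
    qed (use E_sg_carrier[of s "g s"] QL_carrier in auto)
    then have "\<Phi> s \<bullet> (s \<cdot>\<^sub>v le - (1 - g s) \<cdot>\<^sub>v (QL *\<^sub>v le)) = row_mult (\<Phi> s) (E_sg D1 D2 s (g s)) \<bullet> le"
      using row_mult_scalar[OF E_sg_carrier \<Phi>(1) le_carrier] by simp
    also have "\<dots> = s * (c \<bullet> le)" unfolding eq[OF s(2)] using c le_carrier by (intro smult_scalar_prod_distrib) auto
    also have "\<Phi> s \<bullet> (s \<cdot>\<^sub>v le - (1 - g s) \<cdot>\<^sub>v (QL *\<^sub>v le)) = s * (\<Phi> s \<bullet> le) - (1 - g s) * (\<Phi> s \<bullet> (QL *\<^sub>v le))"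
      using \<Phi>(1)[of s] le_carrier Qle by (simp add: scalar_prod_minus_distrib[of _ N] scalar_prod_smult_distrib[of _ N])
    finally have "c \<bullet> le = \<Phi> s \<bullet> le - (1 - g s) / s * (\<Phi> s \<bullet> (QL *\<^sub>v le))"
      using s(1) by (simp add: field_simps)
    then show ?case by (simp add: s_def)
  qed
  have tl: "((\<lambda>t::real. \<Phi> (complex_of_real t) \<bullet> le
      - (1 - g (complex_of_real t)) / complex_of_real t * (\<Phi> (complex_of_real t) \<bullet> (QL *\<^sub>v le)))
    \<longlongrightarrow> cvec \<pi> \<bullet> le - complex_of_real \<mu> * (cvec \<pi> \<bullet> (QL *\<^sub>v le))) (at_right 0)"
    by (intro tendsto_diff tendsto_mult g lim le_carrier Qle)
  from iffD2[OF tendsto_cong[OF ev] tl]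
  have "c \<bullet> le = cvec \<pi> \<bullet> le - complex_of_real \<mu> * (cvec \<pi> \<bullet> (QL *\<^sub>v le))"
    by (simp add: tendsto_const_iff)
  moreover have "cvec \<pi> \<bullet> le = complex_of_real (\<pi> \<bullet> (Lam_inv D1 D2 *\<^sub>v ones N))"
    using le_carrier pi_facts(1) by (intro cvec_scalar[of _ N]) auto
  moreover have "cvec \<pi> \<bullet> (QL *\<^sub>v le) = complex_of_real (\<pi> \<bullet> (Q2P D1 D2 *\<^sub>v ones N))"
    using Qle pi_facts(1) unfolding QL_le by (intro cvec_scalar[of _ N]) auto
  ultimately show ?thesis unfolding drift_eq[OF pi_facts(1)] by simp
qed

end

end

lemma lst_real: "lst F (complex_of_real u) = complex_of_real (LINT x|F. exp (- u * x))"
proof -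
  have "lst F (complex_of_real u) = (LINT x|F. complex_of_real (exp (- u * x)))"
    unfolding lst_def by (simp add: exp_of_real[symmetric])
  then show ?thesis by simp
qed

lemma LINT_mix:
  assumes F: "service_law F" and H: "service_law H" and e: "0 \<le> \<epsilon>" "\<epsilon> \<le> 1" and u: "0 < u"
  shows "(LINT x|mix \<epsilon> F H. exp (- u * x)) = (1 - \<epsilon>) * (LINT x|F. exp (- u * x)) + \<epsilon> * (LINT x|H. exp (- u * x))"
proof -
  note F' = service_lawD[OF F] and H' = service_lawD[OF H]
  have *: "(\<integral>\<^sup>+x. ennreal (exp (- u * x)) \<partial>M) = ennreal (LINT x|M. exp (- u * x))"
    if M: "prob_space M" "sets M = sets borel" "AE x in M. 0 \<le> x" for M :: "real measure"
  proof (rule nn_integral_eq_integral)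
    interpret prob_space M by (rule M)
    note M(2)[measurable_cong]
    show "integrable M (\<lambda>x. exp (- u * x))"
    proof (rule integrable_const_bound[where B = 1])
      show "AE x in M. norm (exp (- u * x)) \<le> 1" using M(3) by eventually_elim (use u in auto)
    qed measurable
  qed auto
  have "ennreal (LINT x|mix \<epsilon> F H. exp (- u * x))
    = ennreal \<epsilon> * ennreal (LINT x|H. exp (- u * x)) + ennreal (1 - \<epsilon>) * ennreal (LINT x|F. exp (- u * x))"
    unfolding *[OF prob_space_mix[OF F'(1,2) H'(1,2) e] sets_mix[OF F'(2) H'(2)]
        AE_mix_nonneg[OF F'(1,2) H'(1,2) e F'(4) H'(4)], symmetric]
      *[OF F'(1,2,4), symmetric] *[OF H'(1,2,4), symmetric]
    by (rule nn_integral_mix[OF F'(1,2) H'(1,2) e]) measurable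
  also have "\<dots> = ennreal ((1 - \<epsilon>) * (LINT x|F. exp (- u * x)) + \<epsilon> * (LINT x|H. exp (- u * x)))"
    using e by (simp add: ennreal_mult integral_nonneg_AE add.commute)
  finally show ?thesis using e by (subst (asm) ennreal_inj) (auto intro!: add_nonneg_nonneg mult_nonneg_nonneg integral_nonneg_AE)
qed

section \<open>Asymptotics and rational functions\<close>

lemma smult_one_mult_vec:
  fixes v :: "complex vec"
  assumes v: "v \<in> carrier_vec n"
  shows "(c \<cdot>\<^sub>m 1\<^sub>m n) *\<^sub>v v = c \<cdot>\<^sub>v v"
proof (rule eq_vecI)
  fix i assume "i < dim_vec (c \<cdot>\<^sub>v v)"
  then have i: "i < n" using v by simp
  have m: "c \<cdot>\<^sub>m 1\<^sub>m n \<in> carrier_mat n n" by simp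
  have "((c \<cdot>\<^sub>m 1\<^sub>m n) *\<^sub>v v) $ i = (\<Sum>j<n. if j = i then c * v $ i else 0)"
    unfolding mat_vec_index[OF m v i] using i by (intro sum.cong) auto
  then show "((c \<cdot>\<^sub>m 1\<^sub>m n) *\<^sub>v v) $ i = (c \<cdot>\<^sub>v v) $ i" using i v by simp
qed (use v in simp)

lemma bigoe_eps_cancel:
  assumes "(\<lambda>\<epsilon>. complex_of_real \<epsilon> * h \<epsilon>) \<in> bigoe (Suc k)"
  shows "h \<in> bigoe k"
proof -
  obtain C where "eventually (\<lambda>\<epsilon>. norm (complex_of_real \<epsilon> * h \<epsilon>) \<le> C * norm (complex_of_real \<epsilon> ^ Suc k)) (at_right 0)"
    using assms by (auto elim: landau_o.bigE)
  then have "eventually (\<lambda>\<epsilon>. norm (h \<epsilon>) \<le> C * norm (complex_of_real \<epsilon> ^ k)) (at_right 0)"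
    using eventually_at_right_less[of "0::real"]
  proof eventually_elim
    case (elim \<epsilon>)
    then have "\<epsilon> * norm (h \<epsilon>) \<le> \<epsilon> * (C * \<epsilon> ^ k)" by (simp add: norm_mult norm_power mult_ac)
    then show ?case using elim by (simp add: norm_power)
  qed
  then show ?thesis by (rule bigoI)
qed

lemma bigoe_tendsto:
  assumes "(\<lambda>\<epsilon>. f \<epsilon> - F) \<in> bigoe 1"
  shows "(f \<longlongrightarrow> F) (at_right 0)"
  using bigoe_tendsto_0[of "\<lambda>\<epsilon>. f \<epsilon> - F" 0] assms by (simp add: Lim_null[of f])

lemma bigoe_diff_mult:
  assumes "(\<lambda>\<epsilon>. f \<epsilon> - F) \<in> bigoe 1" "(\<lambda>\<epsilon>. g \<epsilon> - G) \<in> bigoe 1"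
  shows "(\<lambda>\<epsilon>. f \<epsilon> * g \<epsilon> - F * G) \<in> bigoe 1"
proof -
  have "f \<in> bigoe 0" using bigoe_tendsto[OF assms(1)] by (intro bigoI_tendsto[of _ _ F]) auto
  from bigoe_mult[OF this assms(2)] have "(\<lambda>\<epsilon>. f \<epsilon> * (g \<epsilon> - G)) \<in> bigoe 1" by simp
  from sum_in_bigo(1)[OF this bigoe_cmult(2)[OF assms(1), of G]]
  show ?thesis by (simp add: algebra_simps)
qed

lemma bigoe_diff_inverse:
  assumes "(\<lambda>\<epsilon>. g \<epsilon> - G) \<in> bigoe 1" "G \<noteq> 0"
  shows "(\<lambda>\<epsilon>. 1 / g \<epsilon> - 1 / G) \<in> bigoe 1"
proof -
  note lim = bigoe_tendsto[OF assms(1)]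
  have "((\<lambda>\<epsilon>. - 1 / (g \<epsilon> * G)) \<longlongrightarrow> - 1 / (G * G)) (at_right 0)"
    using assms(2) by (intro tendsto_intros lim) auto
  then have "(\<lambda>\<epsilon>. - 1 / (g \<epsilon> * G)) \<in> bigoe 0" by (intro bigoI_tendsto) auto
  from bigoe_mult[OF this assms(1)] have "(\<lambda>\<epsilon>. - 1 / (g \<epsilon> * G) * (g \<epsilon> - G)) \<in> bigoe 1" by simp
  moreover have "eventually (\<lambda>\<epsilon>. - 1 / (g \<epsilon> * G) * (g \<epsilon> - G) = 1 / g \<epsilon> - 1 / G) (at_right 0)"
    using tendsto_imp_eventually_ne[OF lim assms(2)]
  proof eventually_elim
    case (elim \<epsilon>)
    have "- 1 / (g \<epsilon> * G) * (g \<epsilon> - G) = G / (g \<epsilon> * G) - g \<epsilon> / (g \<epsilon> * G)"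
      by (simp only: times_divide_eq_left diff_divide_distrib[symmetric]) simp
    also have "\<dots> = 1 / g \<epsilon> - 1 / G" using elim assms(2) by simp
    finally show ?case .
  qed
  ultimately show ?thesis by (subst (asm) landau_o.big.in_cong)
qed

lemma poly_eq_0_if_zero_near_0:
  fixes H :: "complex poly"
  assumes "0 < \<rho>" "\<And>s. 0 < Re s \<Longrightarrow> norm s < \<rho> \<Longrightarrow> poly H s = 0"
  shows "H = 0"
proof (rule ccontr)
  assume "H \<noteq> 0"
  then have "finite {s. poly H s = 0}" by (rule poly_roots_finite)
  moreover have "complex_of_real ` {0<..<\<rho>} \<subseteq> {s. poly H s = 0}" using assms by auto
  ultimately have "finite (complex_of_real ` {0<..<\<rho>})" by (rule finite_subset[rotated])
  then have "finite {0<..<\<rho>}" by (rule finite_imageD) (auto simp: inj_on_def)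
  then show False using assms(1) infinite_Ioo by blast
qed

lemma pf_diff:
  "pf N sr \<sigma> y r c0 c1 c2 s - pf N sr \<sigma> y r d0 d1 d2 s
    = pf N sr \<sigma> y r (c0 - d0) (\<lambda>k. c1 k - d1 k) (\<lambda>jl. c2 jl - d2 jl) s"
  by (simp add: pf_def sum_subtractf diff_divide_distrib left_diff_distrib)

lemma bracket_identity:
  fixes P D d s \<alpha> mm b ua t :: complex
  assumes "P \<noteq> 0" "D \<noteq> 0" "d \<noteq> 0"
  shows "s * d / (P * D) * (P * \<alpha> / d - mm * (P * (s * b) / d) + mm * (s * ua / D) * (P * t / d))
    = s * \<alpha> / D + s * (s * mm) * (t * ua - D * b) / D\<^sup>2"
proof -
  have "P * \<alpha> / d - mm * (P * (s * b) / d) + mm * (s * ua / D) * (P * t / d)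
      = P / d * (\<alpha> - mm * (s * b) + mm * (s * ua / D) * t)"
    by (simp add: right_diff_distrib distrib_left mult_ac)
  moreover have "s * d / (P * D) * (P / d) = s / D" using assms by simp
  ultimately have "s * d / (P * D) * (P * \<alpha> / d - mm * (P * (s * b) / d) + mm * (s * ua / D) * (P * t / d))
      = s / D * (\<alpha> - mm * (s * b) + mm * (s * ua / D) * t)"
    by (simp only: mult.assoc[symmetric])
  also have "\<dots> = s * \<alpha> / D + s * (s * mm) * (t * ua / D\<^sup>2 - b / D)"
    by (simp add: power2_eq_square algebra_simps)
  also have "b / D = D * b / D\<^sup>2" using assms by (simp add: power2_eq_square)
  also have "s * (s * mm) * (t * ua / D\<^sup>2 - D * b / D\<^sup>2) = s * (s * mm) * (t * ua - D * b) / D\<^sup>2"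
    by (simp only: diff_divide_distrib[symmetric] times_divide_eq_right)
  finally show ?thesis .
qed

section \<open>The mixture model\<close>

text \<open>
  The hypotheses of the theorem, as a context for the steps of its proof.
\<close>

locale mixture_queue =
  fixes N M r \<sigma> :: nat
    and D1 D2 :: "real mat" and \<pi> \<omega> :: "real vec"
    and Fp Fh :: "real measure" and p q :: "complex poly"
    and \<mu>p \<mu>h \<epsilon>0 :: real
    and Smix Sdis :: "real \<Rightarrow> (real \<times> nat) measure"
    and w_mix w_dis :: "real \<Rightarrow> complex \<Rightarrow> complex"
    and u z zd :: "complex vec" and u_dis :: "real \<Rightarrow> complex vec"
    and E K Kd :: "complex \<Rightarrow> complex mat" and A :: "complex mat"
    and sr x y yd :: "nat \<Rightarrow> complex" and m rr :: "nat \<Rightarrow> nat"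
  \<comment> \<open>arrivals\<close>
  assumes arrivals: "arrival_process N D1 D2"
    and rates: "\<forall>i<N. 0 < rate D1 D2 i"
    and real_customers: "\<exists>i<N. \<exists>j<N. 0 < D2 $$ (i, j)"
    and irred: "irreducible_mat (P_mat D1 D2)"
    and pi: "stationary_vec (P_mat D1 D2) \<pi>"
    and omega: "\<omega> = omega D1 D2 \<pi>"
  \<comment> \<open>service times\<close>
    and Fp: "service_law Fp" "phase_type Fp" "\<mu>p = mean Fp"
    and Fp_rational: "\<forall>s. 0 \<le> Re s \<longrightarrow> lst Fp s = poly q s / poly p s"
      "coprime q p" "lead_coeff p = 1" "degree p = M" "degree q < M"
    and Fh: "service_law Fh" "heavy_tailed Fh" "\<mu>h = mean Fh"
  \<comment> \<open>stability of the replace base, mixture and discard base models\<close>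
    and eps0: "0 < \<epsilon>0" "\<epsilon>0 \<le> 1"
    and stable_base: "0 < drift D1 D2 \<pi> \<mu>p"
    and stable_mix: "\<forall>\<epsilon>\<in>{0<..<\<epsilon>0}. 0 < drift D1 D2 \<pi> ((1 - \<epsilon>) * \<mu>p + \<epsilon> * \<mu>h)"
    and stable_dis: "\<forall>\<epsilon>\<in>{0<..<\<epsilon>0}. 0 < drift D1 D2 \<pi> ((1 - \<epsilon>) * \<mu>p)"
  \<comment> \<open>steady state and delay in the mixture and discard base models\<close>
    and Smix: "\<forall>\<epsilon>\<in>{0<..<\<epsilon>0}. stationary_law N D1 D2 (mix \<epsilon> Fp Fh) (Smix \<epsilon>)"
    and Sdis: "\<forall>\<epsilon>\<in>{0<..<\<epsilon>0}. stationary_law N D1 D2 (mix \<epsilon> Fp (return borel 0)) (Sdis \<epsilon>)"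
    and w_mix: "w_mix = (\<lambda>\<epsilon> s. Phi N (Smix \<epsilon>) s \<bullet> cvec \<omega>)"
    and w_dis: "w_dis = (\<lambda>\<epsilon> s. Phi N (Sdis \<epsilon>) s \<bullet> cvec \<omega>)"
    and u_dis: "\<forall>\<epsilon>\<in>{0<..<\<epsilon>0}. u_dis \<epsilon> \<in> carrier_vec N \<and>
      (\<forall>s. 0 \<le> Re s \<longrightarrow>
        row_mult (Phi N (Sdis \<epsilon>) s)
          (E_sg D1 D2 s ((1 - complex_of_real \<epsilon>) * lst Fp s + complex_of_real \<epsilon>))
        = s \<cdot>\<^sub>v u_dis \<epsilon>)"
  \<comment> \<open>quantities of the replace base model; the roots are numbered from 0\<close>
    and E: "E = (\<lambda>s. E_sg D1 D2 s (poly q s / poly p s))"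
    and roots: "inj_on sr {..<N}" "{s. 0 \<le> Re s \<and> det (E s) = 0} = sr ` {..<N}"
      "sr 0 = 0" "\<forall>i\<in>{1..<N}. 0 < Re (sr i)"
    and simple_roots: "\<forall>i\<in>{1..<N}. deriv (\<lambda>s. det (E s)) (sr i) \<noteq> 0"
    and m: "\<forall>i\<in>{1..<N}. m i < N \<and> a_vec E (sr i) (m i) \<noteq> 0\<^sub>v N"
    and u: "u \<in> carrier_vec N"
      "u \<bullet> cvec (Lam_inv D1 D2 *\<^sub>v ones N) = complex_of_real (drift D1 D2 \<pi> \<mu>p)"
      "\<forall>i\<in>{1..<N}. u \<bullet> a_vec E (sr i) (m i) = 0"
    and u_unique: "\<forall>u'\<in>carrier_vec N.
      u' \<bullet> cvec (Lam_inv D1 D2 *\<^sub>v ones N) = complex_of_real (drift D1 D2 \<pi> \<mu>p) \<and>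
      (\<forall>i\<in>{1..<N}. u' \<bullet> a_vec E (sr i) (m i) = 0) \<longrightarrow> u' = u"
    and r: "r = p_exponent D1 D2 \<omega>"
    and xy_pos: "\<forall>j\<in>{1..r * M}. 0 < Re (x j) \<and> 0 < Re (y j)"
    and x: "\<forall>s. poly p s \<noteq> 0 \<longrightarrow> poly p s ^ r * det (E s)
      = s * (\<Prod>k\<in>{1..<N}. s - sr k) * (\<Prod>j\<in>{1..r * M}. s + x j)"
    and y: "\<forall>s. poly p s \<noteq> 0 \<longrightarrow> poly p s ^ r * (s * (u \<bullet> (adj_mat (E s) *\<^sub>v cvec \<omega>)))
      = (u \<bullet> cvec \<omega>) * s * (\<Prod>k\<in>{1..<N}. s - sr k) * (\<Prod>j\<in>{1..r * M}. s + y j)"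
  \<comment> \<open>the vectors z for the mixture and the discard base model\<close>
    and A: "A = A_mat N (cvec (Lam_inv D1 D2 *\<^sub>v ones N)) E sr m"
    and K: "K = (\<lambda>s. (s * (complex_of_real \<mu>p * excess_lst \<mu>p (\<lambda>t. poly q t / poly p t) s
        - complex_of_real \<mu>h * excess_lst \<mu>h (lst Fh) s)) \<cdot>\<^sub>m cmat (Q2PLam D1 D2))"
    and Kd: "Kd = (\<lambda>s. (s * complex_of_real \<mu>p * excess_lst \<mu>p (\<lambda>t. poly q t / poly p t) s)
        \<cdot>\<^sub>m cmat (Q2PLam D1 D2))"
    and z: "z = z_vec (first_vec N (drift D1 D2 \<pi> \<mu>p)) A (B_mat N E K sr m)
        (first_vec N ((\<mu>p - \<mu>h) * (\<pi> \<bullet> (Q2P D1 D2 *\<^sub>v ones N))))"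
    and zd: "zd = z_vec (first_vec N (drift D1 D2 \<pi> \<mu>p)) A (B_mat N E Kd sr m)
        (first_vec N (\<mu>p * (\<pi> \<bullet> (Q2P D1 D2 *\<^sub>v ones N))))"
  \<comment> \<open>the distinct numbers among the y's and their multiplicities\<close>
    and yd: "bij_betw yd {1..\<sigma>} (y ` {1..r * M})"
    and rr: "\<forall>j\<in>{1..\<sigma>}. rr j = card {i\<in>{1..r * M}. y i = yd j}"
begin

lemma arr: "arrival_process N D1 D2" and rts: "\<forall>i<N. 0 < rate D1 D2 i"
  using arrivals rates by auto

lemma N0: "0 < N"
  using arrivals by (simp add: arrival_process_def)

lemmas E_sg_carrier = E_sg_carrier[OF arr rts] and QL_carrier = QL_carrier[OF arr rts]
  and le_carrier = le_carrier[OF arr rts] and dimN = dimN[OF arr rts]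
  and cpi = cpi[OF arr rts pi] and pi_facts = pi_facts[OF arr rts pi]

abbreviation Q where "Q \<equiv> cmat (Q2PLam D1 D2)"
abbreviation lv where "lv \<equiv> cvec (Lam_inv D1 D2 *\<^sub>v ones N)"

definition f :: "complex \<Rightarrow> complex" where "f s = poly q s / poly p s"

lemma p_nonzero: "p \<noteq> 0"
  using Fp_rational(3) by auto

lemma p_root_free: "0 \<le> Re s \<Longrightarrow> poly p s \<noteq> 0"
  by (rule rational_lst_denominator[OF Fp(1) Fp_rational(1,2) _ p_nonzero])

lemma f_lst: "0 \<le> Re s \<Longrightarrow> f s = lst Fp s"
  using Fp_rational(1) by (simp add: f_def)

lemma f_0: "f 0 = 1"
  using f_lst[of 0] lst_0[OF Fp(1)] by simp

lemma E_eq: "E s = E_sg D1 D2 s (f s)"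
  by (simp add: E f_def)

lemma E_carrier: "E s \<in> carrier_mat N N"
  unfolding E_eq by (rule E_sg_carrier)

definition f' :: "complex \<Rightarrow> complex" where
  "f' s = (poly (pderiv q) s * poly p s - poly q s * poly (pderiv p) s) / (poly p s * poly p s)"

definition E' :: "complex \<Rightarrow> complex mat" where "E' s = 1\<^sub>m N + f' s \<cdot>\<^sub>m Q"

lemma f_deriv: "0 \<le> Re s \<Longrightarrow> (f has_field_derivative f' s) (at s)"
  unfolding f_def[abs_def] f'_def using p_root_free by (intro DERIV_divide poly_DERIV) auto

lemma E_deriv: "0 \<le> Re s \<Longrightarrow> has_mat_deriv N E (E' s) s"
  unfolding E'_def using E_sg_deriv_s[OF arr rts f_deriv[of s]] by (simp add: E_eq[abs_def])

lemma E_0: "E 0 = E_sg D1 D2 0 1"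
  by (simp add: E_eq f_0)

lemma sr_pos: "i \<in> {1..<N} \<Longrightarrow> 0 < Re (sr i)"
  using roots(4) by simp

lemma sr_root: "i < N \<Longrightarrow> det (E (sr i)) = 0"
  using roots(2) by auto

lemma det_nonzero: "0 \<le> Re s \<Longrightarrow> s \<noteq> 0 \<Longrightarrow> s \<notin> sr ` {1..<N} \<Longrightarrow> det (E s) \<noteq> 0"
proof
  assume s: "0 \<le> Re s" "s \<noteq> 0" "s \<notin> sr ` {1..<N}" and "det (E s) = 0"
  then obtain i where i: "i < N" "s = sr i" using roots(2) by blast
  then show False using s roots(3) by (cases "i = 0") auto
qed

lemma sr_simple:
  assumes i: "i \<in> {1..<N}"
  shows "col_subst_sum (E (sr i)) (E' (sr i)) \<noteq> 0"
proof -
  have "((\<lambda>s. det (E s)) has_field_derivative col_subst_sum (E (sr i)) (E' (sr i))) (at (sr i))"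
    using sr_pos[OF i] by (intro has_field_derivative_det[OF E_deriv]) simp
  from DERIV_imp_deriv[OF this] show ?thesis using simple_roots i by auto
qed

text \<open>
  If \<open>A\<close> were singular, then adding a left null vector of \<open>A\<close> to \<open>u\<close> would give a second solution of the
  equations that determine \<open>u\<close>.
\<close>

lemma det_A: "det A \<noteq> 0"
proof
  assume "det A = 0"
  have cA: "A \<in> carrier_mat N N" by (simp add: A A_mat_def)
  have "det (transpose_mat A) = 0" using \<open>det A = 0\<close> det_transpose[OF cA] by simp
  then obtain v where v: "v \<in> carrier_vec N" "v \<noteq> 0\<^sub>v N" "transpose_mat A *\<^sub>v v = 0\<^sub>v N"
    using det_0_iff_vec_prod_zero[of "transpose_mat A" N] cA by auto
  have e: "(if i = 0 then v \<bullet> lv else v \<bullet> a_vec E (sr i) (m i)) = 0" if "i < N" for i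
    using row_mult_A_mat[where E = E and sr = sr and m = m, OF E_carrier le_carrier v(1) that] v(3) that
    by (simp add: A row_mult_def)
  have add: "(u + v) \<bullet> w = u \<bullet> w + v \<bullet> w" if "w \<in> carrier_vec N" for w
    using that u(1) v(1) by (intro add_scalar_prod_distrib) auto
  have "u + v = u"
  proof (rule u_unique[rule_format, OF _ conjI])
    show "u + v \<in> carrier_vec N" using u(1) v(1) by simp
    show "(u + v) \<bullet> lv = complex_of_real (drift D1 D2 \<pi> \<mu>p)"
      using add[OF le_carrier] u(2) e[of 0] N0 by simp
    show "\<forall>i\<in>{1..<N}. (u + v) \<bullet> a_vec E (sr i) (m i) = 0"
    proof
      fix i assume i: "i \<in> {1..<N}"
      have "a_vec E (sr i) (m i) \<in> carrier_vec N"
        unfolding a_vec_def using m i by (intro col_carrier_vec[OF _ adj_mat(1)[OF E_carrier]]) auto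
      then show "(u + v) \<bullet> a_vec E (sr i) (m i) = 0"
        using add u(3) i e[of i] by auto
    qed
  qed
  then have "v = 0\<^sub>v N"
    using u(1) v(1) by (intro eq_vecI) (auto dest: arg_cong[of _ _ "\<lambda>w. w $ _"] simp: vec_eq_iff)
  then show False using v(2) by simp
qed

subsection \<open>The origin\<close>

text \<open>
  The factorization of \<open>p\<^sup>r det E\<close> contains the factor \<open>s\<close> exactly once.
\<close>

lemma det_deriv_0: "col_subst_sum (E 0) (E' 0) \<noteq> 0"
proof -
  define G where "G = (\<lambda>s. (\<Prod>k\<in>{1..<N}. s - sr k) * (\<Prod>j\<in>{1..r * M}. s + x j))"
  have G0: "G 0 \<noteq> 0"
    using sr_pos xy_pos by (force simp: G_def)
  have "(\<lambda>s. det (E s)) \<midarrow>0\<rightarrow> det (E 0)"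
    using has_field_derivative_det[OF E_deriv[of 0]] DERIV_isCont isCont_def by fastforce
  have "((\<lambda>s. (det (E s) - det (E 0)) / (s - 0)) \<longlongrightarrow> col_subst_sum (E 0) (E' 0)) (at 0)"
    using has_field_derivative_det[OF E_deriv[of 0]] by (simp add: has_field_derivative_iff)
  moreover have "det (E 0) = 0" using sr_root[OF N0] roots(3) by simp
  ultimately have "((\<lambda>s. poly p s ^ r * (det (E s) / s)) \<longlongrightarrow> poly p 0 ^ r * col_subst_sum (E 0) (E' 0)) (at 0)"
    by (intro tendsto_mult tendsto_power) (auto simp: isCont_def[symmetric])
  moreover have "eventually (\<lambda>s. poly p s ^ r * (det (E s) / s) = G s) (at 0)"
  proof -
    have "open {s. poly p s \<noteq> 0}" by (intro open_Collect_neq continuous_intros)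
    then have "eventually (\<lambda>s. s \<in> {s. poly p s \<noteq> 0}) (nhds 0)"
      by (rule eventually_nhds_in_open) (use p_root_free[of 0] in simp)
    then show ?thesis unfolding eventually_at_filter
    proof eventually_elim
      case (elim s)
      then show ?case using x[rule_format, of s] by (auto simp: G_def field_simps)
    qed
  qed
  ultimately have "(G \<longlongrightarrow> poly p 0 ^ r * col_subst_sum (E 0) (E' 0)) (at 0)"
    by (rule Lim_transform_eventually)
  moreover have "(G \<longlongrightarrow> G 0) (at 0)"
    unfolding G_def by (intro tendsto_intros)
  ultimately have "G 0 = poly p 0 ^ r * col_subst_sum (E 0) (E' 0)"
    using tendsto_unique[OF at_neq_bot] by blast
  then show ?thesis using G0 by auto
qed

lemma left_kernel_0: "row_mult (cvec \<pi>) (E 0) = 0\<^sub>v N"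
  unfolding E_0 by (rule pi_E_sg_0_1[OF arr rts pi])

text \<open>
  Otherwise the differentiated adjugate identity at 0, multiplied by \<open>\<pi>\<close> from the left, would read
  \<open>0 = det' \<pi>\<close>.
\<close>

lemma adj_0_nonzero: "adj_mat (E 0) \<noteq> 0\<^sub>m N N"
proof
  assume z: "adj_mat (E 0) = 0\<^sub>m N N"
  note d = E_deriv[of 0, simplified]
  note cE' = has_mat_derivD(2)[OF d] and cA' = adj_diff_carrier[OF E_carrier, of 0 "E' 0"]
  have "E' 0 * adj_mat (E 0) = 0\<^sub>m N N" unfolding z using cE' by simp
  then have "E 0 * adj_diff (E 0) (E' 0) = col_subst_sum (E 0) (E' 0) \<cdot>\<^sub>m 1\<^sub>m N"
    using adj_deriv_identities(1)[OF d] left_add_zero_mat[OF mult_carrier_mat[OF E_carrier cA']] by simp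
  then have "col_subst_sum (E 0) (E' 0) \<cdot>\<^sub>v cvec \<pi> = row_mult (row_mult (cvec \<pi>) (E 0)) (adj_diff (E 0) (E' 0))"
    unfolding row_mult_assoc[OF E_carrier cpi cA'] using row_mult_smult_one[OF cpi] by simp
  also have "\<dots> = 0\<^sub>v N" unfolding left_kernel_0 by (rule row_mult_zero_left[OF cA'])
  finally have z': "col_subst_sum (E 0) (E' 0) \<cdot>\<^sub>v cvec \<pi> = 0\<^sub>v N" .
  have "cvec \<pi> $ i = 0" if i: "i < N" for i
  proof -
    have "i < dim_vec (cvec \<pi>)" unfolding carrier_vecD[OF cpi] by (rule i)
    then have "(col_subst_sum (E 0) (E' 0) \<cdot>\<^sub>v cvec \<pi>) $ i = col_subst_sum (E 0) (E' 0) * cvec \<pi> $ i"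
      by (rule index_smult_vec(1))
    then have "col_subst_sum (E 0) (E' 0) * cvec \<pi> $ i = 0" unfolding z' using i by simp
    then show ?thesis using det_deriv_0 unfolding mult_eq_0_iff by blast
  qed
  then have "cvec \<pi> = 0\<^sub>v N" using carrier_vecD[OF cpi] by (intro eq_vecI) auto
  then show False using cpi_nonzero[OF arr rts pi] by simp
qed

lemma left_kernel_unique:
  assumes "a \<in> carrier_vec N" "row_mult a (E 0) = 0\<^sub>v N"
  obtains k where "a = k \<cdot>\<^sub>v cvec \<pi>"
  using adj_nonzero_left_kernel[OF E_carrier adj_0_nonzero assms cpi left_kernel_0 cpi_nonzero[OF arr rts pi]] .

text \<open>
  The rows of \<open>adj E(0)\<close> are left null vectors of \<open>E(0)\<close>, hence multiples of \<open>\<pi>\<close>.  That its columns are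
  multiples of \<open>\<Lambda>\<^sup>-\<^sup>1 e\<close> follows from the differentiated adjugate identity applied to \<open>\<Lambda>\<^sup>-\<^sup>1 e\<close>.
\<close>

lemma adj_0:
  obtains \<kappa> where "\<kappa> \<noteq> 0" "\<And>w. w \<in> carrier_vec N \<Longrightarrow> adj_mat (E 0) *\<^sub>v w = ((cvec \<pi> \<bullet> w) * \<kappa>) \<cdot>\<^sub>v lv"
proof -
  let ?a = "adj_mat (E 0)"
  note ca = adj_mat(1)[OF E_carrier, of 0]
  have det0: "det (E 0) = 0" using sr_root[OF N0] roots(3) by simp
  have "\<exists>k. row ?a j = k \<cdot>\<^sub>v cvec \<pi>" if j: "j < N" for j
  proof -
    have "row_mult (row ?a j) (E 0) = 0\<^sub>v N"
    proof (rule eq_vecI)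
      fix i assume "i < dim_vec (0\<^sub>v N :: complex vec)"
      then have i: "i < N" by simp
      have "row_mult (row ?a j) (E 0) $ i = (\<Sum>k<N. row ?a j $ k * E 0 $$ (k, i))"
        by (rule index_row_mult[OF E_carrier row_carrier_vec[OF j ca] i])
      also have "\<dots> = (?a * E 0) $$ (j, i)"
        unfolding mult_mat_index[OF ca E_carrier j i] using j ca by (intro sum.cong) auto
      finally show "row_mult (row ?a j) (E 0) $ i = 0\<^sub>v N $ i"
        unfolding adj_mat(3)[OF E_carrier] det0 using i j by simp
    qed (use carrier_matD[OF E_carrier, of 0] in simp)
    from left_kernel_unique[OF row_carrier_vec[OF j ca] this] show ?thesis by blast
  qed
  then obtain k where k: "\<And>j. j < N \<Longrightarrow> row ?a j = k j \<cdot>\<^sub>v cvec \<pi>" by metis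
  define kv where "kv = vec N k"
  have ckv: "kv \<in> carrier_vec N" by (simp add: kv_def)
  have mult: "?a *\<^sub>v w = (cvec \<pi> \<bullet> w) \<cdot>\<^sub>v kv" if w: "w \<in> carrier_vec N" for w
  proof (rule eq_vecI)
    fix j assume "j < dim_vec ((cvec \<pi> \<bullet> w) \<cdot>\<^sub>v kv)"
    then have j: "j < N" by (simp add: kv_def)
    have "(?a *\<^sub>v w) $ j = row ?a j \<bullet> w" using j carrier_matD[OF ca] by simp
    also have "\<dots> = k j * (cvec \<pi> \<bullet> w)" unfolding k[OF j] by (rule smult_scalar_prod_distrib[OF cpi w])
    finally show "(?a *\<^sub>v w) $ j = ((cvec \<pi> \<bullet> w) \<cdot>\<^sub>v kv) $ j" using j by (simp add: kv_def)
  qed (use carrier_matD[OF ca] in \<open>simp add: kv_def\<close>)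
  note d = E_deriv[of 0, simplified]
  note cE' = has_mat_derivD(2)[OF d] and cA' = adj_diff_carrier[OF E_carrier, of 0 "E' 0"]
  let ?t = "col_subst_sum (E 0) (E' 0)"
  have El: "E 0 *\<^sub>v lv = 0\<^sub>v N" unfolding E_0 by (rule E_sg_0_1_right[OF arr rts])
  have "?t \<cdot>\<^sub>v lv = (?t \<cdot>\<^sub>m 1\<^sub>m N) *\<^sub>v lv" 
    by (rule smult_one_mult_vec[OF le_carrier, symmetric])
  also have "\<dots> = (adj_diff (E 0) (E' 0) * E 0 + ?a * E' 0) *\<^sub>v lv"
    unfolding adj_deriv_identities(2)[OF d] ..
  also have "\<dots> = (adj_diff (E 0) (E' 0) * E 0) *\<^sub>v lv + (?a * E' 0) *\<^sub>v lv"
    by (rule add_mult_distrib_mat_vec[OF mult_carrier_mat[OF cA' E_carrier] mult_carrier_mat[OF ca cE'] le_carrier])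
  also have "(adj_diff (E 0) (E' 0) * E 0) *\<^sub>v lv = adj_diff (E 0) (E' 0) *\<^sub>v (E 0 *\<^sub>v lv)"
    by (rule assoc_mult_mat_vec[OF cA' E_carrier le_carrier])
  also have "\<dots> = 0\<^sub>v N" unfolding El using cA' by (intro eq_vecI) auto
  also have "(?a * E' 0) *\<^sub>v lv = ?a *\<^sub>v (E' 0 *\<^sub>v lv)"
    by (rule assoc_mult_mat_vec[OF ca cE' le_carrier])
  also have "\<dots> = (cvec \<pi> \<bullet> (E' 0 *\<^sub>v lv)) \<cdot>\<^sub>v kv"
    by (rule mult[OF mult_mat_vec_carrier[OF cE' le_carrier]])
  finally have e: "?t \<cdot>\<^sub>v lv = (cvec \<pi> \<bullet> (E' 0 *\<^sub>v lv)) \<cdot>\<^sub>v kv" using ckv by simp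
  define c where "c = cvec \<pi> \<bullet> (E' 0 *\<^sub>v lv)"
  have ei: "?t * lv $ i = c * kv $ i" if "i < N" for i
    using arg_cong[OF e, of "\<lambda>v. v $ i"] that carrier_vecD[OF le_carrier] carrier_vecD[OF ckv] by (simp add: c_def)
  have l0: "lv $ 0 \<noteq> 0" using le_index[OF arr rts N0] rts N0 by auto
  have c0: "c \<noteq> 0" using ei[OF N0] l0 det_deriv_0 by auto
  have kl: "kv = (?t / c) \<cdot>\<^sub>v lv"
  proof (rule eq_vecI)
    fix i assume "i < dim_vec ((?t / c) \<cdot>\<^sub>v lv)"
    then have i: "i < N" using carrier_vecD[OF le_carrier] by simp
    show "kv $ i = ((?t / c) \<cdot>\<^sub>v lv) $ i" using ei[OF i] c0 i carrier_vecD[OF le_carrier] by (simp add: field_simps)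
  qed (use carrier_vecD[OF le_carrier] in \<open>simp add: kv_def\<close>)
  show ?thesis
  proof (rule that[of "?t / c"])
    show "?t / c \<noteq> 0" using c0 det_deriv_0 by simp
    fix w :: "complex vec" assume w: "w \<in> carrier_vec N"
    show "?a *\<^sub>v w = ((cvec \<pi> \<bullet> w) * (?t / c)) \<cdot>\<^sub>v lv"
      unfolding mult[OF w] kl by (simp add: smult_smult_assoc)
  qed
qed

lemma omega_facts: "\<omega> \<in> carrier_vec N" "cvec \<omega> \<in> carrier_vec N" "cvec \<pi> \<bullet> cvec \<omega> = 1"
proof -
  note o = pi_omega[OF arr rts pi irred real_customers, folded omega]
  show "\<omega> \<in> carrier_vec N" by (rule o(1))
  then show "cvec \<omega> \<in> carrier_vec N" by simp
  show "cvec \<pi> \<bullet> cvec \<omega> = 1" using cvec_scalar[OF arr rts o(1) pi_facts(1)] o(2) by simp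
qed

lemma adj_omega_carrier: "adj_mat (E s) *\<^sub>v cvec \<omega> \<in> carrier_vec N"
  by (rule mult_mat_vec_carrier[OF adj_mat(1)[OF E_carrier] omega_facts(2)])

text \<open>
  The common denominator of the coefficient functions: by \<open>u_adj_omega\<close> it is, up to a constant, the
  numerator of \<open>u adj E \<omega>\<close>.
\<close>

definition den :: "complex \<Rightarrow> complex" where
  "den s = (\<Prod>k\<in>{1..<N}. s - sr k) * (\<Prod>j\<in>{1..\<sigma>}. (s + yd j) ^ rr j)"

lemma yd_facts: "inj_on yd {1..\<sigma>}" "\<And>j. j \<in> {1..\<sigma>} \<Longrightarrow> 0 < Re (yd j)"
proof -
  show "inj_on yd {1..\<sigma>}" using yd by (simp add: bij_betw_def)
  fix j assume "j \<in> {1..\<sigma>}"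
  then have "yd j \<in> y ` {1..r * M}" using yd by (auto simp: bij_betw_def)
  then show "0 < Re (yd j)" using xy_pos by auto
qed

lemma den_y: "den s = (\<Prod>k\<in>{1..<N}. s - sr k) * (\<Prod>j\<in>{1..r * M}. s + y j)"
proof -
  have "(\<Prod>j\<in>{1..r * M}. s + y j) = (\<Prod>v\<in>y ` {1..r * M}. \<Prod>i\<in>{i\<in>{1..r * M}. y i = v}. s + y i)"
    by (rule prod.image_gen) simp
  also have "\<dots> = (\<Prod>v\<in>y ` {1..r * M}. (s + v) ^ card {i\<in>{1..r * M}. y i = v})"
    by (intro prod.cong refl) simp
  also have "\<dots> = (\<Prod>j\<in>{1..\<sigma>}. (s + yd j) ^ card {i\<in>{1..r * M}. y i = yd j})"
    using prod.reindex_bij_betw[OF yd, of "\<lambda>v. (s + v) ^ card {i\<in>{1..r * M}. y i = v}"] by simp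
  finally show ?thesis using rr by (simp add: den_def)
qed

lemma sum_rr: "(\<Sum>j\<in>{1..\<sigma>}. rr j) = r * M"
proof -
  have "(\<Sum>j\<in>{1..r * M}. 1::nat) = (\<Sum>v\<in>y ` {1..r * M}. \<Sum>i\<in>{i\<in>{1..r * M}. y i = v}. 1)"
    by (rule sum.image_gen) simp
  also have "\<dots> = (\<Sum>v\<in>y ` {1..r * M}. card {i\<in>{1..r * M}. y i = v})" by simp
  also have "\<dots> = (\<Sum>j\<in>{1..\<sigma>}. card {i\<in>{1..r * M}. y i = yd j})"
    using sum.reindex_bij_betw[OF yd, of "\<lambda>v. card {i\<in>{1..r * M}. y i = v}"] by simp
  finally show ?thesis using rr by simp
qed

lemma not_pole: "0 \<le> Re s \<Longrightarrow> j \<in> {1..\<sigma>} \<Longrightarrow> s + yd j \<noteq> 0"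
  using yd_facts(2)[of j] by (auto dest: arg_cong[of _ _ Re])

lemma den_nonzero: "0 \<le> Re s \<Longrightarrow> s \<notin> sr ` {1..<N} \<Longrightarrow> den s \<noteq> 0"
  using not_pole by (auto simp: den_def)

lemma zero_not_root: "0 \<notin> sr ` {1..<N}"
  using sr_pos by force

lemma u_adj_omega:
  assumes s: "0 \<le> Re s" "s \<noteq> 0"
  shows "u \<bullet> (adj_mat (E s) *\<^sub>v cvec \<omega>) = (u \<bullet> cvec \<omega>) * den s / poly p s ^ r"
proof -
  have p: "poly p s \<noteq> 0" by (rule p_root_free[OF s(1)])
  then have "s * (poly p s ^ r * (u \<bullet> (adj_mat (E s) *\<^sub>v cvec \<omega>))) = s * ((u \<bullet> cvec \<omega>) * den s)"
    using y[rule_format, OF p] unfolding den_y by (simp add: mult_ac)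
  then have "poly p s ^ r * (u \<bullet> (adj_mat (E s) *\<^sub>v cvec \<omega>)) = (u \<bullet> cvec \<omega>) * den s"
    using s(2) by simp
  then show ?thesis using p by (simp add: field_simps)
qed

text \<open>
  If \<open>u \<omega>\<close> vanished, so would \<open>u adj E \<omega>\<close> on the positive axis and, by continuity, at the origin.
  There it is a nonzero multiple of \<open>u \<Lambda>\<^sup>-\<^sup>1 e\<close>, which is positive by stability.
\<close>

lemma u_omega_nonzero: "u \<bullet> cvec \<omega> \<noteq> 0"
proof
  assume z: "u \<bullet> cvec \<omega> = 0"
  obtain \<kappa> where \<kappa>: "\<kappa> \<noteq> 0" "\<And>w. w \<in> carrier_vec N \<Longrightarrow> adj_mat (E 0) *\<^sub>v w = ((cvec \<pi> \<bullet> w) * \<kappa>) \<cdot>\<^sub>v lv"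
    using adj_0 by blast
  have dA: "has_mat_deriv N (\<lambda>s. adj_mat (E s)) (adj_diff (E 0) (E' 0)) 0"
    by (rule has_mat_deriv_adj[OF E_deriv]) simp
  have lim: "((\<lambda>s. u \<bullet> (adj_mat (E s) *\<^sub>v cvec \<omega>)) \<longlongrightarrow> u \<bullet> (adj_mat (E 0) *\<^sub>v cvec \<omega>)) (at 0)"
    unfolding scalar_index[OF adj_omega_carrier]
  proof (intro tendsto_sum tendsto_mult tendsto_const)
    fix i assume "i \<in> {..<N}"
    then have i: "i < N" by simp
    show "((\<lambda>s. (adj_mat (E s) *\<^sub>v cvec \<omega>) $ i) \<longlongrightarrow> (adj_mat (E 0) *\<^sub>v cvec \<omega>) $ i) (at 0)"
      unfolding mat_vec_index[OF adj_mat(1)[OF E_carrier] omega_facts(2) i]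
      using DERIV_isCont[OF has_mat_derivD(3)[OF dA i]]
      by (intro tendsto_sum tendsto_mult tendsto_const) (auto simp: isCont_def)
  qed
  have "((\<lambda>t::real. u \<bullet> (adj_mat (E (complex_of_real t)) *\<^sub>v cvec \<omega>)) \<longlongrightarrow> u \<bullet> (adj_mat (E 0) *\<^sub>v cvec \<omega>)) (at_right 0)"
  proof (rule filterlim_compose[OF lim])
    have "((\<lambda>t::real. complex_of_real t) \<longlongrightarrow> 0) (at_right 0)" by (auto intro!: tendsto_eq_intros)
    moreover have "eventually (\<lambda>t::real. complex_of_real t \<noteq> 0) (at_right 0)"
      by (rule eventually_mono[OF eventually_at_right_less]) simp
    ultimately show "filterlim complex_of_real (at 0) (at_right 0)" by (simp add: filterlim_at)
  qed
  moreover have "eventually (\<lambda>t::real. u \<bullet> (adj_mat (E (complex_of_real t)) *\<^sub>v cvec \<omega>) = 0) (at_right 0)"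
    using eventually_at_right_less[of 0] by eventually_elim (use u_adj_omega z in simp)
  ultimately have "((\<lambda>t::real. 0) \<longlongrightarrow> u \<bullet> (adj_mat (E 0) *\<^sub>v cvec \<omega>)) (at_right 0)"
    by (rule Lim_transform_eventually)
  then have "u \<bullet> (adj_mat (E 0) *\<^sub>v cvec \<omega>) = 0" by (simp add: tendsto_const_iff)
  then have "\<kappa> * complex_of_real (drift D1 D2 \<pi> \<mu>p) = 0"
    unfolding \<kappa>(2)[OF omega_facts(2)] omega_facts(3) using scalar_prod_smult_distrib[OF u(1) le_carrier] u(2) by simp
  then show False using \<kappa>(1) stable_base by simp
qed

subsection \<open>The two perturbed models\<close>

text \<open>
  A left null vector of \<open>E(0)\<close> is a multiple of \<open>\<pi>\<close>, and the components of \<open>Phi\<close> at 0 sum to 1.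
\<close>

lemma Phi_0:
  assumes F: "prob_space F" "sets F = sets borel" "AE x in F. 0 \<le> x" and S: "stationary_law N D1 D2 F S"
    and eq: "row_mult (Phi N S 0) (E 0) = 0\<^sub>v N"
  shows "Phi N S 0 = cvec \<pi>"
proof -
  note ctx = arr rts F S
  obtain k where k: "Phi N S 0 = k \<cdot>\<^sub>v cvec \<pi>"
    using left_kernel_unique[OF Phi_carrier[OF ctx] eq] by blast
  have ki: "Phi N S 0 $ i = k * complex_of_real (\<pi> $ i)" if "i < N" for i
    unfolding k using that carrier_vecD[OF pi_facts(1)] by simp
  have "1 = (\<Sum>i<N. Phi N S 0 $ i)" using sum_Phi_0[OF ctx] by simp
  also have "\<dots> = (\<Sum>i<N. k * complex_of_real (\<pi> $ i))" using ki by (intro sum.cong) auto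
  also have "\<dots> = k * complex_of_real (\<Sum>i<N. \<pi> $ i)" by (simp add: sum_distrib_left)
  finally have "k = 1" unfolding pi_facts(3) by simp
  then show ?thesis unfolding k by simp
qed

text \<open>
  The perturbations \<open>K\<close> and \<open>K\<^sup>\<bullet>\<close> with \<open>s \<mu> F\<^sup>e(s)\<close> rewritten as \<open>1 - F(s)\<close>.
\<close>

definition K2 :: "complex \<Rightarrow> complex mat" where "K2 s = (lst Fh s - f s) \<cdot>\<^sub>m Q"
definition Kd2 :: "complex \<Rightarrow> complex mat" where "Kd2 s = (1 - f s) \<cdot>\<^sub>m Q"

lemma excess_p: "0 \<le> Re s \<Longrightarrow> s * (complex_of_real \<mu>p * excess_lst \<mu>p (\<lambda>t. poly q t / poly p t) s) = 1 - f s"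
proof -
  assume s: "0 \<le> Re s"
  have "excess_lst \<mu>p (\<lambda>t. poly q t / poly p t) s = excess_lst \<mu>p (lst Fp) s"
    unfolding excess_lst_def f_lst[OF s, symmetric] f_def ..
  then show "s * (complex_of_real \<mu>p * excess_lst \<mu>p (\<lambda>t. poly q t / poly p t) s) = 1 - f s"
    using lst_excess[OF Fp(1) s, folded Fp(3)] f_lst[OF s] by simp
qed

lemma excess_h: "0 \<le> Re s \<Longrightarrow> s * (complex_of_real \<mu>h * excess_lst \<mu>h (lst Fh) s) = 1 - lst Fh s"
  using lst_excess[OF Fh(1), of s] Fh(3) by simp

lemma K_eq: "0 \<le> Re s \<Longrightarrow> K s = K2 s" and Kd_eq: "0 \<le> Re s \<Longrightarrow> Kd s = Kd2 s"
proof -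
  assume s: "0 \<le> Re s"
  have "s * (complex_of_real \<mu>p * excess_lst \<mu>p (\<lambda>t. poly q t / poly p t) s
        - complex_of_real \<mu>h * excess_lst \<mu>h (lst Fh) s) = lst Fh s - f s"
    unfolding right_diff_distrib excess_p[OF s] excess_h[OF s] by simp
  then show "K s = K2 s" unfolding K K2_def by simp
  show "Kd s = Kd2 s" using excess_p[OF s] unfolding Kd Kd2_def by (simp add: mult.assoc)
qed

lemma B_eq: "B_mat N E K sr m = B_mat N E K2 sr m" "B_mat N E Kd sr m = B_mat N E Kd2 sr m"
proof -
  have "K (sr i) = K2 (sr i)" "Kd (sr i) = Kd2 (sr i)" if "i < N" "i \<noteq> 0" for i
    using sr_pos[of i] that by (auto intro!: K_eq Kd_eq)
  then show "B_mat N E K sr m = B_mat N E K2 sr m" "B_mat N E Kd sr m = B_mat N E Kd2 sr m"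
    by (auto simp: B_mat_def delta_def k_vec_def intro!: cong_mat)
qed

lemma scaled_Q_deriv:
  assumes "(\<phi> has_field_derivative \<phi>') (at s)"
  shows "has_mat_deriv N (\<lambda>s. \<phi> s \<cdot>\<^sub>m Q) (\<phi>' \<cdot>\<^sub>m Q) s"
proof (rule has_mat_derivI)
  show "\<phi> t \<cdot>\<^sub>m Q \<in> carrier_mat N N" "\<phi>' \<cdot>\<^sub>m Q \<in> carrier_mat N N" for t
    using QL_carrier by (simp_all only: smult_carrier_mat)
  fix i j assume ij: "i < N" "j < N"
  have e: "(c \<cdot>\<^sub>m Q) $$ (i, j) = c * Q $$ (i, j)" for c
    using ij carrier_matD[OF QL_carrier] by (intro index_smult_mat) auto
  show "((\<lambda>t. (\<phi> t \<cdot>\<^sub>m Q) $$ (i, j)) has_field_derivative (\<phi>' \<cdot>\<^sub>m Q) $$ (i, j)) (at s)"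
    unfolding e using assms by (rule DERIV_cmult_right)
qed

lemma K2_deriv: "i \<in> {1..<N} \<Longrightarrow> has_mat_deriv N K2 ((deriv (lst Fh) (sr i) - f' (sr i)) \<cdot>\<^sub>m Q) (sr i)"
  and Kd2_deriv: "i \<in> {1..<N} \<Longrightarrow> has_mat_deriv N Kd2 ((0 - f' (sr i)) \<cdot>\<^sub>m Q) (sr i)"
proof -
  assume "i \<in> {1..<N}"
  then have s: "0 < Re (sr i)" by (rule sr_pos)
  have "(lst Fh has_field_derivative deriv (lst Fh) (sr i)) (at (sr i))"
    using s by (intro holomorphic_derivI[OF lst_holomorphic[OF Fh(1)]]) (auto simp: open_halfspace_Re_gt)
  then show "has_mat_deriv N K2 ((deriv (lst Fh) (sr i) - f' (sr i)) \<cdot>\<^sub>m Q) (sr i)"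
    unfolding K2_def[abs_def] using f_deriv[of "sr i"] s by (intro scaled_Q_deriv DERIV_diff) auto
  show "has_mat_deriv N Kd2 ((0 - f' (sr i)) \<cdot>\<^sub>m Q) (sr i)"
    unfolding Kd2_def[abs_def] using f_deriv[of "sr i"] s by (intro scaled_Q_deriv DERIV_diff DERIV_const) auto
qed

lemma perturbed_matrix: "E_sg D1 D2 s (f s + complex_of_real \<epsilon> * c) = E s + complex_of_real \<epsilon> \<cdot>\<^sub>m (c \<cdot>\<^sub>m Q)"
proof -
  have "complex_of_real \<epsilon> \<cdot>\<^sub>m (c \<cdot>\<^sub>m Q) = (complex_of_real \<epsilon> * c) \<cdot>\<^sub>m Q" by (intro eq_matI) auto
  then show ?thesis unfolding E_sg_add[OF arr rts] E_eq by simp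
qed

lemma eps_bounds: "0 < \<epsilon> \<Longrightarrow> \<epsilon> < \<epsilon>0 \<Longrightarrow> 0 \<le> \<epsilon> \<and> \<epsilon> \<le> 1"
  using eps0 by simp

lemma mixture_law:
  assumes "0 < \<epsilon>" "\<epsilon> < \<epsilon>0" and H: "service_law H"
  shows "prob_space (mix \<epsilon> Fp H)" "sets (mix \<epsilon> Fp H) = sets borel" "AE x in mix \<epsilon> Fp H. 0 \<le> x"
  using prob_space_mix sets_mix AE_mix_nonneg service_lawD[OF Fp(1)] service_lawD[OF H] eps_bounds[OF assms(1,2)]
  by blast+

lemma dirac_law: "service_law (return borel (0::real))"
  unfolding service_law_def
proof (intro conjI)
  show "prob_space (return borel (0::real))" by (rule prob_space_return) simp
  show "AE x in return borel (0::real). 0 \<le> x" by (subst AE_return) auto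
  show "integrable (return borel (0::real)) (\<lambda>x. x)"
    by (rule integrableI_bounded) (simp_all add: nn_integral_return)
qed simp

lemma excess_rate:
  "((\<lambda>t. (1 - (f (complex_of_real t) + complex_of_real \<epsilon> * (\<phi> (complex_of_real t) - f (complex_of_real t)))) / complex_of_real t)
    \<longlongrightarrow> complex_of_real ((1 - \<epsilon>) * \<mu>p + \<epsilon> * m0)) (at_right 0)"
  if "((\<lambda>t. (1 - \<phi> (complex_of_real t)) / complex_of_real t) \<longlongrightarrow> complex_of_real m0) (at_right 0)"
proof -
  have "((\<lambda>t. (1 - complex_of_real \<epsilon>) * ((1 - lst Fp (complex_of_real t)) / complex_of_real t)
      + complex_of_real \<epsilon> * ((1 - \<phi> (complex_of_real t)) / complex_of_real t))
    \<longlongrightarrow> (1 - complex_of_real \<epsilon>) * complex_of_real \<mu>p + complex_of_real \<epsilon> * complex_of_real m0) (at_right 0)"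
    unfolding Fp(3) by (intro tendsto_intros lst_deriv_at_0[OF Fp(1)] that)
  moreover have "eventually (\<lambda>t. (1 - complex_of_real \<epsilon>) * ((1 - lst Fp (complex_of_real t)) / complex_of_real t)
      + complex_of_real \<epsilon> * ((1 - \<phi> (complex_of_real t)) / complex_of_real t)
    = (1 - (f (complex_of_real t) + complex_of_real \<epsilon> * (\<phi> (complex_of_real t) - f (complex_of_real t)))) / complex_of_real t) (at_right 0)"
    using eventually_at_right_less[of "0::real"]
  proof eventually_elim
    case (elim t)
    then have "f (complex_of_real t) = lst Fp (complex_of_real t)" by (intro f_lst) simp
    then show ?case using elim by (simp add: field_simps)
  qed
  ultimately show ?thesis by (simp add: Lim_transform_eventually)
qed

lemma drift_mix: "drift D1 D2 \<pi> ((1 - \<epsilon>) * \<mu>p + \<epsilon> * m0)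
    = drift D1 D2 \<pi> \<mu>p + \<epsilon> * ((\<mu>p - m0) * (\<pi> \<bullet> (Q2P D1 D2 *\<^sub>v ones N)))"
  unfolding drift_eq[OF arr rts pi_facts(1)] by (simp add: algebra_simps)

lemma mix_transform:
  assumes e: "0 < \<epsilon>" "\<epsilon> < \<epsilon>0"
  shows "\<exists>c. c \<in> carrier_vec N \<and>
    (\<forall>s. 0 \<le> Re s \<longrightarrow> row_mult (Phi N (Smix \<epsilon>) s) (E s + complex_of_real \<epsilon> \<cdot>\<^sub>m K2 s) = s \<cdot>\<^sub>v c)"
proof -
  note F = mixture_law[OF e Fh(1)]
  have S: "stationary_law N D1 D2 (mix \<epsilon> Fp Fh) (Smix \<epsilon>)" using Smix e by simp
  define g where "g = (\<lambda>s. lst Fp s + complex_of_real \<epsilon> * (lst Fh s - lst Fp s))"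
  obtain c where c: "c \<in> carrier_vec N"
    "\<And>s. 0 \<le> Re s \<Longrightarrow> row_mult (Phi N (Smix \<epsilon>) s) (E_sg D1 D2 s (g s)) = s \<cdot>\<^sub>v c"
  proof (rule stationary_transform[OF arr rts F S, of g])
    show "g holomorphic_on {s. 0 < Re s}"
      unfolding g_def by (intro holomorphic_intros lst_holomorphic Fp(1) Fh(1))
    show "continuous_on {s. 0 \<le> Re s} g"
      unfolding g_def by (intro continuous_intros lst_continuous Fp(1) Fh(1))
    show "g (complex_of_real t) = complex_of_real (LINT b|mix \<epsilon> Fp Fh. exp (- t * b))" if "0 < t" for t
    proof -
      have conv: "a + w * (b - a) = (1 - w) * a + w * b" for a b w :: complex by (simp add: algebra_simps)
      have "0 \<le> \<epsilon>" "\<epsilon> \<le> 1" using eps_bounds[OF e] by auto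
      from LINT_mix[OF Fp(1) Fh(1) this that] show ?thesis
        unfolding g_def lst_real by (simp only: conv of_real_mult of_real_add of_real_diff of_real_1)
    qed
  qed blast
  have "E_sg D1 D2 s (g s) = E s + complex_of_real \<epsilon> \<cdot>\<^sub>m K2 s" if "0 \<le> Re s" for s
    unfolding g_def K2_def perturbed_matrix[symmetric] f_lst[OF that] ..
  then show ?thesis using c by auto
qed

definition U_mix :: "real \<Rightarrow> complex vec" where
  "U_mix \<epsilon> = (SOME c. c \<in> carrier_vec N \<and>
    (\<forall>s. 0 \<le> Re s \<longrightarrow> row_mult (Phi N (Smix \<epsilon>) s) (E s + complex_of_real \<epsilon> \<cdot>\<^sub>m K2 s) = s \<cdot>\<^sub>v c))"

lemma U_mix:
  assumes e: "0 < \<epsilon>" "\<epsilon> < \<epsilon>0"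
  shows "U_mix \<epsilon> \<in> carrier_vec N"
    "0 \<le> Re s \<Longrightarrow> row_mult (Phi N (Smix \<epsilon>) s) (E s + complex_of_real \<epsilon> \<cdot>\<^sub>m K2 s) = s \<cdot>\<^sub>v U_mix \<epsilon>"
  using someI_ex[OF mix_transform[OF e], folded U_mix_def] by auto

lemma u_dis_eq:
  assumes e: "0 < \<epsilon>" "\<epsilon> < \<epsilon>0" and s: "0 \<le> Re s"
  shows "row_mult (Phi N (Sdis \<epsilon>) s) (E s + complex_of_real \<epsilon> \<cdot>\<^sub>m Kd2 s) = s \<cdot>\<^sub>v u_dis \<epsilon>"
proof -
  have "(1 - complex_of_real \<epsilon>) * lst Fp s + complex_of_real \<epsilon> = f s + complex_of_real \<epsilon> * (1 - f s)"
    unfolding f_lst[OF s] by (simp add: algebra_simps)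
  then have "E_sg D1 D2 s ((1 - complex_of_real \<epsilon>) * lst Fp s + complex_of_real \<epsilon>) = E s + complex_of_real \<epsilon> \<cdot>\<^sub>m Kd2 s"
    unfolding Kd2_def by (simp only: perturbed_matrix)
  moreover have "\<epsilon> \<in> {0<..<\<epsilon>0}" using e by simp
  note bspec[OF u_dis this, THEN conjunct2, rule_format, OF s]
  ultimately show ?thesis by (simp only:)
qed

lemma at_zero:
  assumes "0 \<le> Re (0::complex) \<Longrightarrow> row_mult P (E 0 + c \<cdot>\<^sub>m (k \<cdot>\<^sub>m Q)) = 0 \<cdot>\<^sub>v w" "k = 0" "w \<in> carrier_vec N"
  shows "row_mult P (E 0) = 0\<^sub>v N"
proof -
  have "c \<cdot>\<^sub>m (0 \<cdot>\<^sub>m Q) = 0\<^sub>m N N" using carrier_matD[OF QL_carrier] by (intro eq_matI) auto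
  then have "E 0 + c \<cdot>\<^sub>m (k \<cdot>\<^sub>m Q) = E 0" using assms(2) E_carrier[of 0] by simp
  moreover have "0 \<cdot>\<^sub>v w = 0\<^sub>v N" using assms(3) by (intro eq_vecI) auto
  ultimately show ?thesis using assms(1) by simp
qed

lemma Phi_mix_0: "0 < \<epsilon> \<Longrightarrow> \<epsilon> < \<epsilon>0 \<Longrightarrow> Phi N (Smix \<epsilon>) 0 = cvec \<pi>"
proof (rule Phi_0)
  assume e: "0 < \<epsilon>" "\<epsilon> < \<epsilon>0"
  show "prob_space (mix \<epsilon> Fp Fh)" "sets (mix \<epsilon> Fp Fh) = sets borel" "AE x in mix \<epsilon> Fp Fh. 0 \<le> x"
    by (rule mixture_law[OF e Fh(1)])+
  show "stationary_law N D1 D2 (mix \<epsilon> Fp Fh) (Smix \<epsilon>)" using Smix e by simp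
  show "row_mult (Phi N (Smix \<epsilon>) 0) (E 0) = 0\<^sub>v N"
    by (rule at_zero[OF U_mix(2)[OF e, of 0, unfolded K2_def] _ U_mix(1)[OF e]]) (auto simp: f_0 lst_0[OF Fh(1)])
qed

lemma Phi_dis_0: "0 < \<epsilon> \<Longrightarrow> \<epsilon> < \<epsilon>0 \<Longrightarrow> Phi N (Sdis \<epsilon>) 0 = cvec \<pi>"
proof (rule Phi_0)
  assume e: "0 < \<epsilon>" "\<epsilon> < \<epsilon>0"
  show "prob_space (mix \<epsilon> Fp (return borel 0))" "sets (mix \<epsilon> Fp (return borel 0)) = sets borel"
    "AE x in mix \<epsilon> Fp (return borel 0). 0 \<le> x"
    by (rule mixture_law[OF e dirac_law])+
  show "stationary_law N D1 D2 (mix \<epsilon> Fp (return borel 0)) (Sdis \<epsilon>)" using Sdis e by simp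
  show "row_mult (Phi N (Sdis \<epsilon>) 0) (E 0) = 0\<^sub>v N"
    by (rule at_zero[OF u_dis_eq[OF e, of 0, unfolded Kd2_def]]) (use u_dis e in \<open>auto simp: f_0\<close>)
qed

lemma U_mix_drift:
  assumes e: "0 < \<epsilon>" "\<epsilon> < \<epsilon>0"
  shows "U_mix \<epsilon> \<bullet> lv = complex_of_real (drift D1 D2 \<pi> \<mu>p + \<epsilon> * ((\<mu>p - \<mu>h) * (\<pi> \<bullet> (Q2P D1 D2 *\<^sub>v ones N))))"
  unfolding drift_mix[symmetric]
proof (rule transform_constant[OF arr rts pi U_mix(1)[OF e], where \<Phi> = "Phi N (Smix \<epsilon>)"
      and g = "\<lambda>s. f s + complex_of_real \<epsilon> * (lst Fh s - f s)"])
  have S: "stationary_law N D1 D2 (mix \<epsilon> Fp Fh) (Smix \<epsilon>)" using Smix e by simp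
  note ctx = arr rts mixture_law[OF e Fh(1)] S
  show "Phi N (Smix \<epsilon>) s \<in> carrier_vec N" for s by (rule Phi_carrier[OF ctx])
  show "Phi N (Smix \<epsilon>) 0 = cvec \<pi>" by (rule Phi_mix_0[OF e])
  show "continuous_on {s. 0 \<le> Re s} (\<lambda>s. Phi N (Smix \<epsilon>) s $ i)" if "i < N" for i
    by (rule Phi_continuous[OF ctx that])
  show "row_mult (Phi N (Smix \<epsilon>) s) (E_sg D1 D2 s (f s + complex_of_real \<epsilon> * (lst Fh s - f s))) = s \<cdot>\<^sub>v U_mix \<epsilon>"
    if "0 \<le> Re s" for s
    using U_mix(2)[OF e that] unfolding perturbed_matrix K2_def .
  show "((\<lambda>t. (1 - (f (complex_of_real t) + complex_of_real \<epsilon> * (lst Fh (complex_of_real t) - f (complex_of_real t)))) / complex_of_real t)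
    \<longlongrightarrow> complex_of_real ((1 - \<epsilon>) * \<mu>p + \<epsilon> * \<mu>h)) (at_right 0)"
    unfolding Fh(3) by (rule excess_rate[OF lst_deriv_at_0[OF Fh(1)]])
qed

lemma u_dis_drift:
  assumes e: "0 < \<epsilon>" "\<epsilon> < \<epsilon>0"
  shows "u_dis \<epsilon> \<bullet> lv = complex_of_real (drift D1 D2 \<pi> \<mu>p + \<epsilon> * (\<mu>p * (\<pi> \<bullet> (Q2P D1 D2 *\<^sub>v ones N))))"
proof -
  have "u_dis \<epsilon> \<in> carrier_vec N" using u_dis e by simp
  then have "u_dis \<epsilon> \<bullet> lv = complex_of_real (drift D1 D2 \<pi> ((1 - \<epsilon>) * \<mu>p + \<epsilon> * 0))"
  proof (rule transform_constant[OF arr rts pi, where \<Phi> = "Phi N (Sdis \<epsilon>)"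
        and g = "\<lambda>s. f s + complex_of_real \<epsilon> * (1 - f s)"])
    have S: "stationary_law N D1 D2 (mix \<epsilon> Fp (return borel 0)) (Sdis \<epsilon>)" using Sdis e by simp
    note ctx = arr rts mixture_law[OF e dirac_law] S
    show "Phi N (Sdis \<epsilon>) s \<in> carrier_vec N" for s by (rule Phi_carrier[OF ctx])
    show "Phi N (Sdis \<epsilon>) 0 = cvec \<pi>" by (rule Phi_dis_0[OF e])
    show "continuous_on {s. 0 \<le> Re s} (\<lambda>s. Phi N (Sdis \<epsilon>) s $ i)" if "i < N" for i
      by (rule Phi_continuous[OF ctx that])
    show "row_mult (Phi N (Sdis \<epsilon>) s) (E_sg D1 D2 s (f s + complex_of_real \<epsilon> * (1 - f s))) = s \<cdot>\<^sub>v u_dis \<epsilon>"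
      if "0 \<le> Re s" for s
      using u_dis_eq[OF e that] unfolding perturbed_matrix Kd2_def .
    show "((\<lambda>t. (1 - (f (complex_of_real t) + complex_of_real \<epsilon> * (1 - f (complex_of_real t)))) / complex_of_real t)
      \<longlongrightarrow> complex_of_real ((1 - \<epsilon>) * \<mu>p + \<epsilon> * 0)) (at_right 0)"
      by (rule excess_rate[where \<phi> = "\<lambda>_. 1"]) simp
  qed
  then show ?thesis unfolding drift_mix by simp
qed

lemma m_less: "i \<in> {1..<N} \<Longrightarrow> m i < N"
  using m by simp

lemma u_orth: "i \<in> {1..<N} \<Longrightarrow> u \<bullet> a_vec E (sr i) (m i) = 0"
  using u(3) by simp

sublocale mixp: perturbed_kernel_equation N E K2 "\<lambda>i. E' (sr i)" "\<lambda>i. (deriv (lst Fh) (sr i) - f' (sr i)) \<cdot>\<^sub>m Q"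
  sr m lv u A "drift D1 D2 \<pi> \<mu>p" "(\<mu>p - \<mu>h) * (\<pi> \<bullet> (Q2P D1 D2 *\<^sub>v ones N))" \<epsilon>0 "\<lambda>\<epsilon>. Phi N (Smix \<epsilon>)" U_mix
proof
  show "K2 s \<in> carrier_mat N N" for s unfolding K2_def using QL_carrier by (simp only: smult_carrier_mat)
  show "has_mat_deriv N E (E' (sr i)) (sr i)" if "i \<in> {1..<N}" for i using sr_pos[OF that] by (intro E_deriv) simp
  show "det (E (sr i)) = 0" if "i \<in> {1..<N}" for i using that by (intro sr_root) simp
  fix \<epsilon> assume e: "0 < \<epsilon>" "\<epsilon> < \<epsilon>0"
  have S: "stationary_law N D1 D2 (mix \<epsilon> Fp Fh) (Smix \<epsilon>)" using Smix e by simp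
  note ctx = arr rts mixture_law[OF e Fh(1)] S
  show "Phi N (Smix \<epsilon>) s \<in> carrier_vec N" for s by (rule Phi_carrier[OF ctx])
  show "norm (Phi N (Smix \<epsilon>) s $ j) \<le> 1" if "j < N" "0 \<le> Re s" for s j by (rule norm_Phi_le[OF ctx that])
  show "(\<lambda>s. Phi N (Smix \<epsilon>) s $ j) holomorphic_on {s. 0 < Re s}" if "j < N" for j by (rule Phi_holomorphic[OF ctx that])
qed (fact N0 eps0(1) K2_deriv E_carrier sr_pos sr_simple m_less le_carrier A det_A u(1) u(2) u_orth U_mix U_mix_drift)+

sublocale disp: perturbed_kernel_equation N E Kd2 "\<lambda>i. E' (sr i)" "\<lambda>i. (0 - f' (sr i)) \<cdot>\<^sub>m Q"
  sr m lv u A "drift D1 D2 \<pi> \<mu>p" "\<mu>p * (\<pi> \<bullet> (Q2P D1 D2 *\<^sub>v ones N))" \<epsilon>0 "\<lambda>\<epsilon>. Phi N (Sdis \<epsilon>)" u_dis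
proof
  show "Kd2 s \<in> carrier_mat N N" for s unfolding Kd2_def using QL_carrier by (simp only: smult_carrier_mat)
  show "has_mat_deriv N E (E' (sr i)) (sr i)" if "i \<in> {1..<N}" for i using sr_pos[OF that] by (intro E_deriv) simp
  show "det (E (sr i)) = 0" if "i \<in> {1..<N}" for i using that by (intro sr_root) simp
  fix \<epsilon> assume e: "0 < \<epsilon>" "\<epsilon> < \<epsilon>0"
  have S: "stationary_law N D1 D2 (mix \<epsilon> Fp (return borel 0)) (Sdis \<epsilon>)" using Sdis e by simp
  note ctx = arr rts mixture_law[OF e dirac_law] S
  show "u_dis \<epsilon> \<in> carrier_vec N" using u_dis e by simp
  show "Phi N (Sdis \<epsilon>) s \<in> carrier_vec N" for s by (rule Phi_carrier[OF ctx])
  show "norm (Phi N (Sdis \<epsilon>) s $ j) \<le> 1" if "j < N" "0 \<le> Re s" for s j by (rule norm_Phi_le[OF ctx that])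
  show "(\<lambda>s. Phi N (Sdis \<epsilon>) s $ j) holomorphic_on {s. 0 < Re s}" if "j < N" for j by (rule Phi_holomorphic[OF ctx that])
qed (fact N0 eps0(1) Kd2_deriv E_carrier sr_pos sr_simple m_less le_carrier A det_A u(1) u(2) u_orth u_dis_eq u_dis_drift)+

lemma z_eq: "z = mixp.z" "zd = disp.z"
  unfolding z zd B_eq by simp_all

lemmas z_facts = mixp.z_facts(1,2)[folded z_eq] and zd_facts = disp.z_facts(1,2)[folded z_eq]

subsection \<open>Partial fractions of the coefficient functions\<close>

lemma growth_ratio_p: "((\<lambda>x. poly p (complex_of_real x) / complex_of_real x ^ M) \<longlongrightarrow> 1) at_top"
  using poly_over_power_tendsto[of p M] Fp_rational(3,4) by simp

lemma growth_p: "((\<lambda>x. poly p (complex_of_real x) ^ r / complex_of_real x ^ (r * M)) \<longlongrightarrow> 1) at_top"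
proof -
  have "((\<lambda>x. (poly p (complex_of_real x) / complex_of_real x ^ M) ^ r) \<longlongrightarrow> 1 ^ r) at_top"
    by (intro tendsto_power growth_ratio_p)
  then show ?thesis by (simp add: power_divide power_mult[symmetric] mult.commute)
qed

lemma growth_f: "((\<lambda>x. f (complex_of_real x)) \<longlongrightarrow> 0) at_top"
proof -
  have "((\<lambda>x. poly q (complex_of_real x) / complex_of_real x ^ M) \<longlongrightarrow> 0) at_top"
    using poly_over_power_tendsto[of q M] Fp_rational(5) coeff_eq_0[OF Fp_rational(5)] by simp
  from tendsto_divide[OF this growth_ratio_p]
  have "((\<lambda>x. (poly q (complex_of_real x) / complex_of_real x ^ M) / (poly p (complex_of_real x) / complex_of_real x ^ M)) \<longlongrightarrow> 0) at_top"
    by simp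
  moreover have "eventually (\<lambda>x. (poly q (complex_of_real x) / complex_of_real x ^ M) / (poly p (complex_of_real x) / complex_of_real x ^ M)
      = f (complex_of_real x)) at_top"
    using eventually_gt_at_top[of "0::real"] by eventually_elim (simp add: f_def)
  ultimately show ?thesis by (rule Lim_transform_eventually)
qed

text \<open>
  Because \<open>deg q < deg p\<close>, the service transform vanishes at infinity, and only \<open>s I\<close> grows.
\<close>

lemma growth_E:
  assumes ij: "i < N" "j < N"
  shows "((\<lambda>x. E (complex_of_real x) $$ (i, j) / complex_of_real x) \<longlongrightarrow> (if i = j then 1 else 0)) at_top"
proof -
  have inv: "((\<lambda>x. inverse (complex_of_real x)) \<longlongrightarrow> 0) at_top"
    using tendsto_of_real[OF tendsto_inverse_0_at_top[OF filterlim_ident], where ?'a = complex] by simp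
  define P where "P = complex_of_real (trans_prob D1 D2 i j * rate D1 D2 j)"
  define R where "R = complex_of_real (real_prob D1 D2 i j)"
  define L where "L = complex_of_real (rate D1 D2 i)"
  define \<delta> :: complex where "\<delta> = (if i = j then 1 else 0)"
  have "((\<lambda>x. P * (1 - R + f (complex_of_real x) * R) * inverse (complex_of_real x)
      + (\<delta> - \<delta> * L * inverse (complex_of_real x)))
    \<longlongrightarrow> P * (1 - R + 0 * R) * 0 + (\<delta> - \<delta> * L * 0)) at_top"
    by (intro tendsto_add tendsto_diff tendsto_mult tendsto_const inv growth_f)
  moreover have "eventually (\<lambda>x. P * (1 - R + f (complex_of_real x) * R) * inverse (complex_of_real x)
      + (\<delta> - \<delta> * L * inverse (complex_of_real x)) = E (complex_of_real x) $$ (i, j) / complex_of_real x) at_top"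
    using eventually_gt_at_top[of "0::real"]
  proof eventually_elim
    case (elim x)
    then show ?case unfolding E_eq E_sg_index[OF arr rts ij] P_def[symmetric] R_def[symmetric] L_def[symmetric]
      by (cases "i = j") (simp_all add: \<delta>_def divide_inverse distrib_right left_diff_distrib)
  qed
  ultimately show ?thesis by (rule Lim_transform_eventually[THEN tendsto_eq_rhs]) (simp add: \<delta>_def)
qed

lemma eval2_E_poly: "map_mat (eval2 s g) (E_poly D1 D2) = E_sg D1 D2 s g"
proof (rule eq_matI)
  have c: "E_poly D1 D2 \<in> carrier_mat N N" unfolding E_poly_def by (rule E_gen_carrier[OF dimN])
  show "dim_row (map_mat (eval2 s g) (E_poly D1 D2)) = dim_row (E_sg D1 D2 s g)"
    "dim_col (map_mat (eval2 s g) (E_poly D1 D2)) = dim_col (E_sg D1 D2 s g)"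
    using c E_sg_carrier[of s g] by auto
  fix i j assume "i < dim_row (E_sg D1 D2 s g)" "j < dim_col (E_sg D1 D2 s g)"
  then have ij: "i < N" "j < N" using E_sg_carrier[of s g] by auto
  show "map_mat (eval2 s g) (E_poly D1 D2) $$ (i, j) = E_sg D1 D2 s g $$ (i, j)"
    using ij carrier_matD[OF c] unfolding E_gen_index[OF dimN ij]
    by (simp add: E_poly_def E_gen_index[OF dimN ij] eval2_def algebra_simps)
qed

lemma E_poly_carrier: "E_poly D1 D2 \<in> carrier_mat N N"
  unfolding E_poly_def by (rule E_gen_carrier[OF dimN])

lemma eval2_det: "det (E_sg D1 D2 s g) = eval2 s g (det (E_poly D1 D2))"
  unfolding eval2_E_poly[symmetric] by (rule comm_ring_hom.hom_det[OF eval2_hom])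

definition adj_omega_poly :: "nat \<Rightarrow> complex poly poly" where
  "adj_omega_poly i = (adj_mat (E_poly D1 D2) *\<^sub>v map_vec (\<lambda>c. [:[:complex_of_real c:]:]) \<omega>) $ i"

lemma eval2_adj_omega:
  assumes i: "i < N"
  shows "(adj_mat (E_sg D1 D2 s g) *\<^sub>v cvec \<omega>) $ i = eval2 s g (adj_omega_poly i)"
proof -
  interpret comm_ring_hom "eval2 s g" by (rule eval2_hom)
  have c: "map_vec (\<lambda>c. [:[:complex_of_real c:]:]) \<omega> \<in> carrier_vec N" using omega_facts(1) by simp
  have "eval2 s g (adj_omega_poly i) = (\<Sum>j<N. eval2 s g (adj_mat (E_poly D1 D2) $$ (i, j)) * eval2 s g [:[:complex_of_real (\<omega> $ j):]:])"
    unfolding adj_omega_poly_def mat_vec_index[OF adj_mat(1)[OF E_poly_carrier] c i] hom_sum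
    using carrier_vecD[OF omega_facts(1)] by (intro sum.cong refl) (simp add: eval2_def)
  also have "\<dots> = (\<Sum>j<N. adj_mat (E_sg D1 D2 s g) $$ (i, j) * cvec \<omega> $ j)"
    using carrier_vecD[OF omega_facts(1)] i
    by (intro sum.cong refl) (simp add: map_mat_hom_adj[OF E_poly_carrier, symmetric] eval2_E_poly, simp add: eval2_def)
  finally show ?thesis unfolding mat_vec_index[OF adj_mat(1)[OF E_sg_carrier] omega_facts(2) i] by simp
qed

text \<open>
  As \<open>E(s, g)\<close> is affine in \<open>g\<close> with slope \<open>Q\<close>, substituting columns of \<open>Q\<close> is differentiation in \<open>g\<close>.
\<close>

lemma eval2_col_subst_sum: "col_subst_sum (E_sg D1 D2 s g) Q = eval2 s g (pderiv (det (E_poly D1 D2)))"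
proof (rule DERIV_unique)
  show "((\<lambda>g. det (E_sg D1 D2 s g)) has_field_derivative col_subst_sum (E_sg D1 D2 s g) Q) (at g)"
    by (rule has_field_derivative_det[OF E_sg_deriv_g[OF arr rts]])
  show "((\<lambda>g. det (E_sg D1 D2 s g)) has_field_derivative eval2 s g (pderiv (det (E_poly D1 D2)))) (at g)"
    unfolding eval2_det by (rule has_field_derivative_eval2)
qed

lemma eval2_adj_diff_omega:
  assumes i: "i < N"
  shows "(adj_diff (E_sg D1 D2 s g) Q *\<^sub>v cvec \<omega>) $ i = eval2 s g (pderiv (adj_omega_poly i))"
proof (rule DERIV_unique)
  show "((\<lambda>g. (adj_mat (E_sg D1 D2 s g) *\<^sub>v cvec \<omega>) $ i) has_field_derivative eval2 s g (pderiv (adj_omega_poly i))) (at g)"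
    unfolding eval2_adj_omega[OF i] by (rule has_field_derivative_eval2)
  note d = has_mat_deriv_adj[OF E_sg_deriv_g[OF arr rts, of s g]]
  show "((\<lambda>g. (adj_mat (E_sg D1 D2 s g) *\<^sub>v cvec \<omega>) $ i) has_field_derivative (adj_diff (E_sg D1 D2 s g) Q *\<^sub>v cvec \<omega>) $ i) (at g)"
    unfolding mat_vec_index[OF adj_mat(1)[OF E_sg_carrier] omega_facts(2) i]
      mat_vec_index[OF adj_diff_carrier[OF E_sg_carrier] omega_facts(2) i]
    using has_mat_derivD(3)[OF d i] by (intro DERIV_sum DERIV_cmult_right) auto
qed

lemma degree_det_E_poly: "degree (det (E_poly D1 D2)) \<le> r"
  unfolding r p_exponent_def by simp

lemma degree_adj_omega_poly:
  assumes "i < N"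
  shows "degree (adj_omega_poly i) \<le> r"
proof -
  have "degree ([:[:0, 1:]:] * adj_omega_poly i) \<le> r"
    unfolding r p_exponent_def adj_omega_poly_def
    using assms dimN by (intro max.coboundedI2 Max_ge) auto
  moreover have "degree ([:[:0, 1:]:] * adj_omega_poly i) = degree (adj_omega_poly i)" by simp
  ultimately show ?thesis by simp
qed

text \<open>
  The power \<open>s ^ k\<close> accommodates the factor \<open>s\<close> of one of the coefficient functions.  The growth condition
  keeps the degree of the numerator within that of \<open>den\<close>.
\<close>

lemma cleared_numerator:
  assumes deg: "degree P \<le> r"
    and lim: "((\<lambda>x. complex_of_real x ^ k * eval2 (complex_of_real x) (f (complex_of_real x)) P / complex_of_real x ^ (N - 1)) \<longlongrightarrow> L) at_top"
  obtains H where "degree H \<le> N - 1 + r * M" "coeff H (N - 1 + r * M) = L"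
    "\<And>s. 0 \<le> Re s \<Longrightarrow> poly H s = poly p s ^ r * (s ^ k * eval2 s (f s) P)"
proof -
  obtain H0 where H0: "\<And>s. poly p s \<noteq> 0 \<Longrightarrow> poly H0 s = poly p s ^ r * eval2 s (poly q s / poly p s) P"
    using eval2_clear_denominators[OF deg, of p q] by blast
  define H where "H = monom 1 k * H0"
  have H: "poly H s = poly p s ^ r * (s ^ k * eval2 s (f s) P)" if "0 \<le> Re s" for s
    using H0[OF p_root_free[OF that]] by (simp add: H_def f_def poly_monom)
  have "((\<lambda>x. (poly p (complex_of_real x) ^ r / complex_of_real x ^ (r * M))
      * (complex_of_real x ^ k * eval2 (complex_of_real x) (f (complex_of_real x)) P / complex_of_real x ^ (N - 1))) \<longlongrightarrow> 1 * L) at_top"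
    by (intro tendsto_mult growth_p lim)
  moreover have "eventually (\<lambda>x. (poly p (complex_of_real x) ^ r / complex_of_real x ^ (r * M))
      * (complex_of_real x ^ k * eval2 (complex_of_real x) (f (complex_of_real x)) P / complex_of_real x ^ (N - 1))
    = poly H (complex_of_real x) / complex_of_real x ^ (N - 1 + r * M)) at_top"
    using eventually_ge_at_top[of "0::real"]
  proof eventually_elim
    case (elim x)
    then have "poly H (complex_of_real x) = poly p (complex_of_real x) ^ r * (complex_of_real x ^ k * eval2 (complex_of_real x) (f (complex_of_real x)) P)"
      by (intro H) simp
    then show ?case by (simp only: power_add times_divide_times_eq mult.commute[of "complex_of_real x ^ (N - 1)"])
  qed
  ultimately have "((\<lambda>x. poly H (complex_of_real x) / complex_of_real x ^ (N - 1 + r * M)) \<longlongrightarrow> L) at_top"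
    by (simp add: Lim_transform_eventually)
  from degree_le_if_growth[OF this] show thesis using H that by blast
qed

lemma inj_sr: "inj_on sr {1..<N}"
  by (rule inj_on_subset[OF roots(1)]) auto

lemma poles_disjoint: "k \<in> {1..<N} \<Longrightarrow> j \<in> {1..\<sigma>} \<Longrightarrow> sr k \<noteq> - yd j"
  using sr_pos[of k] yd_facts(2)[of j] by (auto dest: arg_cong[of _ _ Re])

lemma yd_nonzero: "j \<in> {1..\<sigma>} \<Longrightarrow> yd j \<noteq> 0"
  using yd_facts(2)[of j] by auto

lemma partial_fractions:
  assumes deg: "degree H \<le> N - 1 + r * M"
  obtains c1 c2 where "c1 \<in> extensional {1..<N}" "c2 \<in> extensional (SIGMA j:{1..\<sigma>}. {1..rr j})"
    "\<And>s. 0 \<le> Re s \<Longrightarrow> s \<notin> sr ` {1..<N} \<Longrightarrow> pf N sr \<sigma> yd rr (coeff H (N - 1 + r * M)) c1 c2 s = poly H s / den s"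
proof -
  obtain c1 c2 where c: "c1 \<in> extensional {1..<N}" "c2 \<in> extensional (SIGMA j:{1..\<sigma>}. {1..rr j})"
    "\<And>s. s \<notin> sr ` {1..<N} \<Longrightarrow> (\<And>j. j \<in> {1..\<sigma>} \<Longrightarrow> s + yd j \<noteq> 0) \<Longrightarrow>
      pf N sr \<sigma> yd rr (coeff H (N - 1 + r * M)) c1 c2 s = poly H s / ((\<Prod>k\<in>{1..<N}. s - sr k) * (\<Prod>j\<in>{1..\<sigma>}. (s + yd j) ^ rr j))"
    using pf_exists[OF inj_sr yd_facts(1) poles_disjoint yd_nonzero, of H rr "coeff H (N - 1 + r * M)"] deg unfolding sum_rr by blast
  show thesis
    by (rule that[OF c(1,2)]) (use c(3) not_pole in \<open>simp add: den_def\<close>)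
qed

lemma pf_over_den:
  obtains H where "\<And>s. 0 \<le> Re s \<Longrightarrow> s \<notin> sr ` {1..<N} \<Longrightarrow> pf N sr \<sigma> yd rr c0 c1 c2 s = poly H s / den s"
    "H = 0 \<Longrightarrow> c0 = 0" "H = 0 \<Longrightarrow> k \<in> {1..<N} \<Longrightarrow> c1 k = 0"
    "H = 0 \<Longrightarrow> jl \<in> (SIGMA j:{1..\<sigma>}. {1..rr j}) \<Longrightarrow> c2 jl = 0"
proof (rule pf_numerator[OF inj_sr yd_facts(1) poles_disjoint yd_nonzero, of rr c0 c1 c2 k jl])
  fix H
  assume H: "\<And>s. s \<notin> sr ` {1..<N} \<Longrightarrow> (\<And>j. j \<in> {1..\<sigma>} \<Longrightarrow> s + yd j \<noteq> 0) \<Longrightarrow>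
      pf N sr \<sigma> yd rr c0 c1 c2 s = poly H s / ((\<Prod>k\<in>{1..<N}. s - sr k) * (\<Prod>j\<in>{1..\<sigma>}. (s + yd j) ^ rr j))"
    "H = 0 \<Longrightarrow> c0 = 0" "H = 0 \<Longrightarrow> k \<in> {1..<N} \<Longrightarrow> c1 k = 0"
    "H = 0 \<Longrightarrow> jl \<in> (SIGMA j:{1..\<sigma>}. {1..rr j}) \<Longrightarrow> c2 jl = 0"
  show thesis
    by (rule that[OF _ H(2,3,4)]) (use H(1) not_pole in \<open>simp_all add: den_def\<close>)
qed

lemma pf_eq_0:
  assumes rho: "0 < \<rho>" and zero: "\<forall>s. 0 < Re s \<and> norm s < \<rho> \<longrightarrow> pf N sr \<sigma> yd rr c0 c1 c2 s = 0"
    and avoid: "\<forall>s. norm s < \<rho> \<longrightarrow> s \<notin> sr ` {1..<N}"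
  shows "c0 = 0" "k \<in> {1..<N} \<Longrightarrow> c1 k = 0" "jl \<in> (SIGMA j:{1..\<sigma>}. {1..rr j}) \<Longrightarrow> c2 jl = 0"
proof -
  obtain H where H: "\<And>s. 0 \<le> Re s \<Longrightarrow> s \<notin> sr ` {1..<N} \<Longrightarrow> pf N sr \<sigma> yd rr c0 c1 c2 s = poly H s / den s"
    "H = 0 \<Longrightarrow> c0 = 0" "H = 0 \<Longrightarrow> k \<in> {1..<N} \<Longrightarrow> c1 k = 0"
    "H = 0 \<Longrightarrow> jl \<in> (SIGMA j:{1..\<sigma>}. {1..rr j}) \<Longrightarrow> c2 jl = 0"
    by (rule pf_over_den[of c0 c1 c2 k jl]) blast
  have "H = 0"
  proof (rule poly_eq_0_if_zero_near_0[OF rho])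
    fix s :: complex assume s: "0 < Re s" "norm s < \<rho>"
    show "poly H s = 0" using H(1)[of s] zero[rule_format, OF conjI[OF s]] avoid[rule_format, OF s(2)] den_nonzero[of s] s by simp
  qed
  then show "c0 = 0" "k \<in> {1..<N} \<Longrightarrow> c1 k = 0" "jl \<in> (SIGMA j:{1..\<sigma>}. {1..rr j}) \<Longrightarrow> c2 jl = 0"
    using H by auto
qed

abbreviation T :: "complex \<Rightarrow> complex" where "T s \<equiv> col_subst_sum (E s) Q"
abbreviation a\<omega> :: "complex \<Rightarrow> complex vec" where "a\<omega> s \<equiv> adj_mat (E s) *\<^sub>v cvec \<omega>"
abbreviation a'\<omega> :: "complex \<Rightarrow> complex vec" where "a'\<omega> s \<equiv> adj_diff (E s) Q *\<^sub>v cvec \<omega>"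

lemma a'\<omega>_carrier: "a'\<omega> s \<in> carrier_vec N"
  by (rule mult_mat_vec_carrier[OF adj_diff_carrier[OF E_carrier] omega_facts(2)])

lemma pf_T:
  obtains c1 c2 c0 where "c1 \<in> extensional {1..<N}" "c2 \<in> extensional (SIGMA j:{1..\<sigma>}. {1..rr j})"
    "\<And>s. 0 \<le> Re s \<Longrightarrow> s \<notin> sr ` {1..<N} \<Longrightarrow> pf N sr \<sigma> yd rr c0 c1 c2 s = poly p s ^ r * T s / den s"
proof -
  have deg: "degree (pderiv (det (E_poly D1 D2))) \<le> r"
    using degree_pderiv[of "det (E_poly D1 D2)"] degree_det_E_poly by linarith
  have lim: "((\<lambda>x. complex_of_real x ^ 0 * eval2 (complex_of_real x) (f (complex_of_real x)) (pderiv (det (E_poly D1 D2))) / complex_of_real x ^ (N - 1))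
    \<longlongrightarrow> col_subst_sum (1\<^sub>m N) Q) at_top"
    using growth_col_subst_sum[OF E_carrier growth_E QL_carrier]
    unfolding eval2_col_subst_sum[symmetric] E_eq power_0 mult_1_left .
  obtain H where H: "degree H \<le> N - 1 + r * M"
    "\<And>s. 0 \<le> Re s \<Longrightarrow> poly H s = poly p s ^ r * (s ^ 0 * eval2 s (f s) (pderiv (det (E_poly D1 D2))))"
    using cleared_numerator[OF deg lim] by blast
  obtain c1 c2 where c: "c1 \<in> extensional {1..<N}" "c2 \<in> extensional (SIGMA j:{1..\<sigma>}. {1..rr j})"
    "\<And>s. 0 \<le> Re s \<Longrightarrow> s \<notin> sr ` {1..<N} \<Longrightarrow> pf N sr \<sigma> yd rr (coeff H (N - 1 + r * M)) c1 c2 s = poly H s / den s"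
    by (fact partial_fractions[OF H(1)])
  have "pf N sr \<sigma> yd rr (coeff H (N - 1 + r * M)) c1 c2 s = poly p s ^ r * T s / den s"
    if "0 \<le> Re s" "s \<notin> sr ` {1..<N}" for s
    by (simp only: c(3)[OF that] H(2)[OF that(1)] E_eq eval2_col_subst_sum power_0 mult_1_left)
  then show thesis by (rule that[OF c(1,2)])
qed

lemma adj_omega_numerator:
  assumes i: "i < N"
  obtains H where "degree H \<le> N - 1 + r * M" "coeff H (N - 1 + r * M) = cvec \<omega> $ i"
    "\<And>s. 0 \<le> Re s \<Longrightarrow> poly H s = poly p s ^ r * a\<omega> s $ i"
proof -
  have "((\<lambda>x. \<Sum>j<N. adj_mat (E (complex_of_real x)) $$ (i, j) / complex_of_real x ^ (N - 1) * cvec \<omega> $ j)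
    \<longlongrightarrow> (\<Sum>j<N. (if i = j then 1 else 0) * cvec \<omega> $ j)) at_top"
    using growth_adj[OF E_carrier growth_E i] by (intro tendsto_sum tendsto_mult tendsto_const) auto
  moreover have "(\<Sum>j<N. adj_mat (E s) $$ (i, j) / z * cvec \<omega> $ j) = s ^ 0 * eval2 s (f s) (adj_omega_poly i) / z" for s z
    unfolding eval2_adj_omega[OF i, symmetric] E_eq[symmetric] mat_vec_index[OF adj_mat(1)[OF E_carrier] omega_facts(2) i]
    by (simp add: sum_divide_distrib)
  moreover have "(\<Sum>j<N. (if i = j then 1 else 0) * cvec \<omega> $ j) = cvec \<omega> $ i"
    using i by (subst sum.cong[OF refl, where h = "\<lambda>j. if i = j then cvec \<omega> $ j else 0"]) auto
  ultimately have lim: "((\<lambda>x. complex_of_real x ^ 0 * eval2 (complex_of_real x) (f (complex_of_real x)) (adj_omega_poly i) / complex_of_real x ^ (N - 1))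
    \<longlongrightarrow> cvec \<omega> $ i) at_top"
    by simp
  obtain H where H: "degree H \<le> N - 1 + r * M" "coeff H (N - 1 + r * M) = cvec \<omega> $ i"
    "\<And>s. 0 \<le> Re s \<Longrightarrow> poly H s = poly p s ^ r * (s ^ 0 * eval2 s (f s) (adj_omega_poly i))"
    using cleared_numerator[OF degree_adj_omega_poly[OF i] lim] by blast
  show thesis
    by (rule that[OF H(1,2)]) (simp only: H(3) eval2_adj_omega[OF i, symmetric] E_eq[symmetric] power_0 mult_1_left)
qed

lemma adj_diff_omega_numerator:
  assumes i: "i < N"
  obtains H where "degree H \<le> N - 1 + r * M"
    "\<And>s. 0 \<le> Re s \<Longrightarrow> poly H s = poly p s ^ r * (s * a'\<omega> s $ i)"
proof -
  have "\<forall>j. \<exists>l. j < N \<longrightarrow> ((\<lambda>x. complex_of_real x * adj_diff (E (complex_of_real x)) Q $$ (i, j) / complex_of_real x ^ (N - 1)) \<longlongrightarrow> l) at_top"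
    using growth_adj_diff[OF E_carrier growth_E QL_carrier i] by blast
  from choice[OF this] obtain l where
    l: "\<forall>j. j < N \<longrightarrow> ((\<lambda>x. complex_of_real x * adj_diff (E (complex_of_real x)) Q $$ (i, j) / complex_of_real x ^ (N - 1)) \<longlongrightarrow> l j) at_top"
    by (elim exE)
  have "((\<lambda>x. \<Sum>j<N. complex_of_real x * adj_diff (E (complex_of_real x)) Q $$ (i, j) / complex_of_real x ^ (N - 1) * cvec \<omega> $ j)
    \<longlongrightarrow> (\<Sum>j<N. l j * cvec \<omega> $ j)) at_top"
    using l by (intro tendsto_sum tendsto_mult tendsto_const) auto
  moreover have "(\<Sum>j<N. s * adj_diff (E s) Q $$ (i, j) / z * cvec \<omega> $ j) = s ^ 1 * eval2 s (f s) (pderiv (adj_omega_poly i)) / z" for s z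
    unfolding eval2_adj_diff_omega[OF i, symmetric] E_eq[symmetric] mat_vec_index[OF adj_diff_carrier[OF E_carrier] omega_facts(2) i]
    by (simp add: sum_divide_distrib sum_distrib_left mult.assoc)
  ultimately have lim: "((\<lambda>x. complex_of_real x ^ 1 * eval2 (complex_of_real x) (f (complex_of_real x)) (pderiv (adj_omega_poly i)) / complex_of_real x ^ (N - 1))
    \<longlongrightarrow> (\<Sum>j<N. l j * cvec \<omega> $ j)) at_top"
    by simp
  have deg: "degree (pderiv (adj_omega_poly i)) \<le> r"
    using degree_pderiv[of "adj_omega_poly i"] degree_adj_omega_poly[OF i] by linarith
  obtain H where H: "degree H \<le> N - 1 + r * M"
    "\<And>s. 0 \<le> Re s \<Longrightarrow> poly H s = poly p s ^ r * (s ^ 1 * eval2 s (f s) (pderiv (adj_omega_poly i)))"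
    using cleared_numerator[OF deg lim] by blast
  show thesis
    by (rule that[OF H(1)]) (simp only: H(2) eval2_adj_diff_omega[OF i, symmetric] E_eq[symmetric] power_one_right)
qed

lemma weighted_numerator:
  fixes v :: "complex vec" and H :: "nat \<Rightarrow> complex poly"
  assumes deg: "\<forall>i<N. degree (H i) \<le> n" and H: "\<forall>i<N. \<forall>s. 0 \<le> Re s \<longrightarrow> poly (H i) s = P s * h s i"
  defines "G \<equiv> \<Sum>i<N. Polynomial.smult (v $ i) (H i)"
  shows "degree G \<le> n" "coeff G n = (\<Sum>i<N. v $ i * coeff (H i) n)"
    "0 \<le> Re s \<Longrightarrow> poly G s = P s * (\<Sum>i<N. v $ i * h s i)"
proof -
  show "degree G \<le> n" unfolding G_def
    using deg by (intro degree_sum_le) (auto intro: order.trans[OF degree_smult_le])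
  show "coeff G n = (\<Sum>i<N. v $ i * coeff (H i) n)" by (simp add: G_def coeff_sum)
  show "poly G s = P s * (\<Sum>i<N. v $ i * h s i)" if "0 \<le> Re s"
    unfolding G_def poly_sum sum_distrib_left using H that
    by (intro sum.cong refl) (simp add: mult_ac)
qed

lemma pf_adj_omega:
  assumes v: "v \<in> carrier_vec N"
  obtains c1 c2 where "c1 \<in> extensional {1..<N}" "c2 \<in> extensional (SIGMA j:{1..\<sigma>}. {1..rr j})"
    "\<And>s. 0 \<le> Re s \<Longrightarrow> s \<notin> sr ` {1..<N} \<Longrightarrow> pf N sr \<sigma> yd rr (v \<bullet> cvec \<omega>) c1 c2 s = poly p s ^ r * (v \<bullet> a\<omega> s) / den s"
proof -
  have "\<forall>i. \<exists>H. i < N \<longrightarrow> degree H \<le> N - 1 + r * M \<and> coeff H (N - 1 + r * M) = cvec \<omega> $ i \<and>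
    (\<forall>s. 0 \<le> Re s \<longrightarrow> poly H s = poly p s ^ r * a\<omega> s $ i)" (is "\<forall>i. \<exists>H. i < N \<longrightarrow> ?P i H")
  proof
    fix i
    show "\<exists>H. i < N \<longrightarrow> ?P i H"
    proof (cases "i < N")
      case True
      show ?thesis by (rule adj_omega_numerator[OF True]) (intro exI impI conjI allI)
    qed simp
  qed
  from choice[OF this] obtain H where HH: "\<forall>i. i < N \<longrightarrow> ?P i (H i)" by (elim exE)
  have H: "\<forall>i<N. degree (H i) \<le> N - 1 + r * M" "\<forall>i<N. coeff (H i) (N - 1 + r * M) = cvec \<omega> $ i"
    "\<forall>i<N. \<forall>s. 0 \<le> Re s \<longrightarrow> poly (H i) s = poly p s ^ r * a\<omega> s $ i"
    using HH by simp_all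
  note G = weighted_numerator[OF H(1,3), where v = v]
  have "coeff (\<Sum>i<N. Polynomial.smult (v $ i) (H i)) (N - 1 + r * M) = (\<Sum>i<N. v $ i * coeff (H i) (N - 1 + r * M))"
    by (rule G(2))
  also have "\<dots> = v \<bullet> cvec \<omega>"
    unfolding scalar_index[OF omega_facts(2)] by (intro sum.cong refl) (metis H(2) lessThan_iff)
  finally have "coeff (\<Sum>i<N. Polynomial.smult (v $ i) (H i)) (N - 1 + r * M) = v \<bullet> cvec \<omega>" .
  note lead = this
  obtain c1 c2 where c: "c1 \<in> extensional {1..<N}" "c2 \<in> extensional (SIGMA j:{1..\<sigma>}. {1..rr j})"
    "\<And>s. 0 \<le> Re s \<Longrightarrow> s \<notin> sr ` {1..<N} \<Longrightarrow>
      pf N sr \<sigma> yd rr (coeff (\<Sum>i<N. Polynomial.smult (v $ i) (H i)) (N - 1 + r * M)) c1 c2 s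
        = poly (\<Sum>i<N. Polynomial.smult (v $ i) (H i)) s / den s"
    by (fact partial_fractions[OF G(1)])
  have "pf N sr \<sigma> yd rr (v \<bullet> cvec \<omega>) c1 c2 s = poly p s ^ r * (v \<bullet> a\<omega> s) / den s"
    if "0 \<le> Re s" "s \<notin> sr ` {1..<N}" for s
    using c(3)[OF that] unfolding lead G(3)[OF that(1)] scalar_index[OF adj_omega_carrier] .
  then show thesis by (rule that[OF c(1,2)])
qed

lemma pf_adj_diff_omega:
  assumes v: "v \<in> carrier_vec N"
  obtains c1 c2 c0 where "c1 \<in> extensional {1..<N}" "c2 \<in> extensional (SIGMA j:{1..\<sigma>}. {1..rr j})"
    "\<And>s. 0 \<le> Re s \<Longrightarrow> s \<notin> sr ` {1..<N} \<Longrightarrow> pf N sr \<sigma> yd rr c0 c1 c2 s = poly p s ^ r * (s * (v \<bullet> a'\<omega> s)) / den s"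
proof -
  have "\<forall>i. \<exists>H. i < N \<longrightarrow> degree H \<le> N - 1 + r * M \<and>
    (\<forall>s. 0 \<le> Re s \<longrightarrow> poly H s = poly p s ^ r * (s * a'\<omega> s $ i))" (is "\<forall>i. \<exists>H. i < N \<longrightarrow> ?P i H")
  proof
    fix i
    show "\<exists>H. i < N \<longrightarrow> ?P i H"
    proof (cases "i < N")
      case True
      show ?thesis by (rule adj_diff_omega_numerator[OF True]) (intro exI impI conjI allI)
    qed simp
  qed
  from choice[OF this] obtain H where HH: "\<forall>i. i < N \<longrightarrow> ?P i (H i)" by (elim exE)
  have H: "\<forall>i<N. degree (H i) \<le> N - 1 + r * M"
    "\<forall>i<N. \<forall>s. 0 \<le> Re s \<longrightarrow> poly (H i) s = poly p s ^ r * (s * a'\<omega> s $ i)"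
    using HH by simp_all
  note G = weighted_numerator[OF H, where v = v]
  obtain c1 c2 where c: "c1 \<in> extensional {1..<N}" "c2 \<in> extensional (SIGMA j:{1..\<sigma>}. {1..rr j})"
    "\<And>s. 0 \<le> Re s \<Longrightarrow> s \<notin> sr ` {1..<N} \<Longrightarrow> pf N sr \<sigma> yd rr (coeff (\<Sum>i<N. Polynomial.smult (v $ i) (H i)) (N - 1 + r * M)) c1 c2 s
      = poly (\<Sum>i<N. Polynomial.smult (v $ i) (H i)) s / den s"
    by (fact partial_fractions[OF G(1)])
  have "(\<Sum>i<N. v $ i * (s * a'\<omega> s $ i)) = s * (v \<bullet> a'\<omega> s)" for s
    unfolding scalar_index[OF a'\<omega>_carrier] by (simp add: sum_distrib_left mult_ac)
  note e = this
  have "pf N sr \<sigma> yd rr (coeff (\<Sum>i<N. Polynomial.smult (v $ i) (H i)) (N - 1 + r * M)) c1 c2 s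
      = poly p s ^ r * (s * (v \<bullet> a'\<omega> s)) / den s"
    if "0 \<le> Re s" "s \<notin> sr ` {1..<N}" for s
    using c(3)[OF that] unfolding G(3)[OF that(1)] e .
  then show thesis by (rule that[OF c(1,2)])
qed

subsection \<open>The expansion\<close>

lemma adj_triple_scalar:
  "u \<bullet> ((adj_mat (E s) * (c \<cdot>\<^sub>m Q) * adj_mat (E s)) *\<^sub>v cvec \<omega>)
    = c * (T s * (u \<bullet> a\<omega> s) - det (E s) * (u \<bullet> a'\<omega> s))"
proof -
  note ca = adj_mat(1)[OF E_carrier, of s] and cd = adj_diff_carrier[OF E_carrier, of s Q]
  note caQ = mult_carrier_mat[OF ca QL_carrier] note caQa = mult_carrier_mat[OF caQ ca]
  have sm: "u \<bullet> ((c \<cdot>\<^sub>m X) *\<^sub>v cvec \<omega>) = c * (u \<bullet> (X *\<^sub>v cvec \<omega>))" if X: "X \<in> carrier_mat N N" for c X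
  proof -
    have "(c \<cdot>\<^sub>m X) *\<^sub>v cvec \<omega> = c \<cdot>\<^sub>v (X *\<^sub>v cvec \<omega>)"
    proof (rule eq_vecI)
      fix i assume "i < dim_vec (c \<cdot>\<^sub>v (X *\<^sub>v cvec \<omega>))"
      then have i: "i < N" using X by simp
      show "((c \<cdot>\<^sub>m X) *\<^sub>v cvec \<omega>) $ i = (c \<cdot>\<^sub>v (X *\<^sub>v cvec \<omega>)) $ i"
        unfolding mat_vec_index[OF smult_carrier_mat[OF X] omega_facts(2) i]
        using i X mat_vec_index[OF X omega_facts(2) i] by (simp add: sum_distrib_left mult.assoc)
    qed (use X in simp)
    then show ?thesis using scalar_prod_smult_distrib[OF u(1) mult_mat_vec_carrier[OF X omega_facts(2)]] by simp
  qed
  have "adj_mat (E s) * (c \<cdot>\<^sub>m Q) * adj_mat (E s) = c \<cdot>\<^sub>m (adj_mat (E s) * Q * adj_mat (E s))"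
    unfolding mult_smult_distrib[OF ca QL_carrier] mult_smult_assoc_mat[OF caQ ca] ..
  then have "u \<bullet> ((adj_mat (E s) * (c \<cdot>\<^sub>m Q) * adj_mat (E s)) *\<^sub>v cvec \<omega>)
      = c * (u \<bullet> ((adj_mat (E s) * Q * adj_mat (E s)) *\<^sub>v cvec \<omega>))"
    by (simp only: sm[OF caQa])
  moreover have "u \<bullet> ((adj_mat (E s) * Q * adj_mat (E s)) *\<^sub>v cvec \<omega>) + det (E s) * (u \<bullet> a'\<omega> s) = T s * (u \<bullet> a\<omega> s)"
    using arg_cong[OF adj_triple[OF E_carrier QL_carrier, of s], of "\<lambda>X. u \<bullet> (X *\<^sub>v cvec \<omega>)"]
    unfolding sm[OF ca]
      add_mult_distrib_mat_vec[OF caQa smult_carrier_mat[OF cd] omega_facts(2)]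
      scalar_prod_add_distrib[OF u(1) mult_mat_vec_carrier[OF caQa omega_facts(2)] mult_mat_vec_carrier[OF smult_carrier_mat[OF cd] omega_facts(2)]]
      sm[OF cd] .
  ultimately show ?thesis by (metis add_diff_cancel_right')
qed

lemma diff_z_scalar: "w \<in> carrier_vec N \<Longrightarrow> (z - zd) \<bullet> w = z \<bullet> w - zd \<bullet> w"
  by (rule minus_scalar_prod_distrib[OF z_facts(1) zd_facts(1)])

lemma base_transform:
  assumes s: "0 \<le> Re s" "s \<noteq> 0" "s \<notin> sr ` {1..<N}"
  shows "(\<lambda>\<epsilon>. w_dis \<epsilon> s - s * (u \<bullet> a\<omega> s) / det (E s)) \<in> bigoe 1"
  unfolding w_dis by (rule disp.\<Phi>_expansion(1)[OF s(1) det_nonzero[OF s] omega_facts(2)])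

text \<open>
  The base transform and all terms with \<open>f\<close> cancel, since the two kernels differ by \<open>\<epsilon> (1 - h) Q\<close>.
\<close>

lemma mixture_minus_discard:
  assumes s: "0 \<le> Re s" "s \<noteq> 0" "s \<notin> sr ` {1..<N}"
  shows "(\<lambda>\<epsilon>. w_mix \<epsilon> s - w_dis \<epsilon> s - complex_of_real \<epsilon> * (s * ((z - zd) \<bullet> a\<omega> s) / det (E s)
    + s * (1 - lst Fh s) * (T s * (u \<bullet> a\<omega> s) - det (E s) * (u \<bullet> a'\<omega> s)) / (det (E s))\<^sup>2)) \<in> bigoe 2"
proof -
  note m = mixp.\<Phi>_expansion(2)[OF s(1) det_nonzero[OF s] omega_facts(2), folded z_eq, unfolded K2_def adj_triple_scalar]
  note d = disp.\<Phi>_expansion(2)[OF s(1) det_nonzero[OF s] omega_facts(2), folded z_eq, unfolded Kd2_def adj_triple_scalar]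
  define J where "J = (T s * (u \<bullet> a\<omega> s) - det (E s) * (u \<bullet> a'\<omega> s)) / (det (E s))\<^sup>2"
  have alg: "W1 - W0 - e * (s * a1 / D - s * ((h - g) * JJ) / D2) - (W2 - W0 - e * (s * a2 / D - s * ((1 - g) * JJ) / D2))
    = W1 - W2 - e * (s * (a1 - a2) / D + s * (1 - h) * JJ / D2)"
    for W0 W1 W2 e s a1 a2 D h g JJ D2 :: complex
    by (simp add: divide_inverse algebra_simps)
  show ?thesis
    using sum_in_bigo(2)[OF m d] unfolding w_mix w_dis diff_z_scalar[OF adj_omega_carrier] alg .
qed

lemma u_dis_omega: "(\<lambda>\<epsilon>. u_dis \<epsilon> \<bullet> cvec \<omega> - u \<bullet> cvec \<omega>) \<in> bigoe 1"
  by (rule disp.U_zeroth_order_scalar[OF omega_facts(2)])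

abbreviation mhe :: "complex \<Rightarrow> complex" where
  "mhe s \<equiv> complex_of_real \<mu>h * excess_lst \<mu>h (lst Fh) s"

text \<open>
  The factor in front of the bracket in the expansion.  Its limit does not vanish off the roots.
\<close>

lemma u_dis_factor:
  assumes s: "0 \<le> Re s" "s \<noteq> 0" "s \<notin> sr ` {1..<N}"
  shows "(\<lambda>\<epsilon>. 1 / (u_dis \<epsilon> \<bullet> cvec \<omega>) * w_dis \<epsilon> s - s * den s / (poly p s ^ r * det (E s))) \<in> bigoe 1"
proof -
  have "1 / (u \<bullet> cvec \<omega>) * (s * (u \<bullet> a\<omega> s) / det (E s)) = s * den s / (poly p s ^ r * det (E s))"
    unfolding u_adj_omega[OF s(1,2)] using u_omega_nonzero by simp
  then show ?thesis
    using bigoe_diff_mult[OF bigoe_diff_inverse[OF u_dis_omega u_omega_nonzero] base_transform[OF s]] by simp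
qed

text \<open>
  At the origin \<open>adj E(0) \<omega>\<close> is a multiple of \<open>\<Lambda>\<^sup>-\<^sup>1 e\<close>, on which \<open>z - z\<^sup>\<bullet>\<close> takes the value
  \<open>- \<mu>\<^sub>h \<pi> (Q\<^sup>(\<^sup>2\<^sup>) \<circ> P) e\<close> by construction.  The same multiple appears in \<open>T(0)\<close>, computed from
  \<open>adj_diff_identities\<close> and \<open>\<pi> E(0) = 0\<close>.
\<close>

lemma at_origin: "(z - zd) \<bullet> a\<omega> 0 = - complex_of_real \<mu>h * T 0"
proof -
  obtain \<kappa> where \<kappa>: "\<And>w. w \<in> carrier_vec N \<Longrightarrow> adj_mat (E 0) *\<^sub>v w = ((cvec \<pi> \<bullet> w) * \<kappa>) \<cdot>\<^sub>v lv"
    using adj_0 by blast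
  have a\<omega>: "a\<omega> 0 = \<kappa> \<cdot>\<^sub>v lv" unfolding \<kappa>[OF omega_facts(2)] omega_facts(3) by simp
  note ca = adj_mat(1)[OF E_carrier, of 0] and cd = adj_diff_carrier[OF E_carrier, of 0 Q]
  note cQa = mult_carrier_mat[OF QL_carrier ca] and cEd = mult_carrier_mat[OF E_carrier cd, of 0]
  let ?q = "\<pi> \<bullet> (Q2P D1 D2 *\<^sub>v ones N)"
  have dz: "z \<bullet> lv - zd \<bullet> lv = - complex_of_real (\<mu>h * ?q)"
    unfolding z_facts(2) zd_facts(2) by (simp add: algebra_simps)
  have "cvec \<pi> \<bullet> (Q *\<^sub>v lv) = complex_of_real ?q"
    unfolding QL_le[OF arr rts] by (rule cvec_scalar[OF arr rts Q2P_ones_carrier[OF arr rts] pi_facts(1)])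
  then have "cvec \<pi> \<bullet> (Q *\<^sub>v a\<omega> 0) = \<kappa> * complex_of_real ?q"
    unfolding a\<omega> mult_mat_vec[OF QL_carrier le_carrier]
    using scalar_prod_smult_distrib[OF cpi mult_mat_vec_carrier[OF QL_carrier le_carrier]] by simp
  moreover have "T 0 = cvec \<pi> \<bullet> (Q *\<^sub>v a\<omega> 0)"
  proof -
    have "row_mult (cvec \<pi>) (Q * adj_mat (E 0) + E 0 * adj_diff (E 0) Q) = T 0 \<cdot>\<^sub>v cvec \<pi>"
      unfolding adj_diff_identities(1)[OF E_carrier QL_carrier] by (rule row_mult_smult_one[OF cpi])
    moreover have "row_mult (cvec \<pi>) (E 0 * adj_diff (E 0) Q) = 0\<^sub>v N"
      unfolding row_mult_assoc[OF E_carrier cpi cd, symmetric] left_kernel_0 by (rule row_mult_zero_left[OF cd])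
    ultimately have "row_mult (cvec \<pi>) (Q * adj_mat (E 0)) = T 0 \<cdot>\<^sub>v cvec \<pi>"
      using row_mult_carrier[OF cQa, of "cvec \<pi>"] unfolding row_mult_add_right[OF cQa cEd cpi] by simp
    then have "(T 0 \<cdot>\<^sub>v cvec \<pi>) \<bullet> cvec \<omega> = cvec \<pi> \<bullet> ((Q * adj_mat (E 0)) *\<^sub>v cvec \<omega>)"
      using row_mult_scalar[OF cQa cpi omega_facts(2)] by simp
    then show ?thesis
      unfolding assoc_mult_mat_vec[OF QL_carrier ca omega_facts(2)]
      using smult_scalar_prod_distrib[OF cpi omega_facts(2), of "T 0"] omega_facts(3) by simp
  qed
  ultimately have T0: "T 0 = \<kappa> * complex_of_real ?q" by simp
  have "(z - zd) \<bullet> a\<omega> 0 = \<kappa> * (z \<bullet> lv - zd \<bullet> lv)"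
    unfolding diff_z_scalar[OF adj_omega_carrier, of 0] unfolding a\<omega>
    using scalar_prod_smult_distrib[OF z_facts(1) le_carrier] scalar_prod_smult_distrib[OF zd_facts(1) le_carrier]
    by (simp add: right_diff_distrib)
  then show ?thesis unfolding dz T0 by simp
qed

lemma normalization:
  assumes s: "0 < Re s"
  shows "(u \<bullet> cvec \<omega>) * col_subst_sum (E s) (s \<cdot>\<^sub>m Q) / (s * (u \<bullet> a\<omega> s)) = poly p s ^ r * T s / den s"
proof -
  have s': "0 \<le> Re s" "s \<noteq> 0" using s by auto
  show ?thesis
    unfolding col_subst_sum_smult[OF E_carrier QL_carrier] u_adj_omega[OF s'] using u_omega_nonzero s' by simp
qed

text \<open>
  Off the roots the bracket may be evaluated at \<open>\<epsilon> = 0\<close>, because it is multiplied by \<open>\<epsilon>\<close>; then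
  \<open>bracket_identity\<close> turns it into the first-order term of \<open>mixture_minus_discard\<close>.  At the origin, a
  root of \<open>det E\<close>, both transforms are 1 and the bracket is 0.
\<close>

lemma expansion:
  assumes s: "0 \<le> Re s" "s \<notin> sr ` {1..<N}"
    and a: "a = poly p s ^ r * ((z - zd) \<bullet> a\<omega> s) / den s"
    and b: "b = poly p s ^ r * (s * (u \<bullet> a'\<omega> s)) / den s"
    and c: "c = poly p s ^ r * T s / den s"
  shows "(\<lambda>\<epsilon>. w_mix \<epsilon> s - (w_dis \<epsilon> s + complex_of_real \<epsilon> * (1 / (u_dis \<epsilon> \<bullet> cvec \<omega>)) * w_dis \<epsilon> s *
      (a - mhe s * b + mhe s * w_dis \<epsilon> s * c))) \<in> bigoe 2"
proof (cases "s = 0")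
  case True
  have "a + complex_of_real \<mu>h * c = 0"
    unfolding a c True at_origin by (simp add: mult_ac)
  moreover have b0: "b = 0" and m0: "mhe s = complex_of_real \<mu>h" by (simp_all add: b True excess_lst_def)
  ultimately have br: "a - mhe s * b + mhe s * 1 * c = 0" unfolding b0 m0 by simp
  have zero: "(\<lambda>_. 0) \<in> bigoe 2" by simp
  show ?thesis
  proof (rule bigoe_cong[OF eps0(1) _ zero])
    fix \<epsilon> :: real assume e: "0 < \<epsilon>" "\<epsilon> < \<epsilon>0"
    have "w_mix \<epsilon> s = 1" "w_dis \<epsilon> s = 1"
      unfolding w_mix w_dis True Phi_mix_0[OF e] Phi_dis_0[OF e] omega_facts(3) by simp_all
    then show "0 = w_mix \<epsilon> s - (w_dis \<epsilon> s + complex_of_real \<epsilon> * (1 / (u_dis \<epsilon> \<bullet> cvec \<omega>)) * w_dis \<epsilon> s *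
      (a - mhe s * b + mhe s * w_dis \<epsilon> s * c))"
      using br by simp
  qed
next
  case False
  note s' = s(1) False s(2)
  define w0 where "w0 = s * (u \<bullet> a\<omega> s) / det (E s)"
  define Fac where "Fac \<epsilon> = 1 / (u_dis \<epsilon> \<bullet> cvec \<omega>) * w_dis \<epsilon> s" for \<epsilon>
  define G where "G \<epsilon> = Fac \<epsilon> * (a - mhe s * b + mhe s * w_dis \<epsilon> s * c)" for \<epsilon>
  define G0 where "G0 = s * den s / (poly p s ^ r * det (E s)) * (a - mhe s * b + mhe s * w0 * c)"
  have "(\<lambda>\<epsilon>. mhe s * c * (w_dis \<epsilon> s - w0)) \<in> bigoe 1"
    unfolding w0_def by (rule bigoe_cmult(1)[OF base_transform[OF s']])
  then have "(\<lambda>\<epsilon>. (a - mhe s * b + mhe s * w_dis \<epsilon> s * c) - (a - mhe s * b + mhe s * w0 * c)) \<in> bigoe 1"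
    by (simp add: algebra_simps)
  from bigoe_diff_mult[OF u_dis_factor[OF s'] this]
  have "(\<lambda>\<epsilon>. G \<epsilon> - G0) \<in> bigoe 1" unfolding G_def Fac_def G0_def .
  from bigoe_eps[OF this] have G: "(\<lambda>\<epsilon>. complex_of_real \<epsilon> * (G \<epsilon> - G0)) \<in> bigoe 2" by (simp add: numeral_2_eq_2)
  have "poly p s ^ r \<noteq> 0" using p_root_free[OF s(1)] by simp
  note nz = this det_nonzero[OF s'] den_nonzero[OF s]
  have "G0 = s * ((z - zd) \<bullet> a\<omega> s) / det (E s)
      + s * (1 - lst Fh s) * (T s * (u \<bullet> a\<omega> s) - det (E s) * (u \<bullet> a'\<omega> s)) / (det (E s))\<^sup>2"
    unfolding G0_def a b c w0_def bracket_identity[OF nz] excess_h[OF s(1)] ..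
  note M = mixture_minus_discard[OF s', folded this]
  show ?thesis
    using sum_in_bigo(2)[OF M G] by (simp add: G_def Fac_def algebra_simps)
qed

lemma expansion_determines_bracket:
  assumes s: "0 \<le> Re s" "s \<noteq> 0" "s \<notin> sr ` {1..<N}"
    and 1: "(\<lambda>\<epsilon>. W \<epsilon> - (V \<epsilon> + complex_of_real \<epsilon> * (1 / (u_dis \<epsilon> \<bullet> cvec \<omega>)) * w_dis \<epsilon> s * (a - h * b + C \<epsilon>))) \<in> bigoe 2"
    and 2: "(\<lambda>\<epsilon>. W \<epsilon> - (V \<epsilon> + complex_of_real \<epsilon> * (1 / (u_dis \<epsilon> \<bullet> cvec \<omega>)) * w_dis \<epsilon> s * (a' - h * b' + C \<epsilon>))) \<in> bigoe 2"
  shows "a - a' = h * (b - b')"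
proof -
  define d where "d = a - a' - h * (b - b')"
  define F0 where "F0 = s * den s / (poly p s ^ r * det (E s))"
  define Fac where "Fac \<epsilon> = 1 / (u_dis \<epsilon> \<bullet> cvec \<omega>) * w_dis \<epsilon> s" for \<epsilon>
  have alg: "W - (V + e * F * w * (a' - h * b' + c)) - (W - (V + e * F * w * (a - h * b + c)))
      = e * (F * w * (a - a' - h * (b - b')))" for W V e F w c :: complex
    by (simp add: algebra_simps)
  have "(\<lambda>\<epsilon>. complex_of_real \<epsilon> * (Fac \<epsilon> * d)) \<in> bigoe 2"
    using sum_in_bigo(2)[OF 2 1] unfolding alg Fac_def d_def .
  then have "(\<lambda>\<epsilon>. complex_of_real \<epsilon> * (Fac \<epsilon> * d)) \<in> bigoe (Suc 1)"
    by (simp add: numeral_2_eq_2)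
  from bigoe_eps_cancel[OF this] have "(\<lambda>\<epsilon>. Fac \<epsilon> * d) \<in> bigoe 1" .
  moreover have "(\<lambda>\<epsilon>. (Fac \<epsilon> - F0) * d) \<in> bigoe 1"
    unfolding Fac_def F0_def by (rule bigoe_cmult(2)[OF u_dis_factor[OF s]])
  ultimately have "(\<lambda>\<epsilon>. F0 * d) \<in> bigoe (Suc 0)"
    using sum_in_bigo(2)[of "\<lambda>\<epsilon>. Fac \<epsilon> * d" _ _ "\<lambda>\<epsilon>. (Fac \<epsilon> - F0) * d"] by (simp add: left_diff_distrib)
  then have "F0 * d = 0" by (rule bigoe_const_eq_0)
  moreover have "F0 \<noteq> 0"
    unfolding F0_def using s den_nonzero[OF s(1,3)] det_nonzero[OF s] p_root_free[OF s(1)] by simp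
  ultimately show ?thesis by (simp add: d_def)
qed

lemma roots_avoid_0:
  obtains \<rho> where "0 < \<rho>" "\<forall>s. norm s < \<rho> \<longrightarrow> s \<notin> sr ` {1..<N}"
proof -
  have "finite (sr ` {1..<N})" by simp
  from finite_set_avoid[OF this, of 0] obtain \<rho> where \<rho>: "0 < \<rho>" "\<forall>x\<in>sr ` {1..<N}. x \<noteq> 0 \<longrightarrow> \<rho> \<le> dist 0 x"
    by blast
  have "s \<notin> sr ` {1..<N}" if "norm s < \<rho>" for s
  proof
    assume "s \<in> sr ` {1..<N}"
    moreover from this have "s \<noteq> 0" using zero_not_root by metis
    ultimately have "\<rho> \<le> dist 0 s" using \<rho>(2) by blast
    then show False using that by simp
  qed
  then show thesis using \<rho>(1) by (intro that[of \<rho>]) auto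
qed

text \<open>
  Writing both partial fractions over \<open>den\<close> with numerators \<open>HA\<close> and \<open>HB\<close>, the hypothesis becomes
  \<open>s HA = (1 - h) HB\<close>.  Unless \<open>HB = 0\<close>, this makes \<open>h\<close> a quotient of polynomials near the origin.
\<close>

lemma heavy_tail_separates:
  assumes rho: "0 < \<rho>" "\<forall>s. norm s < \<rho> \<longrightarrow> s \<notin> sr ` {1..<N}"
    and eq: "\<forall>s. 0 < Re s \<and> norm s < \<rho> \<longrightarrow>
      pf N sr \<sigma> yd rr a0 a1 a2 s = mhe s * pf N sr \<sigma> yd rr b0 b1 b2 s"
  shows "\<forall>s. 0 < Re s \<and> norm s < \<rho> \<longrightarrow> pf N sr \<sigma> yd rr b0 b1 b2 s = 0"
proof -
  obtain HA where HA: "\<And>s. 0 \<le> Re s \<Longrightarrow> s \<notin> sr ` {1..<N} \<Longrightarrow> pf N sr \<sigma> yd rr a0 a1 a2 s = poly HA s / den s"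
    using pf_over_den[of a0 a1 a2] by metis
  obtain HB where HB: "\<And>s. 0 \<le> Re s \<Longrightarrow> s \<notin> sr ` {1..<N} \<Longrightarrow> pf N sr \<sigma> yd rr b0 b1 b2 s = poly HB s / den s"
    using pf_over_den[of b0 b1 b2] by metis
  have "HB = 0"
  proof (rule ccontr)
    assume "HB \<noteq> 0"
    have "lst Fh t * poly HB t = poly (HB - [:0, 1:] * HA) t" if t: "0 < Re t" "norm t < \<rho>" for t
    proof -
      have t': "0 \<le> Re t" "t \<notin> sr ` {1..<N}" using t rho(2) by auto
      have "poly HA t = mhe t * poly HB t"
        using eq[rule_format, OF conjI[OF t]] unfolding HA[OF t'] HB[OF t'] using den_nonzero[OF t'] by simp
      then have "t * poly HA t = (1 - lst Fh t) * poly HB t"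
        unfolding excess_h[OF t'(1), symmetric] by simp
      then show ?thesis by (simp add: algebra_simps)
    qed
    from rational_lst_not_heavy_tailed[OF Fh(1) \<open>HB \<noteq> 0\<close> rho(1) this] show False using Fh(2) by simp
  qed
  then show ?thesis using HB rho(2) by simp
qed

lemma coefficients_eq:
  assumes rho: "0 < \<rho>" "\<forall>s. norm s < \<rho> \<longrightarrow> s \<notin> sr ` {1..<N}"
    and eq: "\<forall>s. 0 < Re s \<and> norm s < \<rho> \<longrightarrow> pf N sr \<sigma> yd rr c0 c1 c2 s = pf N sr \<sigma> yd rr d0 d1 d2 s"
    and ext: "c1 \<in> extensional {1..<N}" "d1 \<in> extensional {1..<N}"
      "c2 \<in> extensional (SIGMA j:{1..\<sigma>}. {1..rr j})" "d2 \<in> extensional (SIGMA j:{1..\<sigma>}. {1..rr j})"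
  shows "c0 = d0" "c1 = d1" "c2 = d2"
proof -
  have "\<forall>s. 0 < Re s \<and> norm s < \<rho> \<longrightarrow>
      pf N sr \<sigma> yd rr (c0 - d0) (\<lambda>k. c1 k - d1 k) (\<lambda>jl. c2 jl - d2 jl) s = 0"
    unfolding pf_diff[symmetric] using eq by simp
  note zero = pf_eq_0[OF rho(1) this rho(2)]
  show "c0 = d0" using zero(1) by simp
  show "c1 = d1" using zero(2) by (intro extensionalityI[OF ext(1,2)]) simp
  show "c2 = d2" using zero(3) by (intro extensionalityI[OF ext(3,4)]) (simp only: right_minus_eq)
qed

theorem unique_expansion:
  shows "\<exists>!C. case C of (\<alpha>1, \<alpha>2, \<beta>0, \<beta>1, \<beta>2, \<gamma>0, \<gamma>1, \<gamma>2) \<Rightarrow>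
     {\<alpha>1, \<beta>1, \<gamma>1} \<subseteq> extensional {1..<N} \<and>
     {\<alpha>2, \<beta>2, \<gamma>2} \<subseteq> extensional (SIGMA j:{1..\<sigma>}. {1..rr j}) \<and>
     \<comment> \<open>normalization: with w the base transform, replacing the last two factors B, C by B + h, C + h/w
           (e.g. h = 1) changes the expansion only by O(eps^2)\<close>
     (\<forall>s. 0 < Re s \<and> s \<notin> sr ` {1..<N} \<longrightarrow>
        pf N sr \<sigma> yd rr \<gamma>0 \<gamma>1 \<gamma>2 s
        = (u \<bullet> cvec \<omega>) * col_subst_sum (E s) (s \<cdot>\<^sub>m cmat (Q2PLam D1 D2))
          / (s * (u \<bullet> (adj_mat (E s) *\<^sub>v cvec \<omega>)))) \<and>
     (\<forall>s. 0 \<le> Re s \<and> s \<notin> sr ` {1..<N} \<longrightarrow>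
        (\<lambda>\<epsilon>. w_mix \<epsilon> s -
           (w_dis \<epsilon> s + complex_of_real \<epsilon> * (1 / (u_dis \<epsilon> \<bullet> cvec \<omega>)) * w_dis \<epsilon> s *
             (pf N sr \<sigma> yd rr ((z - zd) \<bullet> cvec \<omega>) \<alpha>1 \<alpha>2 s
              - complex_of_real \<mu>h * excess_lst \<mu>h (lst Fh) s * pf N sr \<sigma> yd rr \<beta>0 \<beta>1 \<beta>2 s
              + complex_of_real \<mu>h * excess_lst \<mu>h (lst Fh) s * w_dis \<epsilon> s
                  * pf N sr \<sigma> yd rr \<gamma>0 \<gamma>1 \<gamma>2 s)))
        \<in> O[at_right 0](\<lambda>\<epsilon>. complex_of_real \<epsilon> ^ 2))"
proof -
  obtain \<gamma>1 \<gamma>2 \<gamma>0 where \<gamma>: "\<gamma>1 \<in> extensional {1..<N}" "\<gamma>2 \<in> extensional (SIGMA j:{1..\<sigma>}. {1..rr j})"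
    "\<And>s. 0 \<le> Re s \<Longrightarrow> s \<notin> sr ` {1..<N} \<Longrightarrow> pf N sr \<sigma> yd rr \<gamma>0 \<gamma>1 \<gamma>2 s = poly p s ^ r * T s / den s"
    by (fact pf_T)
  have "z - zd \<in> carrier_vec N" using z_facts(1) zd_facts(1) by simp
  note zz = this
  obtain \<alpha>1 \<alpha>2 where \<alpha>: "\<alpha>1 \<in> extensional {1..<N}" "\<alpha>2 \<in> extensional (SIGMA j:{1..\<sigma>}. {1..rr j})"
    "\<And>s. 0 \<le> Re s \<Longrightarrow> s \<notin> sr ` {1..<N} \<Longrightarrow>
      pf N sr \<sigma> yd rr ((z - zd) \<bullet> cvec \<omega>) \<alpha>1 \<alpha>2 s = poly p s ^ r * ((z - zd) \<bullet> a\<omega> s) / den s"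
    by (fact pf_adj_omega[OF zz])
  obtain \<beta>1 \<beta>2 \<beta>0 where \<beta>: "\<beta>1 \<in> extensional {1..<N}" "\<beta>2 \<in> extensional (SIGMA j:{1..\<sigma>}. {1..rr j})"
    "\<And>s. 0 \<le> Re s \<Longrightarrow> s \<notin> sr ` {1..<N} \<Longrightarrow> pf N sr \<sigma> yd rr \<beta>0 \<beta>1 \<beta>2 s = poly p s ^ r * (s * (u \<bullet> a'\<omega> s)) / den s"
    by (fact pf_adj_diff_omega[OF u(1)])
  have ex: "(\<lambda>\<epsilon>. w_mix \<epsilon> s -
           (w_dis \<epsilon> s + complex_of_real \<epsilon> * (1 / (u_dis \<epsilon> \<bullet> cvec \<omega>)) * w_dis \<epsilon> s *
             (pf N sr \<sigma> yd rr ((z - zd) \<bullet> cvec \<omega>) \<alpha>1 \<alpha>2 s - mhe s * pf N sr \<sigma> yd rr \<beta>0 \<beta>1 \<beta>2 s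
              + mhe s * w_dis \<epsilon> s * pf N sr \<sigma> yd rr \<gamma>0 \<gamma>1 \<gamma>2 s))) \<in> bigoe 2"
    if s: "0 \<le> Re s" "s \<notin> sr ` {1..<N}" for s
    by (rule expansion[OF s \<alpha>(3)[OF s] \<beta>(3)[OF s] \<gamma>(3)[OF s]])
  show ?thesis
  proof (rule ex1I[of _ "(\<alpha>1, \<alpha>2, \<beta>0, \<beta>1, \<beta>2, \<gamma>0, \<gamma>1, \<gamma>2)"], goal_cases)
    case 1
    show ?case
      unfolding prod.case
    proof (intro conjI allI impI)
      show "{\<alpha>1, \<beta>1, \<gamma>1} \<subseteq> extensional {1..<N}" using \<alpha>(1) \<beta>(1) \<gamma>(1) by blast
      show "{\<alpha>2, \<beta>2, \<gamma>2} \<subseteq> extensional (SIGMA j:{1..\<sigma>}. {1..rr j})" using \<alpha>(2) \<beta>(2) \<gamma>(2) by blast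
    next
      fix s assume s: "0 < Re s \<and> s \<notin> sr ` {1..<N}"
      then have s': "0 < Re s" "0 \<le> Re s" "s \<notin> sr ` {1..<N}" by auto
      show "pf N sr \<sigma> yd rr \<gamma>0 \<gamma>1 \<gamma>2 s
        = (u \<bullet> cvec \<omega>) * col_subst_sum (E s) (s \<cdot>\<^sub>m cmat (Q2PLam D1 D2)) / (s * (u \<bullet> (adj_mat (E s) *\<^sub>v cvec \<omega>)))"
        unfolding normalization[OF s'(1)] by (rule \<gamma>(3)[OF s'(2,3)])
    qed (rule ex, blast, blast)
  next
    case (2 C)
    obtain a1 a2 b0 b1 b2 c0 c1 c2 where C: "C = (a1, a2, b0, b1, b2, c0, c1, c2)"
      by (metis surj_pair)
    note C_props = 2[unfolded C prod.case]
    note ext1 = C_props[THEN conjunct1] and ext2 = C_props[THEN conjunct2, THEN conjunct1]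
      and norm = C_props[THEN conjunct2, THEN conjunct2, THEN conjunct1]
      and ex' = C_props[THEN conjunct2, THEN conjunct2, THEN conjunct2]
    obtain \<rho> where \<rho>: "0 < \<rho>" "\<forall>s. norm s < \<rho> \<longrightarrow> s \<notin> sr ` {1..<N}" by (fact roots_avoid_0)
    have c_eq: "\<forall>s. 0 < Re s \<and> norm s < \<rho> \<longrightarrow> pf N sr \<sigma> yd rr c0 c1 c2 s = pf N sr \<sigma> yd rr \<gamma>0 \<gamma>1 \<gamma>2 s"
    proof (intro allI impI, elim conjE)
      fix s :: complex assume s: "0 < Re s" "norm s < \<rho>"
      note avoid = \<rho>(2)[rule_format, OF s(2)]
      have s': "0 \<le> Re s" using s by simp
      show "pf N sr \<sigma> yd rr c0 c1 c2 s = pf N sr \<sigma> yd rr \<gamma>0 \<gamma>1 \<gamma>2 s"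
        unfolding norm[rule_format, OF conjI[OF s(1) avoid]] normalization[OF s(1)] \<gamma>(3)[OF s' avoid] ..
    qed
    have ab: "\<forall>s. 0 < Re s \<and> norm s < \<rho> \<longrightarrow>
        pf N sr \<sigma> yd rr (((z - zd) \<bullet> cvec \<omega>) - ((z - zd) \<bullet> cvec \<omega>)) (\<lambda>k. a1 k - \<alpha>1 k) (\<lambda>k. a2 k - \<alpha>2 k) s
        = mhe s * pf N sr \<sigma> yd rr (b0 - \<beta>0) (\<lambda>k. b1 k - \<beta>1 k) (\<lambda>k. b2 k - \<beta>2 k) s"
      unfolding pf_diff[symmetric]
    proof (intro allI impI, elim conjE)
      fix s :: complex assume s: "0 < Re s" "norm s < \<rho>"
      have s': "0 \<le> Re s" "s \<noteq> 0" "s \<notin> sr ` {1..<N}" using s \<rho>(2) by auto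
      note bracket' = ex'[rule_format, OF conjI[OF s'(1,3)], unfolded c_eq[rule_format, OF conjI[OF s]]]
      show "pf N sr \<sigma> yd rr ((z - zd) \<bullet> cvec \<omega>) a1 a2 s - pf N sr \<sigma> yd rr ((z - zd) \<bullet> cvec \<omega>) \<alpha>1 \<alpha>2 s
        = mhe s * (pf N sr \<sigma> yd rr b0 b1 b2 s - pf N sr \<sigma> yd rr \<beta>0 \<beta>1 \<beta>2 s)"
        by (rule expansion_determines_bracket[OF s' bracket' ex[OF s'(1,3)]])
    qed
    note b_0 = heavy_tail_separates[OF \<rho> ab]
    have b_eq: "\<forall>s. 0 < Re s \<and> norm s < \<rho> \<longrightarrow> pf N sr \<sigma> yd rr b0 b1 b2 s = pf N sr \<sigma> yd rr \<beta>0 \<beta>1 \<beta>2 s"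
      using b_0 unfolding pf_diff[symmetric] by simp
    have a_eq: "\<forall>s. 0 < Re s \<and> norm s < \<rho> \<longrightarrow>
        pf N sr \<sigma> yd rr ((z - zd) \<bullet> cvec \<omega>) a1 a2 s = pf N sr \<sigma> yd rr ((z - zd) \<bullet> cvec \<omega>) \<alpha>1 \<alpha>2 s"
      using ab b_0 unfolding pf_diff[symmetric] by simp
    have "c0 = \<gamma>0" "c1 = \<gamma>1" "c2 = \<gamma>2"
      by (rule coefficients_eq[OF \<rho> c_eq]; use ext1 ext2 \<gamma>(1,2) in simp)+
    moreover have "b0 = \<beta>0" "b1 = \<beta>1" "b2 = \<beta>2"
      by (rule coefficients_eq[OF \<rho> b_eq]; use ext1 ext2 \<beta>(1,2) in simp)+
    moreover have "a1 = \<alpha>1" "a2 = \<alpha>2"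
      by (rule coefficients_eq(2,3)[OF \<rho> a_eq]; use ext1 ext2 \<alpha>(1,2) in simp)+
    ultimately show ?case unfolding C by simp
  qed
qed

end

theorem proposition4p5:
  fixes N M r \<sigma> :: nat
    and D1 D2 :: "real mat" and \<pi> \<omega> :: "real vec"
    and Fp Fh :: "real measure" and p q :: "complex poly"
    and \<mu>p \<mu>h \<epsilon>0 :: real
    and Smix Sdis :: "real \<Rightarrow> (real \<times> nat) measure"
    and w_mix w_dis :: "real \<Rightarrow> complex \<Rightarrow> complex"
    and u z zd :: "complex vec" and u_dis :: "real \<Rightarrow> complex vec"
    and E K Kd :: "complex \<Rightarrow> complex mat" and A :: "complex mat"
    and sr x y yd :: "nat \<Rightarrow> complex" and m rr :: "nat \<Rightarrow> nat"
  \<comment> \<open>arrivals\<close>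
  assumes arrivals: "arrival_process N D1 D2"
    and rates: "\<forall>i<N. 0 < rate D1 D2 i"
    and real_customers: "\<exists>i<N. \<exists>j<N. 0 < D2 $$ (i, j)"
    and irred: "irreducible_mat (P_mat D1 D2)"
    and pi: "stationary_vec (P_mat D1 D2) \<pi>"
    and omega: "\<omega> = omega D1 D2 \<pi>"
  \<comment> \<open>service times\<close>
    and Fp: "service_law Fp" "phase_type Fp" "\<mu>p = mean Fp"
    and Fp_rational: "\<forall>s. 0 \<le> Re s \<longrightarrow> lst Fp s = poly q s / poly p s"
      "coprime q p" "lead_coeff p = 1" "degree p = M" "degree q < M"
    and Fh: "service_law Fh" "heavy_tailed Fh" "\<mu>h = mean Fh"
  \<comment> \<open>stability of the replace base, mixture and discard base models\<close>
    and eps0: "0 < \<epsilon>0" "\<epsilon>0 \<le> 1"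
    and stable_base: "0 < drift D1 D2 \<pi> \<mu>p"
    and stable_mix: "\<forall>\<epsilon>\<in>{0<..<\<epsilon>0}. 0 < drift D1 D2 \<pi> ((1 - \<epsilon>) * \<mu>p + \<epsilon> * \<mu>h)"
    and stable_dis: "\<forall>\<epsilon>\<in>{0<..<\<epsilon>0}. 0 < drift D1 D2 \<pi> ((1 - \<epsilon>) * \<mu>p)"
  \<comment> \<open>steady state and delay in the mixture and discard base models\<close>
    and Smix: "\<forall>\<epsilon>\<in>{0<..<\<epsilon>0}. stationary_law N D1 D2 (mix \<epsilon> Fp Fh) (Smix \<epsilon>)"
    and Sdis: "\<forall>\<epsilon>\<in>{0<..<\<epsilon>0}. stationary_law N D1 D2 (mix \<epsilon> Fp (return borel 0)) (Sdis \<epsilon>)"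
    and w_mix: "w_mix = (\<lambda>\<epsilon> s. Phi N (Smix \<epsilon>) s \<bullet> cvec \<omega>)"
    and w_dis: "w_dis = (\<lambda>\<epsilon> s. Phi N (Sdis \<epsilon>) s \<bullet> cvec \<omega>)"
    and u_dis: "\<forall>\<epsilon>\<in>{0<..<\<epsilon>0}. u_dis \<epsilon> \<in> carrier_vec N \<and>
      (\<forall>s. 0 \<le> Re s \<longrightarrow>
        row_mult (Phi N (Sdis \<epsilon>) s)
          (E_sg D1 D2 s ((1 - complex_of_real \<epsilon>) * lst Fp s + complex_of_real \<epsilon>))
        = s \<cdot>\<^sub>v u_dis \<epsilon>)"
  \<comment> \<open>quantities of the replace base model; the roots are numbered from 0\<close>
    and E: "E = (\<lambda>s. E_sg D1 D2 s (poly q s / poly p s))"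
    and roots: "inj_on sr {..<N}" "{s. 0 \<le> Re s \<and> det (E s) = 0} = sr ` {..<N}"
      "sr 0 = 0" "\<forall>i\<in>{1..<N}. 0 < Re (sr i)"
    and simple_roots: "\<forall>i\<in>{1..<N}. deriv (\<lambda>s. det (E s)) (sr i) \<noteq> 0"
    and m: "\<forall>i\<in>{1..<N}. m i < N \<and> a_vec E (sr i) (m i) \<noteq> 0\<^sub>v N"
    and u: "u \<in> carrier_vec N"
      "u \<bullet> cvec (Lam_inv D1 D2 *\<^sub>v ones N) = complex_of_real (drift D1 D2 \<pi> \<mu>p)"
      "\<forall>i\<in>{1..<N}. u \<bullet> a_vec E (sr i) (m i) = 0"
    and u_unique: "\<forall>u'\<in>carrier_vec N.
      u' \<bullet> cvec (Lam_inv D1 D2 *\<^sub>v ones N) = complex_of_real (drift D1 D2 \<pi> \<mu>p) \<and>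
      (\<forall>i\<in>{1..<N}. u' \<bullet> a_vec E (sr i) (m i) = 0) \<longrightarrow> u' = u"
    and r: "r = p_exponent D1 D2 \<omega>"
    and xy_pos: "\<forall>j\<in>{1..r * M}. 0 < Re (x j) \<and> 0 < Re (y j)"
    and x: "\<forall>s. poly p s \<noteq> 0 \<longrightarrow> poly p s ^ r * det (E s)
      = s * (\<Prod>k\<in>{1..<N}. s - sr k) * (\<Prod>j\<in>{1..r * M}. s + x j)"
    and y: "\<forall>s. poly p s \<noteq> 0 \<longrightarrow> poly p s ^ r * (s * (u \<bullet> (adj_mat (E s) *\<^sub>v cvec \<omega>)))
      = (u \<bullet> cvec \<omega>) * s * (\<Prod>k\<in>{1..<N}. s - sr k) * (\<Prod>j\<in>{1..r * M}. s + y j)"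
  \<comment> \<open>the vectors z for the mixture and the discard base model\<close>
    and A: "A = A_mat N (cvec (Lam_inv D1 D2 *\<^sub>v ones N)) E sr m"
    and K: "K = (\<lambda>s. (s * (complex_of_real \<mu>p * excess_lst \<mu>p (\<lambda>t. poly q t / poly p t) s
        - complex_of_real \<mu>h * excess_lst \<mu>h (lst Fh) s)) \<cdot>\<^sub>m cmat (Q2PLam D1 D2))"
    and Kd: "Kd = (\<lambda>s. (s * complex_of_real \<mu>p * excess_lst \<mu>p (\<lambda>t. poly q t / poly p t) s)
        \<cdot>\<^sub>m cmat (Q2PLam D1 D2))"
    and z: "z = z_vec (first_vec N (drift D1 D2 \<pi> \<mu>p)) A (B_mat N E K sr m)
        (first_vec N ((\<mu>p - \<mu>h) * (\<pi> \<bullet> (Q2P D1 D2 *\<^sub>v ones N))))"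
    and zd: "zd = z_vec (first_vec N (drift D1 D2 \<pi> \<mu>p)) A (B_mat N E Kd sr m)
        (first_vec N (\<mu>p * (\<pi> \<bullet> (Q2P D1 D2 *\<^sub>v ones N))))"
  \<comment> \<open>the distinct numbers among the y's and their multiplicities\<close>
    and yd: "bij_betw yd {1..\<sigma>} (y ` {1..r * M})"
    and rr: "\<forall>j\<in>{1..\<sigma>}. rr j = card {i\<in>{1..r * M}. y i = yd j}"
  shows "\<exists>!C. case C of (\<alpha>1, \<alpha>2, \<beta>0, \<beta>1, \<beta>2, \<gamma>0, \<gamma>1, \<gamma>2) \<Rightarrow>
     {\<alpha>1, \<beta>1, \<gamma>1} \<subseteq> extensional {1..<N} \<and>
     {\<alpha>2, \<beta>2, \<gamma>2} \<subseteq> extensional (SIGMA j:{1..\<sigma>}. {1..rr j}) \<and>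
     \<comment> \<open>normalization: with w the base transform, replacing the last two factors B, C by B + h, C + h/w
           (e.g. h = 1) changes the expansion only by O(eps^2)\<close>
     (\<forall>s. 0 < Re s \<and> s \<notin> sr ` {1..<N} \<longrightarrow>
        pf N sr \<sigma> yd rr \<gamma>0 \<gamma>1 \<gamma>2 s
        = (u \<bullet> cvec \<omega>) * col_subst_sum (E s) (s \<cdot>\<^sub>m cmat (Q2PLam D1 D2))
          / (s * (u \<bullet> (adj_mat (E s) *\<^sub>v cvec \<omega>)))) \<and>
     (\<forall>s. 0 \<le> Re s \<and> s \<notin> sr ` {1..<N} \<longrightarrow>
        (\<lambda>\<epsilon>. w_mix \<epsilon> s -
           (w_dis \<epsilon> s + complex_of_real \<epsilon> * (1 / (u_dis \<epsilon> \<bullet> cvec \<omega>)) * w_dis \<epsilon> s *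
             (pf N sr \<sigma> yd rr ((z - zd) \<bullet> cvec \<omega>) \<alpha>1 \<alpha>2 s
              - complex_of_real \<mu>h * excess_lst \<mu>h (lst Fh) s * pf N sr \<sigma> yd rr \<beta>0 \<beta>1 \<beta>2 s
              + complex_of_real \<mu>h * excess_lst \<mu>h (lst Fh) s * w_dis \<epsilon> s
                  * pf N sr \<sigma> yd rr \<gamma>0 \<gamma>1 \<gamma>2 s)))
        \<in> O[at_right 0](\<lambda>\<epsilon>. complex_of_real \<epsilon> ^ 2))"
proof -
  interpret mixture_queue N M r \<sigma> D1 D2 \<pi> \<omega> Fp Fh p q \<mu>p \<mu>h \<epsilon>0 Smix Sdis w_mix w_dis
    u z zd u_dis E K Kd A sr x y yd m rr
    by (rule mixture_queue.intro) (fact assms)+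
  show ?thesis by (rule unique_expansion)
qed

end
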